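(* Let $G$ be a compact connected Abelian topological group whose topology has a countable basis, with normalized Haar measure $dg$ and infinite dual $\hat G$. Let $T$ be a centered real-valued isotropic Gaussian field on $G$ with $\mathbb{E}[T(g)^2]=1$, let $a_\pi=\int_G T(g)\chi_\pi(g^{-1})dg$ and $C_\pi=\mathbb{E}|a_\pi|^2$, and assume $C_\pi>0$ for every $\pi\in\hat G$. Fix $m\ge 2$ and set $\widetilde a_\pi(H_m)=\int_G H_m(T(g))\chi_\pi(g^{-1})\,dg$. Then $\mathbb{E}[|\widetilde a_\pi(H_m)|^2]=m!\,\widehat C_{\pi,m}$ for every $\pi\in\hat G$. Moreover, for any sequence $\{\pi_l:l\ge1\}\subset\hat G$, the following four conditions are equivalent (all limits as $l\to\infty$, with $\pi=\pi_l$): 1. $\widetilde a_{\pi}(H_m)/\sqrt{m!\widehat C_{\pi,m}}$ converges in law to $N+iN'$, where $N,N'$ are independent $\mathcal N(0,1/2)$ random variables; 2. $[m!\widehat C_{\pi,m}]^{-2}\mathbb{E}[\Re(\widetilde a_\pi(H_m))^4]\to 3/4$ and $[m!\widehat C_{\pi,m}]^{-2}\mathbb{E}[\Im(\widetilde a_\pi(H_m))^4]\to 3/4$; 3. $\widehat C_{\pi,m}^{-2}\sum_{\lambda\in\hat G}\widehat C_{\lambda,q}^2\,\widehat C_{\pi\lambda^{-1},m-q}^2\to 0$ for every $q=1,\dots,m-1$; 4. $\displaystyle\max_{q=1,\dots,m-1}\frac{\sup_{\lambda\in\hat G}\widehat C_{\lambda,q}\widehat C_{\pi\lambda^{-1},m-q}}{\sum_{\mu\in\hat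 G}\widehat C_{\mu,q}\widehat C_{\pi\mu^{-1},m-q}}\to 0$.
   Context: $\hat G$ is the set of (equivalence classes of) irreducible unitary representations of $G$, all one-dimensional and identified with their characters $\chi_\pi$; it is an Abelian group under $\pi\sigma:=\pi\otimes\sigma$ with identity the trivial representation $\pi_0$ and $\pi^{-1}=\bar\pi$, and $\chi_{\pi\sigma}=\chi_\pi\chi_\sigma$. Isotropy of $T$ means that for all $p\ge1$, $h,g_1,\dots,g_p\in G$, $(T(hg_1),\dots,T(hg_p))$ and $(T(g_1),\dots,T(g_p))$ have the same law; $T$ is jointly measurable. $H_m(x)=(-1)^m e^{x^2/2}\frac{d^m}{dx^m}e^{-x^2/2}$ is the $m$-th Hermite polynomial. For $\pi\in\hat G$ and $m\ge1$, $\widehat C_{\pi,m}=\sum_{\sigma_1,\dots,\sigma_m\in\hat G,\ \sigma_1\cdots\sigma_m=\pi}C_{\sigma_1}\cdots C_{\sigma_m}$ (so $\widehat C_{\pi,1}=C_\pi$). *)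

theory Defs
  imports "HOL-Probability.Probability"
begin

definition is_character :: "('g::{ab_group_add,topological_space} \<Rightarrow> complex) \<Rightarrow> bool" where
  "is_character \<xi> \<longleftrightarrow> continuous_on UNIV \<xi> \<and> (\<forall>x y. \<xi> (x + y) = \<xi> x * \<xi> y) \<and> (\<forall>x. cmod (\<xi> x) = 1)"

definition dual :: "('g::{ab_group_add,topological_space} \<Rightarrow> complex) set" where
  "dual = {\<xi>. is_character \<xi>}"

definition char_mult :: "('g \<Rightarrow> complex) \<Rightarrow> ('g \<Rightarrow> complex) \<Rightarrow> 'g \<Rightarrow> complex" where
  "char_mult \<pi> \<sigma> = (\<lambda>g. \<pi> g * \<sigma> g)"

definition char_inv :: "('g \<Rightarrow> complex) \<Rightarrow> 'g \<Rightarrow> complex" where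
  "char_inv \<pi> = (\<lambda>g. cnj (\<pi> g))"

definition char_prod :: "('g \<Rightarrow> complex) list \<Rightarrow> 'g \<Rightarrow> complex" where
  "char_prod s = (\<lambda>g. prod_list (map (\<lambda>\<sigma>. \<sigma> g) s))"

definition haar_prob :: "('g::{ab_group_add,topological_space}) measure \<Rightarrow> bool" where
  "haar_prob \<mu> \<longleftrightarrow> sets \<mu> = sets borel \<and> prob_space \<mu> \<and>
     (\<forall>h A. A \<in> sets borel \<longrightarrow> emeasure \<mu> ((\<lambda>g. h + g) ` A) = emeasure \<mu> A)"

definition Chat :: "(('g::{ab_group_add,topological_space} \<Rightarrow> complex) \<Rightarrow> real) \<Rightarrow> ('g \<Rightarrow> complex) \<Rightarrow> nat \<Rightarrow> real" where
  "Chat C \<pi> m = (\<Sum>\<^sub>\<infinity>s\<in>{s. length s = m \<and> set s \<subseteq> dual \<and> char_prod s = \<pi>}. prod_list (map C s))"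

definition hermite :: "nat \<Rightarrow> real \<Rightarrow> real" where
  "hermite m x = (-1) ^ m * exp (x\<^sup>2 / 2) * (deriv ^^ m) (\<lambda>t. exp (- (t\<^sup>2) / 2)) x"

definition centered_gaussian_rv :: "'w measure \<Rightarrow> ('w \<Rightarrow> real) \<Rightarrow> bool" where
  "centered_gaussian_rv P X \<longleftrightarrow> X \<in> borel_measurable P \<and>
     ((AE \<omega> in P. X \<omega> = 0) \<or> (\<exists>\<sigma>>0. distributed P lborel X (\<lambda>x. ennreal (normal_density 0 \<sigma> x))))"

text \<open>Centered Gaussian field: all finite linear combinations are centered Gaussian
  (equivalently, all finite-dimensional distributions are centered Gaussian).\<close>
definition centered_gaussian_field :: "'w measure \<Rightarrow> ('g \<Rightarrow> 'w \<Rightarrow> real) \<Rightarrow> bool" where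
  "centered_gaussian_field P T \<longleftrightarrow>
     (\<forall>(n::nat) (g::nat \<Rightarrow> 'g) (c::nat \<Rightarrow> real). centered_gaussian_rv P (\<lambda>\<omega>. \<Sum>i<n. c i * T (g i) \<omega>))"

definition isotropic :: "'w measure \<Rightarrow> ('g::plus \<Rightarrow> 'w \<Rightarrow> real) \<Rightarrow> bool" where
  "isotropic P T \<longleftrightarrow> (\<forall>(p::nat) (h::'g) (g::nat \<Rightarrow> 'g). p \<ge> 1 \<longrightarrow>
     distr P (PiM {..<p} (\<lambda>_. borel)) (\<lambda>\<omega>. \<lambda>i\<in>{..<p}. T (h + g i) \<omega>) =
     distr P (PiM {..<p} (\<lambda>_. borel)) (\<lambda>\<omega>. \<lambda>i\<in>{..<p}. T (g i) \<omega>))"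

definition fcoef :: "'g::uminus measure \<Rightarrow> ('g \<Rightarrow> 'w \<Rightarrow> real) \<Rightarrow> ('g \<Rightarrow> complex) \<Rightarrow> 'w \<Rightarrow> complex" where
  "fcoef \<mu> T \<pi> \<omega> = integral\<^sup>L \<mu> (\<lambda>g. complex_of_real (T g \<omega>) * \<pi> (- g))"

definition hcoef :: "'g::uminus measure \<Rightarrow> ('g \<Rightarrow> 'w \<Rightarrow> real) \<Rightarrow> nat \<Rightarrow> ('g \<Rightarrow> complex) \<Rightarrow> 'w \<Rightarrow> complex" where
  "hcoef \<mu> T m \<pi> \<omega> = integral\<^sup>L \<mu> (\<lambda>g. complex_of_real (hermite m (T g \<omega>)) * \<pi> (- g))"

definition Cpow :: "'w measure \<Rightarrow> 'g::uminus measure \<Rightarrow> ('g \<Rightarrow> 'w \<Rightarrow> real) \<Rightarrow> ('g \<Rightarrow> complex) \<Rightarrow> real" where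
  "Cpow P \<mu> T \<pi> = integral\<^sup>L P (\<lambda>\<omega>. (cmod (fcoef \<mu> T \<pi> \<omega>))\<^sup>2)"

definition cgauss_law :: "(real \<times> real) measure" where
  "cgauss_law = density lborel (\<lambda>x. ennreal (normal_density 0 (sqrt (1/2)) x))
            \<Otimes>\<^sub>M density lborel (\<lambda>x. ennreal (normal_density 0 (sqrt (1/2)) x))"

definition conv_law_cgauss :: "'w measure \<Rightarrow> (nat \<Rightarrow> 'w \<Rightarrow> complex) \<Rightarrow> bool" where
  "conv_law_cgauss P X \<longleftrightarrow> (\<forall>f :: complex \<Rightarrow> real. continuous_on UNIV f \<and> bounded (range f) \<longrightarrow>
     (\<lambda>l. integral\<^sup>L P (\<lambda>\<omega>. f (X l \<omega>))) \<longlonglongrightarrow> integral\<^sup>L cgauss_law (\<lambda>z. f (Complex (fst z) (snd z))))"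

end

theory Submission
  imports Defs "HOL-Computational_Algebra.Polynomial" "HOL-Probability.Product_PMF"
begin

text \<open>The covariance of \<open>T\<close> is the Fourier transform of the probability weights \<open>C\<close> on the dual
  group, so its \<open>k\<close>-th power is the Fourier transform of the law \<open>Chat C _ k\<close> of a product of \<open>k\<close>
  independent random characters. Gaussian integration by parts then expands the fourth moments of
  \<open>hcoef\<close> into diagrams: multigraphs on four vertices whose edges carry independent random
  characters, each diagram being the probability that the characters at every vertex multiply to
  the right value. All diagrams are nonnegative, the pairings give the Gaussian value, the 4-cycles
  are exactly the sums in condition 3, and AM-GM bounds every other diagram by such a sum. Hence
  condition 2 implies condition 3.

  Conversely, let \<open>F\<close> be a real linear combination of the real and imaginary part of \<open>hcoef\<close>, and
  \<open>\<Gamma>\<close> its Malliavin derivative paired with itself, divided by \<open>m\<close>. Then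
  \<open>E[F\<^sup>k\<^sup>+\<^sup>1] = k E[\<Gamma> F\<^sup>k\<^sup>-\<^sup>1]\<close>, and the same diagrams bound \<open>Var \<Gamma>\<close> by the sums in condition 3,
  provided \<open>\<pi>\<^sup>2\<close> and \<open>\<pi>\<^sup>4\<close> are nontrivial; this holds eventually because the dual of a connected group
  is torsion free and condition 3 keeps \<open>\<pi>\<close> away from the trivial character. With hypercontractive
  bounds on the moments of \<open>F\<close> the recursion makes them converge to Gaussian moments, and
  condition 1 follows; hypercontractivity also gives the uniform integrability needed for
  condition 2. Conditions 3 and 4 are equivalent since \<open>(sup x)\<^sup>2 \<le> \<Sum> x\<^sup>2 \<le> sup x \<cdot> \<Sum> x\<close>.\<close>

section \<open>Haar measure on a compact abelian group\<close>

text \<open>The field is only jointly measurable, so continuity of the covariance must be extracted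
  first: translations are continuous in mean on the product space, and the mean absolute value of a
  Gaussian variable determines its variance. Expanding the covariance in characters needs enough of
  them. They come from convolution operators: power iteration yields a projection, and a projection
  of minimal trace is a multiple of a character. One identity, integration by parts against products
  of polynomials of the field, takes the place of chaos decompositions. As the covariance is an
  average of characters, \<open>Gam\<close> of a functional of order \<open>m + 1\<close> is an
  average of squared moduli of functionals of order \<open>m\<close>; this carries
  hypercontractivity from \<open>m\<close> to \<open>m + 1\<close>. Condition 2 is linked to
  diagrams by \<open>Re z ^ 4 + Im z ^ 4 = 3/4 * |z| ^ 4 + 1/4 * Re (z ^ 4)\<close>. In the bound on
  \<open>Gam\<close>, real weights mix \<pi> with its inverse: a diagram with three or four equal
  signs carries the total character \<open>\<pi>^2\<close> or \<open>\<pi>^4\<close>, up to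
  inversion, and vanishes once these are nontrivial.\<close>

lemma continuous_on_sequentiallyI':
  fixes f :: "'a::first_countable_topology \<Rightarrow> 'b::topological_space"
  assumes "\<And>x X. X \<longlonglongrightarrow> x \<Longrightarrow> (\<lambda>n. f (X n)) \<longlonglongrightarrow> f x"
  shows "continuous_on UNIV f"
  using assms by (auto simp: continuous_on_def tendsto_at_iff_sequentially o_def)

locale compact_ab_group =
  fixes \<mu> :: "('g::{ab_group_add, t2_space, second_countable_topology}) measure"
  assumes add_cont: "continuous_on UNIV (\<lambda>p :: 'g \<times> 'g. fst p + snd p)"
    and neg_cont: "continuous_on UNIV (uminus :: 'g \<Rightarrow> 'g)"
    and compact_G: "compact (UNIV :: 'g set)"
    and haar: "haar_prob \<mu>"
begin

lemma sets_mu[simp, measurable_cong]: "sets \<mu> = sets borel"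
  using haar by (simp add: haar_prob_def)

lemma space_mu[simp]: "space \<mu> = UNIV"
  using sets_eq_imp_space_eq[OF sets_mu] by simp

sublocale haar: prob_space \<mu>
  using haar by (simp add: haar_prob_def)

lemma prob_UNIV[simp]: "measure \<mu> UNIV = 1"
  using haar.prob_space by simp

lemma continuous_add:
  fixes f g :: "'c::topological_space \<Rightarrow> 'g"
  assumes "continuous_on S f" "continuous_on S g"
  shows "continuous_on S (\<lambda>x. f x + g x)"
  using continuous_on_compose2[OF add_cont continuous_on_Pair[OF assms]] by simp

lemma continuous_minus:
  fixes f :: "'c::topological_space \<Rightarrow> 'g"
  assumes "continuous_on S f"
  shows "continuous_on S (\<lambda>x. - f x)"
  using continuous_on_compose2[OF neg_cont assms] by simp

lemma continuous_diff:
  fixes f g :: "'c::topological_space \<Rightarrow> 'g"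
  assumes "continuous_on S f" "continuous_on S g"
  shows "continuous_on S (\<lambda>x. f x - g x)"
  using continuous_add[OF assms(1) continuous_minus[OF assms(2)]] by simp

lemma continuous_compose:
  fixes f :: "'g \<Rightarrow> 'b::topological_space" and g :: "'c::topological_space \<Rightarrow> 'g"
  assumes "continuous_on UNIV f" "continuous_on S g"
  shows "continuous_on S (\<lambda>x. f (g x))"
  using continuous_on_compose2[OF assms] by simp

lemma tendsto_add_group:
  fixes X Y :: "'c \<Rightarrow> 'g"
  assumes "(X \<longlongrightarrow> x) F" "(Y \<longlongrightarrow> y) F"
  shows "((\<lambda>n. X n + Y n) \<longlongrightarrow> x + y) F"
proof -
  have "isCont (\<lambda>p :: 'g \<times> 'g. fst p + snd p) (x, y)"
    using add_cont by (simp add: continuous_on_eq_continuous_at)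
  from isCont_tendsto_compose[OF this tendsto_Pair[OF assms]] show ?thesis by simp
qed

lemma tendsto_minus_group:
  fixes Y :: "'c \<Rightarrow> 'g"
  assumes "(Y \<longlongrightarrow> y) F"
  shows "((\<lambda>n. - Y n) \<longlongrightarrow> - y) F"
proof -
  have "isCont (uminus :: 'g \<Rightarrow> 'g) y"
    using neg_cont by (simp add: continuous_on_eq_continuous_at)
  from isCont_tendsto_compose[OF this assms] show ?thesis .
qed

lemma tendsto_diff_group:
  fixes X Y :: "'c \<Rightarrow> 'g"
  assumes "(X \<longlongrightarrow> x) F" "(Y \<longlongrightarrow> y) F"
  shows "((\<lambda>n. X n - Y n) \<longlongrightarrow> x - y) F"
  using tendsto_add_group[OF assms(1) tendsto_minus_group[OF assms(2)]] by simp

lemma measurable_continuous: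
  fixes f :: "'g \<Rightarrow> 'b::topological_space"
  assumes "continuous_on UNIV f"
  shows "f \<in> borel_measurable \<mu>"
  using borel_measurable_continuous_onI[OF assms] by simp

lemma measurable_translate[measurable]: "(\<lambda>g. h + g) \<in> measurable \<mu> \<mu>"
  using borel_measurable_continuous_onI[OF continuous_add[OF continuous_on_const continuous_on_id], of h]
  by (simp add: measurable_def)

text \<open>Second countability of the group enters here: it makes the Borel sets of the square the
  product of the Borel sets, so that continuous functions of two group variables are measurable for
  the product measure.\<close>

lemma sets_mu_pair: "sets (\<mu> \<Otimes>\<^sub>M \<mu>) = sets (borel :: ('g \<times> 'g) measure)"
  using sets_pair_measure_cong[OF sets_mu sets_mu] by (simp only: borel_prod)

lemma measurable_continuous_pair:
  fixes f :: "'g \<times> 'g \<Rightarrow> 'b::topological_space"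
  assumes "continuous_on UNIV f"
  shows "f \<in> borel_measurable (\<mu> \<Otimes>\<^sub>M \<mu>)"
  using borel_measurable_continuous_onI[OF assms] measurable_cong_sets[OF sets_mu_pair refl] by blast

lemma measurable_diff_pair: "(\<lambda>p. fst p - snd p) \<in> measurable (\<mu> \<Otimes>\<^sub>M \<mu>) \<mu>"
proof -
  have "continuous_on UNIV (\<lambda>p :: 'g \<times> 'g. fst p - snd p)"
    by (intro continuous_diff continuous_on_fst continuous_on_snd continuous_on_id)
  from measurable_continuous_pair[OF this] show ?thesis
    by (simp add: measurable_def)
qed

lemma distr_translate: "distr \<mu> \<mu> (\<lambda>g. h + g) = \<mu>"
proof (rule measure_eqI)
  fix A assume "A \<in> sets (distr \<mu> \<mu> (\<lambda>g. h + g))"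
  then have A: "A \<in> sets borel" by simp
  have eq: "(\<lambda>g. h + g) -` A = (\<lambda>g. - h + g) ` A"
    by (auto simp: image_iff algebra_simps intro!: bexI[of _ "h + _"])
  have "emeasure (distr \<mu> \<mu> (\<lambda>g. h + g)) A = emeasure \<mu> ((\<lambda>g. h + g) -` A \<inter> space \<mu>)"
    by (rule emeasure_distr) (auto simp: A)
  also have "\<dots> = emeasure \<mu> A"
    unfolding space_mu Int_UNIV_right eq using haar[unfolded haar_prob_def] A by blast
  finally show "emeasure (distr \<mu> \<mu> (\<lambda>g. h + g)) A = emeasure \<mu> A" .
qed simp

lemma integral_translate:
  fixes f :: "'g \<Rightarrow> 'b::{banach, second_countable_topology}"
  assumes [measurable]: "f \<in> borel_measurable \<mu>"
  shows "(\<integral>g. f (h + g) \<partial>\<mu>) = (\<integral>g. f g \<partial>\<mu>)"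
  by (subst (2) distr_translate[of h, symmetric], subst integral_distr) auto

lemma integral_translate_diff:
  fixes f :: "'g \<Rightarrow> 'b::{banach, second_countable_topology}"
  assumes "f \<in> borel_measurable \<mu>"
  shows "(\<integral>g. f (g - h) \<partial>\<mu>) = (\<integral>g. f g \<partial>\<mu>)"
  using integral_translate[OF assms, of "- h"] by simp

lemma continuous_bounded:
  fixes f :: "'g \<Rightarrow> 'b::real_normed_vector"
  assumes "continuous_on UNIV f"
  obtains B where "\<And>x. norm (f x) \<le> B" "B > 0"
proof -
  have "bounded (range f)"
    using compact_continuous_image[OF assms compact_G] compact_imp_bounded by blast
  then obtain B where "\<And>x. norm (f x) \<le> B" "B > 0" unfolding bounded_pos by auto
  then show ?thesis using that by blast
qed

lemma continuous_integrable:
  fixes f :: "'g \<Rightarrow> 'b::{banach, second_countable_topology}"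
  assumes "continuous_on UNIV f"
  shows "integrable \<mu> f"
proof -
  obtain B where "\<And>x. norm (f x) \<le> B" using continuous_bounded[OF assms] by blast
  then show ?thesis by (intro haar.integrable_const_bound[where B = B] measurable_continuous assms) auto
qed

lemma continuous_Fubini:
  fixes f :: "'g \<Rightarrow> 'g \<Rightarrow> complex"
  assumes "continuous_on UNIV (\<lambda>p. f (fst p) (snd p))"
  shows "(\<integral>x. \<integral>y. f x y \<partial>\<mu> \<partial>\<mu>) = (\<integral>y. \<integral>x. f x y \<partial>\<mu> \<partial>\<mu>)"
proof -
  interpret pp: pair_prob_space \<mu> \<mu> ..
  have "compact (range (\<lambda>p. f (fst p) (snd p)))"
    using compact_continuous_image[OF assms] compact_Times[OF compact_G compact_G] by (simp)
  from compact_imp_bounded[OF this] obtain B where "\<And>p. norm (f (fst p) (snd p)) \<le> B"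
    unfolding bounded_iff by auto
  then have "integrable (\<mu> \<Otimes>\<^sub>M \<mu>) (\<lambda>p. f (fst p) (snd p))"
    by (intro pp.P.integrable_const_bound[where B = B] measurable_continuous_pair assms) auto
  then have "integrable (\<mu> \<Otimes>\<^sub>M \<mu>) (\<lambda>(x, y). f x y)" by (simp add: case_prod_beta')
  from pp.Fubini_integral[OF this] show ?thesis by simp
qed

text \<open>Invariance under inversion follows from translation invariance: the double integral of
  \<open>f (y - x)\<close> gives the left side when \<open>x\<close> is integrated first and the
  right side when \<open>y\<close> is.\<close>

lemma integral_reflect:
  fixes f :: "'g \<Rightarrow> complex"
  assumes f: "continuous_on UNIV f"
  shows "(\<integral>x. f (- x) \<partial>\<mu>) = (\<integral>x. f x \<partial>\<mu>)"
proof -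
  have m: "(\<lambda>x. f (- x)) \<in> borel_measurable \<mu>"
    by (intro measurable_continuous continuous_compose[OF f] continuous_minus continuous_on_id)
  have "(\<integral>x. f (- x) \<partial>\<mu>) = (\<integral>y. \<integral>x. f (- x) \<partial>\<mu> \<partial>\<mu>)" by (simp add: prob_UNIV)
  also have "\<dots> = (\<integral>y. \<integral>x. f (y - x) \<partial>\<mu> \<partial>\<mu>)"
    using integral_translate_diff[OF m] by simp
  also have "\<dots> = (\<integral>x. \<integral>y. f (y - x) \<partial>\<mu> \<partial>\<mu>)"
    by (rule continuous_Fubini) (intro continuous_compose[OF f] continuous_diff continuous_on_fst continuous_on_snd continuous_on_id)
  also have "\<dots> = (\<integral>x. f x \<partial>\<mu>)"
    using integral_translate_diff[OF measurable_continuous[OF f]] by (simp add: prob_UNIV)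
  finally show ?thesis .
qed

text \<open>If a nonempty open set were null, so would be all its translates, and by compactness
  finitely many of them cover the group, whose measure is 1.\<close>

lemma open_emeasure_pos:
  assumes "open U" "U \<noteq> {}"
  shows "emeasure \<mu> U > 0"
proof (rule ccontr)
  assume "\<not> emeasure \<mu> U > 0"
  then have 0: "emeasure \<mu> U = 0" by simp
  have op: "open ((\<lambda>g. h + g) -` U)" for h
    by (rule open_vimage[OF assms(1)]) (intro continuous_add continuous_on_const continuous_on_id)
  have em: "emeasure \<mu> ((\<lambda>g. h + g) -` U) = 0" for h
  proof -
    have "emeasure \<mu> ((\<lambda>g. h + g) -` U) = emeasure (distr \<mu> \<mu> (\<lambda>g. h + g)) U"
      by (subst emeasure_distr) (use assms in auto)
    then show ?thesis by (simp add: distr_translate 0)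
  qed
  obtain u where u: "u \<in> U" using assms by auto
  have cover: "UNIV \<subseteq> (\<Union>h\<in>UNIV. (\<lambda>g. h + g) -` U)"
  proof
    fix x have "(u - x) + x \<in> U" using u by simp
    then show "x \<in> (\<Union>h\<in>UNIV. (\<lambda>g. h + g) -` U)" by blast
  qed
  obtain H where H: "finite H" "UNIV \<subseteq> (\<Union>h\<in>H. (\<lambda>g. h + g) -` U)"
    by (rule compactE_image[OF compact_G op cover])
  have "emeasure \<mu> (\<Union>h\<in>H. (\<lambda>g. h + g) -` U) \<le> (\<Sum>h\<in>H. emeasure \<mu> ((\<lambda>g. h + g) -` U))"
    by (rule emeasure_subadditive_finite[OF H(1)]) (use op in auto)
  moreover have "(\<Union>h\<in>H. (\<lambda>g. h + g) -` U) = UNIV" using H(2) by (rule antisym[OF subset_UNIV])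
  ultimately have "emeasure \<mu> (UNIV :: 'g set) \<le> 0" using em by simp
  then have "(1::ennreal) \<le> 0" using haar.emeasure_space_1 by (simp only: space_mu)
  then show False by (rule notE[OF not_one_le_zero])
qed

lemma continuous_integral_zero:
  fixes f :: "'g \<Rightarrow> real"
  assumes f: "continuous_on UNIV f" and nn: "\<And>x. f x \<ge> 0" and 0: "(\<integral>x. f x \<partial>\<mu>) = 0"
  shows "f x = 0"
proof (rule ccontr)
  assume "f x \<noteq> 0"
  then have "x \<in> {y. f y > 0}" using nn[of x] by auto
  moreover have "open {y. f y > 0}" by (rule open_Collect_less[OF continuous_on_const f])
  ultimately have pos: "emeasure \<mu> {y. f y > 0} > 0" using open_emeasure_pos by blast
  have "AE y in \<mu>. f y = 0"
    using integral_nonneg_eq_0_iff_AE[OF continuous_integrable[OF f], THEN iffD1, OF _ 0] nn by simp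
  then have "AE y in \<mu>. \<not> f y > 0" by (rule AE_mp) simp
  from emeasure_eq_0_AE[OF this] pos show False by simp
qed

end

section \<open>Convolution operators and nonzero Fourier coefficients\<close>

context compact_ab_group
begin

definition conv :: "('g \<Rightarrow> complex) \<Rightarrow> ('g \<Rightarrow> complex) \<Rightarrow> 'g \<Rightarrow> complex" where
  "conv f k x = (\<integral>y. f (x - y) * k y \<partial>\<mu>)"

definition sqn :: "('g \<Rightarrow> complex) \<Rightarrow> real" where
  "sqn f = (\<integral>x. (cmod (f x))\<^sup>2 \<partial>\<mu>)"

text \<open>The condition makes convolution with \<open>f\<close> a self-adjoint operator on the
  square-integrable functions, and it gives \<open>conv f f 0\<close> the value
  \<open>sqn f\<close>.\<close>

definition hermitian :: "('g \<Rightarrow> complex) \<Rightarrow> bool" where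
  "hermitian f \<longleftrightarrow> continuous_on UNIV f \<and> (\<forall>x. f (- x) = cnj (f x))"

lemma conv_measurable:
  fixes f k :: "'g \<Rightarrow> complex"
  assumes "continuous_on UNIV f" "continuous_on UNIV k"
  shows "(\<lambda>y. f (x - y) * k y) \<in> borel_measurable \<mu>"
  by (intro measurable_continuous continuous_on_mult assms continuous_compose[OF assms(1)] continuous_diff
      continuous_on_const continuous_on_id)

lemma conv_integrable:
  fixes f k :: "'g \<Rightarrow> complex"
  assumes "continuous_on UNIV f" "continuous_on UNIV k"
  shows "integrable \<mu> (\<lambda>y. f (x - y) * k y)"
  by (intro continuous_integrable continuous_on_mult assms continuous_compose[OF assms(1)] continuous_diff
      continuous_on_const continuous_on_id)

text \<open>Both factors and the evaluation point may vary; this one dominated convergence argument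
  serves the continuity of a convolution and the limits in the power iteration.\<close>

lemma conv_LIMSEQ:
  assumes "\<And>n. continuous_on UNIV (f n)" "\<And>n. continuous_on UNIV (k n)"
    and "continuous_on UNIV f'" "continuous_on UNIV k'"
    and "\<And>n x. cmod (f n x) \<le> A" "\<And>n x. cmod (k n x) \<le> B"
    and "\<And>y. (\<lambda>n. f n (X n - y)) \<longlonglongrightarrow> f' (x - y)" "\<And>y. (\<lambda>n. k n y) \<longlonglongrightarrow> k' y"
  shows "(\<lambda>n. conv (f n) (k n) (X n)) \<longlonglongrightarrow> conv f' k' x"
  unfolding conv_def
proof (rule integral_dominated_convergence[where w = "\<lambda>_. A * B"])
  show "AE y in \<mu>. norm (f n (X n - y) * k n y) \<le> A * B" for n
    using assms(5)[of n] assms(6)[of n]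
    by (intro AE_I2) (auto simp: norm_mult intro!: mult_mono order_trans[OF norm_ge_zero assms(5)])
qed (auto intro!: conv_measurable assms tendsto_mult)

lemma continuous_conv:
  assumes f: "continuous_on UNIV f" and k: "continuous_on UNIV k"
  shows "continuous_on UNIV (conv f k)"
proof (rule continuous_on_sequentiallyI')
  fix X and x :: 'g assume X: "X \<longlonglongrightarrow> x"
  obtain A where A: "\<And>x. cmod (f x) \<le> A" using continuous_bounded[OF f] by auto
  obtain B where B: "\<And>x. cmod (k x) \<le> B" using continuous_bounded[OF k] by auto
  have *: "(\<lambda>n. f (X n - y)) \<longlonglongrightarrow> f (x - y)" for y
  proof -
    have "isCont f (x - y)" using f by (simp add: continuous_on_eq_continuous_at)
    from isCont_tendsto_compose[OF this tendsto_diff_group[OF X tendsto_const]] show ?thesis .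
  qed
  show "(\<lambda>n. conv f k (X n)) \<longlonglongrightarrow> conv f k x"
    by (rule conv_LIMSEQ[OF f k f k A B * tendsto_const])
qed

lemma conv_commute:
  assumes f: "continuous_on UNIV f" and k: "continuous_on UNIV k"
  shows "conv f k = conv k f"
proof
  fix x
  have c: "continuous_on UNIV (\<lambda>y. f (x + y) * k (- y))"
    by (intro continuous_on_mult continuous_compose[OF f] continuous_compose[OF k] continuous_add
        continuous_minus continuous_on_const continuous_on_id)
  have "conv f k x = (\<integral>y. f (x + - y) * k (- (- y)) \<partial>\<mu>)" by (simp add: conv_def)
  also have "\<dots> = (\<integral>y. f (x + y) * k (- y) \<partial>\<mu>)" by (rule integral_reflect[OF c])
  also have "\<dots> = (\<integral>y. f (x + (- x + y)) * k (- (- x + y)) \<partial>\<mu>)"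
    by (rule integral_translate[OF measurable_continuous[OF c], symmetric])
  also have "\<dots> = conv k f x" by (simp add: conv_def mult.commute)
  finally show "conv f k x = conv k f x" .
qed

lemma conv_assoc:
  assumes f: "continuous_on UNIV f" and g: "continuous_on UNIV g" and k: "continuous_on UNIV k"
  shows "conv (conv f g) k = conv f (conv g k)"
proof
  fix x
  have m: "(\<lambda>z. f (x - z) * g (z - y)) \<in> borel_measurable \<mu>" for y
    by (intro measurable_continuous continuous_on_mult continuous_compose[OF f] continuous_compose[OF g]
        continuous_diff continuous_on_const continuous_on_id)
  have "conv (conv f g) k x = (\<integral>y. (\<integral>z. f (x - y - z) * g z \<partial>\<mu>) * k y \<partial>\<mu>)"
    by (simp add: conv_def)
  also have "\<dots> = (\<integral>y. (\<integral>z. f (x - z) * g (z - y) \<partial>\<mu>) * k y \<partial>\<mu>)"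
  proof -
    have "(\<integral>z. f (x - y - z) * g z \<partial>\<mu>) = (\<integral>z. f (x - z) * g (z - y) \<partial>\<mu>)" for y
      using integral_translate[OF m[of y], of y] by (simp add: algebra_simps)
    then show ?thesis by simp
  qed
  also have "\<dots> = (\<integral>y. \<integral>z. f (x - z) * g (z - y) * k y \<partial>\<mu> \<partial>\<mu>)" by simp
  also have "\<dots> = (\<integral>z. \<integral>y. f (x - z) * g (z - y) * k y \<partial>\<mu> \<partial>\<mu>)"
    by (rule continuous_Fubini) (intro continuous_on_mult continuous_compose[OF f] continuous_compose[OF g]
        continuous_compose[OF k] continuous_diff continuous_on_const continuous_on_fst continuous_on_snd continuous_on_id)
  also have "\<dots> = conv f (conv g k) x" by (simp add: conv_def mult.assoc)
  finally show "conv (conv f g) k x = conv f (conv g k) x" .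
qed

lemma conv_add_right:
  assumes "continuous_on UNIV f" "continuous_on UNIV g" "continuous_on UNIV k"
  shows "conv f (\<lambda>x. g x + k x) = (\<lambda>x. conv f g x + conv f k x)"
  unfolding conv_def distrib_left
  by (intro ext Bochner_Integration.integral_add conv_integrable assms)

lemma conv_diff_right:
  assumes "continuous_on UNIV f" "continuous_on UNIV g" "continuous_on UNIV k"
  shows "conv f (\<lambda>x. g x - k x) = (\<lambda>x. conv f g x - conv f k x)"
  unfolding conv_def right_diff_distrib
  by (intro ext Bochner_Integration.integral_diff conv_integrable assms)

lemma conv_scale_right: "conv f (\<lambda>x. c * g x) = (\<lambda>x. c * conv f g x)"
  unfolding conv_def by (simp add: mult.left_commute)

lemma conv_scale_left: "conv (\<lambda>x. c * f x) g = (\<lambda>x. c * conv f g x)"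
  unfolding conv_def by (simp add: mult.assoc)

lemma conv_add_left:
  assumes "continuous_on UNIV f" "continuous_on UNIV g" "continuous_on UNIV k"
  shows "conv (\<lambda>x. g x + k x) f = (\<lambda>x. conv g f x + conv k f x)"
  using conv_add_right[OF assms] conv_commute assms continuous_on_add[OF assms(2,3)] by metis

lemma conv_diff_left:
  assumes "continuous_on UNIV f" "continuous_on UNIV g" "continuous_on UNIV k"
  shows "conv (\<lambda>x. g x - k x) f = (\<lambda>x. conv g f x - conv k f x)"
  using conv_diff_right[OF assms] conv_commute assms continuous_on_diff[OF assms(2,3)] by metis

lemma sqn_nonneg: "sqn f \<ge> 0"
  by (simp add: sqn_def)

lemma sqn_zero_iff:
  assumes "continuous_on UNIV f" shows "sqn f = 0 \<longleftrightarrow> f = (\<lambda>_. 0)"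
proof
  assume "sqn f = 0"
  have "(cmod (f x))\<^sup>2 = 0" for x
    by (rule continuous_integral_zero) (use \<open>sqn f = 0\<close> in \<open>auto simp: sqn_def intro!: continuous_intros assms\<close>)
  then show "f = (\<lambda>_. 0)" by auto
qed (simp add: sqn_def)

text \<open>Cauchy-Schwarz as a sup norm bound. Invariance under translation and inversion
  identifies the norm of \<open>f (x - y)\<close> in \<open>y\<close> with that of \<open>f\<close>;
  minimizing a quadratic in the parameter \<open>s\<close> gives the product.\<close>

lemma conv_bound:
  assumes f: "continuous_on UNIV f" and k: "continuous_on UNIV k"
  shows "(cmod (conv f k x))\<^sup>2 \<le> sqn f * sqn k"
proof -
  have cf: "continuous_on UNIV (\<lambda>y. f (x - y))"
    by (intro continuous_compose[OF f] continuous_diff continuous_on_const continuous_on_id)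
  have i1: "integrable \<mu> (\<lambda>y. (cmod (f (x - y)))\<^sup>2)" and i2: "integrable \<mu> (\<lambda>y. (cmod (k y))\<^sup>2)"
    and i3: "integrable \<mu> (\<lambda>y. cmod (f (x - y)) * cmod (k y))"
    by (intro continuous_integrable continuous_intros cf k)+
  have sf: "(\<integral>y. (cmod (f (x - y)))\<^sup>2 \<partial>\<mu>) = sqn f"
  proof -
    have c: "continuous_on UNIV (\<lambda>y. complex_of_real ((cmod (f y))\<^sup>2))"
      by (intro continuous_intros f)
    have cr: "continuous_on UNIV (\<lambda>y. complex_of_real ((cmod (f (x + y)))\<^sup>2))"
      by (intro continuous_intros continuous_compose[OF f] continuous_add continuous_on_const continuous_on_id)
    have "complex_of_real (\<integral>y. (cmod (f (x - y)))\<^sup>2 \<partial>\<mu>) = (\<integral>y. complex_of_real ((cmod (f (x + - y)))\<^sup>2) \<partial>\<mu>)"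
      by (simp del: of_real_power)
    also have "\<dots> = (\<integral>y. complex_of_real ((cmod (f (x + y)))\<^sup>2) \<partial>\<mu>)" by (rule integral_reflect[OF cr])
    also have "\<dots> = (\<integral>y. complex_of_real ((cmod (f y))\<^sup>2) \<partial>\<mu>)" by (rule integral_translate[OF measurable_continuous[OF c]])
    finally show ?thesis by (simp add: sqn_def del: of_real_power)
  qed
  have n: "cmod (conv f k x) \<le> (\<integral>y. cmod (f (x - y)) * cmod (k y) \<partial>\<mu>)"
    unfolding conv_def norm_mult[symmetric] by (rule integral_norm_bound)
  have *: "2 * s * cmod (conv f k x) \<le> s\<^sup>2 * sqn f + sqn k" if "s \<ge> 0" for s
  proof -
    have "2 * s * cmod (conv f k x) \<le> 2 * s * (\<integral>y. cmod (f (x - y)) * cmod (k y) \<partial>\<mu>)"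
      using n that by (intro mult_left_mono) auto
    also have "\<dots> = (\<integral>y. 2 * s * (cmod (f (x - y)) * cmod (k y)) \<partial>\<mu>)" by simp
    also have "\<dots> \<le> (\<integral>y. s\<^sup>2 * (cmod (f (x - y)))\<^sup>2 + (cmod (k y))\<^sup>2 \<partial>\<mu>)"
    proof (rule integral_mono)
      fix y
      show "2 * s * (cmod (f (x - y)) * cmod (k y)) \<le> s\<^sup>2 * (cmod (f (x - y)))\<^sup>2 + (cmod (k y))\<^sup>2"
        using zero_le_power2[of "s * cmod (f (x - y)) - cmod (k y)"] by (simp add: power2_diff power_mult_distrib algebra_simps)
    qed (intro Bochner_Integration.integrable_add integrable_mult_right i1 i2 i3)+
    also have "\<dots> = s\<^sup>2 * sqn f + sqn k"
      using i1 i2 by (simp add: sf) (simp add: sqn_def)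
    finally show ?thesis .
  qed
  define c where "c = cmod (conv f k x)"
  have c0: "c \<ge> 0" by (simp add: c_def)
  show ?thesis
  proof (cases "sqn f = 0")
    case True
    have "c = 0"
    proof (rule ccontr)
      assume "c \<noteq> 0"
      then have "c > 0" using c0 by simp
      have "2 * ((sqn k + 1) / c) * c \<le> sqn k" using *[of "(sqn k + 1) / c"] c0 sqn_nonneg[of k] by (simp add: True c_def)
      then show False using \<open>c > 0\<close> sqn_nonneg[of k] by simp
    qed
    then show ?thesis using True by (simp add: c_def)
  next
    case False
    then have p: "sqn f > 0" using sqn_nonneg[of f] by simp
    have "2 * (c / sqn f) * c \<le> (c / sqn f)\<^sup>2 * sqn f + sqn k" using *[of "c / sqn f"] c0 p by (simp add: c_def)
    then have "c\<^sup>2 / sqn f \<le> sqn k" using p by (simp add: power2_eq_square field_simps)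
    then show ?thesis using p by (simp add: c_def field_simps)
  qed
qed

lemma hermitianD: "hermitian f \<Longrightarrow> continuous_on UNIV f" "hermitian f \<Longrightarrow> f (- x) = cnj (f x)"
  by (auto simp: hermitian_def)

lemma hermitian_add: "hermitian f \<Longrightarrow> hermitian g \<Longrightarrow> hermitian (\<lambda>x. f x + g x)"
  by (auto simp: hermitian_def intro!: continuous_intros)

lemma hermitian_diff: "hermitian f \<Longrightarrow> hermitian g \<Longrightarrow> hermitian (\<lambda>x. f x - g x)"
  by (auto simp: hermitian_def intro!: continuous_intros)

lemma hermitian_scale: "hermitian f \<Longrightarrow> hermitian (\<lambda>x. complex_of_real c * f x)"
  by (auto simp: hermitian_def intro!: continuous_intros)

lemma hermitian_conv:
  assumes "hermitian f" "hermitian g" shows "hermitian (conv f g)"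
  unfolding hermitian_def
proof (intro conjI allI)
  note f = hermitianD(1)[OF assms(1)] and g = hermitianD(1)[OF assms(2)]
  show "continuous_on UNIV (conv f g)" by (rule continuous_conv[OF f g])
  fix x
  have c: "continuous_on UNIV (\<lambda>y. f (- x + y) * g (- y))"
    by (intro continuous_on_mult continuous_compose[OF f] continuous_compose[OF g] continuous_add
        continuous_minus continuous_on_const continuous_on_id)
  have "conv f g (- x) = (\<integral>y. f (- x + - y) * g (- (- y)) \<partial>\<mu>)" by (simp add: conv_def)
  also have "\<dots> = (\<integral>y. f (- x + y) * g (- y) \<partial>\<mu>)" by (rule integral_reflect[OF c])
  also have "\<dots> = (\<integral>y. cnj (f (x - y) * g y) \<partial>\<mu>)"
    using hermitianD(2)[OF assms(1), of "x - _"] hermitianD(2)[OF assms(2)] by (simp add: algebra_simps)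
  also have "\<dots> = cnj (conv f g x)" by (simp add: conv_def del: complex_cnj_mult)
  finally show "conv f g (- x) = cnj (conv f g x)" .
qed

lemma conv_self_zero:
  assumes "hermitian f" shows "conv f f 0 = of_real (sqn f)"
proof -
  have "conv f f 0 = (\<integral>y. complex_of_real ((cmod (f y))\<^sup>2) \<partial>\<mu>)"
    unfolding conv_def complex_norm_square using hermitianD(2)[OF assms] by (simp add: mult.commute)
  then show ?thesis by (simp add: sqn_def del: of_real_power)
qed

lemma hermitian_zero_real: "hermitian f \<Longrightarrow> f 0 = of_real (Re (f 0))"
  using hermitianD(2)[of f 0] by (simp add: complex_eq_iff)


lemma sqn_diff:
  assumes u: "hermitian u" and v: "hermitian v"
  shows "sqn (\<lambda>x. u x - v x) = sqn u + sqn v - 2 * Re (conv u v 0)"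
proof -
  note c = hermitianD(1)[OF u] hermitianD(1)[OF v]
  have "of_real (sqn (\<lambda>x. u x - v x)) = conv (\<lambda>x. u x - v x) (\<lambda>x. u x - v x) 0"
    by (rule conv_self_zero[OF hermitian_diff[OF u v], symmetric])
  also have "\<dots> = conv u u 0 - conv u v 0 - (conv v u 0 - conv v v 0)"
    by (simp add: conv_diff_left conv_diff_right c continuous_on_diff)
  also have "\<dots> = of_real (sqn u) + of_real (sqn v) - 2 * conv u v 0"
    by (simp add: conv_self_zero u v conv_commute[OF c(2,1)])
  finally show ?thesis by (simp add: complex_eq_iff)
qed

text \<open>The index is one less than the number of factors, as there is in general no continuous
  unit for convolution; hence \<open>Suc (i + j)\<close> in the product rule.\<close>

primrec conv_pow :: "('g \<Rightarrow> complex) \<Rightarrow> nat \<Rightarrow> 'g \<Rightarrow> complex" where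
  "conv_pow f 0 = f"
| "conv_pow f (Suc n) = conv f (conv_pow f n)"

lemma hermitian_conv_pow: "hermitian f \<Longrightarrow> hermitian (conv_pow f n)"
  by (induction n) (auto intro: hermitian_conv)

lemma conv_pow_add:
  assumes "hermitian f"
  shows "conv (conv_pow f i) (conv_pow f j) = conv_pow f (Suc (i + j))"
proof (induction i)
  case (Suc i)
  note c = hermitianD(1)[OF hermitian_conv_pow[OF assms]]
  show ?case using Suc conv_assoc[OF hermitianD(1)[OF assms] c c] by simp
qed simp

lemma conv_pow_fixed:
  assumes "hermitian f" "continuous_on UNIV e" "conv f e = f"
  shows "conv (conv_pow f n) e = conv_pow f n"
proof (induction n)
  case (Suc n)
  then show ?case
    using conv_assoc[OF hermitianD(1)[OF assms(1)] hermitianD(1)[OF hermitian_conv_pow[OF assms(1)]] assms(2)] by simp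
qed (simp add: assms)

text \<open>Power iteration: the normalised convolution powers of \<open>f \<star> f\<close> converge to (a multiple of)
  the projection onto the top eigenspace. The \<open>L\<^sup>2\<close> inner products of two of them increase in
  both indices, by log-convexity of \<open>a\<close>, which gives the Cauchy property.\<close>

lemma power_iteration:
  assumes f: "hermitian f" and f0: "f \<noteq> (\<lambda>_. 0)"
  obtains p lam where "hermitian p" "p \<noteq> (\<lambda>_. 0)" "conv p p = p" "lam > (0::real)"
    "conv p (conv f f) = (\<lambda>x. of_real lam * p x)"
    "\<And>e. continuous_on UNIV e \<Longrightarrow> conv f e = f \<Longrightarrow> conv p e = p"
proof -
  note hp = hermitian_conv_pow[OF f]
  note cp = hermitianD(1)[OF hp]
  define a where "a n = sqn (conv_pow f n)" for n
  \<comment> \<open>By hermiticity, \<open>a n\<close> is the value at 0 of a power with an even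
    number of factors; dividing by it below normalizes \<open>g n 0 = 1\<close>.\<close>
  have a_eq: "conv_pow f (2 * n + 1) 0 = of_real (a n)" for n
    using conv_self_zero[OF hp, of n] conv_pow_add[OF f, of n n] by (simp add: a_def mult_2)
  have a_nn: "a n \<ge> 0" for n by (simp add: a_def sqn_nonneg)
  \<comment> \<open>Cauchy-Schwarz for the powers of index \<open>n\<close> and
    \<open>n + 2\<close>, whose convolution at 0 is again \<open>a (n + 1)\<close>.\<close>
  have a_log: "(a (Suc n))\<^sup>2 \<le> a n * a (Suc (Suc n))" for n
  proof -
    have "conv (conv_pow f n) (conv_pow f (Suc (Suc n))) 0 = of_real (a (Suc n))"
      using a_eq[of "Suc n"] conv_pow_add[OF f, of n "Suc (Suc n)"] by (simp add: mult_2)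
    then show ?thesis using conv_bound[OF cp cp, of n "Suc (Suc n)" 0] by (simp add: a_def)
  qed
  have a_pos: "a n > 0" for n
  proof -
    have "a n > 0 \<and> a (Suc n) > 0"
    proof (induction n)
      case 0
      have "f \<noteq> (\<lambda>_. 0)" by fact
      then have 1: "a 0 > 0" using sqn_zero_iff[OF hermitianD(1)[OF f]] a_nn[of 0] by (simp add: a_def less_le)
      have "conv f f 0 \<noteq> 0" using 1 conv_self_zero[OF f] by (simp add: a_def)
      then have "conv_pow f 1 \<noteq> (\<lambda>_. 0)" by (auto simp: fun_eq_iff)
      then have "a 1 > 0" using sqn_zero_iff[OF cp, of 1] a_nn[of 1] by (simp add: a_def less_le)
      then show ?case using 1 by simp
    next
      case (Suc n)
      then have "0 < (a (Suc n))\<^sup>2" by simp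
      also have "\<dots> \<le> a n * a (Suc (Suc n))" by (rule a_log)
      finally show ?case using Suc a_nn by (simp add: zero_less_mult_iff)
    qed
    then show ?thesis by simp
  qed
  define b where "b n = a (Suc n) / a n" for n
  have b_mono: "b n \<le> b (Suc n)" for n
    using a_log[of n] a_pos[of n] a_pos[of "Suc n"] by (simp add: b_def field_simps power2_eq_square)
  have b_incseq: "incseq b" by (rule incseq_SucI) (rule b_mono)
  have b_pos: "b n > 0" for n using a_pos by (simp add: b_def)
  define g where "g n = (\<lambda>x. of_real (1 / a n) * conv_pow f (2 * n + 1) x)" for n
  have hg: "hermitian (g n)" for n unfolding g_def by (intro hermitian_scale hp)
  note cg = hermitianD(1)[OF hg]
  \<comment> \<open>This is the inner product of \<open>g n\<close> and \<open>g m\<close>; its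
    monotonicity in both indices comes from the growth of the ratios \<open>b\<close>.\<close>
  define s where "s n m = a (Suc (n + m)) / (a n * a m)" for n m
  have conv_g: "conv (g n) (g m) = (\<lambda>x. of_real (s n m) * g (Suc (n + m)) x)" for n m
  proof -
    have "conv (g n) (g m) = (\<lambda>x. of_real (1 / a n) * (of_real (1 / a m) * conv_pow f (Suc ((2 * n + 1) + (2 * m + 1))) x))"
      unfolding g_def conv_scale_left conv_scale_right conv_pow_add[OF f] ..
    also have "Suc ((2 * n + 1) + (2 * m + 1)) = 2 * (Suc (n + m)) + 1" by simp
    finally show ?thesis using a_pos[of "Suc (n + m)"]
      by (simp add: g_def s_def fun_eq_iff field_simps del: conv_pow.simps)
  qed
  have g0: "g n 0 = 1" for n using a_pos[of n] unfolding g_def a_eq by simp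
  have g_le: "cmod (g n x) \<le> 1" for n x
  proof -
    have "(cmod (conv_pow f (2 * n + 1) x))\<^sup>2 \<le> (a n)\<^sup>2"
      using conv_bound[OF cp cp, of n n x] conv_pow_add[OF f, of n n] by (simp add: a_def mult_2 power2_eq_square)
    then have "cmod (conv_pow f (2 * n + 1) x) \<le> a n" using a_nn by (rule power2_le_imp_le)
    then show ?thesis using a_pos[of n] by (simp add: g_def norm_mult norm_divide field_simps del: conv_pow.simps)
  qed
  have s_comm: "s n m = s m n" for n m by (simp add: s_def add.commute mult.commute)
  have s_Suc: "s n m \<le> s (Suc n) m" for n m
  proof -
    have "b n \<le> b (Suc (n + m))" using b_incseq by (simp add: incseq_def)
    then show ?thesis using a_pos less_imp_le[OF a_pos] by (simp add: s_def b_def field_simps)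
  qed
  have s_mono1: "s n m \<le> s n' m" if "n \<le> n'" for n n' m
    using that by (rule lift_Suc_mono_le[of "\<lambda>n. s n m", rotated]) (rule s_Suc)
  have s_mono: "s n m \<le> s n' m'" if "n \<le> n'" "m \<le> m'" for n n' m m'
    using s_mono1[OF that(1), of m] s_mono1[OF that(2), of n'] by (simp add: s_comm)
  have conv_g0: "conv (g n) (g m) 0 = of_real (s n m)" for n m
    by (simp add: conv_g g0)
  have sqn_g_le: "sqn (g n) \<le> 1" for n
  proof -
    have "sqn (g n) \<le> (\<integral>x. 1 \<partial>\<mu>)" unfolding sqn_def
      by (rule integral_mono) (use g_le in \<open>auto intro!: continuous_integrable continuous_intros cg simp: power_le_one\<close>)
    then show ?thesis by simp
  qed
  have s_le: "s n m \<le> 1" for n m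
  proof -
    have "(s n m)\<^sup>2 \<le> sqn (g n) * sqn (g m)" using conv_bound[OF cg cg, of n m 0] by (simp add: conv_g0)
    also have "\<dots> \<le> 1 * 1" by (intro mult_mono sqn_g_le) (auto simp: sqn_nonneg)
    finally have "(s n m)\<^sup>2 \<le> 1\<^sup>2" by simp
    then show ?thesis by (rule power2_le_imp_le) simp
  qed
  have sqn_g: "sqn (g n) = s n n" for n
    using conv_self_zero[OF hg, of n] conv_g0[of n n] by simp
  have sqn_gd: "sqn (\<lambda>x. g n x - g m x) = s n n + s m m - 2 * s n m" for n m
    by (simp add: sqn_diff hg sqn_g conv_g0)
  define sd where "sd n = s n n" for n
  have "incseq sd" by (auto simp: incseq_def sd_def intro: s_mono)
  moreover have "\<forall>n. sd n \<le> 1" by (simp add: sd_def s_le)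
  ultimately obtain L where L: "sd \<longlonglongrightarrow> L" "\<forall>n. sd n \<le> L" using incseq_convergent by blast
  have s_pos: "s n m > 0" for n m using a_pos by (simp add: s_def)
  have L_pos: "L > 0" using L(2)[THEN spec, of 0] s_pos[of 0 0] by (simp add: sd_def)
  have sqn_gd_le: "sqn (\<lambda>x. g n x - g m x) \<le> 2 * (L - sd N)" if "N \<le> n" "N \<le> m" for n m N
    using L(2)[THEN spec, of n] L(2)[THEN spec, of m] s_mono[OF that] unfolding sqn_gd sd_def by simp
  define k where "k = conv f f"
  have hk: "hermitian k" unfolding k_def by (intro hermitian_conv f)
  note ck = hermitianD(1)[OF hk]
  have conv_k: "conv k (g n) = (\<lambda>x. of_real (b n) * g (Suc n) x)" for n
  proof -
    have "k = conv_pow f 1" by (simp add: k_def)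
    then have "conv k (g n) = (\<lambda>x. of_real (1 / a n) * conv_pow f (Suc (1 + (2 * n + 1))) x)"
      unfolding g_def by (simp only: conv_scale_right conv_pow_add[OF f])
    also have "Suc (1 + (2 * n + 1)) = 2 * Suc n + 1" by simp
    finally show ?thesis using a_pos[of "Suc n"]
      by (simp add: g_def b_def fun_eq_iff field_simps del: conv_pow.simps)
  qed
  \<comment> \<open>The \<open>g n\<close> are Cauchy in mean square only; convolving with the
    continuous \<open>k\<close> upgrades this to uniform convergence, so the limit is continuous. As
    \<open>conv k (g n)\<close> is \<open>b n\<close> times \<open>g (Suc n)\<close>, the
    \<open>g n\<close> then converge pointwise.\<close>
  have kC: "\<exists>M. \<forall>x. \<forall>m\<ge>M. \<forall>n\<ge>M. cmod (conv k (g m) x - conv k (g n) x) < e" if "e > 0" for e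
  proof -
    define d where "d = e\<^sup>2 / (2 * (sqn k + 1))"
    have "d > 0" using that sqn_nonneg[of k] by (simp add: d_def)
    then obtain N where N: "L - sd N < d"
      using L(1)[THEN LIMSEQ_D, of d] L(2) by (metis abs_minus_commute abs_of_nonneg diff_ge_0_iff_ge order_refl real_norm_def)
    have "cmod (conv k (g m) x - conv k (g n) x) < e" if "m \<ge> N" "n \<ge> N" for m n x
    proof (rule power2_less_imp_less)
      have "(cmod (conv k (g m) x - conv k (g n) x))\<^sup>2 = (cmod (conv k (\<lambda>x. g m x - g n x) x))\<^sup>2"
        by (simp add: conv_diff_right[OF ck cg cg])
      also have "\<dots> \<le> sqn k * sqn (\<lambda>x. g m x - g n x)"
        by (intro conv_bound ck continuous_on_diff cg)
      also have "\<dots> \<le> sqn k * (2 * (L - sd N))"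
        by (intro mult_left_mono sqn_gd_le that sqn_nonneg)
      also have "\<dots> \<le> sqn k * (2 * d)" using N by (intro mult_left_mono sqn_nonneg) auto
      also have "\<dots> < (sqn k + 1) * (2 * d)" using \<open>d > 0\<close> by (simp add: algebra_simps)
      also have "\<dots> = e\<^sup>2"
      proof -
        have "sqn k + 1 \<noteq> 0" using sqn_nonneg[of k] by simp
        then show ?thesis unfolding d_def by (simp del: distrib_left_numeral)
      qed
      finally show "(cmod (conv k (g m) x - conv k (g n) x))\<^sup>2 < e\<^sup>2" .
    qed (use \<open>e > 0\<close> in simp)
    then show ?thesis by blast
  qed
  have "uniformly_convergent_on UNIV (\<lambda>n. conv k (g n))"
    by (rule Cauchy_uniformly_convergent) (use kC in \<open>simp add: uniformly_Cauchy_on_def dist_norm\<close>)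
  then obtain h where h: "uniform_limit UNIV (\<lambda>n. conv k (g n)) h sequentially"
    by (auto simp: uniformly_convergent_on_def)
  have ch: "continuous_on UNIV h"
    by (rule uniform_limit_theorem[OF _ h]) (auto intro!: always_eventually continuous_conv ck cg)
  have hl: "(\<lambda>n. of_real (b n) * g (Suc n) x) \<longlonglongrightarrow> h x" for x
    using tendsto_uniform_limitI[OF h, of x] by (simp add: conv_k)
  define lam where "lam = Re (h 0)"
  have b_lim: "b \<longlonglongrightarrow> lam" using tendsto_Re[OF hl[of 0]] by (simp add: g0 lam_def)
  have lam_pos: "lam > 0" using incseq_le[OF b_incseq b_lim, of 0] b_pos[of 0] by simp
  define gl where "gl x = h x / of_real lam" for x
  have cgl: "continuous_on UNIV gl" unfolding gl_def using lam_pos by (intro continuous_intros ch) auto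
  have g_lim: "(\<lambda>n. g n x) \<longlonglongrightarrow> gl x" for x
  proof -
    have "(\<lambda>n. (of_real (b n) * g (Suc n) x) / of_real (b n)) \<longlonglongrightarrow> h x / of_real lam"
      using lam_pos by (intro tendsto_divide hl tendsto_of_real b_lim) auto
    then have "(\<lambda>n. g (Suc n) x) \<longlonglongrightarrow> gl x"
      using b_pos by (simp add: gl_def less_imp_neq[symmetric] less_imp_neq[OF b_pos, symmetric])
    then show ?thesis by (rule LIMSEQ_imp_Suc)
  qed
  have gl0: "gl 0 = 1" using LIMSEQ_unique[OF g_lim[of 0]] g0 by simp
  have hgl: "hermitian gl" unfolding hermitian_def
  proof (intro conjI allI cgl)
    fix x
    have "(\<lambda>n. g n (- x)) \<longlonglongrightarrow> cnj (gl x)"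
      using tendsto_cnj[OF g_lim[of x]] hermitianD(2)[OF hg] by simp
    then show "gl (- x) = cnj (gl x)" using LIMSEQ_unique[OF g_lim] by blast
  qed
  obtain K where K: "\<And>x. cmod (k x) \<le> K" using continuous_bounded[OF ck] by auto
  have glk: "conv gl k = (\<lambda>x. of_real lam * gl x)"
  proof
    fix x
    have "(\<lambda>n. conv (g n) k x) \<longlonglongrightarrow> conv gl k x"
      by (rule conv_LIMSEQ[OF cg ck cgl ck g_le K g_lim tendsto_const])
    then have "(\<lambda>n. of_real (b n) * g (Suc n) x) \<longlonglongrightarrow> conv gl k x"
      by (simp add: conv_commute[OF cg ck] conv_k)
    from LIMSEQ_unique[OF this hl] show "conv gl k x = of_real lam * gl x" using lam_pos by (simp add: gl_def)
  qed
  have glgl: "conv gl gl = (\<lambda>x. of_real L * gl x)"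
  proof
    fix x
    have 1: "(\<lambda>n. conv (g n) (g n) x) \<longlonglongrightarrow> conv gl gl x"
      by (rule conv_LIMSEQ[OF cg cg cgl cgl g_le g_le g_lim g_lim])
    have "(\<lambda>n. g (Suc (n + n)) x) \<longlonglongrightarrow> gl x"
      by (rule LIMSEQ_subseq_LIMSEQ[OF g_lim, of "\<lambda>n. Suc (n + n)", unfolded o_def]) (simp add: strict_mono_def)
    then have "(\<lambda>n. of_real (sd n) * g (Suc (n + n)) x) \<longlonglongrightarrow> of_real L * gl x"
      by (intro tendsto_mult tendsto_of_real L)
    then show "conv gl gl x = of_real L * gl x" using LIMSEQ_unique[OF 1] by (simp add: conv_g sd_def)
  qed
  \<comment> \<open>The limit satisfies \<open>conv gl gl = L * gl\<close>, so dividing it by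
    \<open>L\<close> makes it idempotent.\<close>
  define p where "p x = of_real (1 / L) * gl x" for x
  have hpp: "hermitian p" unfolding p_def by (rule hermitian_scale[OF hgl])
  show ?thesis
  proof (rule that[OF hpp _ _ lam_pos])
    show "p \<noteq> (\<lambda>_. 0)" using gl0 L_pos by (auto simp: p_def fun_eq_iff intro!: exI[of _ 0])
    show "conv p p = p" unfolding p_def conv_scale_left conv_scale_right glgl using L_pos by (simp add: fun_eq_iff)
    show "conv p (conv f f) = (\<lambda>x. of_real lam * p x)"
      using glk unfolding p_def conv_scale_left k_def by (simp add: mult.left_commute)
    \<comment> \<open>A right unit of \<open>f\<close> fixes every \<open>g n\<close> and hence the
      limit. This property later places the projection found from \<open>psi\<close> below the given
      projection.\<close>
    fix e assume e: "continuous_on UNIV e" "conv f e = f"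
    obtain E where E: "\<And>x. cmod (e x) \<le> E" using continuous_bounded[OF e(1)] by auto
    have "conv gl e x = gl x" for x
    proof -
      have "(\<lambda>n. conv (g n) e x) \<longlonglongrightarrow> conv gl e x"
        by (rule conv_LIMSEQ[OF cg e(1) cgl e(1) g_le E g_lim tendsto_const])
      moreover have "conv (g n) e x = g n x" for n
        unfolding g_def conv_scale_left conv_pow_fixed[OF f e] ..
      ultimately show ?thesis using LIMSEQ_unique[OF _ g_lim] by simp
    qed
    then have "conv gl e = gl" by (rule ext)
    then show "conv p e = p" unfolding p_def conv_scale_left by simp
  qed
qed

text \<open>The value \<open>p 0\<close> is the trace of the projection given by convolution with
  \<open>p\<close>. It equals \<open>sqn p\<close> and bounds \<open>p\<close> uniformly;
  integrating the square gives \<open>sqn p \<le> (sqn p)\<^sup>2\<close>, so a nonzero projection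
  has trace at least 1.\<close>

lemma idempotent_at_zero:
  assumes p: "hermitian p" "conv p p = p" "p \<noteq> (\<lambda>_. 0)"
  shows "Re (p 0) \<ge> 1" "cmod (p x) \<le> Re (p 0)"
proof -
  have sq: "of_real (sqn p) = p 0" using conv_self_zero[OF p(1)] p(2) by simp
  have "(cmod (p x))\<^sup>2 \<le> (sqn p)\<^sup>2" for x
    using conv_bound[OF hermitianD(1)[OF p(1)] hermitianD(1)[OF p(1)], of x] p(2) by (simp add: power2_eq_square)
  then have le: "cmod (p x) \<le> sqn p" for x using sqn_nonneg by (rule power2_le_imp_le)
  have Re0: "Re (p 0) = sqn p" by (metis Re_complex_of_real sq)
  show "cmod (p x) \<le> Re (p 0)" using le Re0 by simp
  have pos: "sqn p > 0" using sqn_zero_iff[OF hermitianD(1)[OF p(1)]] p(3) sqn_nonneg[of p] by (simp add: less_le)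
  have "sqn p \<le> (\<integral>x. (sqn p)\<^sup>2 \<partial>\<mu>)"
    unfolding sqn_def[of p]
    by (rule integral_mono) (auto intro!: continuous_integrable continuous_intros hermitianD(1)[OF p(1)] power_mono le[unfolded sqn_def])
  then have "sqn p * 1 \<le> sqn p * sqn p" by (simp add: power2_eq_square)
  then show "Re (p 0) \<ge> 1" using pos Re0 by (simp add: mult_le_cancel_left)
qed

text \<open>A minimal idempotent is a multiple of a character: every hermitian \<open>\<psi> = \<psi> \<star> p\<close> is then a real
  multiple of \<open>p\<close>, in particular the hermitian parts of the translates of \<open>p\<close>.\<close>

lemma exists_nonzero_coefficient:
  assumes f: "hermitian f" and f0: "f \<noteq> (\<lambda>_. 0)"
  shows "\<exists>\<xi>\<in>dual. (\<integral>x. f x * cnj (\<xi> x) \<partial>\<mu>) \<noteq> 0"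
proof -
  obtain p0 lam where p0: "hermitian p0" "p0 \<noteq> (\<lambda>_. 0)" "conv p0 p0 = p0" "lam > (0::real)"
    "conv p0 (conv f f) = (\<lambda>x. of_real lam * p0 x)"
    by (rule power_iteration[OF f f0]) blast
  define k where "k = conv f f"
  have hk: "hermitian k" unfolding k_def by (intro hermitian_conv f)
  define I where "I = {p. hermitian p \<and> p \<noteq> (\<lambda>_. 0) \<and> conv p p = p \<and> conv p k = (\<lambda>x. of_real lam * p x)}"
  have I1: "Re (p 0) \<ge> 1" if "p \<in> I" for p using that idempotent_at_zero unfolding I_def by blast
  have "p0 \<in> I" using p0 by (simp add: I_def k_def)
  then have ne: "(\<lambda>p. Re (p 0)) ` I \<noteq> {}" by blast
  have bdd: "bdd_below ((\<lambda>p. Re (p 0)) ` I)" using I1 by (auto intro!: bdd_belowI[of _ 1])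
  \<comment> \<open>It is not known at this point that the infimum of the traces is attained. A
    proper subprojection has trace smaller by at least 1, so any \<open>p\<close> less than 1 above
    the infimum is minimal.\<close>
  obtain p where p: "p \<in> I" "Re (p 0) < Inf ((\<lambda>p. Re (p 0)) ` I) + 1"
    using cInf_lessD[OF ne, of "Inf ((\<lambda>p. Re (p 0)) ` I) + 1"] by auto
  have hp: "hermitian p" and pne: "p \<noteq> (\<lambda>_. 0)" and pp: "conv p p = p" and pk: "conv p k = (\<lambda>x. of_real lam * p x)"
    using p(1) by (auto simp: I_def)
  note cp = hermitianD(1)[OF hp]
  have minimal: "q = p" if q: "hermitian q" "q \<noteq> (\<lambda>_. 0)" "conv q q = q" "conv q p = q" for q
  proof (rule ccontr)
    assume "q \<noteq> p"
    note cq = hermitianD(1)[OF q(1)]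
    have "conv q k = conv q (conv p k)" using conv_assoc[OF cq cp hermitianD(1)[OF hk]] q(4) by simp
    then have "q \<in> I" using q by (simp add: I_def pk conv_scale_right)
    then have 1: "Inf ((\<lambda>p. Re (p 0)) ` I) \<le> Re (q 0)" by (intro cInf_lower bdd) auto
    have "Re (p 0 - q 0) \<ge> 1"
    proof (rule idempotent_at_zero(1)[where p = "\<lambda>x. p x - q x"])
      show "hermitian (\<lambda>x. p x - q x)" by (intro hermitian_diff hp q)
      show "conv (\<lambda>x. p x - q x) (\<lambda>x. p x - q x) = (\<lambda>x. p x - q x)"
        using q(3,4) pp conv_commute[OF cp cq]
        by (simp add: conv_diff_left conv_diff_right cp cq continuous_on_diff)
      show "(\<lambda>x. p x - q x) \<noteq> (\<lambda>_. 0)" using \<open>q \<noteq> p\<close> by (metis eq_iff_diff_eq_0 ext)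
    qed
    then show False using 1 p(2) by simp
  qed
  \<comment> \<open>Power iteration applied to \<open>psi\<close> yields a projection below
    \<open>p\<close>, which minimality identifies with \<open>p\<close>; its eigenvalue equation
    then says that the square of \<open>psi\<close> is a multiple of \<open>p\<close>.\<close>
  have square: "\<exists>c::real. conv psi psi = (\<lambda>x. of_real c * p x)" if psi: "hermitian psi" "conv psi p = psi" for psi
  proof (cases "psi = (\<lambda>_. 0)")
    case True
    then show ?thesis by (intro exI[of _ 0]) (simp add: conv_def fun_eq_iff)
  next
    case False
    obtain q l where q: "hermitian q" "q \<noteq> (\<lambda>_. 0)" "conv q q = q" "l > (0::real)"
      "conv q (conv psi psi) = (\<lambda>x. of_real l * q x)" "\<And>e. continuous_on UNIV e \<Longrightarrow> conv psi e = psi \<Longrightarrow> conv q e = q"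
      by (rule power_iteration[OF psi(1) False]) blast
    have "q = p" using q cp psi(2) by (intro minimal) auto
    note c = hermitianD(1)[OF psi(1)]
    have "conv p (conv psi psi) = conv (conv psi psi) p" by (rule conv_commute[OF cp continuous_conv[OF c c]])
    also have "\<dots> = conv psi psi" using conv_assoc[OF c c cp] psi(2) by simp
    finally show ?thesis using q(5) \<open>q = p\<close> by auto
  qed
  \<comment> \<open>Polarization: the square of \<open>psi + p\<close> is the square of
    \<open>psi\<close> plus \<open>2 * psi + p\<close>, and both squares are multiples of
    \<open>p\<close>.\<close>
  have multiple: "\<exists>c::real. psi = (\<lambda>x. of_real c * p x)" if psi: "hermitian psi" "conv psi p = psi" for psi
  proof -
    note c = hermitianD(1)[OF psi(1)]
    obtain c1 where c1: "conv psi psi = (\<lambda>x. of_real c1 * p x)" using square[OF psi] by blast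
    have "conv (\<lambda>x. psi x + p x) p = (\<lambda>x. psi x + p x)"
      using psi(2) pp by (simp add: conv_add_left c cp)
    then obtain c2 where c2: "conv (\<lambda>x. psi x + p x) (\<lambda>x. psi x + p x) = (\<lambda>x. of_real c2 * p x)"
      using square[OF hermitian_add[OF psi(1) hp]] by blast
    have "conv (\<lambda>x. psi x + p x) (\<lambda>x. psi x + p x) = (\<lambda>x. conv psi psi x + psi x + (psi x + p x))"
      using psi(2) pp conv_commute[OF cp c] by (simp add: conv_add_left conv_add_right c cp continuous_on_add)
    then have "of_real c2 * p x = of_real c1 * p x + psi x + (psi x + p x)" for x
      using c1 c2 by (metis (no_types, lifting))
    then have "psi x = of_real ((c2 - c1 - 1) / 2) * p x" for x
      by (simp add: field_simps)
    then show ?thesis by blast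
  qed
  have tr: "conv (\<lambda>x. p (x + h)) p = (\<lambda>x. p (x + h))" for h
  proof
    fix x
    have "conv (\<lambda>x. p (x + h)) p x = conv p p (x + h)" by (simp add: conv_def algebra_simps)
    then show "conv (\<lambda>x. p (x + h)) p x = p (x + h)" by (simp add: pp)
  qed
  have ct: "continuous_on UNIV (\<lambda>x. p (x + h))" for h
    by (intro continuous_compose[OF cp] continuous_add continuous_on_const continuous_on_id)
  have ht: "cnj (p (x + h)) = p (- x - h)" for x h using hermitianD(2)[OF hp, of "x + h"] by simp
  \<comment> \<open>A translate of \<open>p\<close> is in general not hermitian, so it is recovered
    from the hermitian functions \<open>p (x + h) + p (x - h)\<close> and
    \<open>\<i> * (p (x + h) - p (x - h))\<close>.\<close>
  have trans: "\<exists>c. \<forall>x. p (x + h) = c * p x" for h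
  proof -
    have "hermitian (\<lambda>x. p (x + h) + p (x + (- h)))"
      using ht[of _ h] ht[of _ "- h"] ct[of h] ct[of "- h"] unfolding hermitian_def
      by (auto intro!: continuous_on_add simp: add.commute)
    moreover have "conv (\<lambda>x. p (x + h) + p (x + (- h))) p = (\<lambda>x. p (x + h) + p (x + (- h)))"
      unfolding conv_add_left[OF cp ct ct] tr ..
    ultimately obtain c1 where c1: "(\<lambda>x. p (x + h) + p (x + (- h))) = (\<lambda>x. of_real c1 * p x)" using multiple by blast
    have "hermitian (\<lambda>x. \<i> * (p (x + h) - p (x + (- h))))"
      using ht[of _ h] ht[of _ "- h"] ct[of h] ct[of "- h"] unfolding hermitian_def
      by (auto intro!: continuous_on_mult continuous_on_const continuous_on_diff simp: algebra_simps)
    moreover have "conv (\<lambda>x. \<i> * (p (x + h) - p (x + (- h)))) p = (\<lambda>x. \<i> * (p (x + h) - p (x + (- h))))"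
      unfolding conv_scale_left conv_diff_left[OF cp ct ct] tr ..
    ultimately obtain c2 where c2: "(\<lambda>x. \<i> * (p (x + h) - p (x + (- h)))) = (\<lambda>x. of_real c2 * p x)" using multiple by blast
    have "2 * p (x + h) = of_real c1 * p x - \<i> * (of_real c2 * p x)" for x
    proof -
      have "2 * p (x + h) = (p (x + h) + p (x + (- h))) - \<i> * (\<i> * (p (x + h) - p (x + (- h))))"
        by (simp add: algebra_simps)
      then show ?thesis unfolding fun_cong[OF c1, of x] fun_cong[OF c2, of x] .
    qed
    then have "p (x + h) = (of_real c1 * p x - \<i> * (of_real c2 * p x)) / 2" for x
      by (metis nonzero_mult_div_cancel_left zero_neq_numeral)
    then have "p (x + h) = ((of_real c1 - \<i> * of_real c2) / 2) * p x" for x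
      by (simp add: left_diff_distrib diff_divide_distrib mult.assoc)
    then show ?thesis by blast
  qed
  define d where "d = Re (p 0)"
  have d1: "d \<ge> 1" using I1[OF p(1)] by (simp add: d_def)
  have p0d: "p 0 = of_real d" using hermitian_zero_real[OF hp] by (simp add: d_def)
  define ch where "ch x = p x / of_real d" for x
  have pch: "p x = of_real d * ch x" for x using d1 by (simp add: ch_def)
  have ch0: "ch 0 = 1" using d1 by (simp add: ch_def p0d)
  have ch_add: "ch (x + h) = ch x * ch h" for x h
  proof -
    obtain c where c: "\<And>x. p (x + h) = c * p x" using trans[of h] by auto
    have "c = ch h" using c[of 0] d1 by (simp add: p0d ch_def)
    then show ?thesis using c[of x] by (simp add: ch_def)
  qed
  have ch_le: "cmod (ch x) \<le> 1" for x
    using idempotent_at_zero(2)[OF hp pp pne, of x] d1 by (simp add: ch_def norm_divide d_def)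
  have ch1: "cmod (ch x) = 1" for x
  proof -
    have "cmod (ch x) * cmod (ch (- x)) = 1" using ch_add[of x "- x"] by (simp add: ch0 norm_mult[symmetric])
    moreover have "cmod (ch x) * cmod (ch (- x)) \<le> cmod (ch x) * 1" by (intro mult_left_mono ch_le) simp
    ultimately show ?thesis using ch_le[of x] by linarith
  qed
  have cch: "continuous_on UNIV ch" unfolding ch_def using d1 by (intro continuous_intros cp) auto
  have dual: "ch \<in> dual" by (simp add: dual_def is_character_def cch ch_add ch1)
  have ch_inv: "ch (- x) = cnj (ch x)" for x
    using hermitianD(2)[OF hp, of x] d1 by (simp add: ch_def)
  define F where "F = (\<integral>x. f x * cnj (ch x) \<partial>\<mu>)"
  have conv_ch: "conv u ch x = (\<integral>y. u y * cnj (ch y) \<partial>\<mu>) * ch x" if u: "continuous_on UNIV u" for u x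
  proof -
    have "conv u ch x = conv ch u x" by (simp add: conv_commute[OF u cch])
    also have "\<dots> = (\<integral>y. ch x * (u y * cnj (ch y)) \<partial>\<mu>)"
      unfolding conv_def using ch_add[of x "- _"] by (simp add: ch_inv mult_ac)
    finally show ?thesis by (simp add: mult.commute)
  qed
  \<comment> \<open>The eigenvalue of \<open>conv f f\<close> at \<open>ch\<close> is both
    \<open>lam > 0\<close> and the square of the Fourier coefficient \<open>F\<close>, which is
    therefore nonzero.\<close>
  have "conv k ch = (\<lambda>x. of_real lam * ch x)"
  proof -
    have "conv k p = (\<lambda>x. of_real lam * p x)" using pk conv_commute[OF cp hermitianD(1)[OF hk]] by simp
    moreover have "p = (\<lambda>x. of_real d * ch x)" using pch by auto
    ultimately have "(\<lambda>x. of_real d * conv k ch x) = (\<lambda>x. of_real lam * (of_real d * ch x))"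
      by (metis conv_scale_right)
    then show ?thesis using d1 by (auto simp: fun_eq_iff)
  qed
  moreover have "conv k ch = conv f (conv f ch)"
    unfolding k_def by (intro conv_assoc hermitianD(1)[OF f] cch)
  moreover have "conv f ch = (\<lambda>x. F * ch x)" using conv_ch[OF hermitianD(1)[OF f]] by (auto simp: F_def)
  ultimately have "F * (F * ch 0) = of_real lam * ch 0" by (metis conv_scale_right)
  then have "F \<noteq> 0" using p0(4) ch0 by auto
  then show ?thesis using dual unfolding F_def by blast
qed

end

section \<open>Gaussian integration by parts\<close>

text \<open>A class closed under sums and products, so that integrability throughout the Gaussian
  calculus becomes a matter of closure rules.\<close>

definition fmom :: "'a measure \<Rightarrow> ('a \<Rightarrow> 'b::{real_normed_field, banach, second_countable_topology}) \<Rightarrow> bool" where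
  "fmom M X \<longleftrightarrow> X \<in> borel_measurable M \<and> (\<forall>n. integrable M (\<lambda>x. norm (X x) ^ n))"

lemma fmom_measurable: "fmom M X \<Longrightarrow> X \<in> borel_measurable M"
  by (simp add: fmom_def)

lemma fmom_power_integrable: "fmom M X \<Longrightarrow> integrable M (\<lambda>x. norm (X x) ^ n)"
  by (simp add: fmom_def)

lemma fmom_integrable: "fmom M X \<Longrightarrow> integrable M X"
  using fmom_power_integrable[of M X 1] fmom_measurable[of M X] by (simp add: integrable_norm_iff)

lemma fmomI:
  assumes "X \<in> borel_measurable M" "\<And>n. integrable M (Y n)" "\<And>n x. x \<in> space M \<Longrightarrow> norm (X x) ^ n \<le> Y n x"
  shows "fmom M X"
  unfolding fmom_def
proof (intro conjI allI assms(1))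
  fix n
  show "integrable M (\<lambda>x. norm (X x) ^ n)"
    by (rule Bochner_Integration.integrable_bound[OF assms(2)[of n]])
      (use assms(1,3) in \<open>auto intro!: AE_I2 order_trans[OF assms(3)]\<close>)
qed

lemma fmom_mono:
  assumes "X \<in> borel_measurable M" "fmom M Y" "\<And>x. x \<in> space M \<Longrightarrow> norm (X x) \<le> norm (Y x)"
  shows "fmom M X"
  by (rule fmomI[OF assms(1) fmom_power_integrable[OF assms(2)]]) (auto intro: power_mono assms(3))

lemma power_add_le: "(a + b) ^ n \<le> 2 ^ n * (a ^ n + b ^ n)" if "a \<ge> 0" "b \<ge> 0" for a b :: real
proof -
  have "(a + b) ^ n \<le> (2 * max a b) ^ n" using that by (intro power_mono) auto
  also have "\<dots> \<le> 2 ^ n * (a ^ n + b ^ n)" using that by (auto simp: power_mult_distrib max_def)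
  finally show ?thesis .
qed

lemma fmom_add:
  assumes "fmom M X" "fmom M Y" shows "fmom M (\<lambda>x. X x + Y x)"
proof (rule fmomI[where Y = "\<lambda>n x. 2 ^ n * (norm (X x) ^ n + norm (Y x) ^ n)"])
  fix n x
  have "norm (X x + Y x) ^ n \<le> (norm (X x) + norm (Y x)) ^ n" by (intro power_mono norm_triangle_ineq) simp
  also have "\<dots> \<le> 2 ^ n * (norm (X x) ^ n + norm (Y x) ^ n)" by (rule power_add_le) auto
  finally show "norm (X x + Y x) ^ n \<le> 2 ^ n * (norm (X x) ^ n + norm (Y x) ^ n)" .
next
  show "(\<lambda>x. X x + Y x) \<in> borel_measurable M"
    by (rule borel_measurable_add[OF assms[THEN fmom_measurable]])
qed (use assms in \<open>auto intro!: fmom_power_integrable\<close>)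

lemma fmom_mult:
  assumes "fmom M X" "fmom M Y" shows "fmom M (\<lambda>x. X x * Y x)"
proof (rule fmomI[where Y = "\<lambda>n x. norm (X x) ^ (2 * n) + norm (Y x) ^ (2 * n)"])
  fix n x
  have "2 * (norm (X x) ^ n * norm (Y x) ^ n) \<le> (norm (X x) ^ n)\<^sup>2 + (norm (Y x) ^ n)\<^sup>2"
    using sum_squares_bound[of "norm (X x) ^ n" "norm (Y x) ^ n"] by (simp only: mult.assoc)
  moreover have "0 \<le> norm (X x) ^ n * norm (Y x) ^ n" by (intro mult_nonneg_nonneg zero_le_power norm_ge_zero)
  ultimately have "norm (X x) ^ n * norm (Y x) ^ n \<le> (norm (X x) ^ n)\<^sup>2 + (norm (Y x) ^ n)\<^sup>2" by linarith
  then show "norm (X x * Y x) ^ n \<le> norm (X x) ^ (2 * n) + norm (Y x) ^ (2 * n)"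
    by (simp add: norm_mult power_mult_distrib power_even_eq)
next
  show "(\<lambda>x. X x * Y x) \<in> borel_measurable M"
    by (rule borel_measurable_times[OF assms[THEN fmom_measurable]])
qed (use assms in \<open>auto intro!: fmom_power_integrable\<close>)

context finite_measure
begin

lemma fmom_bounded:
  assumes "X \<in> borel_measurable M" "\<And>x. x \<in> space M \<Longrightarrow> norm (X x) \<le> B"
  shows "fmom M X"
  by (rule fmomI[where Y = "\<lambda>n _. B ^ n"]) (use assms in \<open>auto intro!: power_mono\<close>)

lemma fmom_const: "fmom M (\<lambda>_. c)"
  by (rule fmom_bounded[where B = "norm c"]) auto

lemma fmom_scale: "fmom M X \<Longrightarrow> fmom M (\<lambda>x. c * X x)"
  by (intro fmom_mult fmom_const)

lemma fmom_uminus: "fmom M X \<Longrightarrow> fmom M (\<lambda>x. - X x)"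
  using fmom_scale[of X "-1"] by simp

lemma fmom_diff: "fmom M X \<Longrightarrow> fmom M Y \<Longrightarrow> fmom M (\<lambda>x. X x - Y x)"
  using fmom_add[OF _ fmom_uminus, of X Y] by simp

lemma fmom_power: "fmom M X \<Longrightarrow> fmom M (\<lambda>x. X x ^ n)"
  by (induction n) (auto intro: fmom_const fmom_mult)

lemma fmom_sum: "(\<And>i. i \<in> I \<Longrightarrow> fmom M (X i)) \<Longrightarrow> fmom M (\<lambda>x. \<Sum>i\<in>I. X i x)"
  by (induction I rule: infinite_finite_induct) (auto intro: fmom_const fmom_add)

lemma fmom_poly: "fmom M X \<Longrightarrow> fmom M (\<lambda>x. poly p (X x))"
  by (induction p) (auto intro: fmom_const fmom_add fmom_mult)

lemma fmom_abs: "fmom M X \<Longrightarrow> fmom M (\<lambda>x. \<bar>X x :: real\<bar>)"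
  by (rule fmom_mono[of _ _ X]) (auto dest: fmom_measurable)

lemmas fmom_intros = fmom_const fmom_scale fmom_uminus fmom_diff fmom_add fmom_mult fmom_power fmom_sum fmom_poly

text \<open>By the binomial theorem the integral is a polynomial in \<open>s\<close>, and its
  derivative at 0 is the linear coefficient.\<close>

lemma DERIV_moment_at_0:
  fixes X Y A :: "'a \<Rightarrow> real"
  assumes "fmom M A" "fmom M X" "fmom M Y"
  shows "((\<lambda>s. \<integral>x. A x * (Y x + s * X x) ^ n \<partial>M) has_real_derivative
    real n * (\<integral>x. A x * X x * Y x ^ (n - 1) \<partial>M)) (at 0)"
proof -
  define c where "c i = real (n choose i) * (\<integral>x. A x * X x ^ i * Y x ^ (n - i) \<partial>M)" for i
  have "(\<integral>x. A x * (Y x + s * X x) ^ n \<partial>M) = (\<Sum>i\<le>n. c i * s ^ i)" for s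
  proof -
    have "(\<integral>x. A x * (Y x + s * X x) ^ n \<partial>M) = (\<integral>x. (\<Sum>i\<le>n. (real (n choose i) * s ^ i) * (A x * X x ^ i * Y x ^ (n - i))) \<partial>M)"
      by (subst add.commute, subst binomial_ring) (simp add: sum_distrib_left power_mult_distrib mult_ac)
    also have "\<dots> = (\<Sum>i\<le>n. (real (n choose i) * s ^ i) * (\<integral>x. A x * X x ^ i * Y x ^ (n - i) \<partial>M))"
      by (subst Bochner_Integration.integral_sum) (auto intro!: integrable_mult_right fmom_integrable fmom_intros assms)
    finally show ?thesis by (simp add: c_def mult_ac)
  qed
  then have eq: "(\<lambda>s. \<integral>x. A x * (Y x + s * X x) ^ n \<partial>M) = (\<lambda>s. \<Sum>i\<le>n. c i * s ^ i)" by auto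
  have "((\<lambda>s. \<Sum>i\<le>n. c i * s ^ i) has_real_derivative (\<Sum>i\<le>n. c i * (real i * 0 ^ (i - Suc 0)))) (at 0)"
    by (auto intro!: derivative_eq_intros sum.cong)
  moreover have "(\<Sum>i\<le>n. c i * (real i * 0 ^ (i - Suc 0))) = real n * (\<integral>x. A x * X x * Y x ^ (n - 1) \<partial>M)"
  proof (cases n)
    case (Suc k)
    have "(\<Sum>i\<le>n. c i * (real i * 0 ^ (i - Suc 0))) = (\<Sum>i\<in>{1}. c i * (real i * 0 ^ (i - Suc 0)))"
      using Suc by (intro sum.mono_neutral_right) (auto simp: power_0_left)
    then show ?thesis using Suc by (simp add: c_def)
  qed (simp add: c_def)
  ultimately show ?thesis unfolding eq by metis
qed

end

lemma (in prob_space) centered_gaussian_rv_fmom: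
  assumes "centered_gaussian_rv M Y" shows "fmom M Y"
  unfolding fmom_def
proof (intro conjI allI)
  show m: "Y \<in> borel_measurable M" using assms by (simp add: centered_gaussian_rv_def)
  fix n
  from assms consider "AE x in M. Y x = 0"
    | \<sigma> where "\<sigma> > 0" "distributed M lborel Y (\<lambda>x. ennreal (normal_density 0 \<sigma> x))"
    unfolding centered_gaussian_rv_def by blast
  then show "integrable M (\<lambda>x. norm (Y x) ^ n)"
  proof cases
    case 1
    have "integrable M (\<lambda>x. norm (Y x) ^ n) = integrable M (\<lambda>x. 0 ^ n :: real)"
      by (rule integrable_cong_AE) (use 1 m in auto)
    then show ?thesis by simp
  next
    case 2
    have "integrable lborel (\<lambda>x. normal_density 0 \<sigma> x * \<bar>x - 0\<bar> ^ n)"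
    proof (cases "even n")
      case True
      then obtain k where k: "n = 2 * k" by (auto elim: evenE)
      show ?thesis using normal_moment_even[OF 2(1), of 0 k] unfolding has_bochner_integral_iff k
        by (simp add: power_even_abs)
    next
      case False
      then obtain k where k: "n = 2 * k + 1" by (auto elim: oddE)
      show ?thesis using normal_moment_abs_odd[OF 2(1), of 0 k] unfolding has_bochner_integral_iff k by blast
    qed
    then show ?thesis
      using distributed_integrable[OF 2(2), of "\<lambda>x. \<bar>x\<bar> ^ n"] by simp
  qed
qed

text \<open>Stein's identity for powers; together with finiteness of the moments it is the only
  property of the normal law behind \<open>gaussian_ibp\<close>. At \<open>n = 0\<close> the
  truncated exponent \<open>n - 1\<close> is harmless because of the factor
  \<open>n\<close>.\<close>

lemma (in prob_space) centered_gaussian_rv_moment: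
  assumes Y: "centered_gaussian_rv M Y"
  shows "expectation (\<lambda>x. Y x ^ Suc n) = real n * expectation (\<lambda>x. (Y x)\<^sup>2) * expectation (\<lambda>x. Y x ^ (n - 1))"
proof -
  have m: "Y \<in> borel_measurable M" using assms by (simp add: centered_gaussian_rv_def)
  from assms consider "AE x in M. Y x = 0"
    | \<sigma> where "\<sigma> > 0" "distributed M lborel Y (\<lambda>x. ennreal (normal_density 0 \<sigma> x))"
    unfolding centered_gaussian_rv_def by blast
  then show ?thesis
  proof cases
    case 1
    have "expectation (\<lambda>x. Y x ^ Suc k) = expectation (\<lambda>x. 0 ^ Suc k)" for k
      by (rule integral_cong_AE) (use 1 m in auto)
    from this[of n] this[of 1] show ?thesis by (simp add: numeral_2_eq_2)
  next
    case 2
    have E: "expectation (\<lambda>x. Y x ^ k) = (\<integral>x. normal_density 0 \<sigma> x * (x - 0) ^ k \<partial>lborel)" for k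
      using distributed_integral[OF 2(2), of "\<lambda>x. x ^ k"] by simp
    have ev: "expectation (\<lambda>x. Y x ^ (2 * k)) = fact (2 * k) / ((2 / \<sigma>\<^sup>2)^k * fact k)" for k
      unfolding E by (rule integral_normal_moment_even[OF 2(1)])
    have od: "expectation (\<lambda>x. Y x ^ (2 * k + 1)) = 0" for k
      unfolding E by (rule integral_normal_moment_odd[OF 2(1)])
    have v: "expectation (\<lambda>x. (Y x)\<^sup>2) = \<sigma>\<^sup>2" using ev[of 1] by simp
    show ?thesis
    proof (cases "even n")
      case True
      then obtain k where k: "n = 2 * k" by (auto elim: evenE)
      show ?thesis
      proof (cases k)
        case 0
        then show ?thesis using od[of 0] k by simp
      next
        case (Suc j)
        have "Suc n = 2 * Suc j + 1" "n - 1 = 2 * j + 1" using k Suc by auto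
        then show ?thesis using od by (simp only: mult_zero_right)
      qed
    next
      case False
      then obtain k where k: "n = 2 * k + 1" by (auto elim: oddE)
      have "Suc n = 2 * Suc k" "n - 1 = 2 * k" using k by auto
      moreover have "fact (2 * Suc k) / ((2 / \<sigma>\<^sup>2) ^ Suc k * fact (Suc k)) =
          real n * \<sigma>\<^sup>2 * (fact (2 * k) / ((2 / \<sigma>\<^sup>2) ^ k * fact k))"
      proof -
        have *: "2 * r * (2 * r - 1) * F / (2 / v * D * (r * G)) = (2 * r - 1) * v * (F / (D * G))"
          if "r > 0" "v > 0" "D > 0" "G > 0" for r v D F G :: real
          using that by (simp add: field_simps)
        have "fact (2 * Suc k) = 2 * real (Suc k) * (2 * real (Suc k) - 1) * fact (2 * k)" by simp
        moreover have "(fact (Suc k) :: real) = real (Suc k) * fact k" by simp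
        moreover have "real n = 2 * real (Suc k) - 1" using k by simp
        ultimately show ?thesis using *[of "real (Suc k)" "\<sigma>\<^sup>2" "(2 / \<sigma>\<^sup>2) ^ k" "fact k" "fact (2 * k)"] 2(1)
          by (simp only: power_Suc) simp
      qed
      ultimately show ?thesis unfolding v by (simp only: ev)
    qed
  qed
qed

section \<open>Integration by parts for polynomials of a Gaussian field\<close>

primrec poly_mono :: "('i \<Rightarrow> 'w \<Rightarrow> real) \<Rightarrow> 'i list \<Rightarrow> 'w \<Rightarrow> real" where
  "poly_mono T [] = (\<lambda>\<omega>. 1)"
| "poly_mono T (g # gs) = (\<lambda>\<omega>. T g \<omega> * poly_mono T gs \<omega>)"

text \<open>The product rule with \<open>R h g\<close> in place of the derivative of
  \<open>T g\<close>; for \<open>R\<close> the covariance it is the derivative of the monomial in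
  the Cameron-Martin direction belonging to \<open>T h\<close>. The same holds for
  \<open>D_prod\<close> and products of polynomials.\<close>

primrec D_mono :: "('i \<Rightarrow> 'i \<Rightarrow> real) \<Rightarrow> ('i \<Rightarrow> 'w \<Rightarrow> real) \<Rightarrow> 'i list \<Rightarrow> 'i \<Rightarrow> 'w \<Rightarrow> real" where
  "D_mono R T [] h = (\<lambda>\<omega>. 0)"
| "D_mono R T (g # gs) h = (\<lambda>\<omega>. R h g * poly_mono T gs \<omega> + T g \<omega> * D_mono R T gs h \<omega>)"

primrec poly_prod :: "('i \<Rightarrow> 'w \<Rightarrow> real) \<Rightarrow> (real poly \<times> 'i) list \<Rightarrow> 'w \<Rightarrow> real" where
  "poly_prod T [] = (\<lambda>\<omega>. 1)"
| "poly_prod T (pg # K) = (\<lambda>\<omega>. poly (fst pg) (T (snd pg) \<omega>) * poly_prod T K \<omega>)"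

primrec D_prod :: "('i \<Rightarrow> 'i \<Rightarrow> real) \<Rightarrow> ('i \<Rightarrow> 'w \<Rightarrow> real) \<Rightarrow> (real poly \<times> 'i) list \<Rightarrow> 'i \<Rightarrow> 'w \<Rightarrow> real" where
  "D_prod R T [] h = (\<lambda>\<omega>. 0)"
| "D_prod R T (pg # K) h = (\<lambda>\<omega>.
    R h (snd pg) * poly (pderiv (fst pg)) (T (snd pg) \<omega>) * poly_prod T K \<omega> + poly (fst pg) (T (snd pg) \<omega>) * D_prod R T K h \<omega>)"

text \<open>Consing \<open>(s, g)\<close> puts the new term on the right, so that the result is
  literally the perturbation \<open>Y + s * X\<close> that \<open>DERIV_moment_at_0\<close>
  differentiates.\<close>

primrec lin_comb :: "('i \<Rightarrow> 'w \<Rightarrow> real) \<Rightarrow> (real \<times> 'i) list \<Rightarrow> 'w \<Rightarrow> real" where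
  "lin_comb T [] = (\<lambda>\<omega>. 0)"
| "lin_comb T (cg # L) = (\<lambda>\<omega>. lin_comb T L \<omega> + fst cg * T (snd cg) \<omega>)"

locale gaussian_field = prob_space P for P :: "'w measure" +
  fixes T :: "'i \<Rightarrow> 'w \<Rightarrow> real"
  assumes T_gauss: "centered_gaussian_field P T"
begin

definition cov :: "'i \<Rightarrow> 'i \<Rightarrow> real" where "cov g h = expectation (\<lambda>\<omega>. T g \<omega> * T h \<omega>)"

lemma cov_commute: "cov g h = cov h g"
  by (simp add: cov_def mult.commute)

lemma lin_comb_gaussian: "centered_gaussian_rv P (lin_comb T L)"
proof -
  have "lin_comb T L = (\<lambda>\<omega>. \<Sum>i<length L. fst (L ! i) * T (snd (L ! i)) \<omega>)"
  proof (induction L)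
    case (Cons a L)
    show ?case by (simp add: Cons sum.lessThan_Suc_shift add.commute fun_eq_iff del: sum.lessThan_Suc)
  qed auto
  then show ?thesis using T_gauss unfolding centered_gaussian_field_def by metis
qed

lemma T_gaussian: "centered_gaussian_rv P (T g)"
proof -
  have "lin_comb T [(1, g)] = T g" by (simp add: fun_eq_iff)
  then show ?thesis using lin_comb_gaussian[of "[(1, g)]"] by simp
qed

lemmas lin_comb_fmom = centered_gaussian_rv_fmom[OF lin_comb_gaussian]

lemma T_fmom: "fmom P (T g)"
  by (rule centered_gaussian_rv_fmom[OF T_gaussian])

lemma poly_mono_fmom: "fmom P (poly_mono T gs)"
  by (induction gs) (auto intro!: fmom_intros T_fmom)

lemma D_mono_fmom: "fmom P (D_mono R T gs h)"
  by (induction gs) (auto intro!: fmom_intros T_fmom poly_mono_fmom)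

lemma poly_prod_fmom: "fmom P (poly_prod T K)"
  by (induction K) (auto intro!: fmom_intros T_fmom)

lemma D_prod_fmom: "fmom P (D_prod R T K h)"
  by (induction K) (auto intro!: fmom_intros T_fmom poly_prod_fmom)

definition covl :: "'i \<Rightarrow> (real \<times> 'i) list \<Rightarrow> real" where
  "covl h L = expectation (\<lambda>\<omega>. T h \<omega> * lin_comb T L \<omega>)"

lemma covl_Cons: "covl h ((s, g) # L) = covl h L + s * cov h g"
proof -
  have "integrable P (\<lambda>\<omega>. T h \<omega> * lin_comb T L \<omega>)" "integrable P (\<lambda>\<omega>. T h \<omega> * T g \<omega>)"
    by (intro fmom_integrable fmom_intros T_fmom lin_comb_fmom)+
  then show ?thesis by (simp add: covl_def cov_def distrib_left mult.left_commute)
qed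

text \<open>Obtained by differentiating the moment recursion of the Gaussian variable \<open>Y + s T\<^sub>h\<close> at \<open>s = 0\<close>.\<close>

lemma wick_power:
  "expectation (\<lambda>\<omega>. T h \<omega> * lin_comb T L \<omega> ^ n) = real n * covl h L * expectation (\<lambda>\<omega>. lin_comb T L \<omega> ^ (n - 1))"
proof (induction n rule: less_induct)
  case (less n)
  let ?Y = "lin_comb T L"
  note f = T_fmom lin_comb_fmom fmom_const
  have mom: "expectation (\<lambda>\<omega>. (?Y \<omega> + s * T h \<omega>) ^ Suc k) = real k * expectation (\<lambda>\<omega>. (?Y \<omega> + s * T h \<omega>)\<^sup>2)
      * expectation (\<lambda>\<omega>. (?Y \<omega> + s * T h \<omega>) ^ (k - 1))" for s k
    using centered_gaussian_rv_moment[OF lin_comb_gaussian[of "(s, h) # L"], of k] by (simp del: power_Suc)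
  show ?case
  proof (cases n)
    case 0
    have "expectation (\<lambda>\<omega>. T h \<omega> ^ Suc 0) = 0"
      by (subst centered_gaussian_rv_moment[OF T_gaussian]) simp
    then show ?thesis using 0 by simp
  next
    case (Suc k)
    let ?I = "\<lambda>j. expectation (\<lambda>\<omega>. ?Y \<omega> ^ j)"
    let ?J = "\<lambda>j. expectation (\<lambda>\<omega>. T h \<omega> * ?Y \<omega> ^ j)"
    have D: "((\<lambda>s. expectation (\<lambda>\<omega>. (?Y \<omega> + s * T h \<omega>) ^ j)) has_real_derivative real j * ?J (j - 1)) (at 0)" for j
      using DERIV_moment_at_0[OF fmom_const[of 1] T_fmom[of h] lin_comb_fmom[of L], of j] by simp
    have "((\<lambda>s. real n * expectation (\<lambda>\<omega>. (?Y \<omega> + s * T h \<omega>)\<^sup>2) * expectation (\<lambda>\<omega>. (?Y \<omega> + s * T h \<omega>) ^ (n - 1)))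
       has_real_derivative real n * (?I 2 * (real (n - 1) * ?J (n - 1 - 1)) + 2 * ?J 1 * ?I (n - 1))) (at 0)"
      using DERIV_cmult[OF DERIV_mult[OF D[of 2] D[of "n - 1"]], of "real n"] by (simp add: mult_ac add_ac)
    with D[of "Suc n"] have "real (Suc n) * ?J n = real n * (?I 2 * (real (n - 1) * ?J (n - 1 - 1)) + 2 * ?J 1 * ?I (n - 1))"
      unfolding mom[of _ n] by (auto dest: DERIV_unique)
    \<comment> \<open>The covariance factor comes out by the induction hypothesis for exponent
      \<open>n - 2\<close>, and the second moment of \<open>Y\<close> disappears by the moment
      recursion at \<open>s = 0\<close>.\<close>
    also have "real (n - 1) * (?I 2 * ?J (n - 1 - 1)) = real (n - 1) * (covl h L * ?I (n - 1))"
    proof (cases k)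
      case (Suc j)
      have "?J j = real j * covl h L * ?I (j - 1)" using less.IH[of j] \<open>n = Suc k\<close> Suc by simp
      moreover have "?I (Suc j) = real j * ?I 2 * ?I (j - 1)" using mom[of 0 j] by simp
      ultimately show ?thesis using \<open>n = Suc k\<close> Suc by simp
    qed (use Suc in simp)
    then have "?I 2 * (real (n - 1) * ?J (n - 1 - 1)) = real (n - 1) * (covl h L * ?I (n - 1))" by (simp add: mult_ac)
    finally have "real (Suc n) * ?J n = real n * (real (n - 1) * (covl h L * ?I (n - 1)) + 2 * ?J 1 * ?I (n - 1))" .
    also have "?J 1 = covl h L" by (simp add: covl_def)
    finally have "real (Suc n) * ?J n = real (Suc n) * (real n * covl h L * ?I (n - 1))"
      using Suc by (simp add: algebra_simps)
    then show ?thesis by (simp only: mult_cancel_left) simp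
  qed
qed

text \<open>The free factor \<open>lin_comb T L ^ n\<close> makes the induction on \<open>gs\<close>
  possible: the identity for exponent \<open>n + 1\<close> and the list \<open>(s, g) # L\<close>,
  differentiated at \<open>s = 0\<close>, moves one factor \<open>T g\<close> into the monomial, up
  to the constant \<open>n + 1\<close>.\<close>

lemma wick_mono_power:
  "expectation (\<lambda>\<omega>. T h \<omega> * poly_mono T gs \<omega> * lin_comb T L \<omega> ^ n) =
   expectation (\<lambda>\<omega>. D_mono cov T gs h \<omega> * lin_comb T L \<omega> ^ n) +
   real n * covl h L * expectation (\<lambda>\<omega>. poly_mono T gs \<omega> * lin_comb T L \<omega> ^ (n - 1))"
proof (induction gs arbitrary: L n)
  case Nil
  then show ?case using wick_power by simp
next
  case (Cons g gs)
  let ?Y = "lin_comb T L"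
  have IH: "expectation (\<lambda>\<omega>. T h \<omega> * poly_mono T gs \<omega> * (?Y \<omega> + s * T g \<omega>) ^ Suc n) =
     expectation (\<lambda>\<omega>. D_mono cov T gs h \<omega> * (?Y \<omega> + s * T g \<omega>) ^ Suc n) +
     real (Suc n) * (covl h L + s * cov h g) * expectation (\<lambda>\<omega>. poly_mono T gs \<omega> * (?Y \<omega> + s * T g \<omega>) ^ n)" for s
    using Cons[of "(s, g) # L" "Suc n"] unfolding covl_Cons by (simp del: power_Suc)
  note f = T_fmom lin_comb_fmom poly_mono_fmom D_mono_fmom
  note D = DERIV_moment_at_0[OF _ T_fmom[of g] lin_comb_fmom[of L]]
  have A: "((\<lambda>s. expectation (\<lambda>\<omega>. T h \<omega> * poly_mono T gs \<omega> * (?Y \<omega> + s * T g \<omega>) ^ Suc n)) has_real_derivative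
    real (Suc n) * expectation (\<lambda>\<omega>. T h \<omega> * poly_mono T gs \<omega> * T g \<omega> * ?Y \<omega> ^ n)) (at 0)"
    using D[of "\<lambda>\<omega>. T h \<omega> * poly_mono T gs \<omega>" "Suc n"] by (simp add: fmom_mult f del: power_Suc)
  have B1: "((\<lambda>s. expectation (\<lambda>\<omega>. D_mono cov T gs h \<omega> * (?Y \<omega> + s * T g \<omega>) ^ Suc n)) has_real_derivative
    real (Suc n) * expectation (\<lambda>\<omega>. D_mono cov T gs h \<omega> * T g \<omega> * ?Y \<omega> ^ n)) (at 0)"
    using D[of "D_mono cov T gs h" "Suc n"] by (simp add: f del: power_Suc)
  have B2: "((\<lambda>s. real (Suc n) * (covl h L + s * cov h g) * expectation (\<lambda>\<omega>. poly_mono T gs \<omega> * (?Y \<omega> + s * T g \<omega>) ^ n)) has_real_derivative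
    real (Suc n) * cov h g * expectation (\<lambda>\<omega>. poly_mono T gs \<omega> * ?Y \<omega> ^ n) +
    real (Suc n) * covl h L * (real n * expectation (\<lambda>\<omega>. poly_mono T gs \<omega> * T g \<omega> * ?Y \<omega> ^ (n - 1)))) (at 0)"
  proof -
    have "((\<lambda>s. real (Suc n) * (covl h L + s * cov h g)) has_real_derivative real (Suc n) * cov h g) (at 0)"
      by (auto intro!: derivative_eq_intros)
    from DERIV_mult[OF this D[of "poly_mono T gs" n]] show ?thesis by (simp add: f add_ac mult_ac)
  qed
  have "real (Suc n) * expectation (\<lambda>\<omega>. T h \<omega> * poly_mono T gs \<omega> * T g \<omega> * ?Y \<omega> ^ n) =
    real (Suc n) * expectation (\<lambda>\<omega>. D_mono cov T gs h \<omega> * T g \<omega> * ?Y \<omega> ^ n) +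
    (real (Suc n) * cov h g * expectation (\<lambda>\<omega>. poly_mono T gs \<omega> * ?Y \<omega> ^ n) +
    real (Suc n) * covl h L * (real n * expectation (\<lambda>\<omega>. poly_mono T gs \<omega> * T g \<omega> * ?Y \<omega> ^ (n - 1))))"
    using DERIV_unique[OF A[unfolded IH] DERIV_add[OF B1 B2]] .
  also have "\<dots> = real (Suc n) * (expectation (\<lambda>\<omega>. D_mono cov T gs h \<omega> * T g \<omega> * ?Y \<omega> ^ n) +
    cov h g * expectation (\<lambda>\<omega>. poly_mono T gs \<omega> * ?Y \<omega> ^ n) +
    covl h L * (real n * expectation (\<lambda>\<omega>. poly_mono T gs \<omega> * T g \<omega> * ?Y \<omega> ^ (n - 1))))"
    by (simp add: algebra_simps)
  finally have *: "expectation (\<lambda>\<omega>. T h \<omega> * poly_mono T gs \<omega> * T g \<omega> * ?Y \<omega> ^ n) = expectation (\<lambda>\<omega>. D_mono cov T gs h \<omega> * T g \<omega> * ?Y \<omega> ^ n) +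
    cov h g * expectation (\<lambda>\<omega>. poly_mono T gs \<omega> * ?Y \<omega> ^ n) +
    covl h L * (real n * expectation (\<lambda>\<omega>. poly_mono T gs \<omega> * T g \<omega> * ?Y \<omega> ^ (n - 1)))"
    by (simp only: mult_cancel_left) simp
  have "expectation (\<lambda>\<omega>. D_mono cov T (g # gs) h \<omega> * ?Y \<omega> ^ n) =
    expectation (\<lambda>\<omega>. cov h g * (poly_mono T gs \<omega> * ?Y \<omega> ^ n) + D_mono cov T gs h \<omega> * T g \<omega> * ?Y \<omega> ^ n)"
    by (simp add: algebra_simps)
  also have "\<dots> = cov h g * expectation (\<lambda>\<omega>. poly_mono T gs \<omega> * ?Y \<omega> ^ n) + expectation (\<lambda>\<omega>. D_mono cov T gs h \<omega> * T g \<omega> * ?Y \<omega> ^ n)"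
    by (subst Bochner_Integration.integral_add) (auto intro!: integrable_mult_right fmom_integrable fmom_intros f)
  finally show ?case using * by (simp add: mult_ac)
qed

lemma wick_mono: "expectation (\<lambda>\<omega>. T h \<omega> * poly_mono T gs \<omega>) = expectation (D_mono cov T gs h)"
  using wick_mono_power[of h gs "[]" 0] by simp

text \<open>In the induction on the coefficients of a polynomial, each factor \<open>T g\<close>
  that is split off is stored in the list \<open>gs\<close>; this is why the statement carries a
  monomial.\<close>

lemma wick_prod_mono:
  "expectation (\<lambda>\<omega>. T h \<omega> * poly_prod T K \<omega> * poly_mono T gs \<omega>) =
   expectation (\<lambda>\<omega>. D_prod cov T K h \<omega> * poly_mono T gs \<omega> + poly_prod T K \<omega> * D_mono cov T gs h \<omega>)"
proof (induction K arbitrary: gs)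
  case Nil
  then show ?case using wick_mono by simp
next
  case (Cons pg K)
  obtain p g where pg: "pg = (p, g)" by (cases pg)
  note f = T_fmom poly_mono_fmom D_mono_fmom poly_prod_fmom D_prod_fmom
  show ?case unfolding pg
  proof (induction p arbitrary: gs)
    case 0
    then show ?case by simp
  next
    case (pCons a q)
    have "expectation (\<lambda>\<omega>. T h \<omega> * poly_prod T ((pCons a q, g) # K) \<omega> * poly_mono T gs \<omega>) =
      expectation (\<lambda>\<omega>. a * (T h \<omega> * poly_prod T K \<omega> * poly_mono T gs \<omega>) + T h \<omega> * poly_prod T ((q, g) # K) \<omega> * poly_mono T (g # gs) \<omega>)"
      by (simp add: algebra_simps)
    also have "\<dots> = a * expectation (\<lambda>\<omega>. T h \<omega> * poly_prod T K \<omega> * poly_mono T gs \<omega>) +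
        expectation (\<lambda>\<omega>. T h \<omega> * poly_prod T ((q, g) # K) \<omega> * poly_mono T (g # gs) \<omega>)"
      by (subst Bochner_Integration.integral_add)
        (simp_all del: poly_prod.simps poly_mono.simps add: fmom_integrable fmom_intros f)
    also have "\<dots> = a * expectation (\<lambda>\<omega>. D_prod cov T K h \<omega> * poly_mono T gs \<omega> + poly_prod T K \<omega> * D_mono cov T gs h \<omega>) +
      expectation (\<lambda>\<omega>. D_prod cov T ((q, g) # K) h \<omega> * poly_mono T (g # gs) \<omega> + poly_prod T ((q, g) # K) \<omega> * D_mono cov T (g # gs) h \<omega>)"
      unfolding Cons pCons(2) ..
    also have "\<dots> = expectation (\<lambda>\<omega>. a * (D_prod cov T K h \<omega> * poly_mono T gs \<omega> + poly_prod T K \<omega> * D_mono cov T gs h \<omega>) +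
      (D_prod cov T ((q, g) # K) h \<omega> * poly_mono T (g # gs) \<omega> + poly_prod T ((q, g) # K) \<omega> * D_mono cov T (g # gs) h \<omega>))"
      by (subst Bochner_Integration.integral_add)
        (simp_all del: poly_prod.simps poly_mono.simps D_prod.simps D_mono.simps add: fmom_integrable fmom_intros f)
    also have "\<dots> = expectation (\<lambda>\<omega>. D_prod cov T ((pCons a q, g) # K) h \<omega> * poly_mono T gs \<omega> +
      poly_prod T ((pCons a q, g) # K) \<omega> * D_mono cov T gs h \<omega>)"
      by (rule arg_cong[where f = expectation]) (simp add: fun_eq_iff pderiv_pCons algebra_simps)
    finally show ?case .
  qed
qed

theorem gaussian_ibp: "expectation (\<lambda>\<omega>. T h \<omega> * poly_prod T K \<omega>) = expectation (D_prod cov T K h)"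
  using wick_prod_mono[of h K "[]"] by simp

end

section \<open>Continuity in mean along measure preserving maps\<close>

text \<open>Bernoulli's inequality for \<open>u / c\<close>, rescaled. It is the convexity input of
  the Jensen and Hoelder inequalities below.\<close>

lemma power_tangent: "c ^ n + real n * c ^ (n - 1) * (u - c) \<le> u ^ n" if "u \<ge> 0" "c \<ge> 0" for u c :: real
proof (cases "c = 0")
  case True
  consider "n = 0" | "n = 1" | k where "n = Suc (Suc k)" by (metis One_nat_def not0_implies_Suc)
  then show ?thesis using True that by cases auto
next
  case False
  then have c: "c > 0" using that by simp
  have "1 + real n * (u / c - 1) \<le> (1 + (u / c - 1)) ^ n" using that by (intro Bernoulli_inequality) simp
  then have "c ^ n * (1 + real n * (u / c - 1)) \<le> c ^ n * (u / c) ^ n" using c by (intro mult_left_mono) auto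
  moreover have "c ^ n * (u / c) ^ n = u ^ n" using c by (simp add: power_divide)
  moreover have "c ^ n * (1 + real n * (u / c - 1)) = c ^ n + real n * c ^ (n - 1) * (u - c)"
    using c by (cases n) (simp_all add: field_simps)
  ultimately show ?thesis by simp
qed

lemma (in prob_space) integral_power_le:
  fixes u :: "'a \<Rightarrow> real"
  assumes "integrable M u" "integrable M (\<lambda>x. u x ^ n)" "\<And>x. x \<in> space M \<Longrightarrow> u x \<ge> 0"
  shows "expectation u ^ n \<le> expectation (\<lambda>x. u x ^ n)"
proof -
  let ?c = "expectation u"
  have c: "?c \<ge> 0" using assms(3) by (intro integral_nonneg_AE AE_I2)
  have "(\<integral>x. ?c ^ n + real n * ?c ^ (n - 1) * (u x - ?c) \<partial>M) \<le> expectation (\<lambda>x. u x ^ n)"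
    using assms c by (intro integral_mono power_tangent) auto
  moreover have "(\<integral>x. ?c ^ n + real n * ?c ^ (n - 1) * (u x - ?c) \<partial>M) = ?c ^ n"
    using assms(1) by (simp add: prob_space)
  ultimately show ?thesis by simp
qed

lemma (in finite_measure) integrable_indicator_real:
  "A \<in> sets M \<Longrightarrow> integrable M (indicator A :: 'a \<Rightarrow> real)"
  using emeasure_finite[of A] by (intro integrable_real_indicator) (simp_all add: less_top[symmetric])

lemma (in finite_measure) fmom_Cauchy_Schwarz:
  fixes X Y :: "'a \<Rightarrow> real"
  assumes "fmom M X" "fmom M Y"
  shows "(\<integral>x. X x * Y x \<partial>M)\<^sup>2 \<le> (\<integral>x. (X x)\<^sup>2 \<partial>M) * (\<integral>x. (Y x)\<^sup>2 \<partial>M)"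
proof -
  let ?a = "\<integral>x. (X x)\<^sup>2 \<partial>M" and ?b = "\<integral>x. X x * Y x \<partial>M" and ?c = "\<integral>x. (Y x)\<^sup>2 \<partial>M"
  note i = fmom_integrable fmom_intros assms
  have *: "0 \<le> s\<^sup>2 * ?a - 2 * s * ?b + ?c" for s
  proof -
    have "0 \<le> (\<integral>x. (s * X x - Y x)\<^sup>2 \<partial>M)" by simp
    also have "\<dots> = (\<integral>x. s\<^sup>2 * (X x)\<^sup>2 - 2 * s * (X x * Y x) + (Y x)\<^sup>2 \<partial>M)"
      by (simp add: power2_diff power_mult_distrib algebra_simps)
    also have "\<dots> = s\<^sup>2 * ?a - 2 * s * ?b + ?c" by (simp add: i)
    finally show ?thesis .
  qed
  have a: "?a \<ge> 0" by simp
  show ?thesis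
  proof (cases "?a = 0")
    case True
    have "AE x in M. (X x)\<^sup>2 = 0"
      by (subst integral_nonneg_eq_0_iff_AE[symmetric]) (auto simp: i True)
    then have "AE x in M. X x * Y x = 0" by (rule AE_mp) simp
    then have "?b = 0" by (rule integral_eq_zero_AE)
    then show ?thesis by (simp add: True)
  next
    case False
    then have a: "?a > 0" using a by linarith
    have "?b\<^sup>2 / ?a \<le> ?c" using *[of "?b / ?a"] a by (simp add: field_simps power2_eq_square)
    then show ?thesis using a by (simp add: field_simps)
  qed
qed

text \<open>Continuity in \<open>L\<^sup>1\<close> along a sequence of measure preserving maps propagates from a generator.\<close>

locale measure_preserving_seq = finite_measure M for M :: "'a measure" +
  fixes t :: "nat \<Rightarrow> 'a \<Rightarrow> 'a"
  assumes t_meas[measurable]: "\<And>n. t n \<in> measurable M M"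
    and t_distr: "\<And>n. distr M M (t n) = M"
begin

definition L1_cont :: "('a \<Rightarrow> real) \<Rightarrow> bool" where
  "L1_cont f \<longleftrightarrow> integrable M f \<and> (\<lambda>n. \<integral>x. \<bar>f (t n x) - f x\<bar> \<partial>M) \<longlonglongrightarrow> 0"

lemma integrable_t: "integrable M f \<Longrightarrow> integrable M (\<lambda>x. f (t n x))" for f :: "'a \<Rightarrow> real"
  by (rule integrable_distr[OF t_meas[of n]]) (simp add: t_distr)

lemma integral_t: "integrable M f \<Longrightarrow> (\<integral>x. f (t n x) \<partial>M) = (\<integral>x. f x \<partial>M)" for f :: "'a \<Rightarrow> real"
  using integral_distr[OF t_meas[of n], of f] by (simp add: t_distr borel_measurable_integrable)

lemma L1_cont_add:
  assumes "L1_cont f" "L1_cont g" shows "L1_cont (\<lambda>x. f x + g x)"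
proof -
  have i: "integrable M f" "integrable M g" using assms by (auto simp: L1_cont_def)
  have "(\<lambda>n. \<integral>x. \<bar>(f (t n x) + g (t n x)) - (f x + g x)\<bar> \<partial>M) \<longlonglongrightarrow> 0"
  proof (rule tendsto_sandwich[OF _ _ tendsto_const])
    show "(\<lambda>n. (\<integral>x. \<bar>f (t n x) - f x\<bar> \<partial>M) + (\<integral>x. \<bar>g (t n x) - g x\<bar> \<partial>M)) \<longlonglongrightarrow> 0"
      using assms by (auto simp: L1_cont_def intro: tendsto_eq_intros)
    show "\<forall>\<^sub>F n in sequentially. (\<integral>x. \<bar>(f (t n x) + g (t n x)) - (f x + g x)\<bar> \<partial>M)
        \<le> (\<integral>x. \<bar>f (t n x) - f x\<bar> \<partial>M) + (\<integral>x. \<bar>g (t n x) - g x\<bar> \<partial>M)"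
    proof (intro always_eventually allI)
      fix n
      show "(\<integral>x. \<bar>(f (t n x) + g (t n x)) - (f x + g x)\<bar> \<partial>M)
        \<le> (\<integral>x. \<bar>f (t n x) - f x\<bar> \<partial>M) + (\<integral>x. \<bar>g (t n x) - g x\<bar> \<partial>M)"
        by (subst Bochner_Integration.integral_add[symmetric]) (auto intro!: integral_mono integrable_abs Bochner_Integration.integrable_add Bochner_Integration.integrable_diff integrable_t i)
    qed
  qed auto
  then show ?thesis using i by (simp add: L1_cont_def)
qed

lemma L1_cont_scale:
  assumes "L1_cont f" shows "L1_cont (\<lambda>x. c * f x)"
proof -
  have "(\<integral>x. \<bar>c * f (t n x) - c * f x\<bar> \<partial>M) = \<bar>c\<bar> * (\<integral>x. \<bar>f (t n x) - f x\<bar> \<partial>M)" for n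
    by (simp add: right_diff_distrib[symmetric] abs_mult)
  then show ?thesis using assms by (auto simp: L1_cont_def intro: tendsto_eq_intros)
qed

text \<open>A three-term estimate; the error at the moved point equals the error at the original
  point because the maps preserve the measure.\<close>

lemma L1_cont_limit:
  assumes s: "\<And>k. L1_cont (s k)" and f: "integrable M f" and lim: "(\<lambda>k. \<integral>x. \<bar>s k x - f x\<bar> \<partial>M) \<longlonglongrightarrow> 0"
  shows "L1_cont f"
  unfolding L1_cont_def
proof (intro conjI f LIMSEQ_I)
  fix e :: real assume "e > 0"
  have i: "integrable M (s k)" for k using s by (simp add: L1_cont_def)
  obtain k where k: "\<bar>\<integral>x. \<bar>s k x - f x\<bar> \<partial>M\<bar> < e / 3"
    using LIMSEQ_D[OF lim, of "e / 3"] \<open>e > 0\<close> by auto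
  obtain N where N: "\<And>n. n \<ge> N \<Longrightarrow> \<bar>\<integral>x. \<bar>s k (t n x) - s k x\<bar> \<partial>M\<bar> < e / 3"
    using s[of k] LIMSEQ_D[of "\<lambda>n. \<integral>x. \<bar>s k (t n x) - s k x\<bar> \<partial>M" 0 "e / 3"] \<open>e > 0\<close> by (auto simp: L1_cont_def)
  have "(\<integral>x. \<bar>f (t n x) - f x\<bar> \<partial>M) \<le> (\<integral>x. \<bar>s k x - f x\<bar> \<partial>M) + (\<integral>x. \<bar>s k (t n x) - s k x\<bar> \<partial>M) + (\<integral>x. \<bar>s k x - f x\<bar> \<partial>M)" for n
  proof -
    have "(\<integral>x. \<bar>f (t n x) - f x\<bar> \<partial>M) \<le> (\<integral>x. \<bar>s k (t n x) - f (t n x)\<bar> + \<bar>s k (t n x) - s k x\<bar> + \<bar>s k x - f x\<bar> \<partial>M)"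
      by (intro integral_mono Bochner_Integration.integrable_add integrable_abs Bochner_Integration.integrable_diff integrable_t i f) auto
    also have "\<dots> = (\<integral>x. \<bar>s k (t n x) - f (t n x)\<bar> \<partial>M) + (\<integral>x. \<bar>s k (t n x) - s k x\<bar> \<partial>M) + (\<integral>x. \<bar>s k x - f x\<bar> \<partial>M)"
      by (simp add: integrable_t i f)
    also have "(\<integral>x. \<bar>s k (t n x) - f (t n x)\<bar> \<partial>M) = (\<integral>x. \<bar>s k x - f x\<bar> \<partial>M)"
      by (rule integral_t[of "\<lambda>x. \<bar>s k x - f x\<bar>"]) (intro integrable_abs Bochner_Integration.integrable_diff i f)
    finally show ?thesis .
  qed
  note bound = this
  have imp: "a < e" if "a \<le> b + c + b" "\<bar>b\<bar> < e / 3" "\<bar>c\<bar> < e / 3" for a b c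
    using that by linarith
  have "\<forall>n\<ge>N. (\<integral>x. \<bar>f (t n x) - f x\<bar> \<partial>M) < e"
    using imp[OF bound k N] by simp
  then show "\<exists>no. \<forall>n\<ge>no. norm ((\<integral>x. \<bar>f (t n x) - f x\<bar> \<partial>M) - 0) < e" by (intro exI[of _ N]) simp
qed

text \<open>A Dynkin argument leads from the generator to all measurable sets, and approximation by
  simple functions to integrable ones; both passages to the limit are instances of
  \<open>L1_cont_limit\<close>.\<close>

lemma L1_cont_integrable:
  assumes E: "sets M = sigma_sets (space M) E" "Int_stable E" "E \<subseteq> Pow (space M)"
    and base: "\<And>A. A \<in> E \<Longrightarrow> L1_cont (indicator A)"
    and f: "integrable M f"
  shows "L1_cont f"
proof -
  have ind: "L1_cont (indicator A)" if A: "A \<in> sets M" for A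
    using E(2,3) A[unfolded E(1)]
  proof (induction rule: sigma_sets_induct_disjoint)
    case (basic A) then show ?case by (rule base)
  next
    case empty then show ?case by (simp add: L1_cont_def)
  next
    case (compl A)
    have "A \<in> sets M" using compl(1) E(1) by simp
    have "(\<integral>x. \<bar>indicator (space M - A) (t n x) - indicator (space M - A) x\<bar> \<partial>M) =
      (\<integral>x. \<bar>indicator A (t n x) - indicator A x :: real\<bar> \<partial>M)" for n
    proof (rule Bochner_Integration.integral_cong[OF refl])
      fix x assume "x \<in> space M"
      then have "t n x \<in> space M" using measurable_space[OF t_meas] by blast
      with \<open>x \<in> space M\<close> show "\<bar>indicator (space M - A) (t n x) - indicator (space M - A) x\<bar> =
        \<bar>indicator A (t n x) - indicator A x :: real\<bar>" by (simp add: indicator_def)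
    qed
    then show ?case using compl(2) \<open>A \<in> sets M\<close> by (simp add: L1_cont_def integrable_indicator_real)
  next
    case (union A)
    have A: "A i \<in> sets M" for i using union(2) E(1) by auto
    have s: "L1_cont (\<lambda>x. \<Sum>i<k. indicator (A i) x)" for k
      by (induction k) (simp add: L1_cont_def, simp add: L1_cont_add union(3))
    have U: "(\<Union>i. A i) \<in> sets M" using A by auto
    show ?case
    proof (rule L1_cont_limit[OF s])
      show "integrable M (indicator (\<Union>i. A i) :: _ \<Rightarrow> real)" using U by (rule integrable_indicator_real)
      have "(\<lambda>k. \<integral>x. \<bar>(\<Sum>i<k. indicator (A i) x) - indicator (\<Union>i. A i) x :: real\<bar> \<partial>M) \<longlonglongrightarrow> (\<integral>x. \<bar>indicator (\<Union>i. A i) x - indicator (\<Union>i. A i) x :: real\<bar> \<partial>M)"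
      proof (rule integral_dominated_convergence[where w = "\<lambda>_. 1"])
        have eq: "(\<Sum>i<k. indicator (A i) x) = (indicator (\<Union>i<k. A i) x :: real)" for k x
          using union(1) by (intro indicator_UN_disjoint[symmetric]) (auto simp: disjoint_family_on_def)
        have "(\<lambda>k. (\<Sum>i<k. indicator (A i) x)) \<longlonglongrightarrow> (indicator (\<Union>i. A i) x :: real)" for x
          unfolding eq by (rule LIMSEQ_indicator_UN)
        then show "AE x in M. (\<lambda>k. \<bar>(\<Sum>i<k. indicator (A i) x) - indicator (\<Union>i. A i) x\<bar>) \<longlonglongrightarrow> \<bar>indicator (\<Union>i. A i) x - indicator (\<Union>i. A i) x :: real\<bar>"
          by (intro AE_I2 tendsto_rabs tendsto_diff tendsto_const)
        show "AE x in M. norm \<bar>(\<Sum>i<k. indicator (A i) x) - indicator (\<Union>i. A i) x :: real\<bar> \<le> 1" for k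
          unfolding eq by (rule AE_I2) (auto simp: indicator_def)
      qed (use A U in auto)
      then show "(\<lambda>k. \<integral>x. \<bar>(\<Sum>i<k. indicator (A i) x) - indicator (\<Union>i. A i) x :: real\<bar> \<partial>M) \<longlonglongrightarrow> 0" by simp
    qed
  qed
  show ?thesis using f
  proof (induction rule: integrable_induct)
    case (base A c)
    then show ?case using L1_cont_scale[OF ind, of A c] by (simp add: mult.commute)
  next
    case (add f g)
    then show ?case by (intro L1_cont_add)
  next
    case (lim f s)
    show ?case
    proof (rule L1_cont_limit[OF lim(5) lim(4)])
      have "(\<lambda>k. \<integral>x. \<bar>s k x - f x\<bar> \<partial>M) \<longlonglongrightarrow> (\<integral>x. \<bar>f x - f x\<bar> \<partial>M)"
      proof (rule integral_dominated_convergence[where w = "\<lambda>x. 3 * \<bar>f x\<bar>"])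
        show "AE x in M. (\<lambda>k. \<bar>s k x - f x\<bar>) \<longlonglongrightarrow> \<bar>f x - f x\<bar>"
          by (intro AE_I2 tendsto_rabs tendsto_diff tendsto_const lim(2))
        show "AE x in M. norm \<bar>s k x - f x\<bar> \<le> 3 * \<bar>f x\<bar>" for k
          by (rule AE_I2) (use lim(3)[of _ k] in \<open>fastforce simp: abs_le_iff\<close>)
      qed (use lim(1,4) in auto)
      then show "(\<lambda>k. \<integral>x. \<bar>s k x - f x\<bar> \<partial>M) \<longlonglongrightarrow> 0" by simp
    qed
  qed
qed

end

text \<open>Rectangles generate the product, and on them only the group coordinate moves, so the
  claim reduces to open subsets of the group. It takes the place of continuity of sample paths,
  which a jointly measurable field need not have.\<close>

lemma (in compact_ab_group) L1_translation:
  fixes h :: "nat \<Rightarrow> 'g" and Q :: "'w measure" and f :: "'g \<times> 'w \<Rightarrow> real"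
  assumes h: "h \<longlonglongrightarrow> 0" and Q: "prob_space Q" and f: "integrable (\<mu> \<Otimes>\<^sub>M Q) f"
  shows "(\<lambda>n. \<integral>x. \<bar>f (h n + fst x, snd x) - f x\<bar> \<partial>(\<mu> \<Otimes>\<^sub>M Q)) \<longlonglongrightarrow> 0"
proof -
  interpret Q: prob_space Q by fact
  interpret PQ: pair_prob_space \<mu> Q ..
  interpret m: measure_preserving_seq \<mu> "\<lambda>n g. h n + g"
    by unfold_locales (auto simp: distr_translate)
  have op: "m.L1_cont (indicator U)" if U: "open U" for U :: "'g set"
  proof -
    have Us[measurable]: "U \<in> sets \<mu>" using U by simp
    have i: "integrable \<mu> (indicator U :: 'g \<Rightarrow> real)" using Us by (rule haar.integrable_indicator_real)
    have i2: "integrable \<mu> (\<lambda>x. indicator U (h n + x) * indicator U x :: real)" for n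
      by (rule haar.integrable_const_bound[where B = 1], rule AE_I2, simp add: indicator_def, measurable)
    \<comment> \<open>Convergence at the points of \<open>U\<close> is enough: the translate of
      \<open>U\<close> has the same measure, so the distance in mean is determined by the
      overlap.\<close>
    have lim: "(\<lambda>n. \<integral>x. (indicator U (h n + x) * indicator U x :: real) \<partial>\<mu>) \<longlonglongrightarrow> (\<integral>x. indicator U x \<partial>\<mu>)"
    proof (rule integral_dominated_convergence[where w = "\<lambda>_. 1"])
      show "AE x in \<mu>. (\<lambda>n. indicator U (h n + x) * indicator U x) \<longlonglongrightarrow> (indicator U x :: real)"
      proof (rule AE_I2)
        fix x
        show "(\<lambda>n. indicator U (h n + x) * indicator U x) \<longlonglongrightarrow> (indicator U x :: real)"
        proof (cases "x \<in> U")
          case True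
          have "(\<lambda>n. h n + x) \<longlonglongrightarrow> 0 + x" by (intro tendsto_add_group h tendsto_const)
          then have "\<forall>\<^sub>F n in sequentially. h n + x \<in> U" using U True by (auto dest: topological_tendstoD)
          then show ?thesis using True by (intro tendsto_eventually) (auto elim!: eventually_mono)
        qed simp
      qed
    next
      show "AE x in \<mu>. norm (indicator U (h n + x) * indicator U x :: real) \<le> 1" for n
        by (rule AE_I2) (simp add: indicator_def)
    qed simp_all
    have "(\<integral>x. \<bar>indicator U (h n + x) - indicator U x\<bar> \<partial>\<mu>) =
       2 * (\<integral>x. indicator U x \<partial>\<mu>) - 2 * (\<integral>x. (indicator U (h n + x) * indicator U x :: real) \<partial>\<mu>)" for n
    proof -
      have "(\<integral>x. \<bar>indicator U (h n + x) - indicator U x :: real\<bar> \<partial>\<mu>) =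
        (\<integral>x. indicator U (h n + x) + indicator U x - 2 * (indicator U (h n + x) * indicator U x) \<partial>\<mu>)"
        by (rule Bochner_Integration.integral_cong) (auto simp: indicator_def)
      also have "\<dots> = (\<integral>x. indicator U (h n + x) \<partial>\<mu>) + (\<integral>x. indicator U x \<partial>\<mu>) - 2 * (\<integral>x. (indicator U (h n + x) * indicator U x :: real) \<partial>\<mu>)"
        using i i2 m.integrable_t[OF i] by simp
      finally show ?thesis using m.integral_t[OF i] by simp
    qed
    moreover have "(\<lambda>n. 2 * (\<integral>x. indicator U x \<partial>\<mu>) - 2 * (\<integral>x. (indicator U (h n + x) * indicator U x :: real) \<partial>\<mu>)) \<longlonglongrightarrow> 0"
      using tendsto_diff[OF tendsto_const[of "2 * (\<integral>x. indicator U x \<partial>\<mu>)"] tendsto_mult[OF tendsto_const[of 2] lim]] by simp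
    ultimately show ?thesis using i by (simp add: m.L1_cont_def)
  qed
  have ind: "m.L1_cont (indicator A)" if "A \<in> sets \<mu>" for A
  proof (rule m.L1_cont_integrable[where E = "{S. open S}"])
    show "sets \<mu> = sigma_sets (space \<mu>) {S. open S}" by (simp add: borel_def)
    show "integrable \<mu> (indicator A :: _ \<Rightarrow> real)" using that by (rule haar.integrable_indicator_real)
  qed (auto simp: Int_stable_def op)
  let ?t = "\<lambda>n x. (h n + fst x, snd x)"
  have dis: "distr (\<mu> \<Otimes>\<^sub>M Q) (\<mu> \<Otimes>\<^sub>M Q) (?t n) = \<mu> \<Otimes>\<^sub>M Q" for n
  proof -
    have "distr \<mu> \<mu> (\<lambda>g. h n + g) \<Otimes>\<^sub>M distr Q Q (\<lambda>x. x) = distr (\<mu> \<Otimes>\<^sub>M Q) (\<mu> \<Otimes>\<^sub>M Q) (\<lambda>(x, y). (h n + x, y))"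
      by (rule pair_measure_distr) (auto simp: distr_id Q.sigma_finite_measure_axioms)
    then show ?thesis by (simp add: distr_translate distr_id case_prod_beta')
  qed
  interpret p: measure_preserving_seq "\<mu> \<Otimes>\<^sub>M Q" ?t
    by unfold_locales (auto simp: dis)
  have "p.L1_cont f"
  proof (rule p.L1_cont_integrable[OF _ _ _ _ f])
    show "sets (\<mu> \<Otimes>\<^sub>M Q) = sigma_sets (space (\<mu> \<Otimes>\<^sub>M Q)) {a \<times> b | a b. a \<in> sets \<mu> \<and> b \<in> sets Q}"
      by (simp only: sets_pair_measure space_pair_measure)
    show "Int_stable {a \<times> b | a b. a \<in> sets \<mu> \<and> b \<in> sets Q}" by (rule Int_stable_pair_measure_generator)
    show "{a \<times> b | a b. a \<in> sets \<mu> \<and> b \<in> sets Q} \<subseteq> Pow (space (\<mu> \<Otimes>\<^sub>M Q))"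
      using sets.sets_into_space by (auto simp: space_pair_measure)
    fix S assume "S \<in> {a \<times> b | a b. a \<in> sets \<mu> \<and> b \<in> sets Q}"
    then obtain A B where S: "S = A \<times> B" and A[measurable]: "A \<in> sets \<mu>" and B: "B \<in> sets Q" by auto
    then have Sm[measurable]: "S \<in> sets (\<mu> \<Otimes>\<^sub>M Q)" by auto
    have iA: "integrable \<mu> (\<lambda>x. \<bar>indicator A (h n + x) - indicator A x\<bar> :: real)" for n
      by (rule haar.integrable_const_bound[where B = 1], rule AE_I2, simp add: indicator_def, measurable)
    have le: "(\<integral>x. \<bar>indicator S (?t n x) - indicator S x :: real\<bar> \<partial>(\<mu> \<Otimes>\<^sub>M Q)) \<le> (\<integral>g. \<bar>indicator A (h n + g) - indicator A g :: real\<bar> \<partial>\<mu>)" for n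
    proof -
      have iP: "integrable (\<mu> \<Otimes>\<^sub>M Q) (\<lambda>x. \<bar>indicator A (h n + fst x) - indicator A (fst x)\<bar> :: real)"
        by (rule PQ.P.integrable_const_bound[where B = 1], rule AE_I2, simp add: indicator_def, measurable)
      have "(\<integral>x. \<bar>indicator S (?t n x) - indicator S x :: real\<bar> \<partial>(\<mu> \<Otimes>\<^sub>M Q)) \<le> (\<integral>x. \<bar>indicator A (h n + fst x) - indicator A (fst x)\<bar> \<partial>(\<mu> \<Otimes>\<^sub>M Q))"
      proof (rule integral_mono[OF _ iP])
        show "integrable (\<mu> \<Otimes>\<^sub>M Q) (\<lambda>x. \<bar>indicator S (?t n x) - indicator S x :: real\<bar>)"
          by (rule PQ.P.integrable_const_bound[where B = 1], rule AE_I2, simp add: indicator_def, measurable)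
      qed (auto simp: S indicator_def)
      also have "\<dots> = (\<integral>g. \<integral>\<omega>. \<bar>indicator A (h n + g) - indicator A g\<bar> \<partial>Q \<partial>\<mu>)"
        using PQ.integral_fst'[OF iP] by simp
      finally show ?thesis by (simp add: Q.prob_space)
    qed
    have "(\<lambda>n. \<integral>x. \<bar>indicator S (?t n x) - indicator S x :: real\<bar> \<partial>(\<mu> \<Otimes>\<^sub>M Q)) \<longlonglongrightarrow> 0"
      by (rule tendsto_sandwich[OF _ _ tendsto_const ind[OF A, unfolded m.L1_cont_def, THEN conjunct2]])
        (auto intro!: always_eventually le)
    then show "p.L1_cont (indicator S)" using Sm by (simp add: p.L1_cont_def PQ.P.integrable_indicator_real)
  qed
  then show ?thesis by (simp add: p.L1_cont_def)
qed

section \<open>Integrals of polynomials of an isotropic field\<close>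

text \<open>The recursion in the form that integration by parts produces: multiplication by the
  variable minus differentiation.\<close>

primrec hermite_poly :: "nat \<Rightarrow> real poly" where
  "hermite_poly 0 = 1"
| "hermite_poly (Suc n) = [:0, 1:] * hermite_poly n - pderiv (hermite_poly n)"

lemma pderiv_hermite_poly: "pderiv (hermite_poly (Suc n)) = smult (real (Suc n)) (hermite_poly n)"
proof (induction n)
  case 0
  show ?case by (simp add: pderiv_pCons)
next
  case (Suc n)
  have "pderiv (hermite_poly (Suc (Suc n))) =
    hermite_poly (Suc n) + [:0, 1:] * pderiv (hermite_poly (Suc n)) - pderiv (pderiv (hermite_poly (Suc n)))"
    by (subst hermite_poly.simps(2)) (simp only: pderiv_diff pderiv_mult, simp add: pderiv_pCons)
  also have "\<dots> = hermite_poly (Suc n) + smult (real (Suc n)) ([:0, 1:] * hermite_poly n - pderiv (hermite_poly n))"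
    unfolding Suc by (simp add: pderiv_smult smult_diff_right algebra_simps)
  also have "\<dots> = smult (real (Suc (Suc n))) (hermite_poly (Suc n))"
    unfolding hermite_poly.simps(2)[symmetric]
    using smult_add_left[of 1 "real (Suc n)" "hermite_poly (Suc n)"] by (simp del: hermite_poly.simps)
  finally show ?case .
qed

lemma hermite_eq_poly: "hermite n x = poly (hermite_poly n) x"
proof -
  define \<phi> :: "real \<Rightarrow> real" where "\<phi> t = exp (- (t\<^sup>2) / 2)" for t
  have d\<phi>: "(\<phi> has_real_derivative - t * \<phi> t) (at t)" for t
    unfolding \<phi>_def by (auto intro!: derivative_eq_intros)
  have "(deriv ^^ n) \<phi> = (\<lambda>t. (-1) ^ n * poly (hermite_poly n) t * \<phi> t)"
  proof (induction n)
    case (Suc n)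
    have "((\<lambda>t. (-1) ^ n * poly (hermite_poly n) t * \<phi> t) has_real_derivative
      (-1) ^ Suc n * poly (hermite_poly (Suc n)) t * \<phi> t) (at t)" for t
      by (rule derivative_eq_intros poly_DERIV d\<phi> refl)+ (simp add: algebra_simps)
    then have "deriv (\<lambda>t. (-1) ^ n * poly (hermite_poly n) t * \<phi> t) = (\<lambda>t. (-1) ^ Suc n * poly (hermite_poly (Suc n)) t * \<phi> t)"
      by (intro ext DERIV_imp_deriv)
    then show ?case using Suc by simp
  qed simp
  moreover have "(\<lambda>t. exp (- (t\<^sup>2) / 2)) = \<phi>" by (simp add: \<phi>_def fun_eq_iff)
  ultimately have "hermite n x = ((-1) ^ n * (-1) ^ n) * (exp (x\<^sup>2 / 2) * exp (- (x\<^sup>2) / 2)) * poly (hermite_poly n) x"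
    unfolding hermite_def by (simp add: \<phi>_def)
  also have "\<dots> = poly (hermite_poly n) x" by (simp add: power_mult_distrib[symmetric] exp_add[symmetric])
  finally show ?thesis .
qed

context pair_prob_space
begin

lemma distr_snd: "distr (M1 \<Otimes>\<^sub>M M2) M2 snd = M2"
proof (rule measure_eqI)
  fix A assume "A \<in> sets (distr (M1 \<Otimes>\<^sub>M M2) M2 snd)"
  then have A: "A \<in> sets M2" by simp
  have "snd -` A \<inter> space (M1 \<Otimes>\<^sub>M M2) = space M1 \<times> A"
    using sets.sets_into_space[OF A] by (auto simp: space_pair_measure)
  then have "emeasure (distr (M1 \<Otimes>\<^sub>M M2) M2 snd) A = emeasure (M1 \<Otimes>\<^sub>M M2) (space M1 \<times> A)"
    using A by (simp add: emeasure_distr)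
  also have "\<dots> = emeasure M2 A"
    using A M2.emeasure_pair_measure_Times[of "space M1" M1 A] M1.emeasure_space_1 by simp
  finally show "emeasure (distr (M1 \<Otimes>\<^sub>M M2) M2 snd) A = emeasure M2 A" .
qed simp

end

lemma fmom_distr:
  assumes f: "f \<in> measurable M N" and X: "fmom (distr M N f) X"
  shows "fmom M (\<lambda>x. X (f x))"
  unfolding fmom_def
proof (intro conjI allI)
  show "(\<lambda>x. X (f x)) \<in> borel_measurable M"
    using measurable_compose[OF f] fmom_measurable[OF X] by simp
  show "integrable M (\<lambda>x. norm (X (f x)) ^ n)" for n
    by (rule integrable_distr[OF f fmom_power_integrable[OF X]])
qed

context pair_prob_space
begin

lemma fmom_snd:
  assumes "fmom M2 Z" shows "fmom (M1 \<Otimes>\<^sub>M M2) (\<lambda>p. Z (snd p))"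
  by (rule fmom_distr[where N = M2]) (simp_all add: distr_snd assms)

lemma fmom_fst:
  assumes "fmom M1 Z" shows "fmom (M1 \<Otimes>\<^sub>M M2) (\<lambda>p. Z (fst p))"
  by (rule fmom_distr[where N = M1]) (simp_all add: M2.distr_pair_fst assms)

text \<open>For almost every \<open>y\<close>, Jensen's inequality bounds a power of the inner
  integral by the inner integral of the power.\<close>

lemma fmom_integral_fst:
  assumes f: "fmom (M1 \<Otimes>\<^sub>M M2) (\<lambda>p. f (fst p) (snd p))"
  shows "fmom M2 (\<lambda>y. \<integral>x. f x y \<partial>M1)"
  unfolding fmom_def
proof (intro conjI allI)
  have m[measurable]: "(\<lambda>p. f (fst p) (snd p)) \<in> borel_measurable (M1 \<Otimes>\<^sub>M M2)" by (rule fmom_measurable[OF f])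
  have m2: "(\<lambda>(y, x). f x y) \<in> borel_measurable (M2 \<Otimes>\<^sub>M M1)"
    using measurable_compose[OF measurable_pair_swap' m] by (simp add: case_prod_beta')
  show I: "(\<lambda>y. \<integral>x. f x y \<partial>M1) \<in> borel_measurable M2"
    by (rule M1.borel_measurable_lebesgue_integral[OF m2])
  fix n
  have i: "integrable (M1 \<Otimes>\<^sub>M M2) (\<lambda>(x, y). norm (f x y) ^ k)" for k
    using fmom_power_integrable[OF f, of k] by (simp add: case_prod_beta')
  show "integrable M2 (\<lambda>y. norm (\<integral>x. f x y \<partial>M1) ^ n)"
  proof (rule Bochner_Integration.integrable_bound[OF integrable_snd[OF i[of n]]])
    show "AE y in M2. norm (norm (\<integral>x. f x y \<partial>M1) ^ n) \<le> norm (\<integral>x. norm (f x y) ^ n \<partial>M1)"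
      using AE_integrable_snd[OF i[of 1]] AE_integrable_snd[OF i[of n]]
    proof eventually_elim
      case (elim y)
      have "norm (\<integral>x. f x y \<partial>M1) ^ n \<le> (\<integral>x. norm (f x y) \<partial>M1) ^ n"
        by (intro power_mono integral_norm_bound) simp
      also have "\<dots> \<le> (\<integral>x. norm (f x y) ^ n \<partial>M1)"
        using elim by (intro M1.integral_power_le) auto
      finally show ?case by simp
    qed
  qed (use I in measurable)
qed

lemma Fubini_mult:
  assumes f: "fmom (M1 \<Otimes>\<^sub>M M2) (\<lambda>p. f (fst p) (snd p))" and Z: "fmom M2 Z"
  shows "(\<integral>y. (\<integral>x. f x y \<partial>M1) * Z y \<partial>M2) = (\<integral>x. (\<integral>y. f x y * Z y \<partial>M2) \<partial>M1)"
proof -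
  have "integrable (M1 \<Otimes>\<^sub>M M2) (\<lambda>p. f (fst p) (snd p) * Z (snd p))"
    by (intro fmom_integrable fmom_mult f fmom_snd Z)
  then have "integrable (M1 \<Otimes>\<^sub>M M2) (\<lambda>(x, y). f x y * Z y)" by (simp add: case_prod_beta')
  from Fubini_integral[OF this] show ?thesis by simp
qed

end

section \<open>The covariance function and its continuity\<close>

locale isotropic_field = compact_ab_group \<mu> + gaussian_field P T
  for \<mu> :: "('g::{ab_group_add, t2_space, second_countable_topology}) measure"
    and P :: "'w measure" and T :: "'g \<Rightarrow> 'w \<Rightarrow> real" +
  assumes T_meas: "(\<lambda>(g, \<omega>). T g \<omega>) \<in> borel_measurable (\<mu> \<Otimes>\<^sub>M P)"
    and T_iso: "isotropic P T"
    and T_var: "\<forall>g. integral\<^sup>L P (\<lambda>\<omega>. (T g \<omega>)\<^sup>2) = 1"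
begin

sublocale PP: pair_prob_space \<mu> P ..

lemma T_measurable_pair[measurable]: "(\<lambda>p. T (fst p) (snd p)) \<in> borel_measurable (\<mu> \<Otimes>\<^sub>M P)"
  using T_meas by (simp add: case_prod_beta')

lemma T_measurable[measurable]: "T g \<in> borel_measurable P"
  by (rule fmom_measurable[OF T_fmom])

lemma cov_translate: "cov (h + a) (h + b) = cov a b"
proof -
  define c :: "nat \<Rightarrow> 'g" where "c i = (if i = 0 then a else b)" for i
  have m: "(\<lambda>v. v 0 * v (Suc 0)) \<in> borel_measurable (PiM {..<2} (\<lambda>_. borel :: real measure))"
    by (intro borel_measurable_times measurable_component_singleton) auto
  have r: "(\<lambda>\<omega>. \<lambda>i\<in>{..<2}. T (k i) \<omega>) \<in> measurable P (PiM {..<2} (\<lambda>_. borel))" for k :: "nat \<Rightarrow> 'g"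
    by (rule measurable_restrict) measurable
  have E: "expectation (\<lambda>\<omega>. T (k 0) \<omega> * T (k (Suc 0)) \<omega>) =
    (\<integral>v. v 0 * v (Suc 0) \<partial>distr P (PiM {..<2} (\<lambda>_. borel)) (\<lambda>\<omega>. \<lambda>i\<in>{..<2}. T (k i) \<omega>))" for k
    by (subst integral_distr[OF r m]) simp
  have "distr P (PiM {..<2} (\<lambda>_. borel)) (\<lambda>\<omega>. \<lambda>i\<in>{..<2}. T (h + c i) \<omega>) =
     distr P (PiM {..<2} (\<lambda>_. borel)) (\<lambda>\<omega>. \<lambda>i\<in>{..<2}. T (c i) \<omega>)"
    using T_iso unfolding isotropic_def by (metis one_le_numeral)
  then have "expectation (\<lambda>\<omega>. T (h + c 0) \<omega> * T (h + c (Suc 0)) \<omega>) = expectation (\<lambda>\<omega>. T (c 0) \<omega> * T (c (Suc 0)) \<omega>)"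
    unfolding E[of "\<lambda>i. h + c i"] E[of c] by simp
  then show ?thesis by (simp add: cov_def c_def)
qed

definition r :: "'g \<Rightarrow> real" where "r x = cov x 0"

lemma cov_eq_r: "cov g h = r (g - h)"
  using cov_translate[of h "g - h" 0] by (simp add: r_def)

lemma cov_self: "cov g g = 1"
  using T_var by (simp add: cov_def power2_eq_square)

lemma r_0: "r 0 = 1"
  by (simp add: r_def cov_self)

lemma r_minus: "r (- x) = r x"
  using cov_eq_r[of 0 x] cov_commute[of 0 x] by (simp add: r_def)

lemma cov_le: "\<bar>cov g h\<bar> \<le> 1"
proof -
  have "(cov g h)\<^sup>2 \<le> 1"
    using fmom_Cauchy_Schwarz[OF T_fmom[of g] T_fmom[of h]] T_var by (simp add: cov_def)
  then show ?thesis by (simp add: abs_square_le_1)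
qed

lemma r_le: "\<bar>r x\<bar> \<le> 1"
  using cov_le by (simp add: r_def)

lemma expectation_diff_sq: "expectation (\<lambda>\<omega>. (T a \<omega> - T b \<omega>)\<^sup>2) = 2 - 2 * r (a - b)"
proof -
  have i: "integrable P (\<lambda>\<omega>. T a \<omega> * T b \<omega>)" for a b by (intro fmom_integrable fmom_intros T_fmom)
  have "expectation (\<lambda>\<omega>. (T a \<omega> - T b \<omega>)\<^sup>2) = expectation (\<lambda>\<omega>. T a \<omega> * T a \<omega> - 2 * (T a \<omega> * T b \<omega>) + T b \<omega> * T b \<omega>)"
    by (simp add: power2_eq_square algebra_simps)
  also have "\<dots> = cov a a - 2 * cov a b + cov b b" using i by (simp add: cov_def)
  finally show ?thesis by (simp add: cov_self cov_eq_r)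
qed

text \<open>The proportionality of first absolute moment and standard deviation turns convergence in
  mean, which is all that measurability provides, into convergence of variances.\<close>

lemma gaussian_abs_moment:
  assumes Y: "centered_gaussian_rv P Y"
  shows "expectation (\<lambda>x. \<bar>Y x\<bar>) = sqrt (2 / pi) * sqrt (expectation (\<lambda>x. (Y x)\<^sup>2))"
proof -
  have m: "Y \<in> borel_measurable P" using assms by (simp add: centered_gaussian_rv_def)
  from assms consider "AE x in P. Y x = 0"
    | \<sigma> where "\<sigma> > 0" "distributed P lborel Y (\<lambda>x. ennreal (normal_density 0 \<sigma> x))"
    unfolding centered_gaussian_rv_def by blast
  then show ?thesis
  proof cases
    case 1
    have "expectation (\<lambda>x. \<bar>Y x\<bar>) = expectation (\<lambda>x. 0)" "expectation (\<lambda>x. (Y x)\<^sup>2) = expectation (\<lambda>x. 0)"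
      by (rule integral_cong_AE; use 1 m in auto)+
    then show ?thesis by simp
  next
    case 2
    have "expectation (\<lambda>x. \<bar>Y x\<bar>) = (\<integral>x. normal_density 0 \<sigma> x * \<bar>x - 0\<bar> ^ (2 * 0 + 1) \<partial>lborel)"
      using distributed_integral[OF 2(2), of "\<lambda>x. \<bar>x\<bar>"] by simp
    moreover have "expectation (\<lambda>x. (Y x)\<^sup>2) = (\<integral>x. normal_density 0 \<sigma> x * (x - 0) ^ (2 * 1) \<partial>lborel)"
      using distributed_integral[OF 2(2), of "\<lambda>x. x\<^sup>2"] by simp
    ultimately show ?thesis
      using integral_normal_moment_abs_odd[OF 2(1), of 0 0] integral_normal_moment_even[OF 2(1), of 0 1] 2(1)
      by simp
  qed
qed

lemma T_moment: "expectation (\<lambda>\<omega>. T g \<omega> ^ k) = expectation (\<lambda>\<omega>. T 0 \<omega> ^ k)"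
proof (induction k rule: less_induct)
  case (less k)
  show ?case
  proof (cases k)
    case (Suc n)
    have "expectation (\<lambda>\<omega>. T g \<omega> ^ Suc n) = real n * expectation (\<lambda>\<omega>. T g \<omega> ^ (n - 1))" for g
      by (subst centered_gaussian_rv_moment[OF T_gaussian]) (use T_var in simp)
    then show ?thesis using less[of "n - 1"] Suc by simp
  qed simp
qed

lemma T_fmom_pair: "fmom (\<mu> \<Otimes>\<^sub>M P) (\<lambda>p. T (fst p) (snd p))"
proof (rule fmomI[where Y = "\<lambda>n p. 1 + T (fst p) (snd p) ^ (2 * n)"])
  fix n
  have i: "integrable P (\<lambda>\<omega>. T g \<omega> ^ k)" for g k by (intro fmom_integrable fmom_intros T_fmom)
  have "integrable (\<mu> \<Otimes>\<^sub>M P) (\<lambda>p. T (fst p) (snd p) ^ (2 * n))"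
  proof (rule PP.Fubini_integrable)
    have "expectation (\<lambda>\<omega>. norm (T g \<omega> ^ (2 * n))) = expectation (\<lambda>\<omega>. T 0 \<omega> ^ (2 * n))" for g
      using T_moment[of g "2 * n"] by simp
    then show "integrable \<mu> (\<lambda>x. expectation (\<lambda>y. norm (T (fst (x, y)) (snd (x, y)) ^ (2 * n))))"
      by (simp only: fst_conv snd_conv) simp
  qed (auto simp: i)
  then show "integrable (\<mu> \<Otimes>\<^sub>M P) (\<lambda>p. 1 + T (fst p) (snd p) ^ (2 * n))" by simp
  fix p :: "'g \<times> 'w"
  have "x \<le> 1 + x\<^sup>2" for x :: real 
  proof -
    have "0 \<le> (x - 1) * (x - 1) + x * x + 1" by (intro add_nonneg_nonneg zero_le_square) simp
    then show ?thesis by (simp add: power2_eq_square algebra_simps)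
  qed
  from this[of "\<bar>T (fst p) (snd p)\<bar> ^ n"] show "norm (T (fst p) (snd p)) ^ n \<le> 1 + T (fst p) (snd p) ^ (2 * n)"
    by (simp add: power_mult[symmetric] mult.commute power_even_abs)
qed simp

text \<open>By isotropy the expected distance of \<open>T (h + g)\<close> and \<open>T g\<close>
  does not depend on \<open>g\<close>. The average over the group that \<open>L1_translation\<close>
  controls is thus this one value, a function of \<open>r h\<close>.\<close>

lemma r_tendsto_1:
  assumes h: "h \<longlonglongrightarrow> 0" shows "(\<lambda>n. r (h n)) \<longlonglongrightarrow> 1"
proof -
  have "(\<lambda>n. \<integral>p. \<bar>T (h n + fst p) (snd p) - T (fst p) (snd p)\<bar> \<partial>(\<mu> \<Otimes>\<^sub>M P)) \<longlonglongrightarrow> 0"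
    using L1_translation[OF h prob_space_axioms fmom_integrable[OF T_fmom_pair]] by simp
  moreover have "(\<integral>p. \<bar>T (h n + fst p) (snd p) - T (fst p) (snd p)\<bar> \<partial>(\<mu> \<Otimes>\<^sub>M P)) = sqrt (2 / pi) * sqrt (2 - 2 * r (h n))" for n
  proof -
    have mt: "(\<lambda>p. (h n + fst p, snd p)) \<in> measurable (\<mu> \<Otimes>\<^sub>M P) (\<mu> \<Otimes>\<^sub>M P)" by measurable
    have m: "(\<lambda>p. \<bar>T (h n + fst p) (snd p) - T (fst p) (snd p)\<bar>) \<in> borel_measurable (\<mu> \<Otimes>\<^sub>M P)"
      using measurable_compose[OF mt T_measurable_pair] by simp
    have g: "centered_gaussian_rv P (\<lambda>\<omega>. T a \<omega> - T b \<omega>)" for a b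
      using lin_comb_gaussian[of "[(1, a), (-1, b)]"] by simp
    have e: "expectation (\<lambda>\<omega>. \<bar>T a \<omega> - T b \<omega>\<bar>) = sqrt (2 / pi) * sqrt (2 - 2 * r (a - b))" for a b
      by (simp add: gaussian_abs_moment[OF g] expectation_diff_sq)
    have "integrable (\<mu> \<Otimes>\<^sub>M P) (\<lambda>p. \<bar>T (h n + fst p) (snd p) - T (fst p) (snd p)\<bar>)"
      by (rule PP.Fubini_integrable[OF m]) (auto simp: e intro!: AE_I2 fmom_integrable fmom_abs fmom_diff T_fmom)
    from PP.integral_fst'[OF this] show ?thesis by (simp add: e)
  qed
  ultimately have "(\<lambda>n. sqrt (2 / pi) * sqrt (2 - 2 * r (h n))) \<longlonglongrightarrow> 0" by simp
  then have "(\<lambda>n. (sqrt (2 / pi) * sqrt (2 - 2 * r (h n)))\<^sup>2) \<longlonglongrightarrow> 0\<^sup>2" by (intro tendsto_power)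
  moreover have "(sqrt (2 / pi) * sqrt (2 - 2 * r (h n)))\<^sup>2 = 2 / pi * (2 - 2 * r (h n))" for n
    using r_le[of "h n"] by (simp add: power_mult_distrib)
  ultimately have "(\<lambda>n. 2 / pi * (2 - 2 * r (h n))) \<longlonglongrightarrow> 0" by simp
  then have "(\<lambda>n. 1 - pi / 4 * (2 / pi * (2 - 2 * r (h n)))) \<longlonglongrightarrow> 1 - pi / 4 * 0"
    by (intro tendsto_intros)
  then show ?thesis by (simp add: field_simps)
qed

text \<open>Continuity at the origin spreads by Cauchy-Schwarz: the squared increment of
  \<open>r\<close> between \<open>x\<close> and \<open>y\<close> is at most the variance of
  \<open>T x - T y\<close>, namely \<open>2 - 2 * r (x - y)\<close>.\<close>

lemma continuous_r: "continuous_on UNIV r"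
proof (rule continuous_on_sequentiallyI')
  fix X :: "nat \<Rightarrow> 'g" and x assume X: "X \<longlonglongrightarrow> x"
  have "(\<lambda>n. X n - x) \<longlonglongrightarrow> x - x" by (intro tendsto_diff_group X tendsto_const)
  then have "(\<lambda>n. sqrt (2 - 2 * r (X n - x))) \<longlonglongrightarrow> sqrt (2 - 2 * 1)"
    by (intro tendsto_real_sqrt tendsto_diff tendsto_mult tendsto_const r_tendsto_1) simp
  then have lim: "(\<lambda>n. sqrt (2 - 2 * r (X n - x))) \<longlonglongrightarrow> 0" by simp
  have "\<bar>r (X n) - r x\<bar> \<le> sqrt (2 - 2 * r (X n - x))" for n
  proof -
    have i: "integrable P (\<lambda>\<omega>. T a \<omega> * T b \<omega>)" for a b by (intro fmom_integrable fmom_intros T_fmom)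
    have "r (X n) - r x = expectation (\<lambda>\<omega>. (T (X n) \<omega> - T x \<omega>) * T 0 \<omega>)"
      using i by (simp add: r_def cov_def left_diff_distrib)
    then have "(r (X n) - r x)\<^sup>2 \<le> 2 - 2 * r (X n - x)"
      using fmom_Cauchy_Schwarz[OF fmom_diff[OF T_fmom[of "X n"] T_fmom[of x]] T_fmom[of 0]] T_var
      by (simp add: expectation_diff_sq)
    then show ?thesis using real_le_rsqrt by (simp add: real_sqrt_abs[symmetric] del: real_sqrt_abs)
  qed
  then have "(\<lambda>n. r (X n) - r x) \<longlonglongrightarrow> 0"
    by (intro Lim_null_comparison[OF always_eventually lim]) simp
  then show "(\<lambda>n. r (X n)) \<longlonglongrightarrow> r x" by (simp add: LIM_zero_iff)
qed

lemma r_measurable[measurable]: "r \<in> borel_measurable \<mu>"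
  by (rule measurable_continuous[OF continuous_r])

definition weight :: "('g \<Rightarrow> 'b::{real_normed_field, banach, second_countable_topology}) \<Rightarrow> bool" where
  "weight w \<longleftrightarrow> w \<in> borel_measurable \<mu> \<and> (\<exists>B. \<forall>g. norm (w g) \<le> B)"

lemma weight_measurable: "weight w \<Longrightarrow> w \<in> borel_measurable \<mu>"
  by (simp add: weight_def)

lemma weight_fmom: "weight w \<Longrightarrow> fmom \<mu> w"
  unfolding weight_def by (auto intro: haar.fmom_bounded)

lemma weight_const: "weight (\<lambda>_. c)"
  by (auto simp: weight_def)

lemma weight_mult: "weight v \<Longrightarrow> weight w \<Longrightarrow> weight (\<lambda>g. v g * w g)"
proof -
  assume a: "weight v" "weight w"
  then obtain A B where "\<And>g. norm (v g) \<le> A" "\<And>g. norm (w g) \<le> B" by (auto simp: weight_def)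
  then have "norm (v g * w g) \<le> \<bar>A\<bar> * \<bar>B\<bar>" for g
    unfolding norm_mult by (intro mult_mono) (auto intro: order_trans[OF _ abs_ge_self])
  then show ?thesis using a by (auto simp: weight_def)
qed

lemma weight_continuous:
  assumes "continuous_on UNIV w" shows "weight w"
proof -
  obtain B where "\<And>x. norm (w x) \<le> B" using continuous_bounded[OF assms] by auto
  then show ?thesis unfolding weight_def using measurable_continuous[OF assms] by (intro conjI exI[of _ B] allI)
qed

lemma weight_r_diff: "weight (\<lambda>g. r (h - g))"
  by (intro weight_continuous continuous_compose[OF continuous_r] continuous_diff continuous_on_const continuous_on_id)

definition gint :: "real poly \<Rightarrow> ('g \<Rightarrow> 'b::{real_normed_field, banach, second_countable_topology}) \<Rightarrow> 'w \<Rightarrow> 'b" where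
  "gint q w \<omega> = (\<integral>g. of_real (poly q (T g \<omega>)) * w g \<partial>\<mu>)"

lemma fmom_of_real: "fmom M (X :: 'x \<Rightarrow> real) \<Longrightarrow> fmom M (\<lambda>x. of_real (X x) :: 'b::{real_normed_field, banach, second_countable_topology})"
  by (rule fmom_mono[of _ _ "\<lambda>x. X x"]) (auto simp: fmom_def fmom_def[of M X] intro!: borel_measurable_of_real)

lemma gint_fmom_pair:
  assumes "weight w"
  shows "fmom (\<mu> \<Otimes>\<^sub>M P) (\<lambda>p. of_real (poly q (T (fst p) (snd p))) * w (fst p))"
  by (intro fmom_mult fmom_of_real PP.P.fmom_poly T_fmom_pair PP.fmom_fst weight_fmom assms)

lemma gint_fmom: "weight w \<Longrightarrow> fmom P (gint q w)"
  unfolding gint_def using PP.fmom_integral_fst[OF gint_fmom_pair[of w q]] by simp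

lemma gint_mult:
  assumes "weight w" "fmom P Z"
  shows "expectation (\<lambda>\<omega>. gint q w \<omega> * Z \<omega>) = (\<integral>g. w g * expectation (\<lambda>\<omega>. of_real (poly q (T g \<omega>)) * Z \<omega>) \<partial>\<mu>)"
proof -
  have "expectation (\<lambda>\<omega>. gint q w \<omega> * Z \<omega>) = (\<integral>g. expectation (\<lambda>\<omega>. (of_real (poly q (T g \<omega>)) * w g) * Z \<omega>) \<partial>\<mu>)"
    unfolding gint_def by (rule PP.Fubini_mult[OF gint_fmom_pair[OF assms(1)] assms(2)])
  also have "\<dots> = (\<integral>g. expectation (\<lambda>\<omega>. w g * (of_real (poly q (T g \<omega>)) * Z \<omega>)) \<partial>\<mu>)"
    by (simp add: mult_ac)
  finally show ?thesis by simp
qed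

lemma gint_smult: "gint (smult c q) w \<omega> = of_real c * gint q w \<omega>"
  by (simp add: gint_def mult.assoc)

end

section \<open>Derivatives, the moment recursion and the diagram formula\<close>

context isotropic_field
begin

text \<open>Here \<open>D h\<close> plays the part of the derivative of \<open>Z\<close> in the
  direction of \<open>T h\<close>, defined by duality against products of polynomials of the field.
  The test factor \<open>K\<close> is what lets the property pass to random integrals over the
  group.\<close>

definition ibp :: "('w \<Rightarrow> real) \<Rightarrow> ('g \<Rightarrow> 'w \<Rightarrow> real) \<Rightarrow> bool" where
  "ibp Z D \<longleftrightarrow> fmom P Z \<and> (\<forall>h. fmom P (D h)) \<and> fmom (\<mu> \<Otimes>\<^sub>M P) (\<lambda>p. D (fst p) (snd p)) \<and>
    (\<forall>K h. expectation (\<lambda>\<omega>. T h \<omega> * Z \<omega> * poly_prod T K \<omega>) =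
      expectation (\<lambda>\<omega>. D h \<omega> * poly_prod T K \<omega> + Z \<omega> * D_prod cov T K h \<omega>))"

lemma ibp_one: "ibp (\<lambda>_. 1) (\<lambda>_ _. 0)"
  unfolding ibp_def using gaussian_ibp by (simp add: fmom_const PP.P.fmom_const)

definition D_gint :: "real poly \<Rightarrow> ('g \<Rightarrow> real) \<Rightarrow> 'g \<Rightarrow> 'w \<Rightarrow> real" where
  "D_gint q w h = gint (pderiv q) (\<lambda>g. r (h - g) * w g)"

lemma D_gint_fmom: "weight w \<Longrightarrow> fmom P (D_gint q w h)"
  unfolding D_gint_def by (intro gint_fmom weight_mult weight_r_diff)

text \<open>The derivative is itself an integral over the group, so its moments jointly in
  \<open>h\<close> and \<omega> are obtained on a product of three factors before \<open>g\<close>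
  is integrated out.\<close>

lemma D_gint_fmom_pair:
  assumes w: "weight w"
  shows "fmom (\<mu> \<Otimes>\<^sub>M P) (\<lambda>p. D_gint q w (fst p) (snd p))"
proof -
  interpret Q: pair_prob_space \<mu> "\<mu> \<Otimes>\<^sub>M P" ..
  have "distr \<mu> \<mu> (\<lambda>x. x) \<Otimes>\<^sub>M distr (\<mu> \<Otimes>\<^sub>M P) P snd =
    distr (\<mu> \<Otimes>\<^sub>M (\<mu> \<Otimes>\<^sub>M P)) (\<mu> \<Otimes>\<^sub>M P) (\<lambda>(x, y). (x, snd y))"
    by (rule pair_measure_distr) (auto simp: PP.distr_snd sigma_finite_measure_axioms)
  then have d: "distr (\<mu> \<Otimes>\<^sub>M (\<mu> \<Otimes>\<^sub>M P)) (\<mu> \<Otimes>\<^sub>M P) (\<lambda>x. (fst x, snd (snd x))) = \<mu> \<Otimes>\<^sub>M P"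
    by (simp add: PP.distr_snd distr_id case_prod_beta')
  have 1: "fmom (\<mu> \<Otimes>\<^sub>M (\<mu> \<Otimes>\<^sub>M P)) (\<lambda>x. poly (pderiv q) (T (fst x) (snd (snd x))) * w (fst x))"
  proof -
    have mm: "(\<lambda>x. (fst x, snd (snd x))) \<in> measurable (\<mu> \<Otimes>\<^sub>M (\<mu> \<Otimes>\<^sub>M P)) (\<mu> \<Otimes>\<^sub>M P)" by measurable
    have "fmom (\<mu> \<Otimes>\<^sub>M P) (\<lambda>p. poly (pderiv q) (T (fst p) (snd p)) * w (fst p))"
      using gint_fmom_pair[OF w, of "pderiv q"] by simp
    from fmom_distr[OF mm, unfolded d, OF this] show ?thesis by simp
  qed
  have 2: "fmom (\<mu> \<Otimes>\<^sub>M (\<mu> \<Otimes>\<^sub>M P)) (\<lambda>x. r (fst (snd x) - fst x))"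
  proof (rule Q.P.fmom_bounded[where B = 1])
    have m1: "(\<lambda>x. (fst (snd x), fst x)) \<in> measurable (\<mu> \<Otimes>\<^sub>M (\<mu> \<Otimes>\<^sub>M P)) (\<mu> \<Otimes>\<^sub>M \<mu>)" by measurable
    have "(\<lambda>x. fst x - snd x) \<in> measurable (\<mu> \<Otimes>\<^sub>M \<mu>) \<mu>" by (rule measurable_diff_pair)
    from measurable_compose[OF measurable_compose[OF m1 this] r_measurable]
    show "(\<lambda>x. r (fst (snd x) - fst x)) \<in> borel_measurable (\<mu> \<Otimes>\<^sub>M (\<mu> \<Otimes>\<^sub>M P))" by simp
  qed (simp add: r_le)
  have "fmom (\<mu> \<Otimes>\<^sub>M (\<mu> \<Otimes>\<^sub>M P)) (\<lambda>x. poly (pderiv q) (T (fst x) (snd (snd x))) * (r (fst (snd x) - fst x) * w (fst x)))"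
    using fmom_mult[OF 1 2] by (simp add: mult_ac)
  then have "fmom (\<mu> \<Otimes>\<^sub>M P) (\<lambda>p. \<integral>g. poly (pderiv q) (T g (snd p)) * (r (fst p - g) * w g) \<partial>\<mu>)"
    by (rule Q.fmom_integral_fst)
  then show ?thesis by (simp add: D_gint_def gint_def)
qed

text \<open>Under the integral over \<open>g\<close> the polynomial of \<open>T g\<close> is one
  more test factor, so the hypothesis on \<open>Z\<close> applies to \<open>(q, g) # K\<close>;
  integrating the two resulting terms over \<open>g\<close> gives the product rule.\<close>

lemma ibp_mult_gint:
  assumes Z: "ibp Z D" and w: "weight w"
  shows "ibp (\<lambda>\<omega>. gint q w \<omega> * Z \<omega>) (\<lambda>h \<omega>. gint q w \<omega> * D h \<omega> + Z \<omega> * D_gint q w h \<omega>)"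
  unfolding ibp_def
proof (intro conjI allI)
  have fZ: "fmom P Z" and fD: "\<And>h. fmom P (D h)" and fDp: "fmom (\<mu> \<Otimes>\<^sub>M P) (\<lambda>p. D (fst p) (snd p))"
    and Zi: "\<And>K h. expectation (\<lambda>\<omega>. T h \<omega> * Z \<omega> * poly_prod T K \<omega>) =
      expectation (\<lambda>\<omega>. D h \<omega> * poly_prod T K \<omega> + Z \<omega> * D_prod cov T K h \<omega>)"
    using Z by (auto simp: ibp_def)
  note f = fZ fD gint_fmom[OF w] D_gint_fmom[OF w] T_fmom poly_prod_fmom D_prod_fmom
  show "fmom P (\<lambda>\<omega>. gint q w \<omega> * Z \<omega>)" "\<And>h. fmom P (\<lambda>\<omega>. gint q w \<omega> * D h \<omega> + Z \<omega> * D_gint q w h \<omega>)"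
    by (intro fmom_intros f)+
  show "fmom (\<mu> \<Otimes>\<^sub>M P) (\<lambda>p. gint q w (snd p) * D (fst p) (snd p) + Z (snd p) * D_gint q w (fst p) (snd p))"
    by (intro fmom_add fmom_mult fDp D_gint_fmom_pair w PP.fmom_snd fZ gint_fmom)
  fix K h
  have w': "weight (\<lambda>g. r (h - g) * w g)" by (intro weight_mult weight_r_diff w)
  define A where "A \<omega> = D h \<omega> * poly_prod T K \<omega> + Z \<omega> * D_prod cov T K h \<omega>" for \<omega>
  define B where "B \<omega> = Z \<omega> * poly_prod T K \<omega>" for \<omega>
  have fA: "fmom P A" and fB: "fmom P B" unfolding A_def B_def by (intro fmom_intros f)+
  have step: "expectation (\<lambda>\<omega>. poly q (T g \<omega>) * (T h \<omega> * B \<omega>)) =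
      expectation (\<lambda>\<omega>. poly q (T g \<omega>) * A \<omega>) + r (h - g) * expectation (\<lambda>\<omega>. poly (pderiv q) (T g \<omega>) * B \<omega>)" for g
  proof -
    have "expectation (\<lambda>\<omega>. poly q (T g \<omega>) * (T h \<omega> * B \<omega>)) = expectation (\<lambda>\<omega>. T h \<omega> * Z \<omega> * poly_prod T ((q, g) # K) \<omega>)"
      by (simp add: B_def mult_ac)
    also have "\<dots> = expectation (\<lambda>\<omega>. poly q (T g \<omega>) * A \<omega> + r (h - g) * (poly (pderiv q) (T g \<omega>) * B \<omega>))"
      unfolding Zi by (simp add: A_def B_def algebra_simps cov_eq_r)
    also have "\<dots> = expectation (\<lambda>\<omega>. poly q (T g \<omega>) * A \<omega>) + r (h - g) * expectation (\<lambda>\<omega>. poly (pderiv q) (T g \<omega>) * B \<omega>)"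
      by (subst Bochner_Integration.integral_add) (auto intro!: integrable_mult_right fmom_integrable fmom_intros f fA fB)
    finally show ?thesis .
  qed
  have i1: "integrable \<mu> (\<lambda>g. w g * expectation (\<lambda>\<omega>. poly p (T g \<omega>) * Y \<omega>))" if w: "weight w" and Y: "fmom P Y" for p Y and w :: "'g \<Rightarrow> real"
  proof -
    have "fmom (\<mu> \<Otimes>\<^sub>M P) (\<lambda>x. poly p (T (fst x) (snd x)) * w (fst x))"
      using gint_fmom_pair[OF w, of p] by simp
    then have "integrable (\<mu> \<Otimes>\<^sub>M P) (\<lambda>x. (poly p (T (fst x) (snd x)) * w (fst x)) * Y (snd x))"
      by (rule fmom_integrable[OF fmom_mult[OF _ PP.fmom_snd[OF Y]]])
    from PP.integrable_fst'[OF this] show ?thesis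
      by (simp add: mult_ac integral_mult_right_zero[symmetric] del: integral_mult_right_zero integral_mult_left_zero)
  qed
  have "expectation (\<lambda>\<omega>. T h \<omega> * (gint q w \<omega> * Z \<omega>) * poly_prod T K \<omega>) = expectation (\<lambda>\<omega>. gint q w \<omega> * (T h \<omega> * B \<omega>))"
    by (simp add: B_def mult_ac)
  also have "\<dots> = (\<integral>g. w g * expectation (\<lambda>\<omega>. poly q (T g \<omega>) * (T h \<omega> * B \<omega>)) \<partial>\<mu>)"
    using gint_mult[OF w, of "\<lambda>\<omega>. T h \<omega> * B \<omega>" q] by (simp add: fmom_mult T_fmom fB)
  also have "\<dots> = (\<integral>g. w g * expectation (\<lambda>\<omega>. poly q (T g \<omega>) * A \<omega>) + (r (h - g) * w g) * expectation (\<lambda>\<omega>. poly (pderiv q) (T g \<omega>) * B \<omega>) \<partial>\<mu>)"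
    unfolding step by (simp add: algebra_simps)
  also have "\<dots> = expectation (\<lambda>\<omega>. gint q w \<omega> * A \<omega>) + expectation (\<lambda>\<omega>. D_gint q w h \<omega> * B \<omega>)"
    using gint_mult[OF w fA, of q] gint_mult[OF w' fB, of "pderiv q"] i1[OF w fA] i1[OF w' fB]
    by (simp add: D_gint_def)
  also have "\<dots> = expectation (\<lambda>\<omega>. gint q w \<omega> * A \<omega> + D_gint q w h \<omega> * B \<omega>)"
    by (subst Bochner_Integration.integral_add) (auto intro!: fmom_integrable fmom_intros f fA fB)
  also have "\<dots> = expectation (\<lambda>\<omega>. (gint q w \<omega> * D h \<omega> + Z \<omega> * D_gint q w h \<omega>) * poly_prod T K \<omega> + gint q w \<omega> * Z \<omega> * D_prod cov T K h \<omega>)"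
    by (simp add: A_def B_def algebra_simps)
  finally show "expectation (\<lambda>\<omega>. T h \<omega> * (gint q w \<omega> * Z \<omega>) * poly_prod T K \<omega>) =
    expectation (\<lambda>\<omega>. (gint q w \<omega> * D h \<omega> + Z \<omega> * D_gint q w h \<omega>) * poly_prod T K \<omega> + gint q w \<omega> * Z \<omega> * D_prod cov T K h \<omega>)" .
qed

lemma ibp_power_gint:
  assumes w: "weight w"
  shows "ibp (\<lambda>\<omega>. gint q w \<omega> ^ n) (\<lambda>h \<omega>. real n * gint q w \<omega> ^ (n - 1) * D_gint q w h \<omega>)"
proof (induction n)
  case 0
  then show ?case using ibp_one by simp
next
  case (Suc n)
  have "(\<lambda>h \<omega>. gint q w \<omega> * (real n * gint q w \<omega> ^ (n - 1) * D_gint q w h \<omega>) + gint q w \<omega> ^ n * D_gint q w h \<omega>) =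
    (\<lambda>h \<omega>. real (Suc n) * gint q w \<omega> ^ (Suc n - 1) * D_gint q w h \<omega>)"
    by (cases n) (simp_all add: fun_eq_iff algebra_simps)
  then show ?case using ibp_mult_gint[OF Suc w, of q] by simp
qed

text \<open>In the recursion \<open>H_{m+1} = x * H_m - H_m'\<close>, the derivative that
  integration by parts lets fall on \<open>H_m\<close> carries the factor \<open>cov h h = 1\<close>
  and cancels the last term, so only \<open>D h\<close> remains.\<close>

lemma hermite_ibp:
  assumes Z: "ibp Z D"
  shows "expectation (\<lambda>\<omega>. poly (hermite_poly (Suc m)) (T h \<omega>) * Z \<omega>) = expectation (\<lambda>\<omega>. poly (hermite_poly m) (T h \<omega>) * D h \<omega>)"
proof -
  have fZ: "fmom P Z" and fD: "fmom P (D h)"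
    and Zi: "\<And>K. expectation (\<lambda>\<omega>. T h \<omega> * Z \<omega> * poly_prod T K \<omega>) =
      expectation (\<lambda>\<omega>. D h \<omega> * poly_prod T K \<omega> + Z \<omega> * D_prod cov T K h \<omega>)"
    using Z by (auto simp: ibp_def)
  note i = fmom_integrable fmom_intros T_fmom fZ fD
  have "expectation (\<lambda>\<omega>. poly (hermite_poly (Suc m)) (T h \<omega>) * Z \<omega>) =
     expectation (\<lambda>\<omega>. T h \<omega> * Z \<omega> * poly_prod T [(hermite_poly m, h)] \<omega> - poly (pderiv (hermite_poly m)) (T h \<omega>) * Z \<omega>)"
    by (simp add: algebra_simps)
  also have "\<dots> = expectation (\<lambda>\<omega>. T h \<omega> * Z \<omega> * poly_prod T [(hermite_poly m, h)] \<omega>) - expectation (\<lambda>\<omega>. poly (pderiv (hermite_poly m)) (T h \<omega>) * Z \<omega>)"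
    by (rule Bochner_Integration.integral_diff; intro i poly_prod_fmom)
  also have "\<dots> = expectation (\<lambda>\<omega>. D h \<omega> * poly_prod T [(hermite_poly m, h)] \<omega> + Z \<omega> * D_prod cov T [(hermite_poly m, h)] h \<omega>) - expectation (\<lambda>\<omega>. poly (pderiv (hermite_poly m)) (T h \<omega>) * Z \<omega>)"
    by (simp only: Zi)
  also have "\<dots> = expectation (\<lambda>\<omega>. (D h \<omega> * poly_prod T [(hermite_poly m, h)] \<omega> + Z \<omega> * D_prod cov T [(hermite_poly m, h)] h \<omega>) - poly (pderiv (hermite_poly m)) (T h \<omega>) * Z \<omega>)"
    by (rule Bochner_Integration.integral_diff[symmetric]; intro i poly_prod_fmom D_prod_fmom)
  also have "\<dots> = expectation (\<lambda>\<omega>. poly (hermite_poly m) (T h \<omega>) * D h \<omega>)"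
    by (simp add: cov_self algebra_simps)
  finally show ?thesis .
qed

definition hint :: "nat \<Rightarrow> ('g \<Rightarrow> 'b::{real_normed_field, banach, second_countable_topology}) \<Rightarrow> 'w \<Rightarrow> 'b" where
  "hint m = gint (hermite_poly m)"

text \<open>The squared norm of the Malliavin derivative of \<open>hint (Suc m) w\<close>, divided by \<open>Suc m\<close>.\<close>

definition Gam :: "nat \<Rightarrow> ('g \<Rightarrow> real) \<Rightarrow> 'w \<Rightarrow> real" where
  "Gam m w \<omega> = (\<integral>h. w h * poly (hermite_poly m) (T h \<omega>) * D_gint (hermite_poly (Suc m)) w h \<omega> \<partial>\<mu>)"

lemma Gam_fmom_pair:
  assumes "weight w"
  shows "fmom (\<mu> \<Otimes>\<^sub>M P) (\<lambda>p. w (fst p) * poly (hermite_poly m) (T (fst p) (snd p)) * D_gint (hermite_poly (Suc m)) w (fst p) (snd p))"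
  using gint_fmom_pair[OF assms, of "hermite_poly m"]
  by (intro fmom_mult[OF _ D_gint_fmom_pair[OF assms]]) (simp add: mult.commute)

lemma Gam_fmom: "weight w \<Longrightarrow> fmom P (Gam m w)"
  unfolding Gam_def[abs_def] by (rule PP.fmom_integral_fst[OF Gam_fmom_pair])

text \<open>One factor is opened as an integral over \<open>h\<close>; \<open>hermite_ibp\<close>
  lowers its Hermite polynomial by one and differentiates the remaining power.\<close>

lemma moment_recursion:
  assumes w: "weight w"
  shows "expectation (\<lambda>\<omega>. hint (Suc m) w \<omega> ^ Suc n) = real n * expectation (\<lambda>\<omega>. Gam m w \<omega> * hint (Suc m) w \<omega> ^ (n - 1))"
proof -
  let ?F = "gint (hermite_poly (Suc m)) w"
  let ?D = "D_gint (hermite_poly (Suc m)) w"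
  have "expectation (\<lambda>\<omega>. ?F \<omega> * ?F \<omega> ^ n) = (\<integral>h. w h * expectation (\<lambda>\<omega>. poly (hermite_poly (Suc m)) (T h \<omega>) * ?F \<omega> ^ n) \<partial>\<mu>)"
    using gint_mult[OF w fmom_power[OF gint_fmom[OF w]], of "hermite_poly (Suc m)" _ n] by (simp del: hermite_poly.simps)
  also have "\<dots> = (\<integral>h. w h * expectation (\<lambda>\<omega>. poly (hermite_poly m) (T h \<omega>) * (real n * ?F \<omega> ^ (n - 1) * ?D h \<omega>)) \<partial>\<mu>)"
    unfolding hermite_ibp[OF ibp_power_gint[OF w]] ..
  also have "\<dots> = (\<integral>h. expectation (\<lambda>\<omega>. (w h * poly (hermite_poly m) (T h \<omega>) * ?D h \<omega>) * (real n * ?F \<omega> ^ (n - 1))) \<partial>\<mu>)"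
    by (simp add: mult_ac integral_mult_right_zero[symmetric] del: hermite_poly.simps integral_mult_right_zero integral_mult_left_zero)
  also have "\<dots> = expectation (\<lambda>\<omega>. Gam m w \<omega> * (real n * ?F \<omega> ^ (n - 1)))"
    unfolding Gam_def by (rule PP.Fubini_mult[OF Gam_fmom_pair[OF w], symmetric]) (intro fmom_intros gint_fmom w)
  finally show ?thesis by (simp add: hint_def mult_ac del: hermite_poly.simps)
qed

end

section \<open>Sums over multigraphs on four vertices\<close>

text \<open>The degrees \<open>(a,b,c,d,e,f)\<close> of the edges 12, 13, 14, 23, 24, 34 of a multigraph on four vertices
  with prescribed vertex degrees.\<close>

definition graphs4 :: "nat \<Rightarrow> nat \<Rightarrow> nat \<Rightarrow> nat \<Rightarrow> (nat \<times> nat \<times> nat \<times> nat \<times> nat \<times> nat) set" where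
  "graphs4 n1 n2 n3 n4 = {(a, b, c, d, e, f). a + b + c = n1 \<and> a + d + e = n2 \<and> b + d + f = n3 \<and> c + e + f = n4}"

text \<open>Divided powers: the factorials are the symmetries of parallel edges, and with them the
  deletion of an edge produces no combinatorial constant.\<close>

definition dpow :: "real \<Rightarrow> nat \<Rightarrow> real" where "dpow x n = x ^ n / fact n"

lemma dpow_0[simp]: "dpow x 0 = 1"
  by (simp add: dpow_def)

lemma dpow_Suc: "dpow x (Suc n) = x * dpow x n / real (Suc n)"
  by (simp add: dpow_def)

fun gweight :: "real \<Rightarrow> real \<Rightarrow> real \<Rightarrow> real \<Rightarrow> real \<Rightarrow> real \<Rightarrow> nat \<times> nat \<times> nat \<times> nat \<times> nat \<times> nat \<Rightarrow> real" where
  "gweight x12 x13 x14 x23 x24 x34 (a, b, c, d, e, f) =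
     dpow x12 a * dpow x13 b * dpow x14 c * dpow x23 d * dpow x24 e * dpow x34 f"

definition gsum where
  "gsum x12 x13 x14 x23 x24 x34 n1 n2 n3 n4 = sum (gweight x12 x13 x14 x23 x24 x34) (graphs4 n1 n2 n3 n4)"

lemma finite_graphs4: "finite (graphs4 n1 n2 n3 n4)"
  by (rule finite_subset[of _ "{..n1} \<times> {..n1} \<times> {..n1} \<times> {..n2} \<times> {..n2} \<times> {..n3}"]) (auto simp: graphs4_def)

lemma gsum_swap12: "gsum x12 x13 x14 x23 x24 x34 n1 n2 n3 n4 = gsum x12 x23 x24 x13 x14 x34 n2 n1 n3 n4"
  unfolding gsum_def
  by (rule sum.reindex_bij_witness[of _ "\<lambda>(a, b, c, d, e, f). (a, d, e, b, c, f)" "\<lambda>(a, b, c, d, e, f). (a, d, e, b, c, f)"])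
    (auto simp: graphs4_def mult_ac)

lemma gsum_swap13: "gsum x12 x13 x14 x23 x24 x34 n1 n2 n3 n4 = gsum x23 x13 x34 x12 x24 x14 n3 n2 n1 n4"
  unfolding gsum_def
  by (rule sum.reindex_bij_witness[of _ "\<lambda>(a, b, c, d, e, f). (d, b, f, a, e, c)" "\<lambda>(a, b, c, d, e, f). (d, b, f, a, e, c)"])
    (auto simp: graphs4_def mult_ac)

lemma gsum_swap14: "gsum x12 x13 x14 x23 x24 x34 n1 n2 n3 n4 = gsum x24 x34 x14 x23 x12 x13 n4 n2 n3 n1"
  unfolding gsum_def
  by (rule sum.reindex_bij_witness[of _ "\<lambda>(a, b, c, d, e, f). (e, f, c, d, a, b)" "\<lambda>(a, b, c, d, e, f). (e, f, c, d, a, b)"])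
    (auto simp: graphs4_def mult_ac)

text \<open>One of the \<open>a\<close> parallel edges 12 is marked and deleted:
  \<open>a * dpow x a = x * dpow x (a - 1)\<close>. The two variants below do the same for the edges
  13 and 14.\<close>

lemma gsum_edge12:
  "(\<Sum>k\<in>graphs4 (Suc n1) n2 n3 n4. real (fst k) * gweight x12 x13 x14 x23 x24 x34 k) =
    (if n2 = 0 then 0 else x12 * gsum x12 x13 x14 x23 x24 x34 n1 (n2 - 1) n3 n4)"
proof (cases n2)
  case 0
  then show ?thesis by (auto simp: graphs4_def intro!: sum.neutral)
next
  case (Suc m)
  have "(\<Sum>k\<in>graphs4 (Suc n1) n2 n3 n4. real (fst k) * gweight x12 x13 x14 x23 x24 x34 k) =
    (\<Sum>k\<in>{k\<in>graphs4 (Suc n1) n2 n3 n4. fst k \<noteq> 0}. real (fst k) * gweight x12 x13 x14 x23 x24 x34 k)"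
    by (rule sum.mono_neutral_right) (auto simp: finite_graphs4)
  also have "\<dots> = (\<Sum>k\<in>graphs4 n1 m n3 n4. x12 * gweight x12 x13 x14 x23 x24 x34 k)"
    by (rule sum.reindex_bij_witness[of _ "\<lambda>(a, b). (Suc a, b)" "\<lambda>(a, b). (a - 1, b)"])
      (auto simp: graphs4_def Suc gr0_conv_Suc dpow_Suc simp del: of_nat_Suc)
  finally show ?thesis by (simp add: gsum_def Suc sum_distrib_left)
qed

lemma gsum_edge13:
  "(\<Sum>k\<in>graphs4 (Suc n1) n2 n3 n4. real (fst (snd k)) * gweight x12 x13 x14 x23 x24 x34 k) =
    (if n3 = 0 then 0 else x13 * gsum x12 x13 x14 x23 x24 x34 n1 n2 (n3 - 1) n4)"
proof (cases n3)
  case 0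
  then show ?thesis by (auto simp: graphs4_def intro!: sum.neutral)
next
  case (Suc m)
  have "(\<Sum>k\<in>graphs4 (Suc n1) n2 n3 n4. real (fst (snd k)) * gweight x12 x13 x14 x23 x24 x34 k) =
    (\<Sum>k\<in>{k\<in>graphs4 (Suc n1) n2 n3 n4. fst (snd k) \<noteq> 0}. real (fst (snd k)) * gweight x12 x13 x14 x23 x24 x34 k)"
    by (rule sum.mono_neutral_right) (auto simp: finite_graphs4)
  also have "\<dots> = (\<Sum>k\<in>graphs4 n1 n2 m n4. x13 * gweight x12 x13 x14 x23 x24 x34 k)"
    by (rule sum.reindex_bij_witness[of _ "\<lambda>(a, b, c). (a, Suc b, c)" "\<lambda>(a, b, c). (a, b - 1, c)"])
      (auto simp: graphs4_def Suc gr0_conv_Suc dpow_Suc simp del: of_nat_Suc)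
  finally show ?thesis by (simp add: gsum_def Suc sum_distrib_left)
qed

lemma gsum_edge14:
  "(\<Sum>k\<in>graphs4 (Suc n1) n2 n3 n4. real (fst (snd (snd k))) * gweight x12 x13 x14 x23 x24 x34 k) =
    (if n4 = 0 then 0 else x14 * gsum x12 x13 x14 x23 x24 x34 n1 n2 n3 (n4 - 1))"
proof (cases n4)
  case 0
  then show ?thesis by (auto simp: graphs4_def intro!: sum.neutral)
next
  case (Suc m)
  have "(\<Sum>k\<in>graphs4 (Suc n1) n2 n3 n4. real (fst (snd (snd k))) * gweight x12 x13 x14 x23 x24 x34 k) =
    (\<Sum>k\<in>{k\<in>graphs4 (Suc n1) n2 n3 n4. fst (snd (snd k)) \<noteq> 0}. real (fst (snd (snd k))) * gweight x12 x13 x14 x23 x24 x34 k)"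
    by (rule sum.mono_neutral_right) (auto simp: finite_graphs4)
  also have "\<dots> = (\<Sum>k\<in>graphs4 n1 n2 n3 m. x14 * gweight x12 x13 x14 x23 x24 x34 k)"
    by (rule sum.reindex_bij_witness[of _ "\<lambda>(a, b, c, d). (a, b, Suc c, d)" "\<lambda>(a, b, c, d). (a, b, c - 1, d)"])
      (auto simp: graphs4_def Suc gr0_conv_Suc dpow_Suc simp del: of_nat_Suc)
  finally show ?thesis by (simp add: gsum_def Suc sum_distrib_left)
qed

text \<open>The first vertex has degree \<open>n1 + 1\<close>, so the left side counts every graph
  once for each edge end there; sorting by the marked edge gives the three terms.\<close>

lemma gsum_Suc:
  "real (Suc n1) * gsum x12 x13 x14 x23 x24 x34 (Suc n1) n2 n3 n4 =
    (if n2 = 0 then 0 else x12 * gsum x12 x13 x14 x23 x24 x34 n1 (n2 - 1) n3 n4) +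
    (if n3 = 0 then 0 else x13 * gsum x12 x13 x14 x23 x24 x34 n1 n2 (n3 - 1) n4) +
    (if n4 = 0 then 0 else x14 * gsum x12 x13 x14 x23 x24 x34 n1 n2 n3 (n4 - 1))"
proof -
  have "real (Suc n1) * gsum x12 x13 x14 x23 x24 x34 (Suc n1) n2 n3 n4 =
    (\<Sum>k\<in>graphs4 (Suc n1) n2 n3 n4. real (fst k) * gweight x12 x13 x14 x23 x24 x34 k
      + real (fst (snd k)) * gweight x12 x13 x14 x23 x24 x34 k + real (fst (snd (snd k))) * gweight x12 x13 x14 x23 x24 x34 k)"
    unfolding gsum_def sum_distrib_left
  proof (rule sum.cong[OF refl])
    fix k assume "k \<in> graphs4 (Suc n1) n2 n3 n4"
    then have "real (Suc n1) = real (fst k) + real (fst (snd k)) + real (fst (snd (snd k)))"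
      by (auto simp: graphs4_def simp del: of_nat_Suc simp flip: of_nat_add)
    then show "real (Suc n1) * gweight x12 x13 x14 x23 x24 x34 k = real (fst k) * gweight x12 x13 x14 x23 x24 x34 k
      + real (fst (snd k)) * gweight x12 x13 x14 x23 x24 x34 k + real (fst (snd (snd k))) * gweight x12 x13 x14 x23 x24 x34 k"
      by (simp only: distrib_right)
  qed
  then show ?thesis by (simp only: sum.distrib gsum_edge12 gsum_edge13 gsum_edge14)
qed

context isotropic_field
begin

definition hmoment4 where
  "hmoment4 g1 g2 g3 g4 n1 n2 n3 n4 = expectation (\<lambda>\<omega>. poly (hermite_poly n1) (T g1 \<omega>) * poly (hermite_poly n2) (T g2 \<omega>) *
     poly (hermite_poly n3) (T g3 \<omega>) * poly (hermite_poly n4) (T g4 \<omega>))"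

lemma ibp_poly_prod: "ibp (poly_prod T K) (\<lambda>h \<omega>. D_prod cov T K h \<omega>)"
proof -
  have app: "poly_prod T (K @ L) \<omega> = poly_prod T K \<omega> * poly_prod T L \<omega>" for K L \<omega> by (induction K) (simp_all add: mult_ac)
  have dapp: "D_prod cov T (K @ L) h \<omega> = D_prod cov T K h \<omega> * poly_prod T L \<omega> + poly_prod T K \<omega> * D_prod cov T L h \<omega>" for K L h \<omega>
    by (induction K) (simp_all add: app algebra_simps)
  have pr: "fmom (\<mu> \<Otimes>\<^sub>M P) (\<lambda>p. D_prod cov T K (fst p) (snd p))"
  proof (induction K)
    case (Cons a K)
    have 1: "fmom \<mu> (\<lambda>h. cov h g)" for g unfolding cov_eq_r
      by (intro weight_fmom weight_continuous continuous_compose[OF continuous_r] continuous_diff continuous_on_const continuous_on_id)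
    show ?case unfolding D_prod.simps
      by (intro fmom_add fmom_mult PP.fmom_fst[OF 1] PP.fmom_snd[of "\<lambda>\<omega>. poly _ (T _ \<omega>)"] PP.fmom_snd[of "poly_prod T K"] Cons poly_prod_fmom fmom_poly T_fmom)
  qed (simp add: PP.P.fmom_const)
  show ?thesis unfolding ibp_def
  proof (intro conjI allI)
    fix L h
    show "expectation (\<lambda>\<omega>. T h \<omega> * poly_prod T K \<omega> * poly_prod T L \<omega>) =
      expectation (\<lambda>\<omega>. D_prod cov T K h \<omega> * poly_prod T L \<omega> + poly_prod T K \<omega> * D_prod cov T L h \<omega>)"
      using gaussian_ibp[of h "K @ L"] unfolding ext[OF dapp] by (simp add: app mult.assoc)
  qed (auto intro: poly_prod_fmom D_prod_fmom pr)
qed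

lemma pderiv_hermite: "pderiv (hermite_poly n) = smult (real n) (hermite_poly (n - 1))"
  by (cases n) (simp_all add: pderiv_hermite_poly del: hermite_poly.simps(2))

lemma hmoment4_Suc:
  "hmoment4 g1 g2 g3 g4 (Suc n1) n2 n3 n4 =
     real n2 * r (g1 - g2) * hmoment4 g1 g2 g3 g4 n1 (n2 - 1) n3 n4 +
     real n3 * r (g1 - g3) * hmoment4 g1 g2 g3 g4 n1 n2 (n3 - 1) n4 +
     real n4 * r (g1 - g4) * hmoment4 g1 g2 g3 g4 n1 n2 n3 (n4 - 1)"
proof -
  let ?H = "\<lambda>n g \<omega>. poly (hermite_poly n) (T g \<omega>)"
  have "hmoment4 g1 g2 g3 g4 (Suc n1) n2 n3 n4 =
    expectation (\<lambda>\<omega>. ?H (Suc n1) g1 \<omega> * poly_prod T [(hermite_poly n2, g2), (hermite_poly n3, g3), (hermite_poly n4, g4)] \<omega>)"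
    by (simp add: hmoment4_def mult.assoc del: hermite_poly.simps)
  also have "\<dots> = expectation (\<lambda>\<omega>. ?H n1 g1 \<omega> * D_prod cov T [(hermite_poly n2, g2), (hermite_poly n3, g3), (hermite_poly n4, g4)] g1 \<omega>)"
    by (rule hermite_ibp[OF ibp_poly_prod])
  also have "\<dots> = expectation (\<lambda>\<omega>. real n2 * r (g1 - g2) * (?H n1 g1 \<omega> * ?H (n2 - 1) g2 \<omega> * ?H n3 g3 \<omega> * ?H n4 g4 \<omega>) +
      real n3 * r (g1 - g3) * (?H n1 g1 \<omega> * ?H n2 g2 \<omega> * ?H (n3 - 1) g3 \<omega> * ?H n4 g4 \<omega>) +
      real n4 * r (g1 - g4) * (?H n1 g1 \<omega> * ?H n2 g2 \<omega> * ?H n3 g3 \<omega> * ?H (n4 - 1) g4 \<omega>))"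
    by (rule arg_cong[where f = expectation]) (simp add: fun_eq_iff pderiv_hermite cov_eq_r algebra_simps)
  also have "\<dots> = real n2 * r (g1 - g2) * hmoment4 g1 g2 g3 g4 n1 (n2 - 1) n3 n4 +
     real n3 * r (g1 - g3) * hmoment4 g1 g2 g3 g4 n1 n2 (n3 - 1) n4 +
     real n4 * r (g1 - g4) * hmoment4 g1 g2 g3 g4 n1 n2 n3 (n4 - 1)"
    unfolding hmoment4_def
    by (simp add: fmom_integrable fmom_intros T_fmom del: hermite_poly.simps)
  finally show ?thesis .
qed

lemma hmoment4_swap12: "hmoment4 g1 g2 g3 g4 n1 n2 n3 n4 = hmoment4 g2 g1 g3 g4 n2 n1 n3 n4"
  and hmoment4_swap13: "hmoment4 g1 g2 g3 g4 n1 n2 n3 n4 = hmoment4 g3 g2 g1 g4 n3 n2 n1 n4"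
  and hmoment4_swap14: "hmoment4 g1 g2 g3 g4 n1 n2 n3 n4 = hmoment4 g4 g2 g3 g1 n4 n2 n3 n1"
  by (simp_all add: hmoment4_def mult_ac)

lemma r_diff_commute: "r (g - h) = r (h - g)"
  using r_minus[of "g - h"] by simp

text \<open>Both sides obey the recursion that lowers the first vertex, \<open>hmoment4_Suc\<close>
  and \<open>gsum_Suc\<close>; relabelling brings a vertex of positive degree to the front.
  Integration by parts never pairs a Hermite polynomial with itself, hence the graphs have no
  loops.\<close>

theorem hmoment4_eq:
  "hmoment4 g1 g2 g3 g4 n1 n2 n3 n4 = fact n1 * fact n2 * fact n3 * fact n4 *
     gsum (r (g1 - g2)) (r (g1 - g3)) (r (g1 - g4)) (r (g2 - g3)) (r (g2 - g4)) (r (g3 - g4)) n1 n2 n3 n4"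
proof (induction "n1 + n2 + n3 + n4" arbitrary: g1 g2 g3 g4 n1 n2 n3 n4 rule: less_induct)
  case less
  let ?S = "\<lambda>g1 g2 g3 g4. gsum (r (g1 - g2)) (r (g1 - g3)) (r (g1 - g4)) (r (g2 - g3)) (r (g2 - g4)) (r (g3 - g4))"
  have main: "hmoment4 g1 g2 g3 g4 k1 k2 k3 k4 = fact k1 * fact k2 * fact k3 * fact k4 * ?S g1 g2 g3 g4 k1 k2 k3 k4"
    if k: "k1 \<noteq> 0" "k1 + k2 + k3 + k4 = n1 + n2 + n3 + n4" for g1 g2 g3 g4 k1 k2 k3 k4
  proof -
    obtain j where j: "k1 = Suc j" using k(1) by (cases k1) auto
    let ?f = "(fact j * fact k2 * fact k3 * fact k4 :: real)"
    have t2: "real k2 * r (g1 - g2) * hmoment4 g1 g2 g3 g4 j (k2 - 1) k3 k4 =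
      ?f * (if k2 = 0 then 0 else r (g1 - g2) * ?S g1 g2 g3 g4 j (k2 - 1) k3 k4)"
      by (cases k2) (use k j in \<open>simp_all add: less\<close>)
    have t3: "real k3 * r (g1 - g3) * hmoment4 g1 g2 g3 g4 j k2 (k3 - 1) k4 =
      ?f * (if k3 = 0 then 0 else r (g1 - g3) * ?S g1 g2 g3 g4 j k2 (k3 - 1) k4)"
      by (cases k3) (use k j in \<open>simp_all add: less\<close>)
    have t4: "real k4 * r (g1 - g4) * hmoment4 g1 g2 g3 g4 j k2 k3 (k4 - 1) =
      ?f * (if k4 = 0 then 0 else r (g1 - g4) * ?S g1 g2 g3 g4 j k2 k3 (k4 - 1))"
      by (cases k4) (use k j in \<open>simp_all add: less\<close>)
    have "hmoment4 g1 g2 g3 g4 k1 k2 k3 k4 = ?f * (real (Suc j) * ?S g1 g2 g3 g4 (Suc j) k2 k3 k4)"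
      unfolding j hmoment4_Suc t2 t3 t4 gsum_Suc distrib_left ..
    then show ?thesis by (simp add: j)
  qed
  consider "n1 \<noteq> 0" | "n1 = 0" "n2 \<noteq> 0" | "n1 = 0" "n2 = 0" "n3 \<noteq> 0" | "n1 = 0" "n2 = 0" "n3 = 0" "n4 \<noteq> 0"
    | "n1 = 0" "n2 = 0" "n3 = 0" "n4 = 0" by blast
  then show ?case
  proof cases
    case 1
    then show ?thesis by (rule main) simp
  next
    case 2
    have "hmoment4 g2 g1 g3 g4 n2 n1 n3 n4 = fact n2 * fact n1 * fact n3 * fact n4 * ?S g2 g1 g3 g4 n2 n1 n3 n4"
      by (rule main) (use 2 in auto)
    then show ?thesis
      by (subst hmoment4_swap12, subst gsum_swap12) (simp add: r_diff_commute[of g2 g1])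
  next
    case 3
    have "hmoment4 g3 g2 g1 g4 n3 n2 n1 n4 = fact n3 * fact n2 * fact n1 * fact n4 * ?S g3 g2 g1 g4 n3 n2 n1 n4"
      by (rule main) (use 3 in auto)
    then show ?thesis
      by (subst hmoment4_swap13, subst gsum_swap13) (simp add: r_diff_commute[of g3 g2] r_diff_commute[of g3 g1] r_diff_commute[of g2 g1])
  next
    case 4
    have "hmoment4 g4 g2 g3 g1 n4 n2 n3 n1 = fact n4 * fact n2 * fact n3 * fact n1 * ?S g4 g2 g3 g1 n4 n2 n3 n1"
      by (rule main) (use 4 in auto)
    then show ?thesis
      by (subst hmoment4_swap14, subst gsum_swap14)
        (simp add: r_diff_commute[of g4 g2] r_diff_commute[of g4 g3] r_diff_commute[of g4 g1] r_diff_commute[of g2 g1] r_diff_commute[of g3 g1])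
  next
    case 5
    have "graphs4 0 0 0 0 = {(0, 0, 0, 0, 0, 0)}" by (auto simp: graphs4_def)
    then show ?thesis by (simp add: 5 hmoment4_def gsum_def prob_space)
  qed
qed

end

section \<open>Spectral decomposition of the covariance\<close>

text \<open>Joint measurability is the issue, as the discrete set of values may be uncountable. The
  support of \<open>p\<close> is countable, so \<open>p\<close> is transported to the natural
  numbers, where measurable sections suffice.\<close>

lemma pmf_Fubini:
  fixes p :: "'a pmf" and \<phi> :: "'a \<Rightarrow> 'b \<Rightarrow> 'c::{banach, second_countable_topology}"
  assumes M: "sigma_finite_measure M"
    and int: "\<And>x. x \<in> set_pmf p \<Longrightarrow> integrable M (\<phi> x)"
    and bound: "\<And>x. x \<in> set_pmf p \<Longrightarrow> (\<integral>y. norm (\<phi> x y) \<partial>M) \<le> B"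
  shows "AE y in M. integrable p (\<lambda>x. \<phi> x y)"
    and "integrable M (\<lambda>y. measure_pmf.expectation p (\<lambda>x. \<phi> x y))"
    and "(\<integral>y. measure_pmf.expectation p (\<lambda>x. \<phi> x y) \<partial>M) = measure_pmf.expectation p (\<lambda>x. \<integral>y. \<phi> x y \<partial>M)"
    and "integrable p (\<lambda>x. \<integral>y. \<phi> x y \<partial>M)"
proof -
  define f where "f = to_nat_on (set_pmf p)"
  define h where "h = from_nat_into (set_pmf p)"
  define q where "q = map_pmf f p"
  have hf: "h (f x) = x" if "x \<in> set_pmf p" for x
    using that unfolding h_def f_def by (intro from_nat_into_to_nat_on countable_set_pmf)
  have p: "p = map_pmf h q"
    unfolding q_def map_pmf_comp by (rule map_pmf_idI[symmetric]) (simp add: hf)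
  have hp: "h n \<in> set_pmf p" for n
    unfolding h_def by (rule from_nat_into) (simp add: set_pmf_not_empty)
  interpret M: sigma_finite_measure M by fact
  interpret Q: pair_sigma_finite "measure_pmf q" M
    by unfold_locales
  have meas: "(\<lambda>(n, y). \<phi> (h n) y) \<in> borel_measurable (measure_pmf q \<Otimes>\<^sub>M M)"
  proof -
    have "(\<lambda>(n, y). \<phi> (h n) y) \<in> borel_measurable (count_space UNIV \<Otimes>\<^sub>M M)"
      by (rule measurable_pair_measure_countable1) (auto intro: borel_measurable_integrable int hp)
    moreover have "sets (measure_pmf q \<Otimes>\<^sub>M M) = sets (count_space UNIV \<Otimes>\<^sub>M M)"
      by (rule sets_pair_measure_cong) auto
    ultimately show ?thesis using measurable_cong_sets by blast
  qed
  have I: "integrable (measure_pmf q \<Otimes>\<^sub>M M) (\<lambda>(n, y). \<phi> (h n) y)"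
  proof (rule Q.Fubini_integrable[OF meas])
    show "integrable (measure_pmf q) (\<lambda>n. \<integral>y. norm (case (n, y) of (n, y) \<Rightarrow> \<phi> (h n) y) \<partial>M)"
      by (rule measure_pmf.integrable_const_bound[where B = B]) (auto intro!: AE_I2 bound hp)
  qed (auto intro!: int hp AE_I2)
  show "AE y in M. integrable p (\<lambda>x. \<phi> x y)"
    using Q.AE_integrable_snd[OF I] unfolding p by simp
  show "integrable M (\<lambda>y. measure_pmf.expectation p (\<lambda>x. \<phi> x y))"
    using Q.integrable_snd[OF I] unfolding p by simp
  show "(\<integral>y. measure_pmf.expectation p (\<lambda>x. \<phi> x y) \<partial>M) = measure_pmf.expectation p (\<lambda>x. \<integral>y. \<phi> x y \<partial>M)"
    using Q.Fubini_integral[OF I] unfolding p by simp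
  show "integrable p (\<lambda>x. \<integral>y. \<phi> x y \<partial>M)"
    using Q.integrable_fst[OF I] unfolding p by simp
qed

lemma pmf_integrable_bounded:
  fixes f :: "'a \<Rightarrow> 'b::{banach, second_countable_topology}"
  assumes "\<And>x. x \<in> set_pmf p \<Longrightarrow> norm (f x) \<le> B"
  shows "integrable (measure_pmf p) f"
  by (rule measure_pmf.integrable_const_bound[where B = B]) (auto simp: AE_measure_pmf_iff assms)

lemma expectation_bind_pmf:
  fixes f :: "'b \<Rightarrow> complex"
  assumes "\<And>y. norm (f y) \<le> B"
  shows "measure_pmf.expectation (bind_pmf p k) f = measure_pmf.expectation p (\<lambda>x. measure_pmf.expectation (k x) f)"
proof -
  have real: "measure_pmf.expectation (bind_pmf p k) g = measure_pmf.expectation p (\<lambda>x. measure_pmf.expectation (k x) g)"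
    if "\<And>y. \<bar>g y\<bar> \<le> B" for g :: "'b \<Rightarrow> real"
    unfolding measure_pmf_bind
    by (rule integral_bind[where K = "count_space UNIV" and B = B and B' = 1])
      (use that measurable_space[OF measurable_measure_pmf[of k]] in \<open>auto simp: measure_pmf.finite_measure_axioms measure_pmf.emeasure_space_1\<close>)
  have b: "norm (Re (f y)) \<le> B" "norm (Im (f y)) \<le> B" for y
    using assms[of y] abs_Re_le_cmod[of "f y"] abs_Im_le_cmod[of "f y"] by auto
  have i: "integrable (measure_pmf q) f" for q by (rule pmf_integrable_bounded[OF assms])
  have iE: "integrable (measure_pmf p) (\<lambda>x. measure_pmf.expectation (k x) f)"
  proof (rule pmf_integrable_bounded[where B = B])
    fix x
    have "norm (measure_pmf.expectation (k x) f) \<le> measure_pmf.expectation (k x) (\<lambda>y. norm (f y))" by (rule integral_norm_bound)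
    also have "\<dots> \<le> measure_pmf.expectation (k x) (\<lambda>y. B)"
      by (intro integral_mono assms integrable_norm i) simp
    finally show "norm (measure_pmf.expectation (k x) f) \<le> B" by simp
  qed
  have re: "Re (measure_pmf.expectation q f) = measure_pmf.expectation q (\<lambda>y. Re (f y))"
    and im: "Im (measure_pmf.expectation q f) = measure_pmf.expectation q (\<lambda>y. Im (f y))" for q
    using i by (simp_all add: integral_Re integral_Im)
  show ?thesis
    using real[OF b(1)[unfolded real_norm_def]] real[OF b(2)[unfolded real_norm_def]] iE
    by (simp add: complex_eq_iff re im integral_Re[OF iE, symmetric] integral_Im[OF iE, symmetric])
qed

lemma expectation_bind_pmf_real:
  fixes f :: "'b \<Rightarrow> real"
  assumes "\<And>y. \<bar>f y\<bar> \<le> B"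
  shows "measure_pmf.expectation (bind_pmf p k) f = measure_pmf.expectation p (\<lambda>x. measure_pmf.expectation (k x) f)"
  unfolding measure_pmf_bind
  by (rule integral_bind[where K = "count_space UNIV" and B = B and B' = 1])
    (use assms measurable_space[OF measurable_measure_pmf[of k]] in \<open>auto simp: measure_pmf.finite_measure_axioms measure_pmf.emeasure_space_1\<close>)

section \<open>The group of characters\<close>

definition char_one :: "'g \<Rightarrow> complex" where "char_one = (\<lambda>_. 1)"

lemma char_mult_assoc: "char_mult (char_mult a b) c = char_mult a (char_mult b c)"
  by (simp add: char_mult_def mult.assoc)

lemma char_mult_commute: "char_mult a b = char_mult b a"
  by (simp add: char_mult_def mult.commute)

lemma char_mult_left_commute: "char_mult a (char_mult b c) = char_mult b (char_mult a c)"
  by (simp add: char_mult_def mult.left_commute)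

lemmas char_mult_ac = char_mult_assoc char_mult_commute char_mult_left_commute

lemma char_mult_one[simp]: "char_mult char_one a = a" "char_mult a char_one = a"
  by (simp_all add: char_mult_def char_one_def)

lemma char_inv_inv[simp]: "char_inv (char_inv a) = a"
  by (simp add: char_inv_def)

lemma char_inv_one[simp]: "char_inv char_one = char_one"
  by (simp add: char_inv_def char_one_def)

lemma char_inv_mult: "char_inv (char_mult a b) = char_mult (char_inv a) (char_inv b)"
  by (simp add: char_inv_def char_mult_def)

context
  fixes a :: "'g::{ab_group_add, topological_space} \<Rightarrow> complex"
  assumes a: "a \<in> dual"
begin

lemma dual_continuous: "continuous_on UNIV a" and dual_add: "a (x + y) = a x * a y" and dual_norm: "cmod (a x) = 1"
  using a by (auto simp: dual_def is_character_def)

lemma dual_0: "a 0 = 1"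
proof -
  have "a 0 * a 0 = a 0" using dual_add[of 0 0] by simp
  moreover have "a 0 \<noteq> 0" using dual_norm[of 0] by auto
  ultimately show ?thesis by simp
qed

lemma dual_cnj_mult: "cnj (a x) * a x = 1" "a x * cnj (a x) = 1"
  using complex_norm_square[of "a x"] dual_norm[of x] by (simp_all add: mult.commute)

lemma dual_minus: "a (- x) = cnj (a x)"
proof -
  have "a x * a (- x) = 1" using dual_add[of x "- x"] dual_0 by simp
  then have "cnj (a x) * (a x * a (- x)) = cnj (a x)" by simp
  then show ?thesis using dual_cnj_mult(1)[of x] by (simp add: mult.assoc[symmetric])
qed

lemma dual_diff: "a (x - y) = a x * cnj (a y)"
  using dual_add[of x "- y"] dual_minus by simp

lemma char_inv_dual: "char_inv a \<in> dual"
  using a by (auto simp: dual_def is_character_def char_inv_def intro!: continuous_intros)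

lemma char_inv_right: "char_mult a (char_inv a) = char_one" and char_inv_left: "char_mult (char_inv a) a = char_one"
  by (simp_all add: char_mult_def char_inv_def char_one_def dual_cnj_mult)

end

lemma char_mult_dual: "a \<in> dual \<Longrightarrow> b \<in> dual \<Longrightarrow> char_mult a b \<in> dual"
  by (auto simp: dual_def is_character_def char_mult_def norm_mult intro!: continuous_intros)

lemma char_one_dual: "char_one \<in> dual"
  by (simp add: dual_def is_character_def char_one_def)

lemma char_mult_eq_iff:
  assumes "a \<in> dual" shows "char_mult a x = y \<longleftrightarrow> x = char_mult (char_inv a) y"
  using char_inv_right[OF assms] char_inv_left[OF assms] by (metis char_mult_assoc char_mult_one(1))

lemma (in compact_ab_group) char_integral:
  assumes "a \<in> dual"
  shows "(\<integral>x. a x \<partial>\<mu>) = (if a = char_one then 1 else 0)"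
proof (cases "a = char_one")
  case False
  then obtain h where h: "a h \<noteq> 1" by (auto simp: char_one_def fun_eq_iff)
  have "(\<integral>x. a x \<partial>\<mu>) = (\<integral>x. a (h + x) \<partial>\<mu>)"
    by (rule integral_translate[OF measurable_continuous[OF dual_continuous[OF assms]], symmetric])
  also have "\<dots> = a h * (\<integral>x. a x \<partial>\<mu>)" by (simp add: dual_add[OF assms])
  finally show ?thesis using h False by simp
qed (simp add: char_one_def)

lemma (in compact_ab_group) char_convolution:
  assumes u: "continuous_on UNIV u" and a: "a \<in> dual"
  shows "(\<integral>h. u (g - h) * a h \<partial>\<mu>) = (\<integral>x. u x * cnj (a x) \<partial>\<mu>) * a g"
proof -
  note ca = dual_continuous[OF a]
  have "(\<integral>h. u (g - h) * a h \<partial>\<mu>) = conv a u g"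
    using fun_cong[OF conv_commute[OF u ca], of g] by (simp add: conv_def)
  also have "\<dots> = (\<integral>x. a g * (u x * cnj (a x)) \<partial>\<mu>)"
    by (simp add: conv_def dual_diff[OF a] mult_ac)
  finally show ?thesis by (simp add: mult.commute)
qed

section \<open>Fourier coefficients of the powers of the covariance\<close>

context isotropic_field
begin

lemma hmoment2: "expectation (\<lambda>\<omega>. poly (hermite_poly m) (T g \<omega>) * poly (hermite_poly m) (T h \<omega>)) = fact m * r (g - h) ^ m"
proof -
  have "graphs4 m m 0 0 = {(m, 0, 0, 0, 0, 0)}" by (auto simp: graphs4_def)
  then show ?thesis using hmoment4_eq[of g h 0 0 m m 0 0]
    by (simp add: hmoment4_def gsum_def dpow_def)
qed

lemma hint_two_point:
  assumes "weight v" "weight w"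
  shows "expectation (\<lambda>\<omega>. hint m v \<omega> * hint m w \<omega> :: complex) =
    fact m * (\<integral>g. v g * (\<integral>h. of_real (r (g - h) ^ m) * w h \<partial>\<mu>) \<partial>\<mu>)"
proof -
  let ?q = "hermite_poly m"
  have o: "fmom P (\<lambda>\<omega>. of_real (poly ?q (T g \<omega>)) :: complex)" for g by (intro fmom_of_real fmom_poly T_fmom)
  have 1: "expectation (\<lambda>\<omega>. of_real (poly ?q (T g \<omega>)) * gint ?q w \<omega> :: complex) = (\<integral>h. of_real (fact m * r (g - h) ^ m) * w h \<partial>\<mu>)" for g
  proof -
    have "expectation (\<lambda>\<omega>. gint ?q w \<omega> * of_real (poly ?q (T g \<omega>)) :: complex) =
      (\<integral>h. w h * expectation (\<lambda>\<omega>. of_real (poly ?q (T g \<omega>) * poly ?q (T h \<omega>))) \<partial>\<mu>)"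
      using gint_mult[OF assms(2) o[of g], of ?q] by (simp add: mult.commute)
    also have "\<dots> = (\<integral>h. of_real (fact m * r (g - h) ^ m) * w h \<partial>\<mu>)"
      unfolding integral_complex_of_real hmoment2 by (simp add: mult.commute)
    finally show ?thesis by (simp add: mult.commute)
  qed
  have "expectation (\<lambda>\<omega>. gint ?q v \<omega> * gint ?q w \<omega>) = (\<integral>g. v g * (\<integral>h. of_real (fact m * r (g - h) ^ m) * w h \<partial>\<mu>) \<partial>\<mu>)"
    using gint_mult[OF assms(1) gint_fmom[OF assms(2)], of ?q ?q] by (simp only: 1)
  also have "\<dots> = (\<integral>g. fact m * (v g * (\<integral>h. of_real (r (g - h) ^ m) * w h \<partial>\<mu>)) \<partial>\<mu>)"
    by (simp add: mult_ac)
  finally show ?thesis by (simp add: hint_def)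
qed

definition rhat :: "nat \<Rightarrow> ('g \<Rightarrow> complex) \<Rightarrow> complex" where
  "rhat m a = (\<integral>x. of_real (r x ^ m) * cnj (a x) \<partial>\<mu>)"

lemma weight_char: "a \<in> dual \<Longrightarrow> weight a"
  by (rule weight_continuous) (rule dual_continuous)

lemma weight_char_inv: "a \<in> dual \<Longrightarrow> weight (char_inv a)"
  by (intro weight_char char_inv_dual)

lemma continuous_r_power: "continuous_on UNIV (\<lambda>x. complex_of_real (r x ^ m))"
  by (intro continuous_intros continuous_r)

lemma hint_char_moment:
  assumes a: "a \<in> dual" and b: "b \<in> dual"
  shows "expectation (\<lambda>\<omega>. hint m (char_inv a) \<omega> * hint m b \<omega>) = (if a = b then fact m * rhat m a else 0)"
proof -
  have "expectation (\<lambda>\<omega>. hint m (char_inv a) \<omega> * hint m b \<omega>) =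
    fact m * (\<integral>g. char_inv a g * (\<integral>h. of_real (r (g - h) ^ m) * b h \<partial>\<mu>) \<partial>\<mu>)"
    by (rule hint_two_point[OF weight_char_inv[OF a] weight_char[OF b]])
  also have "\<dots> = fact m * (\<integral>g. rhat m b * (char_mult (char_inv a) b) g \<partial>\<mu>)"
    unfolding char_convolution[OF continuous_r_power b] by (simp add: rhat_def char_mult_def mult_ac)
  also have "\<dots> = fact m * (rhat m b * (if char_mult (char_inv a) b = char_one then 1 else 0))"
    using char_integral[OF char_mult_dual[OF char_inv_dual[OF a] b]] by simp
  also have "char_mult (char_inv a) b = char_one \<longleftrightarrow> a = b"
    using char_mult_eq_iff[OF char_inv_dual[OF a], of b char_one] by auto
  finally show ?thesis by auto
qed

lemma hint_cnj: "hint m (\<lambda>g. cnj (w g)) \<omega> = cnj (hint m w \<omega>)"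
  using Bochner_Integration.integral_cnj[of \<mu> "\<lambda>g. of_real (poly (hermite_poly m) (T g \<omega>)) * w g"]
  by (simp add: hint_def gint_def del: Bochner_Integration.integral_cnj)

lemma hint_char_inv: "hint m (char_inv a) \<omega> = cnj (hint m a \<omega>)"
  using hint_cnj[of m a \<omega>] by (simp add: char_inv_def)

lemma hint_norm_moment:
  assumes a: "a \<in> dual"
  shows "of_real (expectation (\<lambda>\<omega>. (cmod (hint m (char_inv a) \<omega>))\<^sup>2)) = fact m * rhat m a"
proof -
  have "of_real (expectation (\<lambda>\<omega>. (cmod (hint m (char_inv a) \<omega>))\<^sup>2)) = expectation (\<lambda>\<omega>. hint m (char_inv a) \<omega> * hint m a \<omega>)"
    unfolding integral_complex_of_real[symmetric] complex_norm_square by (simp add: hint_char_inv)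
  then show ?thesis using hint_char_moment[OF a a] by simp
qed

definition C :: "('g \<Rightarrow> complex) \<Rightarrow> real" where "C = Cpow P \<mu> T"

lemma fcoef_eq: "a \<in> dual \<Longrightarrow> fcoef \<mu> T a \<omega> = hint 1 (char_inv a) \<omega>"
  by (simp add: fcoef_def hint_def gint_def dual_minus char_inv_def)

lemma hcoef_eq: "a \<in> dual \<Longrightarrow> hcoef \<mu> T m a \<omega> = hint m (char_inv a) \<omega>"
  by (simp add: hcoef_def hint_def gint_def dual_minus char_inv_def hermite_eq_poly)

lemma C_eq_rhat: "a \<in> dual \<Longrightarrow> complex_of_real (C a) = rhat 1 a"
  using hint_norm_moment[of a 1] by (simp add: C_def Cpow_def fcoef_eq)

lemma C_nonneg: "C a \<ge> 0"
  by (simp add: C_def Cpow_def)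

text \<open>The second moment of \<open>T 0\<close> minus the finite sum of its Fourier coefficients
  is nonnegative, and orthogonality evaluates it as \<open>1 - sum C S\<close>.\<close>

lemma Bessel:
  assumes S: "finite S" "S \<subseteq> dual"
  shows "sum C S \<le> 1"
proof -
  define Y where "Y \<omega> = of_real (T 0 \<omega>) - (\<Sum>a\<in>S. hint 1 (char_inv a) \<omega>)" for \<omega>
  have fh: "fmom P (\<lambda>\<omega>. hint 1 a \<omega> :: complex)" if "a \<in> dual" for a
    unfolding hint_def by (intro gint_fmom weight_char that)
  have fi: "fmom P (\<lambda>\<omega>. hint 1 (char_inv a) \<omega> :: complex)" if "a \<in> dual" for a
    by (intro fh char_inv_dual that)
  have fT: "fmom P (\<lambda>\<omega>. of_real (T 0 \<omega>) :: complex)" by (intro fmom_of_real T_fmom)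
  have cross: "expectation (\<lambda>\<omega>. of_real (T 0 \<omega>) * hint 1 a \<omega>) = of_real (C a)" if a: "a \<in> dual" for a
  proof -
    have "expectation (\<lambda>\<omega>. hint 1 a \<omega> * of_real (T 0 \<omega>)) = (\<integral>h. a h * expectation (\<lambda>\<omega>. of_real (poly (hermite_poly 1) (T h \<omega>)) * of_real (T 0 \<omega>)) \<partial>\<mu>)"
      unfolding hint_def by (rule gint_mult[OF weight_char[OF a] fT])
    also have "\<dots> = (\<integral>h. a h * of_real (expectation (\<lambda>\<omega>. T h \<omega> * T 0 \<omega>)) \<partial>\<mu>)"
      unfolding integral_complex_of_real[symmetric] by simp
    also have "\<dots> = (\<integral>h. of_real (r (0 - h) ^ 1) * a h \<partial>\<mu>)"
      using r_minus by (simp add: r_def cov_def mult.commute)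
    also have "\<dots> = rhat 1 a" unfolding char_convolution[OF continuous_r_power a] by (simp add: rhat_def dual_0[OF a])
    finally show ?thesis using C_eq_rhat[OF a] by (simp add: mult.commute)
  qed
  have cross': "expectation (\<lambda>\<omega>. of_real (T 0 \<omega>) * hint 1 (char_inv a) \<omega>) = of_real (C a)" if a: "a \<in> dual" for a
  proof -
    have "expectation (\<lambda>\<omega>. of_real (T 0 \<omega>) * hint 1 (char_inv a) \<omega>) = cnj (expectation (\<lambda>\<omega>. of_real (T 0 \<omega>) * hint 1 a \<omega>))"
      unfolding hint_char_inv using Bochner_Integration.integral_cnj[of P "\<lambda>\<omega>. of_real (T 0 \<omega>) * hint 1 a \<omega>"]
      by (simp del: Bochner_Integration.integral_cnj)
    then show ?thesis unfolding cross[OF a] complex_cnj_complex_of_real .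
  qed
  have pos: "0 \<le> expectation (\<lambda>\<omega>. (cmod (Y \<omega>))\<^sup>2)" by simp
  have "complex_of_real (expectation (\<lambda>\<omega>. (cmod (Y \<omega>))\<^sup>2)) = expectation (\<lambda>\<omega>. Y \<omega> * cnj (Y \<omega>))"
    unfolding integral_complex_of_real[symmetric] complex_norm_square ..
  also have "\<dots> = expectation (\<lambda>\<omega>. of_real (T 0 \<omega>) * of_real (T 0 \<omega>) - (\<Sum>a\<in>S. of_real (T 0 \<omega>) * hint 1 a \<omega>)
     - (\<Sum>a\<in>S. of_real (T 0 \<omega>) * hint 1 (char_inv a) \<omega>) + (\<Sum>a\<in>S. \<Sum>b\<in>S. hint 1 (char_inv a) \<omega> * hint 1 b \<omega>))"
    by (rule arg_cong[where f = "integral\<^sup>L P"])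
      (simp add: fun_eq_iff Y_def hint_char_inv sum_distrib_left sum_distrib_right sum_product algebra_simps sum_negf)
  also have "\<dots> = expectation (\<lambda>\<omega>. of_real (T 0 \<omega>) * of_real (T 0 \<omega>)) - (\<Sum>a\<in>S. expectation (\<lambda>\<omega>. of_real (T 0 \<omega>) * hint 1 a \<omega>))
     - (\<Sum>a\<in>S. expectation (\<lambda>\<omega>. of_real (T 0 \<omega>) * hint 1 (char_inv a) \<omega>)) + (\<Sum>a\<in>S. \<Sum>b\<in>S. expectation (\<lambda>\<omega>. hint 1 (char_inv a) \<omega> * hint 1 b \<omega>))"
    using S by (simp add: fmom_integrable fmom_mult fmom_sum fh fi fT subset_iff del: One_nat_def)
  also have "\<dots> = of_real (expectation (\<lambda>\<omega>. T 0 \<omega> * T 0 \<omega>)) - (\<Sum>a\<in>S. of_real (C a)) - (\<Sum>a\<in>S. of_real (C a)) + (\<Sum>a\<in>S. \<Sum>b\<in>S. if a = b then of_real (C a) else 0)"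
  proof -
    have "(\<Sum>a\<in>S. \<Sum>b\<in>S. expectation (\<lambda>\<omega>. hint 1 (char_inv a) \<omega> * hint 1 b \<omega>)) = (\<Sum>a\<in>S. \<Sum>b\<in>S. if a = b then complex_of_real (C a) else 0)"
      using S by (intro sum.cong refl) (auto simp: hint_char_moment C_eq_rhat subset_iff)
    moreover have "expectation (\<lambda>\<omega>. complex_of_real (T 0 \<omega>) * of_real (T 0 \<omega>)) = of_real (expectation (\<lambda>\<omega>. T 0 \<omega> * T 0 \<omega>))"
      unfolding integral_complex_of_real[symmetric] by simp
    moreover have "(\<Sum>a\<in>S. expectation (\<lambda>\<omega>. of_real (T 0 \<omega>) * hint 1 a \<omega>)) = (\<Sum>a\<in>S. complex_of_real (C a))"
      by (intro sum.cong refl cross) (use S in auto)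
    moreover have "(\<Sum>a\<in>S. expectation (\<lambda>\<omega>. of_real (T 0 \<omega>) * hint 1 (char_inv a) \<omega>)) = (\<Sum>a\<in>S. complex_of_real (C a))"
      by (intro sum.cong refl cross') (use S in auto)
    ultimately show ?thesis by simp
  qed
  also have "\<dots> = of_real (1 - sum C S)"
    using S cov_self[of 0] by (simp add: cov_def)
  finally have "expectation (\<lambda>\<omega>. (cmod (Y \<omega>))\<^sup>2) = 1 - sum C S" by (simp only: of_real_eq_iff)
  with pos show ?thesis by simp
qed


lemma C_summable: "C summable_on dual"
  by (rule nonneg_bdd_above_summable_on[OF C_nonneg]) (auto intro!: bdd_aboveI[of _ 1] Bessel)

text \<open>The Fourier series that \<open>r\<close> should have. By Bessel's inequality it
  converges uniformly, so \<open>Q\<close> is continuous; the identification with \<open>r\<close>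
  is \<open>r_eq_Q\<close>.\<close>

definition Q :: "'g \<Rightarrow> complex" where "Q x = (\<Sum>\<^sub>\<infinity>a\<in>dual. of_real (C a) * a x)"

lemma Q_uniform: "uniform_limit UNIV (\<lambda>S x. \<Sum>a\<in>S. of_real (C a) * a x) Q (finite_subsets_at_top dual)"
  unfolding Q_def[abs_def]
  by (rule Weierstrass_m_test_general[OF _ C_summable]) (simp add: norm_mult C_nonneg dual_norm)

lemma eventually_finite_subset_dual:
  "\<forall>\<^sub>F S in finite_subsets_at_top dual. finite S \<and> S \<subseteq> dual"
  by (rule eventually_finite_subsets_at_top_weakI) auto

lemma continuous_Q: "continuous_on UNIV Q"
proof (rule uniform_limit_theorem[OF _ Q_uniform])
  show "\<forall>\<^sub>F S in finite_subsets_at_top dual. continuous_on UNIV (\<lambda>x. \<Sum>a\<in>S. complex_of_real (C a) * a x)"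
    using eventually_finite_subset_dual
    by eventually_elim (intro continuous_on_sum continuous_on_mult continuous_on_const dual_continuous, auto)
qed simp

text \<open>Uniform convergence permits integration term by term along the net of finite sets, and
  every finite set containing \<open>b\<close> already has the exact coefficient.\<close>

lemma Q_coefficient:
  assumes b: "b \<in> dual"
  shows "(\<integral>x. Q x * cnj (b x) \<partial>\<mu>) = of_real (C b)"
proof -
  note cb = dual_continuous[OF b]
  have cc: "continuous_on UNIV (\<lambda>x. cnj (b x))" by (intro continuous_intros cb)
  have lim: "((\<lambda>S. \<integral>x. (\<Sum>a\<in>S. of_real (C a) * a x) * cnj (b x) \<partial>\<mu>) \<longlongrightarrow> (\<integral>x. Q x * cnj (b x) \<partial>\<mu>)) (finite_subsets_at_top dual)"
  proof (rule tendstoI)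
    fix e :: real assume "e > 0"
    then have "\<forall>\<^sub>F S in finite_subsets_at_top dual. \<forall>x\<in>UNIV. dist (\<Sum>a\<in>S. of_real (C a) * a x) (Q x) < e / 2"
      using Q_uniform by (intro uniform_limitD) auto
    with eventually_finite_subset_dual
    show "\<forall>\<^sub>F S in finite_subsets_at_top dual. dist (\<integral>x. (\<Sum>a\<in>S. of_real (C a) * a x) * cnj (b x) \<partial>\<mu>) (\<integral>x. Q x * cnj (b x) \<partial>\<mu>) < e"
    proof eventually_elim
      case (elim S)
      let ?s = "\<lambda>x. \<Sum>a\<in>S. complex_of_real (C a) * a x"
      have cs: "continuous_on UNIV ?s" using elim by (intro continuous_on_sum continuous_on_mult continuous_on_const dual_continuous) auto
      have i: "integrable \<mu> (\<lambda>x. ?s x * cnj (b x))" "integrable \<mu> (\<lambda>x. Q x * cnj (b x))"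
        by (intro continuous_integrable continuous_on_mult cs cc continuous_Q)+
      have "norm ((\<integral>x. ?s x * cnj (b x) \<partial>\<mu>) - (\<integral>x. Q x * cnj (b x) \<partial>\<mu>)) = norm (\<integral>x. (?s x - Q x) * cnj (b x) \<partial>\<mu>)"
        using i by (simp add: left_diff_distrib)
      also have "\<dots> \<le> (\<integral>x. norm ((?s x - Q x) * cnj (b x)) \<partial>\<mu>)" by (rule integral_norm_bound)
      also have "\<dots> \<le> (\<integral>x. e / 2 \<partial>\<mu>)"
      proof (rule integral_mono)
        show "integrable \<mu> (\<lambda>x. norm ((?s x - Q x) * cnj (b x)))"
          by (intro integrable_norm continuous_integrable continuous_on_mult continuous_on_diff cs cc continuous_Q)
        show "norm ((?s x - Q x) * cnj (b x)) \<le> e / 2" for x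
          using elim(2) dual_norm[OF b, of x] by (auto simp: norm_mult dist_norm intro: less_imp_le)
      qed simp
      also have "\<dots> < e" using \<open>e > 0\<close> by simp
      finally show ?case by (simp add: dist_norm)
    qed
  qed
  have "\<forall>\<^sub>F S in finite_subsets_at_top dual. finite S \<and> {b} \<subseteq> S \<and> S \<subseteq> dual"
    using b by (auto simp: eventually_finite_subsets_at_top intro!: exI[of _ "{b}"])
  then have "\<forall>\<^sub>F S in finite_subsets_at_top dual. (\<integral>x. (\<Sum>a\<in>S. of_real (C a) * a x) * cnj (b x) \<partial>\<mu>) = of_real (C b)"
  proof eventually_elim
    case (elim S)
    have ci: "integrable \<mu> (\<lambda>x. complex_of_real (C a) * (a x * cnj (b x)))" if "a \<in> S" for a
      using elim that by (intro continuous_integrable continuous_on_mult continuous_on_const dual_continuous[of a] cc) auto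
    have "(\<integral>x. (\<Sum>a\<in>S. of_real (C a) * a x) * cnj (b x) \<partial>\<mu>) = (\<integral>x. (\<Sum>a\<in>S. of_real (C a) * (a x * cnj (b x))) \<partial>\<mu>)"
      by (simp add: sum_distrib_right mult.assoc)
    also have "\<dots> = (\<Sum>a\<in>S. of_real (C a) * (\<integral>x. char_mult a (char_inv b) x \<partial>\<mu>))"
      by (subst Bochner_Integration.integral_sum) (auto simp: ci char_mult_def char_inv_def)
    also have "\<dots> = (\<Sum>a\<in>S. if a = b then of_real (C a) else 0)"
    proof (rule sum.cong[OF refl])
      fix a assume "a \<in> S"
      then have a: "a \<in> dual" using elim by auto
      have "char_mult a (char_inv b) = char_one \<longleftrightarrow> a = b"
        using char_mult_eq_iff[OF char_inv_dual[OF b], of a char_one] by (auto simp: char_mult_commute)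
      then show "of_real (C a) * (\<integral>x. char_mult a (char_inv b) x \<partial>\<mu>) = (if a = b then complex_of_real (C a) else 0)"
        using char_integral[OF char_mult_dual[OF a char_inv_dual[OF b]]] by simp
    qed
    finally show ?case using elim by simp
  qed
  then have "((\<lambda>S. \<integral>x. (\<Sum>a\<in>S. of_real (C a) * a x) * cnj (b x) \<partial>\<mu>) \<longlongrightarrow> of_real (C b)) (finite_subsets_at_top dual)"
    by (rule tendsto_eventually)
  from tendsto_unique[OF _ lim this] show ?thesis by simp
qed

lemma Q_has_sum: "((\<lambda>a. of_real (C a) * a x) has_sum Q x) dual"
proof -
  have "(\<lambda>a. norm (complex_of_real (C a) * a x)) summable_on dual \<longleftrightarrow> C summable_on dual"
    by (rule summable_on_cong) (simp add: norm_mult C_nonneg dual_norm)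
  then have "(\<lambda>a. norm (complex_of_real (C a) * a x)) summable_on dual"
    using C_summable by (rule iffD2)
  then have "(\<lambda>a. complex_of_real (C a) * a x) summable_on dual" by (rule abs_summable_summable)
  then show ?thesis unfolding Q_def by (rule has_sum_infsum)
qed

lemma Q_minus: "Q (- x) = cnj (Q x)"
proof -
  have "((\<lambda>a. cnj (complex_of_real (C a) * a x)) has_sum cnj (Q x)) dual"
    using Q_has_sum[of x] by (simp only: has_sum_cnj_iff)
  moreover have "((\<lambda>a. cnj (complex_of_real (C a) * a x)) has_sum cnj (Q x)) dual \<longleftrightarrow> ((\<lambda>a. complex_of_real (C a) * a (- x)) has_sum cnj (Q x)) dual"
    by (rule has_sum_cong) (simp add: dual_minus)
  ultimately show ?thesis using infsumI[OF Q_has_sum[of "- x"]] infsumI by metis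
qed

text \<open>The difference is continuous and hermitian with all Fourier coefficients zero; by
  \<open>exists_nonzero_coefficient\<close> such a function vanishes.\<close>

lemma r_eq_Q: "of_real (r x) = Q x"
proof -
  let ?f = "\<lambda>x. complex_of_real (r x) - Q x"
  have c: "continuous_on UNIV (\<lambda>x. complex_of_real (r x))" by (intro continuous_intros continuous_r)
  have h: "hermitian ?f"
    unfolding hermitian_def by (auto intro!: continuous_on_diff c continuous_Q simp: r_minus Q_minus)
  have "?f = (\<lambda>_. 0)"
  proof (rule ccontr)
    assume "?f \<noteq> (\<lambda>_. 0)"
    from exists_nonzero_coefficient[OF h this] obtain b where b: "b \<in> dual" and nz: "(\<integral>x. ?f x * cnj (b x) \<partial>\<mu>) \<noteq> 0" by blast
    have cc: "continuous_on UNIV (\<lambda>x. cnj (b x))" by (intro continuous_intros dual_continuous[OF b])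
    have "(\<integral>x. ?f x * cnj (b x) \<partial>\<mu>) = rhat 1 b - of_real (C b)"
      unfolding left_diff_distrib Q_coefficient[OF b, symmetric]
      by (subst Bochner_Integration.integral_diff)
        (auto intro!: continuous_integrable continuous_on_mult c cc continuous_Q simp: rhat_def)
    then show False using nz C_eq_rhat[OF b] by simp
  qed
  then show ?thesis by (simp add: fun_eq_iff)
qed

text \<open>The expansion of \<open>r 0 = 1\<close>; it makes the weights a probability.\<close>

lemma C_has_sum: "(C has_sum 1) dual"
proof -
  have "((\<lambda>a. complex_of_real (C a) * a 0) has_sum 1) dual"
    using Q_has_sum[of 0] r_eq_Q[of 0] by (simp add: r_0)
  moreover have "((\<lambda>a. complex_of_real (C a) * a 0) has_sum 1) dual \<longleftrightarrow> ((\<lambda>a. complex_of_real (C a)) has_sum 1) dual"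
    by (rule has_sum_cong) (simp add: dual_0)
  ultimately have "((\<lambda>a. complex_of_real (C a)) has_sum complex_of_real 1) dual" by simp
  then show ?thesis by (simp only: has_sum_of_real_iff)
qed

definition spec :: "('g \<Rightarrow> complex) pmf" where
  "spec = embed_pmf (\<lambda>a. if a \<in> dual then C a else 0)"

lemma pmf_spec: "pmf spec a = (if a \<in> dual then C a else 0)"
  unfolding spec_def
proof (rule pmf_embed_pmf)
  have abs: "Infinite_Set_Sum.abs_summable_on C dual"
    unfolding abs_summable_equivalent[symmetric] using C_summable by (simp add: C_nonneg)
  have "(\<integral>\<^sup>+ a. ennreal (if a \<in> dual then C a else 0) \<partial>count_space UNIV) = (\<integral>\<^sup>+ a. ennreal (C a) \<partial>count_space dual)"
    by (subst nn_integral_count_space_indicator) (auto intro!: nn_integral_cong simp: indicator_def)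
  also have "\<dots> = ennreal (infsetsum C dual)" by (rule nn_integral_conv_infsetsum[OF abs C_nonneg])
  also have "infsetsum C dual = 1" using infsetsum_infsum[OF abs] infsumI[OF C_has_sum] by simp
  finally show "(\<integral>\<^sup>+ a. ennreal (if a \<in> dual then C a else 0) \<partial>count_space UNIV) = 1" by simp
qed (simp add: C_nonneg)

lemma set_spec: "set_pmf spec \<subseteq> dual"
  by (auto simp: set_pmf_eq pmf_spec split: if_splits)

lemma r_expectation: "of_real (r x) = measure_pmf.expectation spec (\<lambda>a. a x)"
proof -
  have abs: "Infinite_Set_Sum.abs_summable_on (\<lambda>a. complex_of_real (C a) * a x) dual"
  proof -
    have "(\<lambda>a. norm (complex_of_real (C a) * a x)) summable_on dual \<longleftrightarrow> C summable_on dual"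
      by (rule summable_on_cong) (simp add: norm_mult C_nonneg dual_norm)
    then show ?thesis unfolding abs_summable_equivalent[symmetric] using C_summable by (rule iffD2)
  qed
  have "measure_pmf.expectation spec (\<lambda>a. a x) = infsetsum (\<lambda>a. pmf spec a *\<^sub>R a x) UNIV"
    unfolding infsetsum_def measure_pmf_eq_density by (subst integral_density) simp_all
  also have "\<dots> = infsetsum (\<lambda>a. complex_of_real (C a) * a x) dual"
    by (rule infsetsum_cong_neutral) (auto simp: pmf_spec scaleR_conv_of_real)
  also have "\<dots> = Q x" unfolding Q_def by (rule infsetsum_infsum[OF abs])
  finally show ?thesis by (simp add: r_eq_Q)
qed

primrec spec_pow :: "nat \<Rightarrow> ('g \<Rightarrow> complex) pmf" where
  "spec_pow 0 = return_pmf char_one"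
| "spec_pow (Suc m) = bind_pmf spec (\<lambda>a. map_pmf (char_mult a) (spec_pow m))"

lemma set_spec_pow: "set_pmf (spec_pow m) \<subseteq> dual"
  using set_spec by (induction m) (auto simp: char_one_dual intro!: char_mult_dual)

lemma expectation_spec_pow_Suc:
  fixes f :: "('g \<Rightarrow> complex) \<Rightarrow> complex"
  assumes "\<And>a. a \<in> dual \<Longrightarrow> norm (f a) \<le> B"
  shows "measure_pmf.expectation (spec_pow (Suc m)) f =
    measure_pmf.expectation spec (\<lambda>a. measure_pmf.expectation (spec_pow m) (\<lambda>b. f (char_mult a b)))"
proof -
  have B: "B \<ge> 0" using assms[OF char_one_dual] norm_ge_zero order_trans by blast
  let ?g = "\<lambda>a. if a \<in> dual then f a else 0"
  have "measure_pmf.expectation (spec_pow (Suc m)) f = measure_pmf.expectation (spec_pow (Suc m)) ?g"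
    using set_spec_pow[of "Suc m"] by (intro integral_cong_AE) (auto simp: AE_measure_pmf_iff)
  also have "\<dots> = measure_pmf.expectation spec (\<lambda>a. measure_pmf.expectation (map_pmf (char_mult a) (spec_pow m)) ?g)"
    unfolding spec_pow.simps by (rule expectation_bind_pmf[where B = B]) (use assms B in auto)
  also have "\<dots> = measure_pmf.expectation spec (\<lambda>a. measure_pmf.expectation (spec_pow m) (\<lambda>b. f (char_mult a b)))"
    unfolding integral_map_pmf
  proof (intro integral_cong_AE)
    show "AE a in spec. measure_pmf.expectation (spec_pow m) (\<lambda>b. ?g (char_mult a b)) = measure_pmf.expectation (spec_pow m) (\<lambda>b. f (char_mult a b))"
      unfolding AE_measure_pmf_iff
    proof
      fix a assume "a \<in> set_pmf spec"
      then have "a \<in> dual" using set_spec by auto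
      then show "measure_pmf.expectation (spec_pow m) (\<lambda>b. ?g (char_mult a b)) = measure_pmf.expectation (spec_pow m) (\<lambda>b. f (char_mult a b))"
        using set_spec_pow[of m] by (intro integral_cong_AE) (auto simp: AE_measure_pmf_iff intro!: char_mult_dual)
    qed
  qed auto
  finally show ?thesis .
qed

lemma r_power_expectation: "of_real (r x ^ m) = measure_pmf.expectation (spec_pow m) (\<lambda>a. a x)"
proof (induction m)
  case 0
  show ?case by (simp add: char_one_def)
next
  case (Suc m)
  have "measure_pmf.expectation (spec_pow (Suc m)) (\<lambda>a. a x) =
    measure_pmf.expectation spec (\<lambda>a. measure_pmf.expectation (spec_pow m) (\<lambda>b. char_mult a b x))"
    by (rule expectation_spec_pow_Suc[where B = 1]) (simp add: dual_norm)
  also have "\<dots> = measure_pmf.expectation spec (\<lambda>a. a x) * measure_pmf.expectation (spec_pow m) (\<lambda>b. b x)"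
    by (simp add: char_mult_def)
  finally show ?case using Suc r_expectation[of x] by simp
qed

text \<open>Orthogonality of characters picks the atom at \<open>b\<close> out of the law whose
  Fourier transform is the power of \<open>r\<close>.\<close>

lemma rhat_eq_pmf:
  assumes b: "b \<in> dual"
  shows "rhat m b = of_real (pmf (spec_pow m) b)"
proof -
  have d: "a \<in> dual" if "a \<in> set_pmf (spec_pow m)" for a using that set_spec_pow by auto
  have "rhat m b = (\<integral>x. measure_pmf.expectation (spec_pow m) (\<lambda>a. char_mult a (char_inv b) x) \<partial>\<mu>)"
    unfolding rhat_def r_power_expectation by (simp add: char_mult_def char_inv_def)
  also have "\<dots> = measure_pmf.expectation (spec_pow m) (\<lambda>a. \<integral>x. char_mult a (char_inv b) x \<partial>\<mu>)"
  proof (rule pmf_Fubini(3)[where B = 1])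
    show "sigma_finite_measure \<mu>" ..
    fix a assume "a \<in> set_pmf (spec_pow m)"
    then have a: "char_mult a (char_inv b) \<in> dual" using d b by (intro char_mult_dual char_inv_dual) auto
    show "integrable \<mu> (char_mult a (char_inv b))" by (rule continuous_integrable[OF dual_continuous[OF a]])
    show "(\<integral>x. norm (char_mult a (char_inv b) x) \<partial>\<mu>) \<le> 1" by (simp add: dual_norm[OF a])
  qed
  also have "\<dots> = measure_pmf.expectation (spec_pow m) (\<lambda>a. of_real (indicator {b} a))"
  proof (intro integral_cong_AE)
    show "AE a in spec_pow m. (\<integral>x. char_mult a (char_inv b) x \<partial>\<mu>) = of_real (indicator {b} a)"
      unfolding AE_measure_pmf_iff
    proof
      fix a assume "a \<in> set_pmf (spec_pow m)"
      then have a: "a \<in> dual" by (rule d)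
      have "char_mult a (char_inv b) = char_one \<longleftrightarrow> a = b"
        using char_mult_eq_iff[OF char_inv_dual[OF b], of a char_one] by (auto simp: char_mult_commute)
      then show "(\<integral>x. char_mult a (char_inv b) x \<partial>\<mu>) = of_real (indicator {b} a)"
        using char_integral[OF char_mult_dual[OF a char_inv_dual[OF b]]] by (simp add: indicator_def)
    qed
  qed auto
  also have "\<dots> = of_real (pmf (spec_pow m) b)"
    by (simp add: pmf.rep_eq)
  finally show ?thesis .
qed

lemma pmf_spec_pow_notin: "b \<notin> dual \<Longrightarrow> pmf (spec_pow m) b = 0"
  using set_spec_pow[of m] by (auto simp: set_pmf_eq)

lemma pmf_replicate: "pmf (replicate_pmf n p) s = (if length s = n then prod_list (map (pmf p) s) else 0)"
proof (induction n arbitrary: s)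
  case (Suc n)
  show ?case
  proof (cases s)
    case (Cons x xs)
    have "replicate_pmf (Suc n) p = map_pmf (\<lambda>(x, xs). x # xs) (pair_pmf p (replicate_pmf n p))"
      by (simp add: pair_pmf_def map_bind_pmf map_pmf_def bind_assoc_pmf bind_return_pmf)
    moreover have "pmf (map_pmf (\<lambda>(x, xs). x # xs) (pair_pmf p (replicate_pmf n p))) ((\<lambda>(x, xs). x # xs) (x, xs)) = pmf (pair_pmf p (replicate_pmf n p)) (x, xs)"
      by (rule pmf_map_inj') (auto simp: inj_def)
    ultimately show ?thesis using Suc by (simp add: Cons pmf_pair)
  next
    case Nil
    have "[] \<notin> set_pmf (replicate_pmf (Suc n) p)" by (auto simp: set_replicate_pmf simp del: replicate_pmf.simps)
    then show ?thesis by (simp add: Nil set_pmf_eq del: replicate_pmf.simps)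
  qed
qed (auto simp: indicator_def)

lemma spec_pow_replicate: "spec_pow m = map_pmf char_prod (replicate_pmf m spec)"
proof (induction m)
  case 0
  show ?case by (simp add: char_prod_def char_one_def)
next
  case (Suc m)
  have "char_prod (x # xs) = char_mult x (char_prod xs)" for x :: "'g \<Rightarrow> complex" and xs
    by (simp add: char_prod_def char_mult_def)
  then show ?case unfolding spec_pow.simps Suc
    by (simp add: map_bind_pmf map_pmf_comp map_pmf_def[of "\<lambda>x. char_mult _ (char_prod x)"] bind_return_pmf)
qed

text \<open>The lists in \<open>Chat\<close> are the outcomes of independent draws from
  \<open>spec\<close>, and fixing the product selects an event.\<close>

lemma Chat_eq_pmf: "Chat C b m = pmf (spec_pow m) b"
proof -
  let ?S = "{s. length s = m \<and> set s \<subseteq> dual \<and> char_prod s = b}"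
  have eq: "pmf (replicate_pmf m spec) s = prod_list (map C s)" if "length s = m" "set s \<subseteq> dual" for s
    using that by (simp add: pmf_replicate pmf_spec subset_iff cong: map_cong)
  have z: "pmf (replicate_pmf m spec) s = 0" if "\<not> (length s = m \<and> set s \<subseteq> dual)" for s
  proof -
    have "s \<notin> set_pmf (replicate_pmf m spec)" using that set_spec by (auto simp: set_replicate_pmf)
    then show ?thesis by (simp add: set_pmf_eq)
  qed
  have "pmf (spec_pow m) b = measure (replicate_pmf m spec) (char_prod -` {b})"
    unfolding spec_pow_replicate by (rule pmf_map)
  also have "\<dots> = infsetsum (pmf (replicate_pmf m spec)) (char_prod -` {b})" by (rule measure_pmf_conv_infsetsum)
  also have "\<dots> = infsum (pmf (replicate_pmf m spec)) (char_prod -` {b})" by (rule infsetsum_infsum[OF pmf_abs_summable])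
  also have "\<dots> = infsum (\<lambda>s. prod_list (map C s)) ?S"
    by (rule infsum_cong_neutral) (use eq z in auto)
  finally show ?thesis by (simp add: Chat_def)
qed

theorem second_moment:
  assumes "a \<in> dual"
  shows "expectation (\<lambda>\<omega>. (cmod (hcoef \<mu> T m a \<omega>))\<^sup>2) = fact m * Chat C a m"
proof -
  have "complex_of_real (expectation (\<lambda>\<omega>. (cmod (hcoef \<mu> T m a \<omega>))\<^sup>2)) = of_real (fact m * Chat C a m)"
    unfolding hcoef_eq[OF assms] hint_norm_moment[OF assms] rhat_eq_pmf[OF assms] Chat_eq_pmf by simp
  then show ?thesis by (simp only: of_real_eq_iff)
qed

end

section \<open>Hypercontractivity\<close>

text \<open>A Young inequality with free weight \<open>M\<close> and crude constants, read off by
  comparing \<open>b\<close> with \<open>M * a\<close>. The weight is later chosen so that the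
  second term can be absorbed.\<close>

lemma young_power: "a * b ^ j \<le> M ^ j * a ^ Suc j + b ^ Suc j / M" if "a \<ge> 0" "b \<ge> 0" "M > 0" for a b M :: real
proof (cases "b \<le> M * a")
  case True
  have "a * b ^ j \<le> a * (M * a) ^ j" using True that by (intro mult_left_mono power_mono) auto
  also have "\<dots> = M ^ j * a ^ Suc j" by (simp add: power_mult_distrib)
  also have "\<dots> \<le> M ^ j * a ^ Suc j + b ^ Suc j / M" using that by simp
  finally show ?thesis .
next
  case False
  then have "a \<le> b / M" using that by (simp add: field_simps)
  then have "a * b ^ j \<le> b / M * b ^ j" using that by (intro mult_right_mono) auto
  also have "\<dots> \<le> M ^ j * a ^ Suc j + b ^ Suc j / M" using that by simp
  finally show ?thesis .
qed

text \<open>From the tangent to \<open>t\<^sup>k\<close> at \<open>E x / E y\<close>.\<close>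

lemma pmf_Hoelder:
  fixes x y :: "'a \<Rightarrow> real"
  assumes x: "\<And>a. a \<in> set_pmf p \<Longrightarrow> 0 \<le> x a \<and> x a \<le> B" and y: "\<And>a. a \<in> set_pmf p \<Longrightarrow> e \<le> y a \<and> y a \<le> D" and e: "e > 0"
  shows "measure_pmf.expectation p x ^ Suc k \<le> measure_pmf.expectation p y ^ k * measure_pmf.expectation p (\<lambda>a. x a ^ Suc k / y a ^ k)"
proof -
  let ?x = "measure_pmf.expectation p x" and ?y = "measure_pmf.expectation p y"
  have ix: "integrable (measure_pmf p) x" by (rule pmf_integrable_bounded[where B = B]) (use x in auto)
  have iy: "integrable (measure_pmf p) y" by (rule pmf_integrable_bounded[where B = D]) (use y e in force)
  have iz: "integrable (measure_pmf p) (\<lambda>a. x a ^ Suc k / y a ^ k)"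
  proof (rule pmf_integrable_bounded[where B = "B ^ Suc k / e ^ k"])
    fix a assume a: "a \<in> set_pmf p"
    show "norm (x a ^ Suc k / y a ^ k) \<le> B ^ Suc k / e ^ k"
    proof -
      have "norm (x a ^ Suc k / y a ^ k) = x a ^ Suc k / y a ^ k" using x[OF a] y[OF a] e by simp
      also have "\<dots> \<le> B ^ Suc k / e ^ k"
        using x[OF a] y[OF a] e by (intro frac_le power_mono zero_le_power) auto
      finally show ?thesis .
    qed
  qed
  have x0: "?x \<ge> 0" by (rule integral_nonneg_AE) (use x in \<open>auto simp: AE_measure_pmf_iff\<close>)
  have y0: "?y > 0"
  proof -
    have "e = measure_pmf.expectation p (\<lambda>_. e)" by simp
    also have "\<dots> \<le> ?y" by (rule integral_mono_AE) (use y iy in \<open>auto simp: AE_measure_pmf_iff\<close>)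
    finally show ?thesis using e by simp
  qed
  define t where "t = ?x / ?y"
  have t0: "t \<ge> 0" using x0 y0 by (simp add: t_def)
  have "t ^ Suc k * ?y = measure_pmf.expectation p (\<lambda>a. t ^ Suc k * y a + real (Suc k) * t ^ k * (x a - t * y a))"
    using ix iy y0 by (simp add: t_def)
  also have "\<dots> \<le> measure_pmf.expectation p (\<lambda>a. x a ^ Suc k / y a ^ k)"
  proof (rule integral_mono_AE)
    show "AE a in p. t ^ Suc k * y a + real (Suc k) * t ^ k * (x a - t * y a) \<le> x a ^ Suc k / y a ^ k"
      unfolding AE_measure_pmf_iff
    proof
      fix a assume a: "a \<in> set_pmf p"
      have ya: "y a > 0" using y[OF a] e by simp
      have "t ^ Suc k + real (Suc k) * t ^ k * (x a / y a - t) \<le> (x a / y a) ^ Suc k"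
        using power_tangent[of "x a / y a" t "Suc k"] x[OF a] ya t0 by simp
      then have "y a * (t ^ Suc k + real (Suc k) * t ^ k * (x a / y a - t)) \<le> y a * (x a / y a) ^ Suc k"
        using ya by (intro mult_left_mono) auto
      moreover have "y a * (t ^ Suc k + real (Suc k) * t ^ k * (x a / y a - t)) = t ^ Suc k * y a + real (Suc k) * t ^ k * (x a - t * y a)"
        using ya by (simp add: field_simps)
      moreover have "y a * (x a / y a) ^ Suc k = x a ^ Suc k / y a ^ k"
        using ya by (simp add: power_divide)
      ultimately show "t ^ Suc k * y a + real (Suc k) * t ^ k * (x a - t * y a) \<le> x a ^ Suc k / y a ^ k" by simp
    qed
  qed (use ix iy iz in auto)
  finally have "t ^ Suc k * ?y * ?y ^ k \<le> measure_pmf.expectation p (\<lambda>a. x a ^ Suc k / y a ^ k) * ?y ^ k"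
    using y0 by (intro mult_right_mono) auto
  moreover have "t ^ Suc k * ?y * ?y ^ k = ?x ^ Suc k"
    using y0 by (simp add: t_def power_divide)
  ultimately show ?thesis by (simp add: mult.commute)
qed

context isotropic_field
begin

lemma weight_of_real: "weight (w :: 'g \<Rightarrow> real) \<Longrightarrow> weight (\<lambda>g. complex_of_real (w g))"
  by (auto simp: weight_def)

lemma weight_Re: "weight (w :: 'g \<Rightarrow> complex) \<Longrightarrow> weight (\<lambda>g. Re (w g))"
  and weight_Im: "weight (w :: 'g \<Rightarrow> complex) \<Longrightarrow> weight (\<lambda>g. Im (w g))"
proof -
  assume w: "weight w"
  then obtain B where B: "\<And>g. cmod (w g) \<le> B" and [measurable]: "w \<in> borel_measurable \<mu>" by (auto simp: weight_def)
  have "norm (Re (w g)) \<le> B" "norm (Im (w g)) \<le> B" for g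
    using B[of g] abs_Re_le_cmod[of "w g"] abs_Im_le_cmod[of "w g"] by auto
  then show "weight (\<lambda>g. Re (w g))" "weight (\<lambda>g. Im (w g))" by (auto simp: weight_def)
qed

lemma gint_AE_integrable:
  assumes w: "weight w"
  shows "AE \<omega> in P. integrable \<mu> (\<lambda>g. of_real (poly q (T g \<omega>)) * w g)"
proof -
  have "integrable (\<mu> \<Otimes>\<^sub>M P) (\<lambda>(g, \<omega>). of_real (poly q (T g \<omega>)) * w g)"
    using fmom_integrable[OF gint_fmom_pair[OF w, of q]] by (simp add: case_prod_beta')
  from PP.AE_integrable_snd[OF this] show ?thesis .
qed

lemma hint_Re_Im:
  assumes w: "weight (w :: 'g \<Rightarrow> complex)"
  shows "AE \<omega> in P. hint m w \<omega> = Complex (hint m (\<lambda>g. Re (w g)) \<omega>) (hint m (\<lambda>g. Im (w g)) \<omega>)"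
  using gint_AE_integrable[OF w, of "hermite_poly m"]
proof eventually_elim
  case (elim \<omega>)
  then show ?case
    by (simp add: hint_def gint_def complex_eq_iff integral_Re[symmetric] integral_Im[symmetric] del: integral_Re integral_Im)
qed

text \<open>The kernel \<open>r (h - g)\<close> is the average of \<open>a h * cnj (a g)\<close>
  over a random character, which diagonalizes the quadratic form \<open>Gam\<close>. The weights
  \<open>w g * a g\<close> are bounded again, so an induction on the order can proceed.\<close>

lemma Gam_spectral:
  assumes w: "weight w"
  shows "AE \<omega> in P. Gam m w \<omega> = real (Suc m) * measure_pmf.expectation spec (\<lambda>a. (cmod (hint m (\<lambda>g. of_real (w g) * a g) \<omega>))\<^sup>2)"
  using gint_AE_integrable[OF w, of "hermite_poly m"]
proof eventually_elim
  case (elim \<omega>)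
  define H where "H g = poly (hermite_poly m) (T g \<omega>) * w g" for g
  have iH: "integrable \<mu> H" using elim by (simp add: H_def[abs_def])
  have mH[measurable]: "H \<in> borel_measurable \<mu>" using iH by (rule borel_measurable_integrable)
  define Y where "Y a = (\<integral>g. of_real (H g) * a g \<partial>\<mu>)" for a :: "'g \<Rightarrow> complex"
  define X where "X a = (\<integral>g. of_real (H g) * cnj (a g) \<partial>\<mu>)" for a :: "'g \<Rightarrow> complex"
  have XY: "X a = cnj (Y a)" for a
    unfolding X_def Y_def by (subst Bochner_Integration.integral_cnj[symmetric]) simp
  have a: "a \<in> dual" if "a \<in> set_pmf spec" for a using that set_spec by auto
  have ia: "integrable \<mu> (\<lambda>g. of_real (H g) * cnj (a g))" "integrable \<mu> (\<lambda>g. of_real (H g) * a g)" if "a \<in> dual" for a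
  proof -
    have [measurable]: "a \<in> borel_measurable \<mu>" by (rule measurable_continuous[OF dual_continuous[OF that]])
    have "(\<lambda>g. cnj (a g)) \<in> borel_measurable \<mu>"
      by (rule measurable_continuous) (intro continuous_intros dual_continuous[OF that])
    note [measurable] = this
    show "integrable \<mu> (\<lambda>g. of_real (H g) * cnj (a g))"
      by (rule Bochner_Integration.integrable_bound[OF iH]) (auto simp: norm_mult dual_norm[OF that])
    show "integrable \<mu> (\<lambda>g. of_real (H g) * a g)"
      by (rule Bochner_Integration.integrable_bound[OF iH]) (auto simp: norm_mult dual_norm[OF that])
  qed
  define B where "B = (\<integral>g. \<bar>H g\<bar> \<partial>\<mu>)"
  have XB: "norm (X a) \<le> B" if "a \<in> dual" for a
  proof -
    have "norm (X a) \<le> (\<integral>g. norm (of_real (H g) * cnj (a g)) \<partial>\<mu>)" unfolding X_def by (rule integral_norm_bound)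
    then show ?thesis by (simp add: norm_mult dual_norm[OF that] B_def)
  qed
  have D: "complex_of_real (D_gint (hermite_poly (Suc m)) w h \<omega>) = of_nat (Suc m) * measure_pmf.expectation spec (\<lambda>a. a h * X a)" for h
  proof -
    have "complex_of_real (D_gint (hermite_poly (Suc m)) w h \<omega>) = of_nat (Suc m) * (\<integral>g. of_real (H g) * of_real (r (h - g)) \<partial>\<mu>)"
      unfolding D_gint_def pderiv_hermite_poly gint_smult
      by (simp add: gint_def H_def integral_complex_of_real[symmetric] mult_ac del: integral_complex_of_real)
    also have "(\<integral>g. of_real (H g) * of_real (r (h - g)) \<partial>\<mu>) = (\<integral>g. measure_pmf.expectation spec (\<lambda>a. of_real (H g) * cnj (a g) * a h) \<partial>\<mu>)"
    proof (rule Bochner_Integration.integral_cong[OF refl])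
      fix g
      have "complex_of_real (r (h - g)) = measure_pmf.expectation spec (\<lambda>a. cnj (a g) * a h)"
        unfolding r_expectation
        by (rule integral_cong_AE) (use a in \<open>auto simp: AE_measure_pmf_iff dual_diff mult.commute\<close>)
      then show "of_real (H g) * of_real (r (h - g)) = measure_pmf.expectation spec (\<lambda>a. of_real (H g) * cnj (a g) * a h)"
        by (simp add: mult.assoc)
    qed
    also have "\<dots> = measure_pmf.expectation spec (\<lambda>a. \<integral>g. of_real (H g) * cnj (a g) * a h \<partial>\<mu>)"
    proof (rule pmf_Fubini(3)[where B = B])
      fix x assume x: "x \<in> set_pmf spec"
      show "integrable \<mu> (\<lambda>g. of_real (H g) * cnj (x g) * x h)" by (intro integrable_mult_left ia a x)
      show "(\<integral>g. norm (of_real (H g) * cnj (x g) * x h) \<partial>\<mu>) \<le> B" by (simp add: norm_mult dual_norm[OF a[OF x]] B_def)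
    qed (rule haar.sigma_finite_measure_axioms)
    finally show ?thesis by (simp add: X_def mult.commute)
  qed
  have "complex_of_real (Gam m w \<omega>) = (\<integral>h. of_real (H h) * complex_of_real (D_gint (hermite_poly (Suc m)) w h \<omega>) \<partial>\<mu>)"
    unfolding Gam_def integral_complex_of_real[symmetric] by (simp add: H_def mult_ac del: integral_complex_of_real)
  also have "\<dots> = of_nat (Suc m) * (\<integral>h. measure_pmf.expectation spec (\<lambda>a. of_real (H h) * a h * X a) \<partial>\<mu>)"
  proof -
    have eq: "of_real (H h) * (of_nat (Suc m) * measure_pmf.expectation spec (\<lambda>a. a h * X a)) =
      of_nat (Suc m) * measure_pmf.expectation spec (\<lambda>a. of_real (H h) * a h * X a)" for h
    proof -
      have "measure_pmf.expectation spec (\<lambda>a. of_real (H h) * a h * X a) = of_real (H h) * measure_pmf.expectation spec (\<lambda>a. a h * X a)"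
        by (simp add: mult.assoc)
      then show ?thesis by (simp only: mult.left_commute)
    qed
    show ?thesis unfolding D eq by (rule integral_mult_right_zero)
  qed
  also have "(\<integral>h. measure_pmf.expectation spec (\<lambda>a. of_real (H h) * a h * X a) \<partial>\<mu>) = measure_pmf.expectation spec (\<lambda>a. \<integral>h. of_real (H h) * a h * X a \<partial>\<mu>)"
  proof (rule pmf_Fubini(3)[where B = "B * B"])
    fix x assume x: "x \<in> set_pmf spec"
    show "integrable \<mu> (\<lambda>h. of_real (H h) * x h * X x)" by (intro integrable_mult_left ia a x)
    have "(\<integral>h. norm (of_real (H h) * x h * X x) \<partial>\<mu>) = B * norm (X x)" by (simp add: norm_mult dual_norm[OF a[OF x]] B_def)
    also have "\<dots> \<le> B * B" by (intro mult_left_mono XB a x) (simp add: B_def)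
    finally show "(\<integral>h. norm (of_real (H h) * x h * X x) \<partial>\<mu>) \<le> B * B" .
  qed (rule haar.sigma_finite_measure_axioms)
  also have "(\<lambda>a. \<integral>h. of_real (H h) * a h * X a \<partial>\<mu>) = (\<lambda>a. complex_of_real ((cmod (Y a))\<^sup>2))"
    unfolding complex_norm_square by (simp add: XY Y_def fun_eq_iff)
  also have "of_nat (Suc m) * measure_pmf.expectation spec (\<lambda>a. complex_of_real ((cmod (Y a))\<^sup>2)) =
    complex_of_real (real (Suc m) * measure_pmf.expectation spec (\<lambda>a. (cmod (Y a))\<^sup>2))"
    by (simp del: of_real_power)
  finally have "Gam m w \<omega> = real (Suc m) * measure_pmf.expectation spec (\<lambda>a. (cmod (Y a))\<^sup>2)" by (simp only: of_real_eq_iff)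
  then show ?case by (simp add: Y_def hint_def gint_def H_def mult.assoc)
qed

lemma hint_fmom: "weight w \<Longrightarrow> fmom P (hint m w)"
  unfolding hint_def by (rule gint_fmom)

lemma fmom_cmod: "fmom M X \<Longrightarrow> fmom M (\<lambda>x. cmod (X x))"
  by (auto simp: fmom_def intro!: borel_measurable_norm)

text \<open>The constant has a factor \<open>2 ^ k\<close> from splitting the power of a sum of two
  squares, and a factor 2 from bounding the variances of the real and the imaginary part by their
  sum.\<close>

lemma hypercontractive_complex:
  assumes K: "\<And>w :: 'g \<Rightarrow> real. weight w \<Longrightarrow> expectation (\<lambda>\<omega>. hint m w \<omega> ^ (2 * k)) \<le> K * expectation (\<lambda>\<omega>. (hint m w \<omega>)\<^sup>2) ^ k"
    and K0: "K \<ge> 0" and w: "weight (w :: 'g \<Rightarrow> complex)"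
  shows "expectation (\<lambda>\<omega>. cmod (hint m w \<omega>) ^ (2 * k)) \<le> 2 ^ Suc k * K * expectation (\<lambda>\<omega>. (cmod (hint m w \<omega>))\<^sup>2) ^ k"
proof -
  let ?A = "hint m (\<lambda>g. Re (w g))" and ?B = "hint m (\<lambda>g. Im (w g))"
  note wRI = weight_Re[OF w] weight_Im[OF w]
  have f: "fmom P ?A" "fmom P ?B" "fmom P (\<lambda>\<omega>. cmod (hint m w \<omega>))"
    by (intro hint_fmom wRI fmom_cmod w)+
  have ae: "AE \<omega> in P. (cmod (hint m w \<omega>))\<^sup>2 = (?A \<omega>)\<^sup>2 + (?B \<omega>)\<^sup>2"
    using hint_Re_Im[OF w, of m] by eventually_elim (simp add: cmod_power2)
  let ?a = "expectation (\<lambda>\<omega>. (?A \<omega>)\<^sup>2)" and ?b = "expectation (\<lambda>\<omega>. (?B \<omega>)\<^sup>2)"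
  have sq: "expectation (\<lambda>\<omega>. (cmod (hint m w \<omega>))\<^sup>2) = ?a + ?b"
  proof -
    have "expectation (\<lambda>\<omega>. (cmod (hint m w \<omega>))\<^sup>2) = expectation (\<lambda>\<omega>. (?A \<omega>)\<^sup>2 + (?B \<omega>)\<^sup>2)"
      by (rule integral_cong_AE[OF _ _ ae]) (intro fmom_measurable fmom_intros f)+
    then show ?thesis by (simp add: fmom_integrable fmom_power f)
  qed
  have ab: "?a \<ge> 0" "?b \<ge> 0" by simp_all
  have "expectation (\<lambda>\<omega>. cmod (hint m w \<omega>) ^ (2 * k)) \<le> expectation (\<lambda>\<omega>. 2 ^ k * (?A \<omega> ^ (2 * k) + ?B \<omega> ^ (2 * k)))"
  proof (rule integral_mono_AE)
    show "AE \<omega> in P. cmod (hint m w \<omega>) ^ (2 * k) \<le> 2 ^ k * (?A \<omega> ^ (2 * k) + ?B \<omega> ^ (2 * k))"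
      using ae
    proof eventually_elim
      case (elim \<omega>)
      have "cmod (hint m w \<omega>) ^ (2 * k) = ((?A \<omega>)\<^sup>2 + (?B \<omega>)\<^sup>2) ^ k" by (simp add: power_mult elim)
      also have "\<dots> \<le> 2 ^ k * (((?A \<omega>)\<^sup>2) ^ k + ((?B \<omega>)\<^sup>2) ^ k)" by (rule power_add_le) auto
      finally show ?case by (simp add: power_mult)
    qed
  qed (intro fmom_integrable fmom_intros f)+
  also have "\<dots> = 2 ^ k * (expectation (\<lambda>\<omega>. ?A \<omega> ^ (2 * k)) + expectation (\<lambda>\<omega>. ?B \<omega> ^ (2 * k)))"
    by (simp add: fmom_integrable fmom_power f)
  also have "\<dots> \<le> 2 ^ k * (K * ?a ^ k + K * ?b ^ k)"
    by (intro mult_left_mono add_mono K wRI) auto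
  also have "\<dots> \<le> 2 ^ k * (K * (?a + ?b) ^ k + K * (?a + ?b) ^ k)"
    using ab by (intro mult_left_mono add_mono power_mono K0) auto
  finally show ?thesis by (simp add: sq)
qed

lemma second_moment_Gam: "weight w \<Longrightarrow> expectation (\<lambda>\<omega>. (hint (Suc m) w \<omega>)\<^sup>2) = expectation (Gam m w)"
  using moment_recursion[of w m 1] by (simp add: numeral_2_eq_2)

text \<open>Each character has its own second moment \<open>y a\<close>, and the hypothesis compares
  powers only with that. Hoelder's inequality with weights adapted to \<open>y a\<close> recombines
  them, so that the average of the \<open>y a\<close> appears rather than their supremum.\<close>

lemma Gam_moment_bound:
  assumes K: "\<And>w :: 'g \<Rightarrow> complex. weight w \<Longrightarrow> expectation (\<lambda>\<omega>. cmod (hint m w \<omega>) ^ (2 * Suc k)) \<le> K * expectation (\<lambda>\<omega>. (cmod (hint m w \<omega>))\<^sup>2) ^ Suc k"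
    and K0: "K \<ge> 0" and w: "weight w"
  shows "expectation (\<lambda>\<omega>. \<bar>Gam m w \<omega>\<bar> ^ Suc k) \<le> 2 ^ k * K * expectation (Gam m w) ^ Suc k"
proof -
  define Y where "Y a \<omega> = (cmod (hint m (\<lambda>g. of_real (w g) * a g) \<omega>))\<^sup>2" for a \<omega>
  have a: "a \<in> dual" if "a \<in> set_pmf spec" for a using that set_spec by auto
  have wa: "weight (\<lambda>g. complex_of_real (w g) * a g)" if "a \<in> set_pmf spec" for a
    by (intro weight_mult weight_of_real w weight_char a that)
  have fY: "fmom P (Y a)" if "a \<in> set_pmf spec" for a
    unfolding Y_def[abs_def] by (intro fmom_power fmom_cmod hint_fmom wa that)
  define B where "B \<omega> = (\<integral>g. \<bar>poly (hermite_poly m) (T g \<omega>) * w g\<bar> \<partial>\<mu>)" for \<omega>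
  have fB: "fmom P B" unfolding B_def
  proof (rule PP.fmom_integral_fst)
    have "fmom (\<mu> \<Otimes>\<^sub>M P) (\<lambda>p. poly (hermite_poly m) (T (fst p) (snd p)) * w (fst p))"
      using gint_fmom_pair[OF w, of "hermite_poly m"] by simp
    then show "fmom (\<mu> \<Otimes>\<^sub>M P) (\<lambda>p. \<bar>poly (hermite_poly m) (T (fst p) (snd p)) * w (fst p)\<bar>)" by (rule PP.P.fmom_abs)
  qed
  have Y0: "Y a \<omega> \<ge> 0" for a \<omega> by (simp add: Y_def)
  have YB: "Y a \<omega> \<le> (B \<omega>)\<^sup>2" if "a \<in> set_pmf spec" for a \<omega>
  proof -
    have "cmod (hint m (\<lambda>g. of_real (w g) * a g) \<omega>) \<le> (\<integral>g. cmod (of_real (poly (hermite_poly m) (T g \<omega>)) * (of_real (w g) * a g)) \<partial>\<mu>)"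
      unfolding hint_def gint_def by (rule integral_norm_bound)
    then have "cmod (hint m (\<lambda>g. of_real (w g) * a g) \<omega>) \<le> B \<omega>"
      by (simp add: norm_mult dual_norm[OF a[OF that]] B_def abs_mult)
    then show ?thesis unfolding Y_def by (intro power_mono) auto
  qed
  define y where "y a = expectation (Y a)" for a
  have y0: "y a \<ge> 0" for a unfolding y_def by (simp add: Y0)
  have yB: "y a \<le> expectation (\<lambda>\<omega>. (B \<omega>)\<^sup>2)" if "a \<in> set_pmf spec" for a
    unfolding y_def using YB[OF that] by (intro integral_mono fmom_integrable fmom_power fY fB that) auto
  define V where "V = measure_pmf.expectation spec y"
  have V0: "V \<ge> 0" unfolding V_def by (simp add: y0)
  have iyp: "integrable (measure_pmf spec) y"
    by (rule pmf_integrable_bounded[where B = "expectation (\<lambda>\<omega>. (B \<omega>)\<^sup>2)"]) (use y0 yB in auto)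
  note swap = pmf_Fubini[where M = P and \<phi> = Y and p = spec and B = "expectation (\<lambda>\<omega>. (B \<omega>)\<^sup>2)"]
  have Gam_AE: "AE \<omega> in P. Gam m w \<omega> = real (Suc m) * measure_pmf.expectation spec (\<lambda>a. Y a \<omega>)"
    using Gam_spectral[OF w, of m] by (simp add: Y_def)
  have EG: "expectation (Gam m w) = real (Suc m) * V"
  proof -
    have i: "integrable P (\<lambda>\<omega>. measure_pmf.expectation spec (\<lambda>a. Y a \<omega>))"
      and e: "expectation (\<lambda>\<omega>. measure_pmf.expectation spec (\<lambda>a. Y a \<omega>)) = V"
      unfolding V_def y_def
      by (rule swap(2), goal_cases) (use yB fY Y0 in \<open>auto simp: y_def sigma_finite_measure_axioms intro: fmom_integrable\<close>,
          rule swap(3), goal_cases, use yB fY Y0 in \<open>auto simp: y_def sigma_finite_measure_axioms intro: fmom_integrable\<close>)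
    have "expectation (Gam m w) = expectation (\<lambda>\<omega>. real (Suc m) * measure_pmf.expectation spec (\<lambda>a. Y a \<omega>))"
      by (rule integral_cong_AE) (use Gam_AE i fmom_measurable[OF Gam_fmom[OF w]] in \<open>auto intro: borel_measurable_integrable\<close>)
    then show ?thesis by (simp add: e)
  qed
  \<comment> \<open>The shift by \<open>e\<close> keeps the denominators positive where
    \<open>y a = 0\<close>. The choice \<open>e = V\<close> costs
    \<open>(V + V) ^ k = 2 ^ k * V ^ k\<close>; for \<open>V = 0\<close> the final bound is 0 and
    any positive \<open>e\<close> serves.\<close>
  define e where "e = (if V = 0 then 1 else V)"
  have e: "e > 0" using V0 by (simp add: e_def)
  define Z where "Z a \<omega> = Y a \<omega> ^ Suc k / (y a + e) ^ k" for a \<omega>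
  have fZ: "fmom P (Z a)" if "a \<in> set_pmf spec" for a
  proof -
    have "fmom P (\<lambda>\<omega>. (1 / (y a + e) ^ k) * Y a \<omega> ^ Suc k)" by (intro fmom_scale fmom_power fY that)
    then show ?thesis by (simp add: Z_def[abs_def] del: power_Suc)
  qed
  have Z0: "Z a \<omega> \<ge> 0" for a \<omega> using Y0[of a \<omega>] y0[of a] e by (simp add: Z_def)
  have EZ: "expectation (Z a) \<le> K * y a" if "a \<in> set_pmf spec" for a
  proof -
    have "expectation (Z a) = expectation (\<lambda>\<omega>. Y a \<omega> ^ Suc k) / (y a + e) ^ k" by (simp add: Z_def[abs_def] del: power_Suc)
    also have "\<dots> \<le> K * y a ^ Suc k / (y a + e) ^ k"
    proof (intro divide_right_mono)
      have "expectation (\<lambda>\<omega>. Y a \<omega> ^ Suc k) = expectation (\<lambda>\<omega>. cmod (hint m (\<lambda>g. of_real (w g) * a g) \<omega>) ^ (2 * Suc k))"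
        by (simp only: Y_def power_mult)
      also have "\<dots> \<le> K * y a ^ Suc k" using K[OF wa[OF that]] by (simp only: y_def Y_def[abs_def])
      finally show "expectation (\<lambda>\<omega>. Y a \<omega> ^ Suc k) \<le> K * y a ^ Suc k" .
    qed (use y0 e in auto)
    also have "\<dots> \<le> K * y a"
    proof -
      have "y a ^ k \<le> (y a + e) ^ k" using y0 e by (intro power_mono) auto
      then have "K * y a * y a ^ k \<le> K * y a * (y a + e) ^ k" using K0 y0 by (intro mult_left_mono) auto
      then show ?thesis using y0[of a] e by (simp add: divide_le_eq mult_ac add_nonneg_pos)
    qed
    finally show ?thesis .
  qed
  have EZB: "expectation (Z a) \<le> K * expectation (\<lambda>\<omega>. (B \<omega>)\<^sup>2)" if "a \<in> set_pmf spec" for a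
    using EZ[OF that] mult_left_mono[OF yB[OF that] K0] by linarith
  note swapZ = pmf_Fubini[where M = P and \<phi> = Z and p = spec and B = "K * expectation (\<lambda>\<omega>. (B \<omega>)\<^sup>2)"]
  have iZ: "integrable P (\<lambda>\<omega>. measure_pmf.expectation spec (\<lambda>a. Z a \<omega>))"
    by (rule swapZ(2)) (use EZB fZ Z0 in \<open>auto simp: sigma_finite_measure_axioms intro: fmom_integrable\<close>)
  have eZ: "expectation (\<lambda>\<omega>. measure_pmf.expectation spec (\<lambda>a. Z a \<omega>)) = measure_pmf.expectation spec (\<lambda>a. expectation (Z a))"
    by (rule swapZ(3)) (use EZB fZ Z0 in \<open>auto simp: sigma_finite_measure_axioms intro: fmom_integrable\<close>)
  have iZp: "integrable (measure_pmf spec) (\<lambda>a. expectation (Z a))"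
    by (rule swapZ(4)) (use EZB fZ Z0 in \<open>auto simp: sigma_finite_measure_axioms intro: fmom_integrable\<close>)
  have Ey: "measure_pmf.expectation spec (\<lambda>a. y a + e) = V + e" using iyp by (simp add: V_def)
  have "expectation (\<lambda>\<omega>. \<bar>Gam m w \<omega>\<bar> ^ Suc k) \<le> expectation (\<lambda>\<omega>. real (Suc m) ^ Suc k * ((V + e) ^ k * measure_pmf.expectation spec (\<lambda>a. Z a \<omega>)))"
  proof (rule integral_mono_AE)
    show "AE \<omega> in P. \<bar>Gam m w \<omega>\<bar> ^ Suc k \<le> real (Suc m) ^ Suc k * ((V + e) ^ k * measure_pmf.expectation spec (\<lambda>a. Z a \<omega>))"
      using Gam_AE
    proof eventually_elim
      case (elim \<omega>)
      have "measure_pmf.expectation spec (\<lambda>a. Y a \<omega>) \<ge> 0" by (simp add: Y0)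
      then have "\<bar>Gam m w \<omega>\<bar> ^ Suc k = real (Suc m) ^ Suc k * measure_pmf.expectation spec (\<lambda>a. Y a \<omega>) ^ Suc k"
        unfolding elim by (simp add: abs_mult power_mult_distrib del: power_Suc)
      also have "\<dots> \<le> real (Suc m) ^ Suc k * ((V + e) ^ k * measure_pmf.expectation spec (\<lambda>a. Z a \<omega>))"
        unfolding Ey[symmetric] Z_def
        by (intro mult_left_mono pmf_Hoelder[where B = "(B \<omega>)\<^sup>2" and e = e and D = "expectation (\<lambda>\<omega>. (B \<omega>)\<^sup>2) + e"])
          (use YB Y0 y0 yB e in auto)
      finally show ?case .
    qed
    show "integrable P (\<lambda>\<omega>. \<bar>Gam m w \<omega>\<bar> ^ Suc k)" by (intro fmom_integrable fmom_power fmom_abs Gam_fmom w)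
  qed (rule integrable_mult_right[OF integrable_mult_right[OF iZ]])
  also have "\<dots> = real (Suc m) ^ Suc k * ((V + e) ^ k * measure_pmf.expectation spec (\<lambda>a. expectation (Z a)))"
    by (simp add: eZ del: power_Suc)
  also have "\<dots> \<le> real (Suc m) ^ Suc k * ((V + e) ^ k * (K * V))"
  proof (intro mult_left_mono)
    have "measure_pmf.expectation spec (\<lambda>a. expectation (Z a)) \<le> measure_pmf.expectation spec (\<lambda>a. K * y a)"
      by (rule integral_mono_AE) (use iZp iyp EZ in \<open>auto simp: AE_measure_pmf_iff\<close>)
    then show "measure_pmf.expectation spec (\<lambda>a. expectation (Z a)) \<le> K * V" by (simp add: V_def)
  qed (use V0 e in auto)
  also have "\<dots> = 2 ^ k * K * (real (Suc m) * V) ^ Suc k"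
  proof (cases "V = 0")
    case False
    have "(V + V) ^ k = 2 ^ k * V ^ k" by (simp add: mult_2[symmetric] power_mult_distrib)
    then show ?thesis using False by (simp add: e_def power_mult_distrib mult_ac del: of_nat_Suc)
  qed simp
  finally show ?thesis by (simp add: EG)
qed

text \<open>Induction on the order for fixed \<open>k\<close>: the moment recursion introduces
  \<open>Gam\<close>, Young's inequality separates it from the power of the functional, and
  \<open>Gam_moment_bound\<close> leads back to order \<open>m\<close>.\<close>

theorem hypercontractive:
  "\<exists>K\<ge>0. \<forall>w :: 'g \<Rightarrow> real. weight w \<longrightarrow> expectation (\<lambda>\<omega>. hint m w \<omega> ^ (2 * k)) \<le> K * expectation (\<lambda>\<omega>. (hint m w \<omega>)\<^sup>2) ^ k"
proof (cases k)
  case 0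
  then show ?thesis by (intro exI[of _ 1]) (simp add: prob_space)
next
  case (Suc j)
  show ?thesis
  proof (induction m)
    case 0
    have "hint 0 w \<omega> = (\<integral>g. w g \<partial>\<mu>)" for w :: "'g \<Rightarrow> real" and \<omega> by (simp add: hint_def gint_def)
    then show ?case by (intro exI[of _ 1]) (simp add: prob_space power_mult)
  next
    case (Suc m)
    then obtain K where K0: "K \<ge> 0" and K: "\<And>w :: 'g \<Rightarrow> real. weight w \<Longrightarrow> expectation (\<lambda>\<omega>. hint m w \<omega> ^ (2 * k)) \<le> K * expectation (\<lambda>\<omega>. (hint m w \<omega>)\<^sup>2) ^ k" by blast
    define K' where "K' = 2 ^ Suc k * K"
    have K'0: "K' \<ge> 0" using K0 by (simp add: K'_def)
    have K': "expectation (\<lambda>\<omega>. cmod (hint m w \<omega>) ^ (2 * Suc j)) \<le> K' * expectation (\<lambda>\<omega>. (cmod (hint m w \<omega>))\<^sup>2) ^ Suc j"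
      if "weight w" for w :: "'g \<Rightarrow> complex"
      using hypercontractive_complex[OF K K0 that] unfolding K'_def \<open>k = Suc j\<close> by blast
    \<comment> \<open>With this \<open>M\<close> the term returned by Young's inequality is exactly
      half of the moment to be bounded, and it is absorbed on the left.\<close>
    define M where "M = 2 * (2 * real j + 1)"
    have M: "M > 0" by (simp add: M_def)
    have main: "expectation (\<lambda>\<omega>. hint (Suc m) w \<omega> ^ (2 * k)) \<le> (M ^ Suc j * (2 ^ j * K')) * expectation (\<lambda>\<omega>. (hint (Suc m) w \<omega>)\<^sup>2) ^ k"
      if w: "weight w" for w :: "'g \<Rightarrow> real"
    proof -
      let ?F = "hint (Suc m) w" and ?G = "Gam m w"
      note f = hint_fmom[OF w, of "Suc m"] Gam_fmom[OF w, of m]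
      let ?E = "expectation (\<lambda>\<omega>. ?F \<omega> ^ (2 * Suc j))"
      have "?E = (2 * real j + 1) * expectation (\<lambda>\<omega>. ?G \<omega> * ?F \<omega> ^ (2 * j))"
        using moment_recursion[OF w, of m "2 * j + 1"] by simp
      also have "\<dots> \<le> (2 * real j + 1) * expectation (\<lambda>\<omega>. M ^ j * \<bar>?G \<omega>\<bar> ^ Suc j + ?F \<omega> ^ (2 * Suc j) / M)"
      proof (intro mult_left_mono integral_mono)
        fix \<omega>
        have "?G \<omega> * ?F \<omega> ^ (2 * j) \<le> \<bar>?G \<omega>\<bar> * ((?F \<omega>)\<^sup>2) ^ j"
          unfolding power_mult by (intro mult_right_mono) auto
        also have "\<dots> \<le> M ^ j * \<bar>?G \<omega>\<bar> ^ Suc j + ((?F \<omega>)\<^sup>2) ^ Suc j / M" by (rule young_power) (use M in auto)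
        finally show "?G \<omega> * ?F \<omega> ^ (2 * j) \<le> M ^ j * \<bar>?G \<omega>\<bar> ^ Suc j + ?F \<omega> ^ (2 * Suc j) / M"
          by (simp only: power_mult)
      next
        have "integrable P (\<lambda>\<omega>. M ^ j * \<bar>?G \<omega>\<bar> ^ Suc j + (1 / M) * ?F \<omega> ^ (2 * Suc j))"
          by (intro fmom_integrable fmom_intros fmom_abs f)
        then show "integrable P (\<lambda>\<omega>. M ^ j * \<bar>?G \<omega>\<bar> ^ Suc j + ?F \<omega> ^ (2 * Suc j) / M)" by simp
      qed (intro fmom_integrable fmom_intros f, simp)
      also have "expectation (\<lambda>\<omega>. M ^ j * \<bar>?G \<omega>\<bar> ^ Suc j + ?F \<omega> ^ (2 * Suc j) / M) =
        M ^ j * expectation (\<lambda>\<omega>. \<bar>?G \<omega>\<bar> ^ Suc j) + ?E / M"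
      proof (subst Bochner_Integration.integral_add)
        show "integrable P (\<lambda>\<omega>. M ^ j * \<bar>?G \<omega>\<bar> ^ Suc j)" by (intro fmom_integrable fmom_intros fmom_abs f)
        have "integrable P (\<lambda>\<omega>. (1 / M) * ?F \<omega> ^ (2 * Suc j))" by (intro fmom_integrable fmom_intros f)
        then show "integrable P (\<lambda>\<omega>. ?F \<omega> ^ (2 * Suc j) / M)" by simp
      qed simp
      finally have "?E \<le> (2 * real j + 1) * (M ^ j * expectation (\<lambda>\<omega>. \<bar>?G \<omega>\<bar> ^ Suc j) + ?E / M)" .
      moreover have "(2 * real j + 1) * (M ^ j * X + E / M) = M ^ Suc j * X / 2 + E / 2" for X E :: real
        using M by (simp add: M_def field_simps)
      ultimately have "?E \<le> M ^ Suc j * expectation (\<lambda>\<omega>. \<bar>?G \<omega>\<bar> ^ Suc j)" by simp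
      also have "\<dots> \<le> M ^ Suc j * (2 ^ j * K' * expectation ?G ^ Suc j)"
        using M by (intro mult_left_mono Gam_moment_bound K' K'0 w) auto
      finally show ?thesis unfolding second_moment_Gam[OF w] \<open>k = Suc j\<close> by (simp only: mult.assoc)
    qed
    have "M ^ Suc j * (2 ^ j * K') \<ge> 0" using M K'0 by simp
    then show ?case using main by blast
  qed
qed

end

section \<open>Diagrams as probabilities on the dual group\<close>

lemma expectation_return_pmf: "measure_pmf.expectation (return_pmf x) f = (f x :: real)"
  by simp

lemma pmf_swap:
  fixes \<phi> :: "'a \<Rightarrow> 'b \<Rightarrow> real"
  assumes "\<And>x y. \<bar>\<phi> x y\<bar> \<le> B"
  shows "measure_pmf.expectation p (\<lambda>x. measure_pmf.expectation q (\<phi> x)) = measure_pmf.expectation q (\<lambda>y. measure_pmf.expectation p (\<lambda>x. \<phi> x y))"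
proof (rule pmf_Fubini(3)[where M = "measure_pmf q" and p = p and \<phi> = \<phi> and B = B, symmetric])
  show "sigma_finite_measure (measure_pmf q)" ..
  fix x
  show i: "integrable (measure_pmf q) (\<phi> x)" by (rule pmf_integrable_bounded[where B = B]) (simp add: assms)
  have "measure_pmf.expectation q (\<lambda>y. norm (\<phi> x y)) \<le> measure_pmf.expectation q (\<lambda>y. B)"
    by (rule integral_mono) (use i assms in auto)
  then show "(\<integral>y. norm (\<phi> x y) \<partial>measure_pmf q) \<le> B" by simp
qed

lemma pmf_expectation_abs_le:
  fixes f :: "'a \<Rightarrow> real"
  assumes "\<And>x. x \<in> set_pmf p \<Longrightarrow> 0 \<le> f x \<and> f x \<le> B"
  shows "0 \<le> measure_pmf.expectation p f" "measure_pmf.expectation p f \<le> B"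
proof -
  have i: "integrable (measure_pmf p) f" by (rule pmf_integrable_bounded[where B = B]) (use assms in force)
  show "0 \<le> measure_pmf.expectation p f"
    by (rule integral_nonneg_AE) (use assms in \<open>auto simp: AE_measure_pmf_iff\<close>)
  have "measure_pmf.expectation p f \<le> measure_pmf.expectation p (\<lambda>_. B)"
    by (rule integral_mono_AE) (use i assms in \<open>auto simp: AE_measure_pmf_iff\<close>)
  then show "measure_pmf.expectation p f \<le> B" by simp
qed

lemma pmf_expectation_cong:
  assumes "\<And>x. x \<in> set_pmf p \<Longrightarrow> f x = g x"
  shows "measure_pmf.expectation p f = measure_pmf.expectation p g"
  by (rule integral_cong_AE) (use assms in \<open>auto simp: AE_measure_pmf_iff\<close>)

lemma pmf_expectation_mono:
  fixes f g :: "'a \<Rightarrow> real"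
  assumes "\<And>x. x \<in> set_pmf p \<Longrightarrow> 0 \<le> f x" "\<And>x. x \<in> set_pmf p \<Longrightarrow> f x \<le> g x" "\<And>x. x \<in> set_pmf p \<Longrightarrow> g x \<le> B"
  shows "measure_pmf.expectation p f \<le> measure_pmf.expectation p g"
proof (rule integral_mono_AE)
  show "integrable (measure_pmf p) f" "integrable (measure_pmf p) g"
    by (rule pmf_integrable_bounded[where B = B]; use assms in force)+
qed (use assms in \<open>auto simp: AE_measure_pmf_iff\<close>)

lemma pmf_expectation_point:
  "measure_pmf.expectation p (\<lambda>a. if a = x then f a else (0::real)) = pmf p x * f x"
proof -
  have "measure_pmf.expectation p (\<lambda>a. if a = x then f a else 0) = measure_pmf.expectation p (\<lambda>a. f x * indicator {x} a)"
    by (intro Bochner_Integration.integral_cong) (auto simp: indicator_def)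
  then show ?thesis by (simp add: pmf.rep_eq)
qed

definition unit_ind :: "('g \<Rightarrow> complex) \<Rightarrow> real" where "unit_ind c = (if c = char_one then 1 else 0)"

context isotropic_field
begin

lemma dual_spec_pow: "a \<in> set_pmf (spec_pow k) \<Longrightarrow> a \<in> dual"
  using set_spec_pow by auto

lemma spec_pow_add: "spec_pow (i + j) = bind_pmf (spec_pow i) (\<lambda>x. map_pmf (char_mult x) (spec_pow j))"
proof (induction i)
  case 0
  have "char_mult (char_one :: 'g \<Rightarrow> complex) = (\<lambda>x. x)" by (simp add: fun_eq_iff)
  then show ?case by (simp add: bind_return_pmf map_pmf_ident)
next
  case (Suc i)
  have "char_mult (char_mult a x) = (\<lambda>z. char_mult a (char_mult x z))" for a x :: "'g \<Rightarrow> complex"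
    by (simp add: fun_eq_iff char_mult_assoc)
  then show ?case
    by (simp add: Suc map_bind_pmf bind_assoc_pmf bind_map_pmf map_pmf_comp)
qed

lemma expectation_spec_pow_add:
  fixes f :: "('g \<Rightarrow> complex) \<Rightarrow> real"
  assumes "\<And>y. \<bar>f y\<bar> \<le> B"
  shows "measure_pmf.expectation (spec_pow (i + j)) f =
    measure_pmf.expectation (spec_pow i) (\<lambda>x. measure_pmf.expectation (spec_pow j) (\<lambda>y. f (char_mult x y)))"
  unfolding spec_pow_add by (subst expectation_bind_pmf_real[OF assms]) simp

lemma rhat_char_inv: "rhat m (char_inv a) = cnj (rhat m a)"
  unfolding rhat_def by (subst Bochner_Integration.integral_cnj[symmetric]) (simp add: char_inv_def)

text \<open>The covariance is real, so its Fourier coefficients at \<open>a\<close> and at the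
  inverse of \<open>a\<close> are complex conjugates; being probabilities, they agree.\<close>

lemma pmf_spec_pow_inv: "pmf (spec_pow k) (char_inv a) = pmf (spec_pow k) a"
proof (cases "a \<in> dual")
  case True
  have "complex_of_real (pmf (spec_pow k) (char_inv a)) = of_real (pmf (spec_pow k) a)"
    using rhat_char_inv[of k a] by (simp add: rhat_eq_pmf True char_inv_dual)
  then show ?thesis by (simp only: of_real_eq_iff)
next
  case False
  then have "char_inv a \<notin> dual" using char_inv_dual[of "char_inv a"] by auto
  then show ?thesis using False by (simp add: pmf_spec_pow_notin)
qed

lemma map_char_inv_spec_pow: "map_pmf char_inv (spec_pow k) = spec_pow k"
proof (rule pmf_eqI)
  fix a
  have "pmf (map_pmf char_inv (spec_pow k)) (char_inv (char_inv a)) = pmf (spec_pow k) (char_inv a)"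
    by (rule pmf_map_inj') (metis char_inv_inv injI)
  then show "pmf (map_pmf char_inv (spec_pow k)) a = pmf (spec_pow k) a" by (simp add: pmf_spec_pow_inv)
qed

lemma expectation_spec_pow_inv:
  fixes f :: "('g \<Rightarrow> complex) \<Rightarrow> real"
  shows "measure_pmf.expectation (spec_pow k) (\<lambda>a. f (char_inv a)) = measure_pmf.expectation (spec_pow k) f"
  using integral_map_pmf[of char_inv "spec_pow k" f] by (simp add: map_char_inv_spec_pow)

text \<open>Attaching an independent random character \<open>a \<sim> spec_pow k\<close> to each edge \<open>(i, j, k)\<close>, as \<open>a\<close> at
  vertex \<open>i\<close> and \<open>a\<^sup>-\<^sup>1\<close> at vertex \<open>j\<close>: the probability that the total character is trivial
  at each of the four vertices.\<close>

primrec graph_prob :: "(nat \<times> nat \<times> nat) list \<Rightarrow> (nat \<Rightarrow> 'g \<Rightarrow> complex) \<Rightarrow> real" where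
  "graph_prob [] c = (\<Prod>i<4. unit_ind (c i))"
| "graph_prob (e # es) c = measure_pmf.expectation (spec_pow (snd (snd e)))
     (\<lambda>a. graph_prob es (c(fst e := char_mult (c (fst e)) a, fst (snd e) := char_mult (c (fst (snd e))) (char_inv a))))"

lemma graph_prob_bounds: "0 \<le> graph_prob es c \<and> graph_prob es c \<le> 1"
proof (induction es arbitrary: c)
  case Nil
  show ?case by (auto simp: unit_ind_def intro!: prod_nonneg prod_le_1)
next
  case (Cons e es)
  then show ?case unfolding graph_prob.simps by (intro conjI pmf_expectation_abs_le) auto
qed

definition valid_edges :: "(nat \<times> nat \<times> nat) list \<Rightarrow> bool" where
  "valid_edges es \<longleftrightarrow> (\<forall>(i, j, k)\<in>set es. i < 4 \<and> j < 4 \<and> i \<noteq> j)"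

lemma lessThan_4: "{..<4::nat} = {0, 1, 2, 3}"
  by auto

lemma prod_4: "(\<Prod>i<4. f i) = f 0 * f 1 * f 2 * (f (3::nat) :: 'b::comm_monoid_mult)"
  by (simp add: lessThan_4 mult_ac)

text \<open>An edge adds \<open>a\<close> at one end and its inverse at the other, so the product of
  the four vertex characters is preserved, and all four can become trivial only if that product
  is.\<close>

lemma graph_prob_eq_0:
  assumes "valid_edges es" "\<And>i. c i \<in> dual" "(\<lambda>g. \<Prod>i<4. c i g) \<noteq> char_one"
  shows "graph_prob es c = 0"
  using assms
proof (induction es arbitrary: c)
  case Nil
  have "\<exists>i<4. c i \<noteq> char_one"
  proof (rule ccontr)
    assume "\<not> (\<exists>i<4. c i \<noteq> char_one)"
    then have "(\<lambda>g. \<Prod>i<4. c i g) = char_one" by (auto simp: char_one_def fun_eq_iff intro!: prod.neutral)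
    then show False using Nil by simp
  qed
  then show ?case by (auto simp: unit_ind_def)
next
  case (Cons e es)
  obtain i j k where e: "e = (i, j, k)" by (cases e)
  have ij: "i < 4" "j < 4" "i \<noteq> j" and v: "valid_edges es" using Cons.prems(1) by (auto simp: valid_edges_def e)
  have "graph_prob (e # es) c = measure_pmf.expectation (spec_pow k) (\<lambda>a. 0)"
    unfolding graph_prob.simps e fst_conv snd_conv
  proof (rule pmf_expectation_cong)
    fix a assume "a \<in> set_pmf (spec_pow k)"
    then have a: "a \<in> dual" by (rule dual_spec_pow)
    let ?c = "c(i := char_mult (c i) a, j := char_mult (c j) (char_inv a))"
    have "(\<lambda>g. \<Prod>l<4. ?c l g) = (\<lambda>g. \<Prod>l<4. c l g)"
    proof
      fix g
      have *: "a g * cnj (a g) = 1" by (rule dual_cnj_mult(2)[OF a])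
      have fin: "{..<4} = insert i (insert j ({..<4} - {i, j}))" using ij by auto
      have "(\<Prod>l<4. f l) = f i * f j * (\<Prod>l\<in>{..<4} - {i, j}. f l)" for f :: "nat \<Rightarrow> complex"
        by (subst fin) (use ij in \<open>simp add: mult.assoc\<close>)
      moreover have "(\<Prod>l\<in>{..<4} - {i, j}. ?c l g) = (\<Prod>l\<in>{..<4} - {i, j}. c l g)"
        by (rule prod.cong) auto
      ultimately show "(\<Prod>l<4. ?c l g) = (\<Prod>l<4. c l g)"
        using ij * by (simp add: char_mult_def char_inv_def mult_ac)
    qed
    then show "graph_prob es ?c = 0"
      using Cons.prems by (intro Cons.IH v) (auto intro!: char_mult_dual char_inv_dual a)
  qed
  then show ?case by simp
qed

section \<open>Integrals over four points of the group\<close>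

definition M4 :: "('g \<times> 'g \<times> 'g \<times> 'g) measure" where "M4 = \<mu> \<Otimes>\<^sub>M (\<mu> \<Otimes>\<^sub>M (\<mu> \<Otimes>\<^sub>M \<mu>))"

definition co :: "nat \<Rightarrow> 'g \<times> 'g \<times> 'g \<times> 'g \<Rightarrow> 'g" where
  "co i x = (if i = 0 then fst x else if i = 1 then fst (snd x) else if i = 2 then fst (snd (snd x)) else snd (snd (snd x)))"

lemma co_simps[simp]: "co 0 x = fst x" "co 1 x = fst (snd x)" "co (Suc 0) x = fst (snd x)" "co 2 x = fst (snd (snd x))" "co 3 x = snd (snd (snd x))"
  by (simp_all add: co_def)

lemma co_measurable[measurable]: "co i \<in> measurable M4 \<mu>"
  unfolding co_def[abs_def] M4_def by measurable

lemma prob_space_M4: "prob_space M4"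
proof -
  interpret a: pair_prob_space \<mu> \<mu> ..
  interpret b: pair_prob_space \<mu> "\<mu> \<Otimes>\<^sub>M \<mu>" ..
  interpret c: pair_prob_space \<mu> "\<mu> \<Otimes>\<^sub>M (\<mu> \<Otimes>\<^sub>M \<mu>)" ..
  show ?thesis unfolding M4_def by (rule c.P.prob_space_axioms)
qed

lemma integral_M4:
  fixes f :: "'g \<Rightarrow> 'g \<Rightarrow> 'g \<Rightarrow> 'g \<Rightarrow> 'b::{banach, second_countable_topology}"
  assumes f: "(\<lambda>x. f (co 0 x) (co 1 x) (co 2 x) (co 3 x)) \<in> borel_measurable M4" and B: "\<And>a b c d. norm (f a b c d) \<le> B"
  shows "(\<integral>a. \<integral>b. \<integral>c. \<integral>d. f a b c d \<partial>\<mu> \<partial>\<mu> \<partial>\<mu> \<partial>\<mu>) = (\<integral>x. f (co 0 x) (co 1 x) (co 2 x) (co 3 x) \<partial>M4)"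
proof -
  interpret a: pair_prob_space \<mu> \<mu> ..
  interpret b: pair_prob_space \<mu> "\<mu> \<Otimes>\<^sub>M \<mu>" ..
  interpret c: pair_prob_space \<mu> "\<mu> \<Otimes>\<^sub>M (\<mu> \<Otimes>\<^sub>M \<mu>)" ..
  have m4: "(\<lambda>x. f (fst x) (fst (snd x)) (fst (snd (snd x))) (snd (snd (snd x)))) \<in> borel_measurable (\<mu> \<Otimes>\<^sub>M (\<mu> \<Otimes>\<^sub>M (\<mu> \<Otimes>\<^sub>M \<mu>)))"
    using f by (simp add: M4_def)
  have m3: "(\<lambda>x. f a (fst x) (fst (snd x)) (snd (snd x))) \<in> borel_measurable (\<mu> \<Otimes>\<^sub>M (\<mu> \<Otimes>\<^sub>M \<mu>))" for a
    using measurable_compose[OF measurable_Pair1'[of a \<mu>] m4] by simp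
  have m2: "(\<lambda>x. f a b (fst x) (snd x)) \<in> borel_measurable (\<mu> \<Otimes>\<^sub>M \<mu>)" for a b
    using measurable_compose[OF measurable_Pair1'[of b \<mu>] m3] by simp
  have i4: "integrable (\<mu> \<Otimes>\<^sub>M (\<mu> \<Otimes>\<^sub>M (\<mu> \<Otimes>\<^sub>M \<mu>))) (\<lambda>x. f (fst x) (fst (snd x)) (fst (snd (snd x))) (snd (snd (snd x))))"
    by (rule c.P.integrable_const_bound[OF _ m4, where B = B]) (simp add: B)
  have i3: "integrable (\<mu> \<Otimes>\<^sub>M (\<mu> \<Otimes>\<^sub>M \<mu>)) (\<lambda>x. f a (fst x) (fst (snd x)) (snd (snd x)))" for a
    by (rule b.P.integrable_const_bound[OF _ m3, where B = B]) (simp add: B)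
  have i2: "integrable (\<mu> \<Otimes>\<^sub>M \<mu>) (\<lambda>x. f a b (fst x) (snd x))" for a b
    by (rule a.P.integrable_const_bound[OF _ m2, where B = B]) (simp add: B)
  show ?thesis
    using c.integral_fst'[OF i4] b.integral_fst'[OF i3] a.integral_fst'[OF i2] by (simp add: M4_def)
qed

lemma integral_M4_chars:
  assumes c: "\<And>i. c i \<in> dual"
  shows "(\<integral>x. (\<Prod>i<4. c i (co i x)) \<partial>M4) = of_real (\<Prod>i<4. unit_ind (c i))"
proof -
  note m[measurable] = measurable_continuous[OF dual_continuous[OF c]]
  have "(\<integral>x. (\<Prod>i<4. c i (co i x)) \<partial>M4) = (\<integral>x. c 0 (co 0 x) * c 1 (co 1 x) * c 2 (co 2 x) * c 3 (co 3 x) \<partial>M4)"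
    by (simp only: prod_4)
  also have "\<dots> = (\<integral>x0. \<integral>x1. \<integral>x2. \<integral>x3. c 0 x0 * c 1 x1 * c 2 x2 * c 3 x3 \<partial>\<mu> \<partial>\<mu> \<partial>\<mu> \<partial>\<mu>)"
    by (rule integral_M4[where B = 1, symmetric]) (measurable, simp add: norm_mult dual_norm[OF c])
  also have "\<dots> = (\<integral>x. c 0 x \<partial>\<mu>) * (\<integral>x. c 1 x \<partial>\<mu>) * (\<integral>x. c 2 x \<partial>\<mu>) * (\<integral>x. c 3 x \<partial>\<mu>)"
    by simp
  also have "\<dots> = of_real (\<Prod>i<4. unit_ind (c i))"
    by (simp add: char_integral[OF c] prod_4 unit_ind_def)
  finally show ?thesis .
qed

text \<open>Induction on the edges: the power of \<open>r\<close> on an edge is the average of a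
  random character at \<open>co i x - co j x\<close>, which splits over the two ends and is absorbed
  into the vertex characters. Without edges the claim is orthogonality of characters.\<close>

theorem graph_integral:
  assumes "valid_edges es" "\<And>i. c i \<in> dual"
  shows "(\<integral>x. of_real (\<Prod>(i, j, k)\<leftarrow>es. r (co i x - co j x) ^ k) * (\<Prod>i<4. c i (co i x)) \<partial>M4) = of_real (graph_prob es c)"
  using assms
proof (induction es arbitrary: c)
  case Nil
  then show ?case using integral_M4_chars[of c] by simp
next
  case (Cons e es)
  interpret m: prob_space M4 by (rule prob_space_M4)
  obtain i j k where e: "e = (i, j, k)" by (cases e)
  have ij: "i < 4" "j < 4" "i \<noteq> j" and v: "valid_edges es" using Cons.prems(1) by (auto simp: valid_edges_def e)
  let ?c = "\<lambda>a. c(i := char_mult (c i) a, j := char_mult (c j) (char_inv a))"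
  let ?R = "\<lambda>x. \<Prod>(i, j, k)\<leftarrow>es. r (co i x - co j x) ^ k"
  have rij[measurable]: "(\<lambda>x. r (co i x - co j x)) \<in> borel_measurable M4" for i j
  proof -
    have "(\<lambda>x. (co i x, co j x)) \<in> measurable M4 (\<mu> \<Otimes>\<^sub>M \<mu>)" by measurable
    from measurable_compose[OF measurable_compose[OF this measurable_diff_pair] r_measurable] show ?thesis by simp
  qed
  have mR: "?R \<in> borel_measurable M4"
    by (induction es) (auto simp: case_prod_beta')
  have bR: "\<bar>?R x\<bar> \<le> 1" for x
  proof (induction es)
    case (Cons e es)
    then show ?case
      using r_le by (auto simp: abs_mult power_abs case_prod_beta' intro!: mult_le_one power_le_one)
  qed simp
  have dc: "?c a l \<in> dual" if "a \<in> dual" for a l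
    using Cons.prems(2) that by (auto intro!: char_mult_dual char_inv_dual)
  have step: "of_real (r (co i x - co j x) ^ k) * (\<Prod>l<4. c l (co l x)) = measure_pmf.expectation (spec_pow k) (\<lambda>a. \<Prod>l<4. ?c a l (co l x))" for x
  proof -
    have fin: "{..<4} = insert i (insert j ({..<4} - {i, j}))" using ij by auto
    have pr: "(\<Prod>l<4. f l) = f i * f j * (\<Prod>l\<in>{..<4} - {i, j}. f l)" for f :: "nat \<Rightarrow> complex"
      by (subst fin) (use ij in \<open>simp add: mult.assoc\<close>)
    have "measure_pmf.expectation (spec_pow k) (\<lambda>a. \<Prod>l<4. ?c a l (co l x)) =
      measure_pmf.expectation (spec_pow k) (\<lambda>a. a (co i x - co j x) * (\<Prod>l<4. c l (co l x)))"
    proof (rule pmf_expectation_cong)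
      fix a assume "a \<in> set_pmf (spec_pow k)"
      then have a: "a \<in> dual" by (rule dual_spec_pow)
      have "(\<Prod>l\<in>{..<4} - {i, j}. ?c a l (co l x)) = (\<Prod>l\<in>{..<4} - {i, j}. c l (co l x))"
        by (rule prod.cong) auto
      then show "(\<Prod>l<4. ?c a l (co l x)) = a (co i x - co j x) * (\<Prod>l<4. c l (co l x))"
        unfolding pr using ij by (simp add: char_mult_def char_inv_def dual_diff[OF a] mult_ac)
    qed
    also have "\<dots> = measure_pmf.expectation (spec_pow k) (\<lambda>a. a (co i x - co j x)) * (\<Prod>l<4. c l (co l x))" by simp
    finally show ?thesis unfolding r_power_expectation by (rule sym)
  qed
  have "(\<integral>x. of_real (\<Prod>(i, j, k)\<leftarrow>e # es. r (co i x - co j x) ^ k) * (\<Prod>i<4. c i (co i x)) \<partial>M4) =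
    (\<integral>x. measure_pmf.expectation (spec_pow k) (\<lambda>a. of_real (?R x) * (\<Prod>l<4. ?c a l (co l x))) \<partial>M4)"
  proof (rule Bochner_Integration.integral_cong[OF refl])
    fix x
    have "of_real (\<Prod>(i, j, k)\<leftarrow>e # es. r (co i x - co j x) ^ k) * (\<Prod>i<4. c i (co i x)) =
      of_real (?R x) * (of_real (r (co i x - co j x) ^ k) * (\<Prod>i<4. c i (co i x)))" by (simp add: e mult_ac)
    then show "of_real (\<Prod>(i, j, k)\<leftarrow>e # es. r (co i x - co j x) ^ k) * (\<Prod>i<4. c i (co i x)) =
      measure_pmf.expectation (spec_pow k) (\<lambda>a. of_real (?R x) * (\<Prod>l<4. ?c a l (co l x)))"
      unfolding step by simp
  qed
  also have "\<dots> = measure_pmf.expectation (spec_pow k) (\<lambda>a. \<integral>x. of_real (?R x) * (\<Prod>l<4. ?c a l (co l x)) \<partial>M4)"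
  proof (rule pmf_Fubini(3)[where B = 1])
    show "sigma_finite_measure M4" ..
    fix a assume "a \<in> set_pmf (spec_pow k)"
    then have a: "a \<in> dual" by (rule dual_spec_pow)
    have [measurable]: "?c a l \<in> borel_measurable \<mu>" for l by (rule measurable_continuous[OF dual_continuous[OF dc[OF a]]])
    have b: "norm (of_real (?R x) * (\<Prod>l<4. ?c a l (co l x))) \<le> 1" for x
    proof -
      have "norm (\<Prod>l<4. ?c a l (co l x)) = 1"
        unfolding prod_norm[symmetric] by (rule prod.neutral) (use dual_norm[OF dc[OF a]] in blast)
      then show ?thesis using bR[of x] by (simp add: norm_mult)
    qed
    have mm: "(\<lambda>x. of_real (?R x) * (\<Prod>l<4. ?c a l (co l x))) \<in> borel_measurable M4"
      by (intro borel_measurable_times[OF measurable_compose[OF mR borel_measurable_of_real]] borel_measurable_prod measurable_compose[OF co_measurable]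
          measurable_continuous dual_continuous dc a)
    show i: "integrable M4 (\<lambda>x. of_real (?R x) * (\<Prod>l<4. ?c a l (co l x)))"
      by (rule m.integrable_const_bound[OF _ mm, where B = 1]) (rule AE_I2, rule b)
    have "(\<integral>x. norm (of_real (?R x) * (\<Prod>l<4. ?c a l (co l x))) \<partial>M4) \<le> (\<integral>x. 1 \<partial>M4)"
      by (rule integral_mono[OF integrable_norm[OF i]]) (use b in auto)
    then show "(\<integral>x. norm (of_real (?R x) * (\<Prod>l<4. ?c a l (co l x))) \<partial>M4) \<le> 1" by (simp add: m.prob_space)
  qed
  also have "\<dots> = measure_pmf.expectation (spec_pow k) (\<lambda>a. complex_of_real (graph_prob es (?c a)))"
    by (rule pmf_expectation_cong) (rule Cons.IH[OF v], rule dc, erule dual_spec_pow)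
  finally show ?case by (simp add: e)
qed

text \<open>The sum over \<kappa> in condition 3: one of the two factors
  \<open>pmf (spec_pow i) \<kappa>\<close> is the law under which the expectation is taken.\<close>

definition SS :: "nat \<Rightarrow> nat \<Rightarrow> ('g \<Rightarrow> complex) \<Rightarrow> real" where
  "SS i j \<pi> = measure_pmf.expectation (spec_pow i) (\<lambda>\<kappa>. pmf (spec_pow i) \<kappa> * (pmf (spec_pow j) (char_mult \<pi> (char_inv \<kappa>)))\<^sup>2)"

text \<open>The letters \<open>a\<close> to \<open>f\<close> are the multiplicities of pq, ps, pt,
  qs, qt, st. The edges ps and qt stand last, so their characters are the innermost expectations and
  can be eliminated first.\<close>

abbreviation "full_graph p q s t a b c d e f \<equiv>
  [(p, q, a), (p, t, c), (s, t, f), (q, s, d), (p, s, b), (q, t, e)]"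

text \<open>Conditionally on the other four edges, the vertex constraints at \<open>p\<close> and \<open>q\<close> determine the characters on the
  opposite edges \<open>ps\<close> and \<open>qt\<close>; the remaining two constraints coincide.\<close>

lemma graph_prob_formula:
  assumes pi: "\<pi> \<in> dual" and perm: "{p, q, s, t} = {..<4}" "distinct [p, q, s, t]"
    and c: "c p = char_inv \<pi>" "c q = char_inv \<pi>" "c s = \<pi>" "c t = \<pi>"
  shows "graph_prob (full_graph p q s t a b cc d e f) c =
    measure_pmf.expectation (spec_pow a) (\<lambda>a12. measure_pmf.expectation (spec_pow cc) (\<lambda>a14.
    measure_pmf.expectation (spec_pow f) (\<lambda>a34. measure_pmf.expectation (spec_pow d) (\<lambda>a23.
      pmf (spec_pow b) (char_mult \<pi> (char_inv (char_mult a12 a14))) * pmf (spec_pow e) (char_mult \<pi> (char_mult a12 (char_inv a23))) *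
      (if char_mult a12 a14 = char_mult a23 (char_inv a34) then 1 else 0)))))" (is "_ = ?rhs")
proof -
  have d: "p \<noteq> q" "p \<noteq> s" "p \<noteq> t" "q \<noteq> s" "q \<noteq> t" "s \<noteq> t" using perm(2) by auto
  have prod: "(\<Prod>i<4. F i) = F p * (F q * (F s * F t))" for F :: "nat \<Rightarrow> real"
    unfolding perm(1)[symmetric] using d by simp
  have main: "measure_pmf.expectation (spec_pow b) (\<lambda>a13. measure_pmf.expectation (spec_pow e) (\<lambda>a24.
       unit_ind (char_mult (char_mult (char_mult (char_inv \<pi>) a12) a14) a13) *
       (unit_ind (char_mult (char_mult (char_mult (char_inv \<pi>) (char_inv a12)) a23) a24) *
       (unit_ind (char_mult (char_mult (char_mult \<pi> a34) (char_inv a23)) (char_inv a13)) *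
        unit_ind (char_mult (char_mult (char_mult \<pi> (char_inv a14)) (char_inv a34)) (char_inv a24)))))) =
       pmf (spec_pow b) (char_mult \<pi> (char_inv (char_mult a12 a14))) * pmf (spec_pow e) (char_mult \<pi> (char_mult a12 (char_inv a23))) *
      (if char_mult a12 a14 = char_mult a23 (char_inv a34) then 1 else 0)"
    if "a12 \<in> set_pmf (spec_pow a)" "a14 \<in> set_pmf (spec_pow cc)" "a34 \<in> set_pmf (spec_pow f)" "a23 \<in> set_pmf (spec_pow d)"
    for a12 a14 a34 a23
  proof -
    from that have D: "a12 \<in> dual" "a14 \<in> dual" "a34 \<in> dual" "a23 \<in> dual" by (auto intro: dual_spec_pow)
    let ?x = "char_mult \<pi> (char_inv (char_mult a12 a14))" and ?y = "char_mult \<pi> (char_mult a12 (char_inv a23))"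
    let ?K = "if char_mult a12 a14 = char_mult a23 (char_inv a34) then 1 else 0 :: real"
    have nz: "z \<noteq> 0" if "cmod z = 1" for z using that by auto
    have inner: "unit_ind (char_mult (char_mult (char_mult (char_inv \<pi>) a12) a14) a13) *
       (unit_ind (char_mult (char_mult (char_mult (char_inv \<pi>) (char_inv a12)) a23) a24) *
       (unit_ind (char_mult (char_mult (char_mult \<pi> a34) (char_inv a23)) (char_inv a13)) *
        unit_ind (char_mult (char_mult (char_mult \<pi> (char_inv a14)) (char_inv a34)) (char_inv a24)))) =
       (if a13 = ?x then if a24 = ?y then ?K else 0 else 0)"
      if A: "a13 \<in> dual" "a24 \<in> dual" for a13 a24
    proof -
      have iff: "char_mult u v = char_one \<longleftrightarrow> v = char_inv u" if "u \<in> dual" for u v :: "'g \<Rightarrow> complex"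
        using char_mult_eq_iff[OF that, of v char_one] by simp
      have 1: "char_mult (char_mult (char_mult (char_inv \<pi>) a12) a14) a13 = char_one \<longleftrightarrow> a13 = ?x"
        by (subst iff) (auto intro!: char_mult_dual char_inv_dual pi D simp: char_inv_mult char_mult_assoc)
      have 2: "char_mult (char_mult (char_mult (char_inv \<pi>) (char_inv a12)) a23) a24 = char_one \<longleftrightarrow> a24 = ?y"
        by (subst iff) (auto intro!: char_mult_dual char_inv_dual pi D simp: char_inv_mult char_mult_assoc)
      have canc: "char_mult (char_mult \<pi> u) (char_mult (char_inv \<pi>) v) = char_mult u v" for u v :: "'g \<Rightarrow> complex"
      proof
        fix g
        have "(\<pi> g * u g) * (cnj (\<pi> g) * v g) = (\<pi> g * cnj (\<pi> g)) * (u g * v g)" by (simp only: mult_ac)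
        then show "char_mult (char_mult \<pi> u) (char_mult (char_inv \<pi>) v) g = char_mult u v g"
          by (simp add: char_mult_def char_inv_def dual_cnj_mult[OF pi])
      qed
      have 3: "char_mult (char_mult (char_mult \<pi> a34) (char_inv a23)) (char_inv ?x) = char_one \<longleftrightarrow> char_mult a12 a14 = char_mult a23 (char_inv a34)"
      proof -
        have "char_mult (char_mult (char_mult \<pi> a34) (char_inv a23)) (char_inv ?x) = char_mult (char_mult \<pi> (char_mult a34 (char_inv a23))) (char_mult (char_inv \<pi>) (char_mult a12 a14))"
          by (simp only: char_inv_mult char_mult_assoc char_inv_inv)
        also have "\<dots> = char_mult (char_mult a34 (char_inv a23)) (char_mult a12 a14)" by (rule canc)
        finally have eq: "char_mult (char_mult (char_mult \<pi> a34) (char_inv a23)) (char_inv ?x) = char_mult (char_mult a34 (char_inv a23)) (char_mult a12 a14)" .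
        show ?thesis unfolding eq iff[OF char_mult_dual[OF D(3) char_inv_dual[OF D(4)]]]
          by (simp only: char_inv_mult char_inv_inv char_mult_commute)
      qed
      have 4: "char_mult (char_mult (char_mult \<pi> (char_inv a14)) (char_inv a34)) (char_inv ?y) = char_one \<longleftrightarrow> char_mult a12 a14 = char_mult a23 (char_inv a34)"
      proof -
        have "char_mult (char_mult (char_mult \<pi> (char_inv a14)) (char_inv a34)) (char_inv ?y) = char_mult (char_mult \<pi> (char_mult (char_inv a14) (char_inv a34))) (char_mult (char_inv \<pi>) (char_mult (char_inv a12) a23))"
          by (simp only: char_inv_mult char_mult_assoc char_inv_inv)
        also have "\<dots> = char_mult (char_mult (char_inv a14) (char_inv a34)) (char_mult (char_inv a12) a23)" by (rule canc)
        also have "\<dots> = char_mult (char_inv (char_mult a12 a14)) (char_mult a23 (char_inv a34))"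
          by (simp only: char_inv_mult char_mult_ac)
        finally have eq: "char_mult (char_mult (char_mult \<pi> (char_inv a14)) (char_inv a34)) (char_inv ?y) = char_mult (char_inv (char_mult a12 a14)) (char_mult a23 (char_inv a34))" .
        show ?thesis unfolding eq iff[OF char_inv_dual[OF char_mult_dual[OF D(1,2)]]] char_inv_inv by auto
      qed
      show ?thesis using 3 4 unfolding unit_ind_def 1 2 by (cases "a13 = ?x"; cases "a24 = ?y") auto
    qed
    have "measure_pmf.expectation (spec_pow b) (\<lambda>a13. measure_pmf.expectation (spec_pow e) (\<lambda>a24.
       unit_ind (char_mult (char_mult (char_mult (char_inv \<pi>) a12) a14) a13) *
       (unit_ind (char_mult (char_mult (char_mult (char_inv \<pi>) (char_inv a12)) a23) a24) *
       (unit_ind (char_mult (char_mult (char_mult \<pi> a34) (char_inv a23)) (char_inv a13)) *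
        unit_ind (char_mult (char_mult (char_mult \<pi> (char_inv a14)) (char_inv a34)) (char_inv a24)))))) =
       measure_pmf.expectation (spec_pow b) (\<lambda>a13. measure_pmf.expectation (spec_pow e) (\<lambda>a24. if a13 = ?x then if a24 = ?y then ?K else 0 else 0))"
      by (intro pmf_expectation_cong inner) (auto intro: dual_spec_pow)
    also have "\<dots> = measure_pmf.expectation (spec_pow b) (\<lambda>a13. if a13 = ?x then pmf (spec_pow e) ?y * ?K else 0)"
      by (rule pmf_expectation_cong) (use pmf_expectation_point[of "spec_pow e" ?y "\<lambda>_. ?K"] in \<open>simp cong: if_cong\<close>)
    also have "\<dots> = pmf (spec_pow b) ?x * pmf (spec_pow e) ?y * ?K"
      by (subst pmf_expectation_point) simp
    finally show ?thesis .
  qed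
  have "graph_prob (full_graph p q s t a b cc d e f) c =
    measure_pmf.expectation (spec_pow a) (\<lambda>a12. measure_pmf.expectation (spec_pow cc) (\<lambda>a14.
    measure_pmf.expectation (spec_pow f) (\<lambda>a34. measure_pmf.expectation (spec_pow d) (\<lambda>a23.
    measure_pmf.expectation (spec_pow b) (\<lambda>a13. measure_pmf.expectation (spec_pow e) (\<lambda>a24.
       unit_ind (char_mult (char_mult (char_mult (char_inv \<pi>) a12) a14) a13) *
       (unit_ind (char_mult (char_mult (char_mult (char_inv \<pi>) (char_inv a12)) a23) a24) *
       (unit_ind (char_mult (char_mult (char_mult \<pi> a34) (char_inv a23)) (char_inv a13)) *
        unit_ind (char_mult (char_mult (char_mult \<pi> (char_inv a14)) (char_inv a34)) (char_inv a24))))))))))"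
    using d not_sym[OF d(1)] not_sym[OF d(2)] not_sym[OF d(3)] not_sym[OF d(4)] not_sym[OF d(5)] not_sym[OF d(6)]
    by (simp only: graph_prob.simps fst_conv snd_conv fun_upd_same fun_upd_other fun_upd_apply if_True if_False prod c refl not_False_eq_True simp_thms)
  also have "\<dots> = ?rhs"
    by (intro pmf_expectation_cong main)
  finally show ?thesis .
qed

text \<open>The joint law of the characters on pq, pt, st, qs; under this single expectation the
  AM-GM inequality can be applied pointwise.\<close>

definition quad_pmf :: "nat \<Rightarrow> nat \<Rightarrow> nat \<Rightarrow> nat \<Rightarrow> (('g \<Rightarrow> complex) \<times> ('g \<Rightarrow> complex) \<times> ('g \<Rightarrow> complex) \<times> ('g \<Rightarrow> complex)) pmf" where
  "quad_pmf a c f d = bind_pmf (spec_pow a) (\<lambda>w. bind_pmf (spec_pow c) (\<lambda>x. bind_pmf (spec_pow f) (\<lambda>y. map_pmf (\<lambda>z. (w, x, y, z)) (spec_pow d))))"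

lemma expectation_quad_pmf:
  fixes \<phi> :: "_ \<Rightarrow> real"
  assumes "\<And>z. \<bar>\<phi> z\<bar> \<le> B"
  shows "measure_pmf.expectation (quad_pmf a c f d) \<phi> = measure_pmf.expectation (spec_pow a) (\<lambda>w. measure_pmf.expectation (spec_pow c) (\<lambda>x.
    measure_pmf.expectation (spec_pow f) (\<lambda>y. measure_pmf.expectation (spec_pow d) (\<lambda>z. \<phi> (w, x, y, z)))))"
  unfolding quad_pmf_def by (simp add: expectation_bind_pmf_real[OF assms])

lemma set_quad_pmf: "(w, x, y, z) \<in> set_pmf (quad_pmf a c f d) \<Longrightarrow> w \<in> dual \<and> x \<in> dual \<and> y \<in> dual \<and> z \<in> dual"
  using dual_spec_pow by (auto simp: quad_pmf_def)

lemma pmf_convolution_point: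
  "measure_pmf.expectation (spec_pow f) (\<lambda>y. measure_pmf.expectation (spec_pow d) (\<lambda>z. if \<kappa> = char_mult z (char_inv y) then 1 else 0 :: real)) = pmf (spec_pow (f + d)) \<kappa>"
proof -
  have "measure_pmf.expectation (spec_pow f) (\<lambda>y. measure_pmf.expectation (spec_pow d) (\<lambda>z. if \<kappa> = char_mult z (char_inv y) then 1 else 0 :: real)) =
    measure_pmf.expectation (spec_pow f) (\<lambda>y. measure_pmf.expectation (spec_pow d) (\<lambda>z. if char_mult y z = \<kappa> then 1 else 0 :: real))"
    by (subst expectation_spec_pow_inv) (simp add: char_mult_commute eq_commute)
  also have "\<dots> = measure_pmf.expectation (spec_pow (f + d)) (\<lambda>z. if z = \<kappa> then 1 else 0)"
    by (rule expectation_spec_pow_add[where B = 1, symmetric]) simp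
  finally show ?thesis using pmf_expectation_point[of "spec_pow (f + d)" \<kappa> "\<lambda>_. 1"] by simp
qed

lemma quad_expectation:
  assumes h: "\<And>\<kappa>. \<bar>h \<kappa> :: real\<bar> \<le> 1"
  shows "measure_pmf.expectation (spec_pow a) (\<lambda>w. measure_pmf.expectation (spec_pow c) (\<lambda>x.
    measure_pmf.expectation (spec_pow f) (\<lambda>y. measure_pmf.expectation (spec_pow d) (\<lambda>z.
      h (char_mult w x) * (if char_mult w x = char_mult z (char_inv y) then 1 else 0))))) =
    measure_pmf.expectation (spec_pow (a + c)) (\<lambda>\<kappa>. h \<kappa> * pmf (spec_pow (f + d)) \<kappa>)"
proof -
  have b: "\<bar>h \<kappa> * pmf (spec_pow (f + d)) \<kappa>\<bar> \<le> 1" for \<kappa>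
    using h[of \<kappa>] by (auto simp: abs_mult pmf_le_1 intro!: mult_le_one)
  show ?thesis unfolding expectation_spec_pow_add[OF b] by (simp add: pmf_convolution_point)
qed

lemma SS_eq: "SS (a + c) b \<pi> = measure_pmf.expectation (spec_pow (a + c)) (\<lambda>\<kappa>. (pmf (spec_pow b) (char_mult \<pi> (char_inv \<kappa>)))\<^sup>2 * pmf (spec_pow (a + c)) \<kappa>)"
  by (simp add: SS_def mult.commute)

lemma pmf_sq_le: "\<bar>(pmf p x)\<^sup>2\<bar> \<le> 1"
  by (simp add: pmf_le_1 power_le_one)

text \<open>AM-GM on the two opposite edges \<open>ps\<close> and \<open>qt\<close>.\<close>

lemma graph_prob_le_SS:
  assumes pi: "\<pi> \<in> dual" and perm: "{p, q, s, t} = {..<4}" "distinct [p, q, s, t]"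
    and c: "c p = char_inv \<pi>" "c q = char_inv \<pi>" "c s = \<pi>" "c t = \<pi>"
  shows "graph_prob (full_graph p q s t a b d d b a) c \<le> SS (a + d) b \<pi>"
proof -
  let ?h = "\<lambda>\<kappa>. (pmf (spec_pow b) (char_mult \<pi> (char_inv \<kappa>)))\<^sup>2"
  define J where "J = (\<lambda>(w, x, y, z). pmf (spec_pow b) (char_mult \<pi> (char_inv (char_mult w x))) * pmf (spec_pow b) (char_mult \<pi> (char_mult w (char_inv z))) *
      (if char_mult w x = char_mult z (char_inv y) then 1 else 0 :: real))"
  define X where "X = (\<lambda>(w, x, y, z). ?h (char_mult w x) * (if char_mult w x = char_mult z (char_inv y) then 1 else 0 :: real))"
  define Y where "Y = (\<lambda>(w, x, y, z). ?h (char_mult y x) * (if char_mult y x = char_mult z (char_inv w) then 1 else 0 :: real))"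
  have bJ: "\<bar>J u\<bar> \<le> 1" and bX: "\<bar>X u\<bar> \<le> 1" and bY: "\<bar>Y u\<bar> \<le> 1" for u
    using pmf_sq_le by (auto simp: J_def X_def Y_def pmf_le_1 abs_mult case_prod_beta' intro!: mult_le_one)
  let ?Q = "quad_pmf a d a d"
  have EX: "measure_pmf.expectation ?Q X = SS (a + d) b \<pi>"
    unfolding expectation_quad_pmf[OF bX] SS_eq
    unfolding X_def prod.case by (rule quad_expectation[of ?h]) (rule pmf_sq_le)
  have EY: "measure_pmf.expectation ?Q Y = SS (a + d) b \<pi>"
  proof -
    let ?E = "\<lambda>k. measure_pmf.expectation (spec_pow k)"
    have bE: "\<bar>?E k g\<bar> \<le> 1" if "\<And>x. \<bar>g x\<bar> \<le> 1" for k and g :: "_ \<Rightarrow> real"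
    proof -
      have "\<bar>?E k g\<bar> \<le> ?E k (\<lambda>x. \<bar>g x\<bar>)" using integral_norm_bound[of "spec_pow k" g] by simp
      also have "\<dots> \<le> 1" by (rule pmf_expectation_abs_le) (use that in auto)
      finally show ?thesis .
    qed
    \<comment> \<open>The characters \<open>w\<close> and \<open>y\<close> have the same law; moving
      expectations past each other until the two are exchanged brings \<open>Y\<close> into the form
      of \<open>X\<close>.\<close>
    have "measure_pmf.expectation ?Q Y = ?E a (\<lambda>w. ?E d (\<lambda>x. ?E a (\<lambda>y. ?E d (\<lambda>z. Y (w, x, y, z)))))"
      by (rule expectation_quad_pmf[OF bY])
    also have "\<dots> = ?E d (\<lambda>x. ?E a (\<lambda>w. ?E a (\<lambda>y. ?E d (\<lambda>z. Y (w, x, y, z)))))"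
      by (rule pmf_swap[where B = 1]) (intro bE bY)
    also have "\<dots> = ?E d (\<lambda>x. ?E a (\<lambda>y. ?E a (\<lambda>w. ?E d (\<lambda>z. Y (w, x, y, z)))))"
      by (intro pmf_expectation_cong pmf_swap[where B = 1] bE bY)
    also have "\<dots> = ?E a (\<lambda>y. ?E d (\<lambda>x. ?E a (\<lambda>w. ?E d (\<lambda>z. Y (w, x, y, z)))))"
      by (rule pmf_swap[where B = 1]) (intro bE bY)
    also have "\<dots> = SS (a + d) b \<pi>"
      unfolding SS_eq Y_def prod.case by (rule quad_expectation[of ?h]) (rule pmf_sq_le)
    finally show ?thesis .
  qed
  have iX: "integrable ?Q X" "integrable ?Q Y" "integrable ?Q J"
    by (rule pmf_integrable_bounded[where B = 1]; use bX bY bJ in simp)+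
  have "graph_prob (full_graph p q s t a b d d b a) c = measure_pmf.expectation ?Q J"
    unfolding graph_prob_formula[OF pi perm c] expectation_quad_pmf[OF bJ] by (simp only: J_def prod.case)
  also have "\<dots> \<le> measure_pmf.expectation ?Q (\<lambda>u. (X u + Y u) / 2)"
  proof (rule integral_mono_AE)
    show "AE u in ?Q. J u \<le> (X u + Y u) / 2"
      unfolding AE_measure_pmf_iff
    proof (clarify)
      fix w x y z assume "(w, x, y, z) \<in> set_pmf ?Q"
      then have D: "w \<in> dual" "x \<in> dual" "y \<in> dual" "z \<in> dual" using set_quad_pmf by auto
      show "J (w, x, y, z) \<le> (X (w, x, y, z) + Y (w, x, y, z)) / 2"
      proof (cases "char_mult w x = char_mult z (char_inv y)")
        case True
        \<comment> \<open>The constraint is symmetric in \<open>w\<close> and \<open>y\<close>, so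
          the second of the opposite edges is governed by \<open>y\<close> times \<open>x\<close>
          just as the first is by \<open>w\<close> times \<open>x\<close>.\<close>
        have yx: "char_mult y x = char_mult z (char_inv w)"
        proof
          fix g
          have "w g * x g = z g * cnj (y g)" using fun_cong[OF True, of g] by (simp add: char_mult_def char_inv_def)
          then have "y g * cnj (w g) * (w g * x g) = y g * cnj (w g) * (z g * cnj (y g))" by simp
          moreover have "y g * cnj (w g) * (w g * x g) = (cnj (w g) * w g) * (y g * x g)" by (simp only: mult_ac)
          moreover have "y g * cnj (w g) * (z g * cnj (y g)) = (y g * cnj (y g)) * (z g * cnj (w g))" by (simp only: mult_ac)
          ultimately show "char_mult y x g = char_mult z (char_inv w) g"
            by (simp add: char_mult_def char_inv_def dual_cnj_mult[OF D(1)] dual_cnj_mult[OF D(3)])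
        qed
        have "char_mult w (char_inv z) = char_inv (char_mult y x)" unfolding yx by (simp add: char_inv_mult char_mult_commute)
        then have "J (w, x, y, z) = pmf (spec_pow b) (char_mult \<pi> (char_inv (char_mult w x))) * pmf (spec_pow b) (char_mult \<pi> (char_inv (char_mult y x)))"
          using True by (simp add: J_def)
        moreover have "X (w, x, y, z) = ?h (char_mult w x)" using True by (simp add: X_def)
        moreover have "Y (w, x, y, z) = ?h (char_mult y x)" using yx by (simp add: Y_def)
        ultimately show ?thesis
          using sum_squares_bound[of "pmf (spec_pow b) (char_mult \<pi> (char_inv (char_mult w x)))" "pmf (spec_pow b) (char_mult \<pi> (char_inv (char_mult y x)))"]
          by simp
      qed (simp add: J_def X_def Y_def)
    qed
  qed (use iX in auto)
  also have "\<dots> = SS (a + d) b \<pi>" using iX by (simp add: EX EY)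
  finally show ?thesis .
qed

text \<open>Without the edges pq and st the constraint forces the characters on pt and qs to agree,
  hence also those on ps and qt, and AM-GM becomes an equality.\<close>

lemma graph_prob_cycle:
  assumes pi: "\<pi> \<in> dual" and perm: "{p, q, s, t} = {..<4}" "distinct [p, q, s, t]"
    and c: "c p = char_inv \<pi>" "c q = char_inv \<pi>" "c s = \<pi>" "c t = \<pi>"
  shows "graph_prob (full_graph p q s t 0 b d d b 0) c = SS d b \<pi>"
proof -
  have "graph_prob (full_graph p q s t 0 b d d b 0) c =
    measure_pmf.expectation (spec_pow d) (\<lambda>x. measure_pmf.expectation (spec_pow d) (\<lambda>z.
      if z = x then pmf (spec_pow b) (char_mult \<pi> (char_inv x)) * pmf (spec_pow b) (char_mult \<pi> (char_inv z)) else 0))"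
    unfolding graph_prob_formula[OF pi perm c] spec_pow.simps expectation_return_pmf char_mult_one char_inv_one
    by (intro pmf_expectation_cong) auto
  also have "\<dots> = SS d b \<pi>"
    unfolding pmf_expectation_point SS_def by (simp add: power2_eq_square)
  finally show ?thesis .
qed

text \<open>The edges pq and st join vertices with equal characters, so trivial totals at
  \<open>p\<close> and \<open>q\<close> would make the character on pq equal both to \<pi> and to
  its inverse.\<close>

lemma graph_prob_two_edges:
  assumes pi: "\<pi> \<in> dual" "char_inv \<pi> \<noteq> \<pi>" and perm: "{p, q, s, t} = {..<4}" "distinct [p, q, s, t]"
    and c: "c p = char_inv \<pi>" "c q = char_inv \<pi>" "c s = \<pi>" "c t = \<pi>"
  shows "graph_prob (full_graph p q s t a 0 0 0 0 a) c = 0"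
proof -
  have z: "pmf (return_pmf char_one) (char_mult \<pi> (char_inv w)) * pmf (return_pmf char_one) (char_mult \<pi> w) = 0" for w :: "'g \<Rightarrow> complex"
  proof (rule ccontr)
    assume "pmf (return_pmf char_one) (char_mult \<pi> (char_inv w)) * pmf (return_pmf char_one) (char_mult \<pi> w) \<noteq> 0"
    then have "char_mult \<pi> (char_inv w) = char_one" "char_mult \<pi> w = char_one" by (auto simp: indicator_def split: if_splits)
    then have "char_inv w = char_inv \<pi>" "w = char_inv \<pi>" using char_mult_eq_iff[OF pi(1), of _ char_one] by auto
    then show False using pi(2) by (metis char_inv_inv)
  qed
  show ?thesis unfolding graph_prob_formula[OF pi(1) perm c] spec_pow.simps expectation_return_pmf char_mult_one char_inv_one z by simp
qed

lemma SS_0: "SS 0 m \<pi> = (pmf (spec_pow m) \<pi>)\<^sup>2"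
  by (simp add: SS_def)

lemma SS_m_0:
  assumes "\<pi> \<in> dual" shows "SS m 0 \<pi> = (pmf (spec_pow m) \<pi>)\<^sup>2"
proof -
  have iff: "char_mult \<pi> (char_inv \<kappa>) = char_one \<longleftrightarrow> \<kappa> = \<pi>" for \<kappa>
    using char_mult_eq_iff[OF assms, of "char_inv \<kappa>" char_one] by (metis char_inv_inv char_mult_one(2))
  have "SS m 0 \<pi> = measure_pmf.expectation (spec_pow m) (\<lambda>\<kappa>. if \<kappa> = \<pi> then pmf (spec_pow m) \<kappa> else 0)"
    unfolding SS_def by (intro pmf_expectation_cong) (simp add: iff indicator_def eq_commute[of char_one])
  then show ?thesis by (simp add: pmf_expectation_point power2_eq_square)
qed

lemma SS_nonneg: "SS i j \<pi> \<ge> 0"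
  unfolding SS_def by (rule integral_nonneg_AE) (auto intro!: AE_I2)

end

section \<open>Fourth moments\<close>

definition triples :: "nat \<Rightarrow> (nat \<times> nat \<times> nat) set" where
  "triples n = {(a, b, c). a + b + c = n}"

lemma finite_triples: "finite (triples n)"
  by (rule finite_subset[of _ "{..n} \<times> {..n} \<times> {..n}"]) (auto simp: triples_def)

text \<open>The number of diagrams on four vertices of degree \<open>n\<close> whose three pairs of
  opposite edges have multiplicities \<open>a\<close>, \<open>b\<close>, \<open>c\<close>:
  \<open>fact n ^ 4\<close> divided by the square of
  \<open>fact a * fact b * fact c\<close>.\<close>

definition tcoef :: "nat \<Rightarrow> nat \<Rightarrow> nat \<Rightarrow> nat \<Rightarrow> real" where
  "tcoef n a b c = ((fact n)\<^sup>2 / (fact a * fact b * fact c))\<^sup>2"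

lemma tcoef_nonneg: "tcoef n a b c \<ge> 0"
  by (simp add: tcoef_def)

text \<open>Adding the four degree equations in pairs shows that opposite edges have equal
  multiplicity when all degrees agree.\<close>

lemma graphs4_regular: "(a, b, c, d, e, f) \<in> graphs4 n n n n \<longleftrightarrow> (a, b, c) \<in> triples n \<and> d = c \<and> e = b \<and> f = a"
  unfolding graphs4_def triples_def by auto

lemma gsum_regular:
  "gsum x12 x13 x14 x23 x24 x34 n n n n =
    (\<Sum>(a, b, c)\<in>triples n. dpow x12 a * dpow x13 b * dpow x14 c * dpow x23 c * dpow x24 b * dpow x34 a)"
  unfolding gsum_def
  by (rule sum.reindex_bij_witness[where i = "\<lambda>(a, b, c). (a, b, c, c, b, a)" and j = "\<lambda>(a, b, c, d, e, f). (a, b, c)"])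
    (auto simp: graphs4_regular)

context isotropic_field
begin

definition ker :: "nat \<Rightarrow> nat \<Rightarrow> nat \<Rightarrow> 'g \<times> 'g \<times> 'g \<times> 'g \<Rightarrow> real" where
  "ker A B D x = (r (co 0 x - co 1 x) * r (co 2 x - co 3 x)) ^ A * (r (co 0 x - co 2 x) * r (co 1 x - co 3 x)) ^ B *
     (r (co 0 x - co 3 x) * r (co 1 x - co 2 x)) ^ D"

lemma r_co_measurable[measurable]: "(\<lambda>x. r (co i x - co j x)) \<in> borel_measurable M4"
proof -
  have "(\<lambda>x. (co i x, co j x)) \<in> measurable M4 (\<mu> \<Otimes>\<^sub>M \<mu>)" by measurable
  from measurable_compose[OF measurable_compose[OF this measurable_diff_pair] r_measurable] show ?thesis by simp
qed

lemma ker_measurable[measurable]: "ker A B D \<in> borel_measurable M4"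
  unfolding ker_def[abs_def] by measurable

lemma ker_le: "\<bar>ker A B D x\<bar> \<le> 1"
  unfolding ker_def abs_mult power_abs by (intro mult_le_one power_le_one mult_nonneg_nonneg zero_le_power abs_ge_zero r_le)

lemma hmoment4_ker:
  "hmoment4 (co 0 x) (co 1 x) (co 2 x) (co 3 x) n n n n = (\<Sum>(a, b, c)\<in>triples n. tcoef n a b c * ker a b c x)"
  unfolding hmoment4_eq gsum_regular sum_distrib_left
  by (intro sum.cong) (auto simp: tcoef_def ker_def dpow_def power_mult_distrib power_divide power2_eq_square mult_ac)

definition gval :: "nat \<Rightarrow> nat \<Rightarrow> nat \<Rightarrow> (nat \<Rightarrow> 'g \<Rightarrow> complex) \<Rightarrow> real" where
  "gval A B D c = graph_prob (full_graph 0 1 2 3 A B D D B A) c"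

lemma gval_nonneg: "0 \<le> gval A B D c"
  unfolding gval_def by (rule conjunct1[OF graph_prob_bounds])

lemma ker_integral:
  assumes "\<And>i. c i \<in> dual"
  shows "(\<integral>x. of_real (ker A B D x) * (\<Prod>i<4. c i (co i x)) \<partial>M4) = of_real (gval A B D c)"
proof -
  have "ker A B D x = (\<Prod>(i, j, k)\<leftarrow>full_graph 0 1 2 3 A B D D B A. r (co i x - co j x) ^ k)" for x
    by (simp add: ker_def power_mult_distrib mult_ac)
  then show ?thesis
    unfolding gval_def using graph_integral[of "full_graph 0 1 2 3 A B D D B A" c] assms by (simp add: valid_edges_def)
qed

text \<open>Reordering edges or vertices would mean permuting nested expectations; instead both
  values are identified with the same integral over four points.\<close>

lemma gval_relabel:
  assumes "\<And>i. c i \<in> dual" "valid_edges es" "\<And>x. (\<Prod>(i, j, k)\<leftarrow>es. r (co i x - co j x) ^ k) = ker A B D x"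
  shows "gval A B D c = graph_prob es c"
  using graph_integral[OF assms(2,1)] ker_integral[OF assms(1), of A B D] by (simp only: assms(3) of_real_eq_iff)

lemma gval_perms:
  assumes c: "\<And>i. c i \<in> dual"
  shows "gval A B D c = graph_prob (full_graph 0 1 3 2 A D B B D A) c"
    "gval A B D c = graph_prob (full_graph 2 3 0 1 A B D D B A) c"
    "gval A B D c = graph_prob (full_graph 2 3 1 0 A D B B D A) c"
    "gval A B D c = graph_prob (full_graph 0 2 1 3 B A D D A B) c"
    "gval A B D c = graph_prob (full_graph 1 3 0 2 B A D D A B) c"
    "gval A B D c = graph_prob (full_graph 0 3 1 2 D A B B A D) c"
    "gval A B D c = graph_prob (full_graph 1 2 0 3 D A B B A D) c"
  by (intro gval_relabel c; simp add: valid_edges_def ker_def power_mult_distrib mult_ac r_diff_commute)+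

lemma gval_sum_integral:
  assumes c: "\<And>i. c i \<in> dual" and S: "finite S"
  shows "(\<integral>x. of_real (\<Sum>t\<in>S. \<kappa> t * ker (A t) (B t) (D t) x) * (\<Prod>i<4. c i (co i x)) \<partial>M4) = of_real (\<Sum>t\<in>S. \<kappa> t * gval (A t) (B t) (D t) c)"
proof -
  interpret m: prob_space M4 by (rule prob_space_M4)
  note [measurable] = measurable_continuous[OF dual_continuous[OF c]]
  have i: "integrable M4 (\<lambda>x. of_real (ker (A t) (B t) (D t) x) * (\<Prod>i<4. c i (co i x)))" for t
  proof (rule m.integrable_const_bound[where B = 1])
    have "norm (\<Prod>i<4. c i (co i x)) = 1" for x
      unfolding prod_norm[symmetric] by (rule prod.neutral) (use dual_norm[OF c] in blast)
    then show "AE x in M4. norm (of_real (ker (A t) (B t) (D t) x) * (\<Prod>i<4. c i (co i x))) \<le> 1"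
      using ker_le by (simp add: norm_mult)
  qed measurable
  have "(\<integral>x. of_real (\<Sum>t\<in>S. \<kappa> t * ker (A t) (B t) (D t) x) * (\<Prod>i<4. c i (co i x)) \<partial>M4) =
     (\<integral>x. (\<Sum>t\<in>S. of_real (\<kappa> t) * (of_real (ker (A t) (B t) (D t) x) * (\<Prod>i<4. c i (co i x)))) \<partial>M4)"
    by (simp add: sum_distrib_right mult.assoc)
  also have "\<dots> = (\<Sum>t\<in>S. of_real (\<kappa> t) * (\<integral>x. of_real (ker (A t) (B t) (D t) x) * (\<Prod>i<4. c i (co i x)) \<partial>M4))"
    using i by (subst Bochner_Integration.integral_sum) (auto intro!: integrable_mult_right)
  also have "\<dots> = of_real (\<Sum>t\<in>S. \<kappa> t * gval (A t) (B t) (D t) c)"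
    by (simp add: ker_integral[OF c])
  finally show ?thesis .
qed

lemma hermite_T_fmom: "fmom P (\<lambda>\<omega>. of_real (poly (hermite_poly n) (T g \<omega>)) :: 'c::{real_normed_field, banach, second_countable_topology})"
  by (intro fmom_of_real fmom_intros T_fmom)

lemma fourth_moment_nested:
  fixes w0 w1 w2 w3 :: "'g \<Rightarrow> complex"
  assumes w: "weight w0" "weight w1" "weight w2" "weight w3"
  shows "expectation (\<lambda>\<omega>. hint n w0 \<omega> * (hint n w1 \<omega> * (hint n w2 \<omega> * hint n w3 \<omega>))) =
    (\<integral>a. \<integral>b. \<integral>c. \<integral>d. of_real (hmoment4 a b c d n n n n) * (w0 a * w1 b * w2 c * w3 d) \<partial>\<mu> \<partial>\<mu> \<partial>\<mu> \<partial>\<mu>)"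
proof -
  let ?H = "\<lambda>g \<omega>. complex_of_real (poly (hermite_poly n) (T g \<omega>))"
  note fm = fmom_mult hermite_T_fmom hint_fmom w
  have step: "expectation (\<lambda>\<omega>. hint n v \<omega> * Z \<omega>) = (\<integral>g. v g * expectation (\<lambda>\<omega>. ?H g \<omega> * Z \<omega>) \<partial>\<mu>)"
    if "weight v" "fmom P Z" for v Z
    unfolding hint_def by (rule gint_mult[OF that])
  have 3: "expectation (\<lambda>\<omega>. hint n w3 \<omega> * (?H a \<omega> * ?H b \<omega> * ?H c \<omega>)) = (\<integral>d. w3 d * of_real (hmoment4 a b c d n n n n) \<partial>\<mu>)" for a b c
    unfolding hmoment4_def integral_complex_of_real[symmetric]
    by (subst step) (auto intro!: fm simp: mult_ac simp del: hermite_poly.simps integral_complex_of_real)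
  have 2: "expectation (\<lambda>\<omega>. hint n w2 \<omega> * (?H a \<omega> * ?H b \<omega> * hint n w3 \<omega>)) =
      (\<integral>c. w2 c * (\<integral>d. w3 d * of_real (hmoment4 a b c d n n n n) \<partial>\<mu>) \<partial>\<mu>)" for a b
    unfolding 3[symmetric] by (subst step) (auto intro!: fm simp: mult_ac simp del: hermite_poly.simps)
  have 1: "expectation (\<lambda>\<omega>. hint n w1 \<omega> * (?H a \<omega> * (hint n w2 \<omega> * hint n w3 \<omega>))) =
      (\<integral>b. w1 b * (\<integral>c. w2 c * (\<integral>d. w3 d * of_real (hmoment4 a b c d n n n n) \<partial>\<mu>) \<partial>\<mu>) \<partial>\<mu>)" for a
    unfolding 2[symmetric] by (subst step) (auto intro!: fm simp: mult_ac simp del: hermite_poly.simps)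
  have "expectation (\<lambda>\<omega>. hint n w0 \<omega> * (hint n w1 \<omega> * (hint n w2 \<omega> * hint n w3 \<omega>))) =
      (\<integral>a. w0 a * (\<integral>b. w1 b * (\<integral>c. w2 c * (\<integral>d. w3 d * of_real (hmoment4 a b c d n n n n) \<partial>\<mu>) \<partial>\<mu>) \<partial>\<mu>) \<partial>\<mu>)"
    unfolding 1[symmetric] by (subst step) (auto intro!: fm simp: mult_ac simp del: hermite_poly.simps)
  also have "\<dots> = (\<integral>a. \<integral>b. \<integral>c. \<integral>d. w0 a * (w1 b * (w2 c * (w3 d * of_real (hmoment4 a b c d n n n n)))) \<partial>\<mu> \<partial>\<mu> \<partial>\<mu> \<partial>\<mu>)"
    by simp
  finally show ?thesis by (simp only: mult_ac)
qed

lemma hmoment4_bound: "\<bar>hmoment4 a b c d n n n n\<bar> \<le> (\<Sum>(i, j, k)\<in>triples n. tcoef n i j k)"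
proof -
  have "hmoment4 a b c d n n n n = (\<Sum>(i, j, k)\<in>triples n. tcoef n i j k * ker i j k (a, b, c, d))"
    using hmoment4_ker[of "(a, b, c, d)" n] by simp
  also have "\<bar>\<dots>\<bar> \<le> (\<Sum>(i, j, k)\<in>triples n. tcoef n i j k)"
    by (rule order_trans[OF sum_abs], rule sum_mono)
      (auto simp: abs_mult tcoef_nonneg intro!: mult_left_le ker_le)
  finally show ?thesis .
qed

lemma fourth_moment_char:
  assumes c: "\<And>i. c i \<in> dual"
  shows "expectation (\<lambda>\<omega>. hint n (c 0) \<omega> * (hint n (c 1) \<omega> * (hint n (c 2) \<omega> * hint n (c 3) \<omega>))) =
    of_real (\<Sum>(i, j, k)\<in>triples n. tcoef n i j k * gval i j k c)"
proof -
  note [measurable] = measurable_continuous[OF dual_continuous[OF c]]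
  have "expectation (\<lambda>\<omega>. hint n (c 0) \<omega> * (hint n (c 1) \<omega> * (hint n (c 2) \<omega> * hint n (c 3) \<omega>))) =
    (\<integral>x. of_real (hmoment4 (co 0 x) (co 1 x) (co 2 x) (co 3 x) n n n n) * (c 0 (co 0 x) * c 1 (co 1 x) * c 2 (co 2 x) * c 3 (co 3 x)) \<partial>M4)"
    unfolding fourth_moment_nested[OF weight_char weight_char weight_char weight_char, OF c c c c]
  proof (rule integral_M4)
    show "(\<lambda>x. complex_of_real (hmoment4 (co 0 x) (co 1 x) (co 2 x) (co 3 x) n n n n) * (c 0 (co 0 x) * c 1 (co 1 x) * c 2 (co 2 x) * c 3 (co 3 x))) \<in> borel_measurable M4"
      unfolding hmoment4_ker case_prod_beta' by measurable
  qed (use hmoment4_bound in \<open>simp add: norm_mult dual_norm[OF c]\<close>)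
  also have "\<dots> = of_real (\<Sum>(i, j, k)\<in>triples n. tcoef n i j k * gval i j k c)"
    using gval_sum_integral[of c "triples n" "\<lambda>(i, j, k). tcoef n i j k" fst "fst \<circ> snd" "snd \<circ> snd", OF c finite_triples]
    unfolding hmoment4_ker by (simp add: prod_4 case_prod_beta')
  finally show ?thesis .
qed

text \<open>The end terms \<open>q = 0\<close> and \<open>q = n\<close> are left out: for \<pi> in
  the dual they equal the square of \<open>pmf (spec_pow n) \<pi>\<close>, by \<open>SS_0\<close>
  and \<open>SS_m_0\<close>, and belong to the Gaussian value.\<close>

definition SS_sum :: "nat \<Rightarrow> ('g \<Rightarrow> complex) \<Rightarrow> real" where
  "SS_sum n \<pi> = (\<Sum>q=1..n-1. SS (n - q) q \<pi>)"

lemma SS_sum_nonneg: "SS_sum n \<pi> \<ge> 0"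
  unfolding SS_sum_def by (intro sum_nonneg SS_nonneg)

lemma SS_le_SS_sum: "1 \<le> q \<Longrightarrow> q < n \<Longrightarrow> SS (n - q) q \<pi> \<le> SS_sum n \<pi>"
  unfolding SS_sum_def by (rule member_le_sum) (auto simp: SS_nonneg)

text \<open>Only the diagrams without edges 12 and 34 are kept, the others being nonnegative. These
  are the cycles; the two degenerate ones are pairings worth \<open>v\<^sup>2\<close> each, and the
  remaining ones have coefficient at least 1.\<close>

theorem fourth_moment_lower:
  assumes pi: "\<pi> \<in> dual" and n: "n \<ge> 1"
  defines "v \<equiv> fact n * pmf (spec_pow n) \<pi>"
  shows "2 * v\<^sup>2 + SS_sum n \<pi> \<le> expectation (\<lambda>\<omega>. cmod (hint n (char_inv \<pi>) \<omega>) ^ 4)"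
    and "0 \<le> Re (expectation (\<lambda>\<omega>. hint n (char_inv \<pi>) \<omega> ^ 4))"
proof -
  let ?F = "hint n (char_inv \<pi>)"
  have four: "z ^ 4 = z * (z * (z * z))" for z :: complex by (simp add: eval_nat_numeral)
  show "0 \<le> Re (expectation (\<lambda>\<omega>. ?F \<omega> ^ 4))"
    unfolding four using fourth_moment_char[of "\<lambda>_. char_inv \<pi>" n] pi
    by (auto simp: char_inv_dual intro!: sum_nonneg mult_nonneg_nonneg gval_nonneg tcoef_nonneg)
  define c where "c i = (if i < 2 then char_inv \<pi> else \<pi>)" for i :: nat
  have c: "c i \<in> dual" for i using pi by (simp add: c_def char_inv_dual)
  have "complex_of_real (cmod z ^ 4) = z * (z * (cnj z * cnj z))" for z
    using complex_norm_square[of z] by (simp add: power2_eq_square eval_nat_numeral mult_ac)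
  then have "complex_of_real (expectation (\<lambda>\<omega>. cmod (?F \<omega>) ^ 4)) = expectation (\<lambda>\<omega>. ?F \<omega> * (?F \<omega> * (cnj (?F \<omega>) * cnj (?F \<omega>))))"
    unfolding integral_complex_of_real[symmetric] by (simp only:)
  also have "\<dots> = of_real (\<Sum>(i, j, k)\<in>triples n. tcoef n i j k * gval i j k c)"
    using fourth_moment_char[of c n, OF c] by (simp add: c_def hint_char_inv)
  finally have E: "expectation (\<lambda>\<omega>. cmod (?F \<omega>) ^ 4) = (\<Sum>(i, j, k)\<in>triples n. tcoef n i j k * gval i j k c)"
    by (simp only: of_real_eq_iff)
  have cyc: "gval 0 b d c = SS d b \<pi>" for b d
    unfolding gval_def by (rule graph_prob_cycle[OF pi]) (auto simp: c_def)
  have "2 * v\<^sup>2 + SS_sum n \<pi> \<le> (\<Sum>q=0..n. tcoef n 0 q (n - q) * SS (n - q) q \<pi>)"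
  proof -
    have split: "{0..n} = insert 0 (insert n {1..n-1})" using n by auto
    have ends: "tcoef n 0 0 n * SS n 0 \<pi> = v\<^sup>2" "tcoef n 0 n 0 * SS 0 n \<pi> = v\<^sup>2"
      by (simp_all add: tcoef_def v_def SS_0 SS_m_0[OF pi] power2_eq_square)
    have "SS (n - q) q \<pi> \<le> tcoef n 0 q (n - q) * SS (n - q) q \<pi>" if "q \<in> {1..n-1}" for q
    proof -
      have "fact q * fact (n - q) \<le> (fact n * fact n :: real)" by (intro mult_mono fact_mono) (use that in auto)
      then have "1 \<le> (fact n)\<^sup>2 / (fact 0 * fact q * fact (n - q) :: real)" by (simp add: power2_eq_square)
      then have "1 \<le> tcoef n 0 q (n - q)" unfolding tcoef_def by (rule one_le_power)
      then show ?thesis using SS_nonneg[of "n - q" q \<pi>] by (simp add: mult_le_cancel_right1)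
    qed
    then have "SS_sum n \<pi> \<le> (\<Sum>q=1..n-1. tcoef n 0 q (n - q) * SS (n - q) q \<pi>)" unfolding SS_sum_def by (rule sum_mono)
    then show ?thesis unfolding split using n ends by simp
  qed
  also have "\<dots> = (\<Sum>t\<in>(\<lambda>q. (0, q, n - q)) ` {0..n}. case t of (i, j, k) \<Rightarrow> tcoef n i j k * gval i j k c)"
    by (subst sum.reindex) (auto simp: inj_on_def cyc)
  also have "\<dots> \<le> (\<Sum>(i, j, k)\<in>triples n. tcoef n i j k * gval i j k c)"
    by (rule sum_mono2[OF finite_triples]) (auto simp: triples_def intro!: mult_nonneg_nonneg tcoef_nonneg gval_nonneg)
  finally show "2 * v\<^sup>2 + SS_sum n \<pi> \<le> expectation (\<lambda>\<omega>. cmod (?F \<omega>) ^ 4)" unfolding E .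
qed

section \<open>The second moment of the squared derivative norm \<open>Gam\<close>\<close>

lemma Gam_mult:
  assumes w: "weight w" and Z: "fmom P Z"
  shows "expectation (\<lambda>\<omega>. Gam n w \<omega> * Z \<omega>) = real (Suc n) * (\<integral>h. \<integral>g. w h * (w g * (r (h - g) *
    expectation (\<lambda>\<omega>. poly (hermite_poly n) (T h \<omega>) * (poly (hermite_poly n) (T g \<omega>) * Z \<omega>)))) \<partial>\<mu> \<partial>\<mu>)"
proof -
  let ?H = "\<lambda>g \<omega>. poly (hermite_poly n) (T g \<omega>)"
  have D: "D_gint (hermite_poly (Suc n)) w h \<omega> = real (Suc n) * gint (hermite_poly n) (\<lambda>g. r (h - g) * w g) \<omega>" for h \<omega>
    unfolding D_gint_def pderiv_hermite using gint_smult[of "real (Suc n)" "hermite_poly n" "\<lambda>g. r (h - g) * w g" \<omega>] by simp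
  have "expectation (\<lambda>\<omega>. Gam n w \<omega> * Z \<omega>) =
      (\<integral>h. expectation (\<lambda>\<omega>. w h * ?H h \<omega> * D_gint (hermite_poly (Suc n)) w h \<omega> * Z \<omega>) \<partial>\<mu>)"
    unfolding Gam_def by (rule PP.Fubini_mult[OF Gam_fmom_pair[OF w] Z])
  also have "\<dots> = (\<integral>h. real (Suc n) * (w h * expectation (\<lambda>\<omega>. gint (hermite_poly n) (\<lambda>g. r (h - g) * w g) \<omega> * (?H h \<omega> * Z \<omega>))) \<partial>\<mu>)"
    unfolding D integral_mult_right_zero[symmetric] by (simp only: mult_ac)
  also have "\<dots> = (\<integral>h. real (Suc n) * (w h * (\<integral>g. r (h - g) * w g * expectation (\<lambda>\<omega>. ?H g \<omega> * (?H h \<omega> * Z \<omega>)) \<partial>\<mu>)) \<partial>\<mu>)"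
  proof (rule arg_cong[where f = "integral\<^sup>L \<mu>"], rule ext)
    fix h
    have "expectation (\<lambda>\<omega>. gint (hermite_poly n) (\<lambda>g. r (h - g) * w g) \<omega> * (?H h \<omega> * Z \<omega>)) =
        (\<integral>g. r (h - g) * w g * expectation (\<lambda>\<omega>. ?H g \<omega> * (?H h \<omega> * Z \<omega>)) \<partial>\<mu>)"
      using gint_mult[OF weight_mult[OF weight_r_diff w], of "\<lambda>\<omega>. ?H h \<omega> * Z \<omega>" "hermite_poly n" h]
      by (simp add: fmom_intros T_fmom Z del: hermite_poly.simps)
    then show "real (Suc n) * (w h * expectation (\<lambda>\<omega>. gint (hermite_poly n) (\<lambda>g. r (h - g) * w g) \<omega> * (?H h \<omega> * Z \<omega>))) =
      real (Suc n) * (w h * (\<integral>g. r (h - g) * w g * expectation (\<lambda>\<omega>. ?H g \<omega> * (?H h \<omega> * Z \<omega>)) \<partial>\<mu>))" by (simp only:)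
  qed
  also have "\<dots> = real (Suc n) * (\<integral>h. \<integral>g. w h * (r (h - g) * w g * expectation (\<lambda>\<omega>. ?H g \<omega> * (?H h \<omega> * Z \<omega>))) \<partial>\<mu> \<partial>\<mu>)"
    by (simp del: hermite_poly.simps of_nat_Suc)
  finally show ?thesis by (simp only: mult_ac)
qed

lemma Gam_square_nested:
  assumes w: "weight w"
  shows "expectation (\<lambda>\<omega>. (Gam n w \<omega>)\<^sup>2) = (real (Suc n))\<^sup>2 *
    (\<integral>a. \<integral>b. \<integral>c. \<integral>d. w a * w b * w c * w d * (r (a - b) * r (c - d) * hmoment4 a b c d n n n n) \<partial>\<mu> \<partial>\<mu> \<partial>\<mu> \<partial>\<mu>)"
proof -
  let ?H = "\<lambda>g \<omega>. poly (hermite_poly n) (T g \<omega>)"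
  have inner: "expectation (\<lambda>\<omega>. ?H a \<omega> * (?H b \<omega> * Gam n w \<omega>)) =
      real (Suc n) * (\<integral>c. \<integral>d. w c * (w d * (r (c - d) * hmoment4 a b c d n n n n)) \<partial>\<mu> \<partial>\<mu>)" for a b
  proof -
    have "expectation (\<lambda>\<omega>. ?H a \<omega> * (?H b \<omega> * Gam n w \<omega>)) = expectation (\<lambda>\<omega>. Gam n w \<omega> * (?H a \<omega> * ?H b \<omega>))" by (simp only: mult_ac)
    also have "\<dots> = real (Suc n) * (\<integral>c. \<integral>d. w c * (w d * (r (c - d) * expectation (\<lambda>\<omega>. ?H c \<omega> * (?H d \<omega> * (?H a \<omega> * ?H b \<omega>))))) \<partial>\<mu> \<partial>\<mu>)"
      by (rule Gam_mult[OF w]) (intro fmom_intros T_fmom)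
    finally show ?thesis by (simp only: hmoment4_def mult_ac)
  qed
  have e: "w a * (w b * (x * (real (Suc n) * y))) = real (Suc n) * (w a * (w b * (x * y)))" for a b x y
    by (simp only: mult_ac)
  have "expectation (\<lambda>\<omega>. (Gam n w \<omega>)\<^sup>2) = real (Suc n) * (\<integral>a. \<integral>b. w a * (w b * (r (a - b) *
      (real (Suc n) * (\<integral>c. \<integral>d. w c * (w d * (r (c - d) * hmoment4 a b c d n n n n)) \<partial>\<mu> \<partial>\<mu>)))) \<partial>\<mu> \<partial>\<mu>)"
    unfolding power2_eq_square Gam_mult[OF w Gam_fmom[OF w]] inner ..
  also have "\<dots> = (real (Suc n))\<^sup>2 * (\<integral>a. \<integral>b. \<integral>c. \<integral>d. w a * (w b * (r (a - b) * (w c * (w d * (r (c - d) * hmoment4 a b c d n n n n))))) \<partial>\<mu> \<partial>\<mu> \<partial>\<mu> \<partial>\<mu>)"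
    by (simp only: e integral_mult_right_zero power2_eq_square mult.assoc)
  finally show ?thesis by (simp only: mult_ac)
qed

definition bchar :: "('g \<Rightarrow> complex) \<Rightarrow> bool \<Rightarrow> 'g \<Rightarrow> complex" where "bchar \<pi> b = (if b then char_inv \<pi> else \<pi>)"

definition bsign :: "complex \<Rightarrow> bool \<Rightarrow> complex" where "bsign \<zeta> b = (if b then \<zeta> else cnj \<zeta>)"

abbreviation "bchars \<pi> b0 b1 b2 b3 \<equiv> (\<lambda>i. bchar \<pi> (if i = (0::nat) then b0 else if i = 1 then b1 else if i = 2 then b2 else b3))"

text \<open>The two inner products of derivatives put one additional edge on 12 and one on 34, so
  diagrams of order \<open>n\<close> appear with \<open>Suc i\<close> for that pair.\<close>

definition gam_graphs :: "nat \<Rightarrow> (nat \<Rightarrow> 'g \<Rightarrow> complex) \<Rightarrow> real" where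
  "gam_graphs n c = (\<Sum>(i, j, k)\<in>triples n. tcoef n i j k * gval (Suc i) j k c)"

text \<open>Expanding each weight \<open>Re (\<zeta> * cnj (\<pi> g))\<close> as half the sum of a character and its conjugate.\<close>

lemma Gam_square_expansion:
  assumes pi: "\<pi> \<in> dual"
  shows "complex_of_real (expectation (\<lambda>\<omega>. (Gam n (\<lambda>g. Re (\<zeta> * char_inv \<pi> g)) \<omega>)\<^sup>2)) = (of_nat (Suc n))\<^sup>2 / 16 *
    (\<Sum>b0\<in>UNIV. \<Sum>b1\<in>UNIV. \<Sum>b2\<in>UNIV. \<Sum>b3\<in>UNIV. bsign \<zeta> b0 * bsign \<zeta> b1 * bsign \<zeta> b2 * bsign \<zeta> b3 *
      of_real (gam_graphs n (bchars \<pi> b0 b1 b2 b3)))"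
proof -
  interpret m: prob_space M4 by (rule prob_space_M4)
  let ?w = "\<lambda>g. Re (\<zeta> * char_inv \<pi> g)"
  have bd: "bchar \<pi> b \<in> dual" for b using pi by (simp add: bchar_def char_inv_dual)
  note [measurable] = measurable_continuous[OF dual_continuous[OF bd]] measurable_continuous[OF dual_continuous[OF pi]]
  have w: "weight ?w" by (intro weight_Re weight_mult weight_const weight_char char_inv_dual pi)
  note [measurable] = weight_measurable[OF w]
  obtain B where B: "\<bar>?w g\<bar> \<le> B" for g using w by (auto simp: weight_def)
  have B0: "B \<ge> 0" using B[of 0] by linarith
  have ws: "complex_of_real (?w g) = (\<Sum>b\<in>UNIV. bsign \<zeta> b * bchar \<pi> b g) / 2" for g
    using complex_add_cnj[of "\<zeta> * char_inv \<pi> g"] by (simp add: UNIV_bool bsign_def bchar_def char_inv_def add.commute)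
  let ?h = "\<lambda>x. r (co 0 x - co 1 x) * r (co 2 x - co 3 x) * hmoment4 (co 0 x) (co 1 x) (co 2 x) (co 3 x) n n n n"
  have h: "?h x = (\<Sum>(i, j, k)\<in>triples n. tcoef n i j k * ker (Suc i) j k x)" for x
    unfolding hmoment4_ker sum_distrib_left by (intro sum.cong) (auto simp: ker_def mult_ac)
  have hm[measurable]: "?h \<in> borel_measurable M4" unfolding h case_prod_beta' by measurable
  define K where "K = (\<Sum>(i, j, k)\<in>triples n. tcoef n i j k)"
  have hb: "\<bar>r (a - b) * r (c - d) * hmoment4 a b c d n n n n\<bar> \<le> K" for a b c d
  proof -
    have "\<bar>r (a - b) * r (c - d)\<bar> * \<bar>hmoment4 a b c d n n n n\<bar> \<le> 1 * K"
      unfolding K_def abs_mult by (intro mult_mono hmoment4_bound mult_le_one r_le) auto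
    then show ?thesis by (simp add: abs_mult)
  qed
  have nested: "expectation (\<lambda>\<omega>. (Gam n ?w \<omega>)\<^sup>2) = (real (Suc n))\<^sup>2 * (\<integral>x. ?w (co 0 x) * ?w (co 1 x) * ?w (co 2 x) * ?w (co 3 x) * ?h x \<partial>M4)"
    unfolding Gam_square_nested[OF w]
  proof (rule arg_cong[where f = "\<lambda>u. _ * u"], rule integral_M4)
    show "(\<lambda>x. ?w (co 0 x) * ?w (co 1 x) * ?w (co 2 x) * ?w (co 3 x) * ?h x) \<in> borel_measurable M4" by measurable
    show "norm (?w a * ?w b * ?w c * ?w d * (r (a - b) * r (c - d) * hmoment4 a b c d n n n n)) \<le> B * B * B * B * K" for a b c d
      unfolding real_norm_def abs_mult[of _ "r (a - b) * r (c - d) * _"]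
      by (rule mult_mono[OF _ hb]) (simp_all only: abs_mult, intro mult_mono B mult_nonneg_nonneg abs_ge_zero B0, intro mult_nonneg_nonneg B0 abs_ge_zero, intro mult_nonneg_nonneg abs_ge_zero)
  qed
  define ch where "ch b0 b1 b2 b3 x = (\<Prod>i<4. bchars \<pi> b0 b1 b2 b3 i (co i x))" for b0 b1 b2 b3 x
  have int: "integrable M4 (\<lambda>x. complex_of_real (?h x) * ch b0 b1 b2 b3 x)" for b0 b1 b2 b3
  proof (rule m.integrable_const_bound[where B = K])
    have "norm (ch b0 b1 b2 b3 x) = 1" for x
      unfolding ch_def prod_norm[symmetric] by (rule prod.neutral) (use dual_norm[OF bd] in blast)
    then show "AE x in M4. norm (complex_of_real (?h x) * ch b0 b1 b2 b3 x) \<le> K"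
      using hb by (simp add: norm_mult del: of_real_mult)
    show "(\<lambda>x. complex_of_real (?h x) * ch b0 b1 b2 b3 x) \<in> borel_measurable M4" unfolding ch_def by measurable
  qed
  have ch_int: "(\<integral>x. complex_of_real (?h x) * ch b0 b1 b2 b3 x \<partial>M4) = of_real (gam_graphs n (bchars \<pi> b0 b1 b2 b3))" for b0 b1 b2 b3
    using gval_sum_integral[of "bchars \<pi> b0 b1 b2 b3" "triples n" "\<lambda>(i, j, k). tcoef n i j k" "Suc \<circ> fst" "fst \<circ> snd" "snd \<circ> snd", OF bd finite_triples]
    unfolding h gam_graphs_def ch_def by (simp add: case_prod_beta')
  have "complex_of_real (\<integral>x. ?w (co 0 x) * ?w (co 1 x) * ?w (co 2 x) * ?w (co 3 x) * ?h x \<partial>M4) =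
    (\<integral>x. of_real (?w (co 0 x)) * of_real (?w (co 1 x)) * of_real (?w (co 2 x)) * of_real (?w (co 3 x)) * complex_of_real (?h x) \<partial>M4)"
    unfolding integral_complex_of_real[symmetric] by (simp only: of_real_mult)
  also have "\<dots> = (\<integral>x. (\<Sum>b0\<in>UNIV. \<Sum>b1\<in>UNIV. \<Sum>b2\<in>UNIV. \<Sum>b3\<in>UNIV. (bsign \<zeta> b0 * bsign \<zeta> b1 * bsign \<zeta> b2 * bsign \<zeta> b3 / 16) *
      (complex_of_real (?h x) * ch b0 b1 b2 b3 x)) \<partial>M4)"
  proof (rule arg_cong[where f = "integral\<^sup>L M4"], rule ext)
    fix x
    have alg: "((\<Sum>b\<in>UNIV. s b * f0 b) / 2) * ((\<Sum>b\<in>UNIV. s b * f1 b) / 2) * ((\<Sum>b\<in>UNIV. s b * f2 b) / 2) * ((\<Sum>b\<in>UNIV. s b * f3 b) / 2) * H =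
      (\<Sum>b0\<in>UNIV. \<Sum>b1\<in>UNIV. \<Sum>b2\<in>UNIV. \<Sum>b3\<in>UNIV. (s b0 * s b1 * s b2 * s b3 / 16) * (H * (f0 b0 * f1 b1 * f2 b2 * f3 b3)))"
      for s f0 f1 f2 f3 :: "bool \<Rightarrow> complex" and H
      by (simp add: UNIV_bool field_simps)
    show "of_real (?w (co 0 x)) * of_real (?w (co 1 x)) * of_real (?w (co 2 x)) * of_real (?w (co 3 x)) * complex_of_real (?h x) =
      (\<Sum>b0\<in>UNIV. \<Sum>b1\<in>UNIV. \<Sum>b2\<in>UNIV. \<Sum>b3\<in>UNIV. (bsign \<zeta> b0 * bsign \<zeta> b1 * bsign \<zeta> b2 * bsign \<zeta> b3 / 16) *
      (complex_of_real (?h x) * ch b0 b1 b2 b3 x))"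
      unfolding ws alg ch_def prod_4 by simp
  qed
  also have "\<dots> = (\<Sum>b0\<in>UNIV. \<Sum>b1\<in>UNIV. \<Sum>b2\<in>UNIV. \<Sum>b3\<in>UNIV. (bsign \<zeta> b0 * bsign \<zeta> b1 * bsign \<zeta> b2 * bsign \<zeta> b3 / 16) *
      of_real (gam_graphs n (bchars \<pi> b0 b1 b2 b3)))"
    unfolding ch_int[symmetric]
    by (subst Bochner_Integration.integral_sum, intro Bochner_Integration.integrable_sum integrable_mult_right int, rule sum.cong[OF refl])+
      (rule integral_mult_right_zero)
  finally show ?thesis unfolding nested by (simp add: sum_distrib_left del: of_nat_Suc)
qed

end

context isotropic_field
begin

text \<open>The diagram with all edges on 12 and 34 is a pairing and gets a separate bound
  \<open>M\<close>; its coefficient \<open>tcoef n n 0 0\<close> is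
  \<open>(fact n)\<^sup>2\<close>.\<close>

lemma gam_graphs_bound:
  assumes b: "\<And>a b c. (a, b, c) \<in> triples n \<Longrightarrow> (a, b, c) \<noteq> (n, 0, 0) \<Longrightarrow> gval (Suc a) b c ch \<le> S"
    and m: "gval (Suc n) 0 0 ch \<le> M" and S: "S \<ge> 0"
  shows "gam_graphs n ch \<le> (fact n)\<^sup>2 * M + (\<Sum>(a, b, c)\<in>triples n. tcoef n a b c) * S"
proof -
  have "gam_graphs n ch \<le> (\<Sum>t\<in>triples n. (if t = (n, 0, 0) then (fact n)\<^sup>2 * M else 0) + (case t of (a, b, c) \<Rightarrow> tcoef n a b c) * S)"
    unfolding gam_graphs_def
  proof (rule sum_mono, clarify)
    fix a b c assume t: "(a, b, c) \<in> triples n"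
    show "tcoef n a b c * gval (Suc a) b c ch \<le> (if (a, b, c) = (n, 0, 0) then (fact n)\<^sup>2 * M else 0) + tcoef n a b c * S"
    proof (cases "(a, b, c) = (n, 0, 0)")
      case True
      have "tcoef n n 0 0 = (fact n)\<^sup>2" by (simp add: tcoef_def power2_eq_square)
      moreover have "(fact n)\<^sup>2 * gval (Suc n) 0 0 ch \<le> (fact n)\<^sup>2 * M" using m by simp
      moreover have "0 \<le> (fact n)\<^sup>2 * S" using S by simp
      moreover have "a = n" "b = 0" "c = 0" using True by auto
      ultimately show ?thesis by (simp only: if_True refl)
    next
      case False
      then show ?thesis using mult_left_mono[OF b[OF t False] tcoef_nonneg[of n a b c]] by auto
    qed
  qed
  also have "\<dots> = (fact n)\<^sup>2 * M + (\<Sum>(a, b, c)\<in>triples n. tcoef n a b c) * S"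
  proof -
    have "(n, 0, 0) \<in> triples n" by (simp add: triples_def)
    then show ?thesis by (simp add: sum.distrib sum_distrib_right finite_triples)
  qed
  finally show ?thesis .
qed

lemma gam_graphs_eq_0:
  assumes c: "\<And>i. c i \<in> dual" "(\<lambda>g. \<Prod>i<4. c i g) \<noteq> char_one"
  shows "gam_graphs n c = 0"
proof -
  have "gval A B D c = 0" for A B D
    unfolding gval_def by (rule graph_prob_eq_0[OF _ c]) (simp add: valid_edges_def)
  then show ?thesis by (simp add: gam_graphs_def)
qed

text \<open>Of the sixteen sign patterns the ten unbalanced ones vanish, their total character being
  nontrivial. In the two balanced patterns with equal signs along 12 the pure pairing vanishes too;
  in the other four it survives, and together these make up the square of the mean of
  \<open>Gam\<close>.\<close>

theorem Gam_square_upper: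
  fixes n :: nat
  assumes pi: "\<pi> \<in> dual" and nontriv: "char_mult \<pi> \<pi> \<noteq> char_one" "char_mult (char_mult \<pi> \<pi>) (char_mult \<pi> \<pi>) \<noteq> char_one"
  defines "v \<equiv> fact (Suc n) * pmf (spec_pow (Suc n)) \<pi>"
  shows "expectation (\<lambda>\<omega>. (Gam n (\<lambda>g. Re (\<zeta> * char_inv \<pi> g)) \<omega>)\<^sup>2) \<le> ((cmod \<zeta>)\<^sup>2 * v / 2)\<^sup>2 +
    (real (Suc n))\<^sup>2 * (\<Sum>(a, b, c)\<in>triples n. tcoef n a b c) * cmod \<zeta> ^ 4 * SS_sum (Suc n) \<pi>"
proof -
  define K where "K = (\<Sum>(a, b, c)\<in>triples n. tcoef n a b c)"
  define S where "S = SS_sum (Suc n) \<pi>"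
  define p where "p = (pmf (spec_pow (Suc n)) \<pi>)\<^sup>2"
  have S0: "S \<ge> 0" unfolding S_def by (rule SS_sum_nonneg)
  have K0: "K \<ge> 0" unfolding K_def by (intro sum_nonneg) (auto simp: tcoef_nonneg)
  let ?U = "\<lambda>b0 b1 b2 b3. gam_graphs n (bchars \<pi> b0 b1 b2 b3)"
  have bd: "bchar \<pi> b \<in> dual" for b using pi by (simp add: bchar_def char_inv_dual)
  have SSS: "SS i j \<pi> \<le> S" if "i \<ge> 1" "j \<ge> 1" "i + j = Suc n" for i j
  proof -
    have "Suc n - j = i" "j < Suc n" using that by auto
    then show ?thesis using SS_le_SS_sum[of j "Suc n" \<pi>] that(2) unfolding S_def by (simp only:)
  qed
  have ne: "char_inv \<pi> \<noteq> \<pi>"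
  proof
    assume "char_inv \<pi> = \<pi>"
    then have "char_mult \<pi> \<pi> = char_one" using char_inv_right[OF pi] by simp
    then show False using nontriv by simp
  qed
  have cm: "cmod (\<pi> g) = 1" "\<pi> g * cnj (\<pi> g) = 1" "cnj (\<pi> g) * \<pi> g = 1" for g
    using dual_norm[OF pi] dual_cnj_mult[OF pi] by auto
  have inv: "(\<lambda>g. cnj (f g)) \<noteq> char_one" if "f \<noteq> char_one" for f :: "'g \<Rightarrow> complex"
    using that by (auto simp: char_one_def fun_eq_iff)
  have nt: "(\<lambda>g. \<pi> g * \<pi> g) \<noteq> char_one" "(\<lambda>g. \<pi> g * \<pi> g * (\<pi> g * \<pi> g)) \<noteq> char_one"
    "(\<lambda>g. cnj (\<pi> g) * cnj (\<pi> g)) \<noteq> char_one" "(\<lambda>g. cnj (\<pi> g) * cnj (\<pi> g) * (cnj (\<pi> g) * cnj (\<pi> g))) \<noteq> char_one"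
    using nontriv inv[OF nontriv(1)] inv[OF nontriv(2)] by (simp_all add: char_mult_def)
  have zero: "?U b0 b1 b2 b3 = 0" if "of_bool b0 + of_bool b1 + of_bool b2 + of_bool b3 \<noteq> (2::nat)" for b0 b1 b2 b3
  proof (rule gam_graphs_eq_0[OF bd])
    have "(\<lambda>g. bchar \<pi> b0 g * bchar \<pi> b1 g * bchar \<pi> b2 g * bchar \<pi> b3 g) \<in>
      {\<lambda>g. \<pi> g * \<pi> g, \<lambda>g. \<pi> g * \<pi> g * (\<pi> g * \<pi> g), \<lambda>g. cnj (\<pi> g) * cnj (\<pi> g), \<lambda>g. cnj (\<pi> g) * cnj (\<pi> g) * (cnj (\<pi> g) * cnj (\<pi> g))}"
    proof -
      have e: "\<pi> g * cnj (\<pi> g) * z = z" "cnj (\<pi> g) * \<pi> g * z = z" "\<pi> g * (cnj (\<pi> g) * z) = z" "cnj (\<pi> g) * (\<pi> g * z) = z" for g z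
        using cm(2,3)[of g] by (simp_all only: mult.assoc[symmetric] mult_1_left)
      show ?thesis using that
        by (cases b0; cases b1; cases b2; cases b3; simp add: bchar_def char_inv_def mult.assoc cm e)
    qed
    then show "(\<lambda>g. \<Prod>i<4. bchars \<pi> b0 b1 b2 b3 i g) \<noteq> char_one"
      using nt unfolding prod_4 by auto
  qed
  have part: "{0, 1, 2, 3} = {..<4::nat}" "{0, 1, 3, 2} = {..<4::nat}" "{2, 3, 0, 1} = {..<4::nat}" "{2, 3, 1, 0} = {..<4::nat}"
     "{0, 2, 1, 3} = {..<4::nat}" "{1, 3, 0, 2} = {..<4::nat}" "{0, 3, 1, 2} = {..<4::nat}" "{1, 2, 0, 3} = {..<4::nat}"
    by auto
  have TTFF: "?U True True False False \<le> (fact n)\<^sup>2 * 0 + K * S" unfolding K_def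
  proof (rule gam_graphs_bound[OF _ _ S0])
    fix a b c assume t: "(a, b, c) \<in> triples n" "(a, b, c) \<noteq> (n, 0, 0)"
    show "gval (Suc a) b c (bchars \<pi> True True False False) \<le> S"
    \<comment> \<open>A value of \<open>SS\<close> occurs in \<open>SS_sum\<close> only if both
      indices are positive. Since the diagram is not the pairing, \<open>b\<close> or
      \<open>c\<close> is positive; in the second case the last two vertices are
      interchanged.\<close>
    proof (cases "b \<ge> 1")
      case True
      have "gval (Suc a) b c (bchars \<pi> True True False False) \<le> SS (Suc a + c) b \<pi>"
        unfolding gval_def by (rule graph_prob_le_SS[OF pi part(1)]) (auto simp: bchar_def)
      also have "\<dots> \<le> S" by (rule SSS) (use t True in \<open>auto simp: triples_def\<close>)
      finally show ?thesis .
    next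
      case False
      have "gval (Suc a) b c (bchars \<pi> True True False False) \<le> SS (Suc a + b) c \<pi>"
        unfolding gval_perms(1)[OF bd] by (rule graph_prob_le_SS[OF pi part(2)]) (auto simp: bchar_def)
      also have "\<dots> \<le> S" by (rule SSS) (use t False in \<open>auto simp: triples_def\<close>)
      finally show ?thesis .
    qed
  next
    show "gval (Suc n) 0 0 (bchars \<pi> True True False False) \<le> 0"
      unfolding gval_def by (subst graph_prob_two_edges[OF pi ne part(1)]) (auto simp: bchar_def)
  qed
  have FFTT: "?U False False True True \<le> (fact n)\<^sup>2 * 0 + K * S" unfolding K_def
  proof (rule gam_graphs_bound[OF _ _ S0])
    fix a b c assume t: "(a, b, c) \<in> triples n" "(a, b, c) \<noteq> (n, 0, 0)"
    show "gval (Suc a) b c (bchars \<pi> False False True True) \<le> S"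
    proof (cases "b \<ge> 1")
      case True
      have "gval (Suc a) b c (bchars \<pi> False False True True) \<le> SS (Suc a + c) b \<pi>"
        unfolding gval_perms(2)[OF bd] by (rule graph_prob_le_SS[OF pi part(3)]) (auto simp: bchar_def)
      also have "\<dots> \<le> S" by (rule SSS) (use t True in \<open>auto simp: triples_def\<close>)
      finally show ?thesis .
    next
      case False
      have "gval (Suc a) b c (bchars \<pi> False False True True) \<le> SS (Suc a + b) c \<pi>"
        unfolding gval_perms(3)[OF bd] by (rule graph_prob_le_SS[OF pi part(4)]) (auto simp: bchar_def)
      also have "\<dots> \<le> S" by (rule SSS) (use t False in \<open>auto simp: triples_def\<close>)
      finally show ?thesis .
    qed
  next
    show "gval (Suc n) 0 0 (bchars \<pi> False False True True) \<le> 0"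
      unfolding gval_perms(2)[OF bd] by (subst graph_prob_two_edges[OF pi ne part(3)]) (auto simp: bchar_def)
  qed
  \<comment> \<open>In the alternating patterns the reinforced edges join opposite signs and can
    serve as the pair treated by AM-GM. Their multiplicity \<open>Suc a\<close> is always positive,
    and \<open>b = c = 0\<close> gives \<open>p\<close>.\<close>
  have alt: "gam_graphs n ch \<le> (fact n)\<^sup>2 * p + K * S"
    if le: "\<And>a b c. gval (Suc a) b c ch \<le> SS (b + c) (Suc a) \<pi>" for ch
    unfolding K_def
  proof (rule gam_graphs_bound[OF _ _ S0])
    show "gval (Suc n) 0 0 ch \<le> p" using le[of n 0 0] by (simp add: p_def SS_0 del: spec_pow.simps)
    fix a b c assume t: "(a, b, c) \<in> triples n" "(a, b, c) \<noteq> (n, 0, 0)"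
    show "gval (Suc a) b c ch \<le> S" by (rule order_trans[OF le SSS]) (use t in \<open>auto simp: triples_def\<close>)
  qed
  have TFTF: "?U True False True False \<le> (fact n)\<^sup>2 * p + K * S"
    by (rule alt, unfold gval_perms(4)[OF bd], rule graph_prob_le_SS[OF pi part(5)]) (auto simp: bchar_def)
  have FTFT: "?U False True False True \<le> (fact n)\<^sup>2 * p + K * S"
    by (rule alt, unfold gval_perms(5)[OF bd], rule graph_prob_le_SS[OF pi part(6)]) (auto simp: bchar_def)
  have TFFT: "?U True False False True \<le> (fact n)\<^sup>2 * p + K * S"
    by (rule alt, unfold gval_perms(6)[OF bd], subst add.commute, rule graph_prob_le_SS[OF pi part(7)]) (auto simp: bchar_def)
  have FTTF: "?U False True True False \<le> (fact n)\<^sup>2 * p + K * S"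
    by (rule alt, unfold gval_perms(7)[OF bd], subst add.commute, rule graph_prob_le_SS[OF pi part(8)]) (auto simp: bchar_def)
  have zz: "\<zeta> * cnj \<zeta> = of_real ((cmod \<zeta>)\<^sup>2)" by (simp only: complex_norm_square)
  have "complex_of_real (expectation (\<lambda>\<omega>. (Gam n (\<lambda>g. Re (\<zeta> * char_inv \<pi> g)) \<omega>)\<^sup>2)) = (of_nat (Suc n))\<^sup>2 / 16 *
     ((\<zeta> * cnj \<zeta>) * (\<zeta> * cnj \<zeta>) * of_real (?U True True False False + ?U False False True True + ?U True False True False + ?U False True False True + ?U True False False True + ?U False True True False))"
    unfolding Gam_square_expansion[OF pi] UNIV_bool bsign_def
    by (simp add: zero del: of_nat_Suc) (simp add: algebra_simps del: of_nat_Suc)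
  also have "\<dots> = of_real ((real (Suc n))\<^sup>2 / 16 * (cmod \<zeta> ^ 4 *
     (?U True True False False + ?U False False True True + ?U True False True False + ?U False True False True + ?U True False False True + ?U False True True False)))"
    unfolding zz by (simp add: power2_eq_square eval_nat_numeral mult_ac)
  finally have "expectation (\<lambda>\<omega>. (Gam n (\<lambda>g. Re (\<zeta> * char_inv \<pi> g)) \<omega>)\<^sup>2) = (real (Suc n))\<^sup>2 / 16 * (cmod \<zeta> ^ 4 *
     (?U True True False False + ?U False False True True + ?U True False True False + ?U False True False True + ?U True False False True + ?U False True True False))"
    by (simp only: of_real_eq_iff)
  \<comment> \<open>Four patterns carry the pairing and all six an error \<open>K * S\<close>;
    raising 6 to 16 cancels the denominator.\<close>
  also have "\<dots> \<le> (real (Suc n))\<^sup>2 / 16 * (cmod \<zeta> ^ 4 * (4 * ((fact n)\<^sup>2 * p) + 16 * (K * S)))"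
  proof (intro mult_left_mono)
    have "0 \<le> K * S" using K0 S0 by simp
    then show "?U True True False False + ?U False False True True + ?U True False True False + ?U False True False True + ?U True False False True + ?U False True True False \<le> 4 * ((fact n)\<^sup>2 * p) + 16 * (K * S)"
      using TTFF FFTT TFTF FTFT TFFT FTTF by linarith
  qed auto
  also have "\<dots> = ((cmod \<zeta>)\<^sup>2 * v / 2)\<^sup>2 + (real (Suc n))\<^sup>2 * K * cmod \<zeta> ^ 4 * S"
  proof -
    have v2: "v\<^sup>2 = (real (Suc n))\<^sup>2 * (fact n)\<^sup>2 * p" unfolding v_def p_def by (simp add: power_mult_distrib del: spec_pow.simps of_nat_Suc)
    have z4: "((cmod \<zeta>)\<^sup>2)\<^sup>2 = cmod \<zeta> ^ 4" by simp
    show ?thesis unfolding power_divide power_mult_distrib[of "(cmod \<zeta>)\<^sup>2"] z4 v2 by (simp add: field_simps del: of_nat_Suc)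
  qed
  finally show ?thesis unfolding K_def S_def .
qed

end

section \<open>Convergence in law from moments and characteristic functions\<close>

text \<open>The moments of the centered normal law with variance \<open>s\<close>, in the form of
  the recursion that the functionals satisfy in the limit.\<close>

fun gmom :: "real \<Rightarrow> nat \<Rightarrow> real" where
  "gmom s 0 = 1"
| "gmom s (Suc 0) = 0"
| "gmom s (Suc (Suc k)) = real (Suc k) * s * gmom s k"

lemma gmom_odd: "gmom s (Suc (2 * k)) = 0"
  by (induction k) auto

lemma gmom_even: "gmom s (2 * k) / fact (2 * k) = (s / 2) ^ k / fact k"
proof (induction k)
  case (Suc k)
  have "gmom s (Suc (Suc n)) / fact (Suc (Suc n)) = s / real (Suc (Suc n)) * (gmom s n / fact n)" for n
    by (simp only: gmom.simps fact_Suc of_nat_mult) (simp add: divide_simps del: of_nat_Suc)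
  then have "gmom s (2 * Suc k) / fact (2 * Suc k) = s / real (2 * Suc k) * (gmom s (2 * k) / fact (2 * k))"
    by (simp only: mult_Suc_right add_2_eq_Suc)
  then show ?case unfolding Suc by (simp add: field_simps)
qed simp

lemma gmom_series: "(\<Sum>k\<le>2 * p. \<i> ^ k * of_real (gmom s k) / fact k) = of_real (\<Sum>k\<le>p. (- s / 2) ^ k / fact k)"
proof (induction p)
  case (Suc p)
  have "\<i> ^ (2 * Suc p) * complex_of_real (gmom s (2 * Suc p)) / fact (2 * Suc p) =
      \<i> ^ (2 * Suc p) * of_real (gmom s (2 * Suc p) / fact (2 * Suc p))"
    by (simp del: gmom.simps fact_Suc mult_Suc_right)
  also have "\<dots> = of_real ((- s / 2) ^ Suc p / fact (Suc p))"
  proof -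
    have "\<i> ^ (2 * Suc p) = complex_of_real ((- 1) ^ Suc p)" by (simp only: power_mult power2_i of_real_power of_real_minus of_real_1)
    moreover have "(- 1) ^ Suc p * ((s / 2) ^ Suc p / fact (Suc p)) = (- s / 2) ^ Suc p / fact (Suc p)"
      using power_mult_distrib[of "- 1" "s / 2" "Suc p"] by (simp del: power_Suc fact_Suc)
    ultimately show ?thesis unfolding gmom_even by (simp only: of_real_mult[symmetric])
  qed
  finally have "\<i> ^ Suc (Suc (2 * p)) * complex_of_real (gmom s (Suc (Suc (2 * p)))) / fact (Suc (Suc (2 * p))) = of_real ((- s / 2) ^ Suc p / fact (Suc p))"
    by (simp only: mult_Suc_right add_2_eq_Suc)
  then show ?case
    by (simp add: gmom_odd Suc del: gmom.simps fact_Suc power_Suc)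
qed simp

text \<open>The exponential is replaced by its Taylor polynomial of degree \<open>2 * p\<close>. The
  error is at most twice the moment of order \<open>2 * p\<close> over its factorial, which tends to
  \<open>2 * (s / 2) ^ p / fact p\<close>; \<open>p\<close> is fixed to make this small, and then
  \<open>l\<close> goes to infinity.\<close>

lemma (in prob_space) moment_method:
  assumes Y: "\<And>l. fmom M (Y l :: 'a \<Rightarrow> real)" and lim: "\<And>k. (\<lambda>l. expectation (\<lambda>x. Y l x ^ k)) \<longlonglongrightarrow> gmom s k"
  shows "(\<lambda>l. expectation (\<lambda>x. iexp (Y l x))) \<longlonglongrightarrow> of_real (exp (- s / 2))"
proof (rule tendstoI)
  fix e :: real assume e: "e > 0"
  have "(\<lambda>p. (s / 2) ^ p / fact p) \<longlonglongrightarrow> 0"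
    using summable_LIMSEQ_zero[OF summable_exp[of "s / 2"]] by (simp add: field_simps)
  then have "(\<lambda>p. 2 * ((s / 2) ^ p / fact p)) \<longlonglongrightarrow> 2 * 0" by (rule tendsto_mult_left)
  then have 1: "eventually (\<lambda>p. 2 * ((s / 2) ^ p / fact p) < e / 4) sequentially"
    by (rule order_tendstoD(2)) (use e in simp)
  have "(\<lambda>p. \<Sum>k\<le>p. (- s / 2) ^ k / fact k) \<longlonglongrightarrow> exp (- s / 2)"
    using exp_converges[of "- s / 2"] unfolding sums_def_le by (simp add: field_simps)
  then have "eventually (\<lambda>p. dist (\<Sum>k\<le>p. (- s / 2) ^ k / fact k) (exp (- s / 2)) < e / 4) sequentially"
    using e by (intro tendstoD) auto
  with 1 have "eventually (\<lambda>p. 2 * ((s / 2) ^ p / fact p) < e / 4 \<and> dist (\<Sum>k\<le>p. (- s / 2) ^ k / fact k) (exp (- s / 2)) < e / 4) sequentially"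
    by (rule eventually_conj)
  then obtain p where p: "2 * ((s / 2) ^ p / fact p) < e / 4" "dist (\<Sum>k\<le>p. (- s / 2) ^ k / fact k) (exp (- s / 2)) < e / 4"
    by (auto simp: eventually_sequentially)
  define S where "S l = (\<Sum>k\<le>2 * p. \<i> ^ k * of_real (expectation (\<lambda>x. Y l x ^ k)) / fact k)" for l
  define S' where "S' = (\<Sum>k\<le>2 * p. \<i> ^ k * complex_of_real (gmom s k) / fact k)"
  have "S \<longlonglongrightarrow> S'" unfolding S_def S'_def by (intro tendsto_intros lim) auto
  then have ev1: "eventually (\<lambda>l. dist (S l) S' < e / 4) sequentially" using e by (intro tendstoD) auto
  have "(\<lambda>l. 2 * (expectation (\<lambda>x. Y l x ^ (2 * p)) / fact (2 * p))) \<longlonglongrightarrow> 2 * (gmom s (2 * p) / fact (2 * p))"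
    by (intro tendsto_intros lim) auto
  then have ev2: "eventually (\<lambda>l. 2 * (expectation (\<lambda>x. Y l x ^ (2 * p)) / fact (2 * p)) < e / 4) sequentially"
    using p(1) unfolding gmom_even by (rule order_tendstoD(2))
  have S'e: "dist S' (of_real (exp (- s / 2))) < e / 4"
    unfolding S'_def gmom_series dist_of_real by (rule p(2))
  have b: "dist (expectation (\<lambda>x. iexp (Y l x))) (S l) \<le> 2 * (expectation (\<lambda>x. Y l x ^ (2 * p)) / fact (2 * p))" for l
  proof -
    have m[measurable]: "Y l \<in> borel_measurable M" by (rule fmom_measurable[OF Y])
    have i1: "integrable M (\<lambda>x. iexp (Y l x))" by (rule integrable_const_bound[where B = 1]) auto
    have i2: "integrable M (\<lambda>x. (\<i> * complex_of_real (Y l x)) ^ k / fact k)" for k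
    proof -
      have "integrable M (\<lambda>x. \<i> ^ k / fact k * complex_of_real (Y l x ^ k))"
        by (intro integrable_mult_right integrable_of_real fmom_integrable fmom_power Y)
      then show ?thesis by (simp add: power_mult_distrib)
    qed
    have "S l = expectation (\<lambda>x. \<Sum>k\<le>2 * p. (\<i> * complex_of_real (Y l x)) ^ k / fact k)"
    proof (subst Bochner_Integration.integral_sum[OF i2], unfold S_def, rule sum.cong[OF refl])
      fix k
      have "expectation (\<lambda>x. (\<i> * complex_of_real (Y l x)) ^ k / fact k) = expectation (\<lambda>x. \<i> ^ k / fact k * complex_of_real (Y l x ^ k))"
        by (simp add: power_mult_distrib)
      also have "\<dots> = \<i> ^ k / fact k * of_real (expectation (\<lambda>x. Y l x ^ k))"
        by (simp only: integral_mult_right_zero integral_complex_of_real)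
      finally show "\<i> ^ k * of_real (expectation (\<lambda>x. Y l x ^ k)) / fact k = expectation (\<lambda>x. (\<i> * complex_of_real (Y l x)) ^ k / fact k)" by simp
    qed
    then have "dist (expectation (\<lambda>x. iexp (Y l x))) (S l) = cmod (expectation (\<lambda>x. iexp (Y l x) - (\<Sum>k\<le>2 * p. (\<i> * complex_of_real (Y l x)) ^ k / fact k)))"
      using i1 i2 by (subst Bochner_Integration.integral_diff) (auto simp: dist_norm intro!: Bochner_Integration.integrable_sum)
    also have "\<dots> \<le> expectation (\<lambda>x. cmod (iexp (Y l x) - (\<Sum>k\<le>2 * p. (\<i> * complex_of_real (Y l x)) ^ k / fact k)))"
      by (rule integral_norm_bound)
    also have "\<dots> \<le> expectation (\<lambda>x. 2 * (Y l x ^ (2 * p) / fact (2 * p)))"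
    proof (rule integral_mono)
      show "integrable M (\<lambda>x. cmod (iexp (Y l x) - (\<Sum>k\<le>2 * p. (\<i> * complex_of_real (Y l x)) ^ k / fact k)))"
        using i1 i2 by (intro integrable_norm Bochner_Integration.integrable_diff Bochner_Integration.integrable_sum)
      show "integrable M (\<lambda>x. 2 * (Y l x ^ (2 * p) / fact (2 * p)))"
        by (intro integrable_mult_right integrable_divide fmom_integrable fmom_power Y)
      show "cmod (iexp (Y l x) - (\<Sum>k\<le>2 * p. (\<i> * complex_of_real (Y l x)) ^ k / fact k)) \<le> 2 * (Y l x ^ (2 * p) / fact (2 * p))" for x
        using iexp_approx2[of "Y l x" "2 * p"] by (simp add: power_even_abs)
    qed
    finally show ?thesis by simp
  qed
  from ev1 ev2 show "eventually (\<lambda>l. dist (expectation (\<lambda>x. iexp (Y l x))) (of_real (exp (- s / 2))) < e) sequentially"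
  proof eventually_elim
    case (elim l)
    have "dist (expectation (\<lambda>x. iexp (Y l x))) (of_real (exp (- s / 2))) \<le>
      dist (expectation (\<lambda>x. iexp (Y l x))) (S l) + (dist (S l) S' + dist S' (of_real (exp (- s / 2))))"
      using dist_triangle[of "expectation (\<lambda>x. iexp (Y l x))" "of_real (exp (- s / 2))" "S l"] dist_triangle[of "S l" "of_real (exp (- s / 2))" S'] by linarith
    also have "\<dots> < e" using b[of l] elim S'e e by linarith
    finally show ?case .
  qed
qed

lemma (in prob_space) gaussian_moments_limit:
  assumes 1: "(\<lambda>l. expectation (Y l)) \<longlonglongrightarrow> 0"
    and rec: "\<And>k. (\<lambda>l. expectation (\<lambda>x. Y l x ^ Suc (Suc k)) - real (Suc k) * s * expectation (\<lambda>x. Y l x ^ k)) \<longlonglongrightarrow> 0"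
  shows "(\<lambda>l. expectation (\<lambda>x. Y l x ^ k)) \<longlonglongrightarrow> gmom s k"
proof (induction k rule: induct_nat_012)
  case (ge2 k)
  from tendsto_add[OF rec[of k] tendsto_mult_left[OF ge2(1), of "real (Suc k) * s"]]
  show ?case by (simp del: power_Suc)
qed (use 1 in \<open>auto simp: prob_space\<close>)

section \<open>The continuity theorem for characteristic functions in the plane\<close>

inductive trig :: "(complex \<Rightarrow> complex) \<Rightarrow> bool" where
  trig_exp: "trig (\<lambda>x. c * iexp (Re (\<zeta> * x)))"
| trig_add: "trig f \<Longrightarrow> trig g \<Longrightarrow> trig (\<lambda>x. f x + g x)"

lemma iexp_add: "iexp s * iexp t = iexp (s + t)"
  by (simp add: exp_add[symmetric] distrib_left)

lemma trig_mult: "trig f \<Longrightarrow> trig g \<Longrightarrow> trig (\<lambda>x. f x * g x)"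
proof (induction f rule: trig.induct)
  case (trig_exp c \<zeta>)
  then show ?case
  proof (induction g rule: trig.induct)
    case (trig_exp d \<eta>)
    have "c * iexp (Re (\<zeta> * x)) * (d * iexp (Re (\<eta> * x))) = c * d * iexp (Re ((\<zeta> + \<eta>) * x))" for x
    proof -
      have "Re (\<zeta> * x) + Re (\<eta> * x) = Re ((\<zeta> + \<eta>) * x)" by (simp add: algebra_simps)
      then show ?thesis by (metis iexp_add mult.assoc mult.left_commute)
    qed
    then show ?case using trig.trig_exp[of "c * d" "\<zeta> + \<eta>"] by (simp only:)
  next
    case (trig_add f g)
    then show ?case using trig.trig_add by (simp add: distrib_left)
  qed
next
  case (trig_add f1 f2)
  then show ?case using trig.trig_add by (simp add: distrib_right)
qed

lemma trig_const: "trig (\<lambda>x. c)"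
  using trig_exp[of c 0] by simp

lemma trig_cos: "trig (\<lambda>x. c * of_real (cos (Re (\<zeta> * x))))"
proof -
  have neg: "Re (- \<zeta> * x) = - Re (\<zeta> * x)" for x by simp
  have "c * of_real (cos t) = c / 2 * iexp t + c / 2 * iexp (- t)" for t
    by (simp add: cos_of_real[symmetric] cos_exp_eq field_simps)
  then have "(\<lambda>x. c * of_real (cos (Re (\<zeta> * x)))) = (\<lambda>x. c / 2 * iexp (Re (\<zeta> * x)) + c / 2 * iexp (Re (- \<zeta> * x)))"
    by (simp only: neg)
  then show ?thesis by (simp only: trig_add trig_exp)
qed

lemma trig_sin: "trig (\<lambda>x. c * of_real (sin (Re (\<zeta> * x))))"
proof -
  have neg: "Re (- \<zeta> * x) = - Re (\<zeta> * x)" for x by simp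
  have "c * of_real (sin t) = c / (2 * \<i>) * iexp t + (- c / (2 * \<i>)) * iexp (- t)" for t
    by (simp add: sin_of_real[symmetric] sin_exp_eq field_simps)
  then have "(\<lambda>x. c * of_real (sin (Re (\<zeta> * x)))) = (\<lambda>x. c / (2 * \<i>) * iexp (Re (\<zeta> * x)) + (- c / (2 * \<i>)) * iexp (Re (- \<zeta> * x)))"
    by (simp only: neg)
  then show ?thesis by (simp only: trig_add trig_exp)
qed

text \<open>Real polynomials in these two coordinates are trigonometric polynomials of
  \<open>x\<close>; the scale \<open>a\<close> decides on which disc the map is injective.\<close>

definition torus_map :: "real \<Rightarrow> complex \<Rightarrow> complex \<times> complex" where
  "torus_map a x = (cis (a * Re x), cis (a * Im x))"

lemma trig_polynomial:
  assumes "real_polynomial_function p"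
  shows "trig (\<lambda>x. of_real (p (torus_map a x)))"
  using assms
proof induction
  case (linear f)
  interpret bounded_linear f by (rule linear)
  let ?u = "complex_of_real a" and ?v = "complex_of_real a * - \<i>"
  have "f (torus_map a x) = f (1, 0) * cos (Re (?u * x)) + f (\<i>, 0) * sin (Re (?u * x)) + f (0, 1) * cos (Re (?v * x)) + f (0, \<i>) * sin (Re (?v * x))" for x
  proof -
    have "torus_map a x = cos (a * Re x) *\<^sub>R (1, 0) + sin (a * Re x) *\<^sub>R (\<i>, 0) + cos (a * Im x) *\<^sub>R (0, 1) + sin (a * Im x) *\<^sub>R (0, \<i>)"
      by (simp add: torus_map_def complex_eq_iff)
    then show ?thesis by (simp only: add scaleR) (simp add: mult.commute)
  qed
  then have "(\<lambda>x. complex_of_real (f (torus_map a x))) = (\<lambda>x. of_real (f (1, 0)) * of_real (cos (Re (?u * x))) + of_real (f (\<i>, 0)) * of_real (sin (Re (?u * x))) +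
      of_real (f (0, 1)) * of_real (cos (Re (?v * x))) + of_real (f (0, \<i>)) * of_real (sin (Re (?v * x))))"
    by (simp only: of_real_add of_real_mult)
  then show ?case by (simp only: trig_add trig_cos trig_sin)
next
  case (const c)
  show ?case by (rule trig_const)
next
  case (add f g)
  then show ?case using trig_add by (simp only: of_real_add)
next
  case (mult f g)
  then show ?case using trig_mult by (simp only: of_real_mult)
qed

text \<open>The disc embeds into the torus, since after scaling by \<open>1 / R\<close> the angles
  are at most 1, below pi. Stone-Weierstrass is applied on the torus to a bounded extension of
  \<open>f\<close>, and since every point of the plane is mapped to the torus, the bound on
  \<open>g\<close> is global.\<close>

lemma trig_approx:
  fixes f :: "complex \<Rightarrow> real"
  assumes f: "continuous_on UNIV f" "\<And>x. \<bar>f x\<bar> \<le> B" and R: "R > 0" and e: "e > 0"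
  obtains g where "trig (\<lambda>x. of_real (g x))" "\<And>x. cmod x \<le> R \<Longrightarrow> \<bar>f x - g x\<bar> < e" "\<And>x. \<bar>g x\<bar> \<le> B + e"
proof -
  define \<theta> where "\<theta> = torus_map (1 / R)"
  let ?K = "cball (0::complex) R"
  have c\<theta>: "continuous_on A \<theta>" for A
    unfolding \<theta>_def torus_map_def by (intro continuous_intros)
  have inj: "inj_on \<theta> ?K"
  proof (rule inj_onI)
    fix x y assume xy: "x \<in> ?K" "y \<in> ?K" "\<theta> x = \<theta> y"
    have cis_inj: "s = t" if "cis s = cis t" "\<bar>s\<bar> \<le> 1" "\<bar>t\<bar> \<le> 1" for s t
    proof -
      have "- pi < s" "s \<le> pi" "- pi < t" "t \<le> pi" using that(2,3) pi_gt3 by auto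
      then show ?thesis using that(1) by (metis Arg_cis greaterThanAtMost_iff)
    qed
    have small: "\<bar>1 / R * Re z\<bar> \<le> 1" "\<bar>1 / R * Im z\<bar> \<le> 1" if "z \<in> ?K" for z
      using that R abs_Re_le_cmod[of z] abs_Im_le_cmod[of z] by (auto simp: abs_mult divide_simps)
    have ce: "cis (1 / R * Re x) = cis (1 / R * Re y)" "cis (1 / R * Im x) = cis (1 / R * Im y)"
      using xy(3) unfolding \<theta>_def torus_map_def by (simp_all only: prod.inject)
    have "1 / R * Re x = 1 / R * Re y" "1 / R * Im x = 1 / R * Im y"
      using cis_inj[OF ce(1) small(1)[OF xy(1)] small(1)[OF xy(2)]] cis_inj[OF ce(2) small(2)[OF xy(1)] small(2)[OF xy(2)]] .
    then show "x = y" using R by (auto simp: complex_eq_iff)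
  qed
  have "continuous_on (\<theta> ` ?K) (inv_into ?K \<theta>)"
    by (rule continuous_on_inv[OF c\<theta>]) (use inj in \<open>auto simp: inv_into_f_f\<close>)
  then have ch: "continuous_on (\<theta> ` ?K) (f \<circ> inv_into ?K \<theta>)"
    by (rule continuous_on_compose) (rule continuous_on_subset[OF f(1)], simp)
  have comp: "compact (\<theta> ` ?K)" by (intro compact_continuous_image c\<theta>) simp
  have B: "B \<ge> 0" using f(2)[of 0] by linarith
  \<comment> \<open>Tietze's extension keeps the bound \<open>B\<close>, which is what yields
    \<open>B + e\<close> on the whole torus.\<close>
  obtain h where h: "continuous_on UNIV h" "\<And>x. x \<in> \<theta> ` ?K \<Longrightarrow> h x = (f \<circ> inv_into ?K \<theta>) x" "\<And>x. x \<in> UNIV \<Longrightarrow> norm (h x) \<le> B"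
    by (rule Tietze[OF ch, of UNIV B]) (use B f(2) compact_imp_closed[OF comp] in auto)
  let ?T = "sphere (0::complex) 1 \<times> sphere (0::complex) 1"
  have "compact ?T" by (intro compact_Times compact_sphere)
  then obtain p where p: "real_polynomial_function p" "\<And>x. x \<in> ?T \<Longrightarrow> \<bar>h x - p x\<bar> < e"
    by (rule Stone_Weierstrass_real_polynomial_function[OF _ continuous_on_subset[OF h(1)] e]) auto
  have T: "\<theta> x \<in> ?T" for x by (simp add: \<theta>_def torus_map_def)
  show ?thesis
  proof (rule that[of "\<lambda>x. p (\<theta> x)"])
    show "trig (\<lambda>x. of_real (p (\<theta> x)))" unfolding \<theta>_def by (rule trig_polynomial[OF p(1)])
    show "\<bar>f x - p (\<theta> x)\<bar> < e" if "cmod x \<le> R" for x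
      using p(2)[OF T[of x]] h(2)[of "\<theta> x"] inv_into_f_f[OF inj, of x] that by simp
    show "\<bar>p (\<theta> x)\<bar> \<le> B + e" for x
      using p(2)[OF T[of x]] h(3)[of "\<theta> x"] by (simp add: abs_if split: if_splits)
  qed
qed

lemma trig_continuous: "trig g \<Longrightarrow> continuous_on UNIV g"
  by (induction rule: trig.induct) (auto intro!: continuous_intros)

text \<open>The common bound on second moments provides tightness: what happens outside a large disc
  is negligible, and on the disc \<open>f\<close> is close to a trigonometric polynomial, for which
  convergence is the hypothesis.\<close>

theorem planar_Levy:
  fixes X :: "nat \<Rightarrow> 'a \<Rightarrow> complex" and Z :: "'b \<Rightarrow> complex" and f :: "complex \<Rightarrow> real"
  assumes P: "prob_space P" and Q: "prob_space Q"
    and X[measurable]: "\<And>l. X l \<in> borel_measurable P" and Z[measurable]: "Z \<in> borel_measurable Q"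
    and X2: "\<And>l. integrable P (\<lambda>\<omega>. (cmod (X l \<omega>))\<^sup>2)" "\<And>l. (\<integral>\<omega>. (cmod (X l \<omega>))\<^sup>2 \<partial>P) \<le> K"
    and Z2: "integrable Q (\<lambda>\<omega>. (cmod (Z \<omega>))\<^sup>2)" "(\<integral>\<omega>. (cmod (Z \<omega>))\<^sup>2 \<partial>Q) \<le> K"
    and char: "\<And>\<zeta>. (\<lambda>l. (\<integral>\<omega>. iexp (Re (\<zeta> * X l \<omega>)) \<partial>P)) \<longlonglongrightarrow> (\<integral>\<omega>. iexp (Re (\<zeta> * Z \<omega>)) \<partial>Q)"
    and f: "continuous_on UNIV f" "\<And>x. \<bar>f x\<bar> \<le> B"
  shows "(\<lambda>l. (\<integral>\<omega>. f (X l \<omega>) \<partial>P)) \<longlonglongrightarrow> (\<integral>\<omega>. f (Z \<omega>) \<partial>Q)"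
proof -
  interpret P: prob_space P by (rule P)
  interpret Q: prob_space Q by (rule Q)
  have fm[measurable]: "f \<in> borel_measurable borel" by (rule borel_measurable_continuous_onI[OF f(1)])
  have lim: "(\<forall>l. integrable P (\<lambda>\<omega>. g (X l \<omega>))) \<and> integrable Q (\<lambda>\<omega>. g (Z \<omega>)) \<and> (\<lambda>l. (\<integral>\<omega>. g (X l \<omega>) \<partial>P)) \<longlonglongrightarrow> (\<integral>\<omega>. g (Z \<omega>) \<partial>Q)" if "trig g" for g
    using that
  proof induction
    case (trig_exp c \<zeta>)
    have "integrable P (\<lambda>\<omega>. iexp (Re (\<zeta> * X l \<omega>)))" for l by (rule P.integrable_const_bound[where B = 1]) auto
    moreover have "integrable Q (\<lambda>\<omega>. iexp (Re (\<zeta> * Z \<omega>)))" by (rule Q.integrable_const_bound[where B = 1]) auto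
    ultimately show ?case using tendsto_mult_left[OF char[of \<zeta>], of c] by (simp del: times_complex.simps)
  next
    case (trig_add f g)
    then show ?case using tendsto_add by fastforce
  qed
  have B: "B \<ge> 0" using f(2)[of 0] by linarith
  have K: "K \<ge> 0" using Z2(2) by (rule order_trans[rotated]) simp
  show ?thesis
  proof (rule tendstoI)
    fix e :: real assume e: "e > 0"
    \<comment> \<open>This makes \<open>2 * B * K / R\<^sup>2\<close> at most \<open>e / 8\<close>;
      the added ones keep the radius positive.\<close>
    define R where "R = sqrt (16 * (B + 1) * (K + 1) / e)"
    have R: "R > 0" using B K e by (simp add: R_def)
    have R2: "R\<^sup>2 = 16 * (B + 1) * (K + 1) / e" using B K e by (simp add: R_def)
    obtain g where g: "trig (\<lambda>x. of_real (g x))" "\<And>x. cmod x \<le> R \<Longrightarrow> \<bar>f x - g x\<bar> < e / 8" "\<And>x. \<bar>g x\<bar> \<le> B + e / 8"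
      using trig_approx[OF f R, of "e / 8"] e by auto
    have gm[measurable]: "g \<in> borel_measurable borel"
    proof -
      have "(\<lambda>x. Re (complex_of_real (g x))) \<in> borel_measurable borel"
        by (intro borel_measurable_continuous_onI continuous_on_Re trig_continuous[OF g(1)])
      then show ?thesis by simp
    qed
    \<comment> \<open>Outside the disc \<open>cmod x / R\<close> exceeds 1, so the quadratic term
      covers the crude bound \<open>2 * B + e / 8\<close> on the difference.\<close>
    have pt: "\<bar>f x - g x\<bar> \<le> e / 8 + 2 * B / R\<^sup>2 * (cmod x)\<^sup>2" for x
    proof (cases "cmod x \<le> R")
      case True
      have "0 \<le> 2 * B / R\<^sup>2 * (cmod x)\<^sup>2" using B by simp
      then show ?thesis using g(2)[OF True] by linarith
    next
      case False
      then have "R\<^sup>2 \<le> (cmod x)\<^sup>2" using R by (intro power_mono) auto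
      then have "1 \<le> (cmod x)\<^sup>2 / R\<^sup>2" using R by (simp add: divide_simps)
      then have "2 * B * 1 \<le> 2 * B * ((cmod x)\<^sup>2 / R\<^sup>2)" using B by (intro mult_left_mono) auto
      then show ?thesis using f(2)[of x] g(3)[of x] by (simp add: abs_if split: if_splits)
    qed
    have close: "\<bar>(\<integral>\<omega>. f (W \<omega>) \<partial>M) - (\<integral>\<omega>. g (W \<omega>) \<partial>M)\<bar> \<le> e / 4"
      if M: "prob_space M" and W[measurable]: "W \<in> borel_measurable M" and W2: "integrable M (\<lambda>\<omega>. (cmod (W \<omega>))\<^sup>2)" "(\<integral>\<omega>. (cmod (W \<omega>))\<^sup>2 \<partial>M) \<le> K" for M :: "'c measure" and W
    proof -
      interpret M: prob_space M by (rule M)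
      have "integrable M (\<lambda>\<omega>. f (W \<omega>))"
        by (rule M.integrable_const_bound[where B = B]) (use f(2) in auto)
      moreover have "integrable M (\<lambda>\<omega>. g (W \<omega>))"
        by (rule M.integrable_const_bound[where B = "B + e / 8"]) (use g(3) in auto)
      ultimately have i: "integrable M (\<lambda>\<omega>. f (W \<omega>))" "integrable M (\<lambda>\<omega>. g (W \<omega>))" .
      have "\<bar>(\<integral>\<omega>. f (W \<omega>) \<partial>M) - (\<integral>\<omega>. g (W \<omega>) \<partial>M)\<bar> = \<bar>\<integral>\<omega>. f (W \<omega>) - g (W \<omega>) \<partial>M\<bar>" using i by simp
      also have "\<dots> \<le> (\<integral>\<omega>. \<bar>f (W \<omega>) - g (W \<omega>)\<bar> \<partial>M)" using integral_norm_bound[of M "\<lambda>\<omega>. f (W \<omega>) - g (W \<omega>)"] by simp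
      also have "\<dots> \<le> (\<integral>\<omega>. e / 8 + 2 * B / R\<^sup>2 * (cmod (W \<omega>))\<^sup>2 \<partial>M)"
        by (rule integral_mono[OF _ _ pt]) (use i W2 in auto)
      also have "\<dots> = e / 8 + 2 * B / R\<^sup>2 * (\<integral>\<omega>. (cmod (W \<omega>))\<^sup>2 \<partial>M)" using W2 by (simp add: M.prob_space)
      also have "\<dots> \<le> e / 8 + 2 * B / R\<^sup>2 * K" using W2(2) B by (intro add_left_mono mult_left_mono) auto
      also have "2 * B / R\<^sup>2 * K \<le> e / 8"
      proof -
        have "B * K \<le> (B + 1) * (K + 1)" using B K by (intro mult_mono) auto
        then have "2 * (B * K) / R\<^sup>2 \<le> 2 * ((B + 1) * (K + 1)) / R\<^sup>2" by (intro divide_right_mono mult_left_mono) auto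
        also have "\<dots> = e / 8"
        proof -
          define D where "D = (B + 1) * (K + 1)"
          have "D > 0" unfolding D_def using B K by (intro mult_pos_pos) auto
          moreover have "R\<^sup>2 = 16 * D / e" unfolding R2 D_def by (simp only: mult.assoc)
          ultimately show ?thesis using e unfolding D_def[symmetric] by simp
        qed
        finally show ?thesis by simp
      qed
      finally show ?thesis by simp
    qed
    have "(\<lambda>l. \<integral>\<omega>. g (X l \<omega>) \<partial>P) \<longlonglongrightarrow> (\<integral>\<omega>. g (Z \<omega>) \<partial>Q)"
      using lim[OF g(1)] by (simp add: tendsto_of_real_iff)
    then have "eventually (\<lambda>l. dist (\<integral>\<omega>. g (X l \<omega>) \<partial>P) (\<integral>\<omega>. g (Z \<omega>) \<partial>Q) < e / 4) sequentially"
      using e by (intro tendstoD) auto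
    then show "eventually (\<lambda>l. dist (\<integral>\<omega>. f (X l \<omega>) \<partial>P) (\<integral>\<omega>. f (Z \<omega>) \<partial>Q) < e) sequentially"
    proof eventually_elim
      case (elim l)
      then show ?case using close[OF P X X2, of l] close[OF Q Z Z2] e by (simp add: dist_real_def abs_if split: if_splits)
    qed
  qed
qed

text \<open>Truncating \<open>\<phi> x ^ 4\<close> at \<open>M\<^sup>2\<close> changes it by at most
  \<open>cmod x ^ 6 / M\<close>, which the sixth moments control uniformly; the truncated function
  is bounded and continuous.\<close>

lemma fourth_moment_limit:
  fixes X :: "nat \<Rightarrow> 'a \<Rightarrow> complex" and Z :: "'b \<Rightarrow> complex" and \<phi> :: "complex \<Rightarrow> real"
  assumes P: "prob_space P" and Q: "prob_space Q" and X: "\<And>l. fmom P (X l)" and Z: "fmom Q Z"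
    and X6: "\<And>l. (\<integral>\<omega>. cmod (X l \<omega>) ^ 6 \<partial>P) \<le> K"
    and \<phi>: "continuous_on UNIV \<phi>" "\<And>x. \<bar>\<phi> x\<bar> \<le> cmod x"
    and conv: "\<And>f :: complex \<Rightarrow> real. continuous_on UNIV f \<Longrightarrow> bounded (range f) \<Longrightarrow> (\<lambda>l. (\<integral>\<omega>. f (X l \<omega>) \<partial>P)) \<longlonglongrightarrow> (\<integral>\<omega>. f (Z \<omega>) \<partial>Q)"
  shows "(\<lambda>l. (\<integral>\<omega>. \<phi> (X l \<omega>) ^ 4 \<partial>P)) \<longlonglongrightarrow> (\<integral>\<omega>. \<phi> (Z \<omega>) ^ 4 \<partial>Q)"
proof (rule tendstoI)
  interpret P: prob_space P by (rule P)
  interpret Q: prob_space Q by (rule Q)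
  fix e :: real assume e: "e > 0"
  \<comment> \<open>A bound for the sixth moments of all \<open>X l\<close> and of \<open>Z\<close>,
    at least 1 so that \<open>M\<close> is positive.\<close>
  define K' where "K' = max (max K (\<integral>\<omega>. cmod (Z \<omega>) ^ 6 \<partial>Q)) 1"
  define M where "M = 4 * K' / e"
  have M: "M > 0" using e by (simp add: M_def K'_def)
  define f where "f x = min (\<phi> x ^ 4) (M\<^sup>2)" for x
  have cf: "continuous_on UNIV f" unfolding f_def by (intro continuous_intros \<phi>(1))
  have bf: "0 \<le> f x \<and> f x \<le> M\<^sup>2" for x by (simp add: f_def)
  have brf: "bounded (range f)" unfolding bounded_iff using bf by (intro exI[of _ "M\<^sup>2"]) auto
  have fm[measurable]: "f \<in> borel_measurable borel" "\<phi> \<in> borel_measurable borel"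
    by (rule borel_measurable_continuous_onI[OF cf], rule borel_measurable_continuous_onI[OF \<phi>(1)])
  have pt: "\<bar>\<phi> x ^ 4 - f x\<bar> \<le> cmod x ^ 6 / M" for x
  proof (cases "\<phi> x ^ 4 \<le> M\<^sup>2")
    case True
    then show ?thesis using M by (simp add: f_def)
  next
    case False
    have "M\<^sup>2 < ((\<phi> x)\<^sup>2)\<^sup>2" using False by simp
    then have "M < (\<phi> x)\<^sup>2" by (rule power_less_imp_less_base) simp
    then have "\<phi> x ^ 4 * M \<le> \<phi> x ^ 4 * (\<phi> x)\<^sup>2" by (intro mult_left_mono) auto
    also have "\<dots> = \<bar>\<phi> x\<bar> ^ 6" by (simp add: power_add[symmetric] power_even_abs)
    also have "\<dots> \<le> cmod x ^ 6" by (intro power_mono \<phi>(2)) auto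
    finally have "\<phi> x ^ 4 \<le> cmod x ^ 6 / M" using M by (simp add: field_simps)
    moreover have "\<bar>\<phi> x ^ 4 - f x\<bar> \<le> \<phi> x ^ 4" using bf[of x] False by (simp add: f_def min_def)
    ultimately show ?thesis by linarith
  qed
  have close: "\<bar>(\<integral>\<omega>. \<phi> (W \<omega>) ^ 4 \<partial>N) - (\<integral>\<omega>. f (W \<omega>) \<partial>N)\<bar> \<le> e / 4"
    if N: "prob_space N" and W: "fmom N W" and W6: "(\<integral>\<omega>. cmod (W \<omega>) ^ 6 \<partial>N) \<le> K'" for N :: "'c measure" and W
  proof -
    interpret N: prob_space N by (rule N)
    have [measurable]: "W \<in> borel_measurable N" by (rule fmom_measurable[OF W])
    have i1: "integrable N (\<lambda>\<omega>. f (W \<omega>))" by (rule N.integrable_const_bound[where B = "M\<^sup>2"]) (use bf in auto)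
    have i2: "integrable N (\<lambda>\<omega>. \<phi> (W \<omega>) ^ 4)"
    proof (rule Bochner_Integration.integrable_bound[OF fmom_power_integrable[OF W, of 4]])
      have "\<bar>\<phi> x\<bar> ^ 4 \<le> cmod x ^ 4" for x by (intro power_mono \<phi>(2)) auto
      then show "AE \<omega> in N. norm (\<phi> (W \<omega>) ^ 4) \<le> norm (cmod (W \<omega>) ^ 4)" by (simp add: power_even_abs)
    qed measurable
    have "\<bar>(\<integral>\<omega>. \<phi> (W \<omega>) ^ 4 \<partial>N) - (\<integral>\<omega>. f (W \<omega>) \<partial>N)\<bar> = \<bar>\<integral>\<omega>. \<phi> (W \<omega>) ^ 4 - f (W \<omega>) \<partial>N\<bar>" using i1 i2 by simp
    also have "\<dots> \<le> (\<integral>\<omega>. \<bar>\<phi> (W \<omega>) ^ 4 - f (W \<omega>)\<bar> \<partial>N)" using integral_norm_bound[of N "\<lambda>\<omega>. \<phi> (W \<omega>) ^ 4 - f (W \<omega>)"] by simp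
    also have "\<dots> \<le> (\<integral>\<omega>. cmod (W \<omega>) ^ 6 / M \<partial>N)"
      by (rule integral_mono[OF _ _ pt]) (use i1 i2 fmom_power_integrable[OF W, of 6] in auto)
    also have "\<dots> = (\<integral>\<omega>. cmod (W \<omega>) ^ 6 \<partial>N) / M" by simp
    also have "\<dots> \<le> K' / M" using W6 M by (intro divide_right_mono) auto
    also have "\<dots> = e / 4" using e by (simp add: M_def K'_def max_def)
    finally show ?thesis .
  qed
  have "eventually (\<lambda>l. dist (\<integral>\<omega>. f (X l \<omega>) \<partial>P) (\<integral>\<omega>. f (Z \<omega>) \<partial>Q) < e / 4) sequentially"
    using e by (intro tendstoD conv cf brf) auto
  then show "eventually (\<lambda>l. dist (\<integral>\<omega>. \<phi> (X l \<omega>) ^ 4 \<partial>P) (\<integral>\<omega>. \<phi> (Z \<omega>) ^ 4 \<partial>Q) < e) sequentially"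
  proof eventually_elim
    case (elim l)
    have "\<bar>(\<integral>\<omega>. \<phi> (X l \<omega>) ^ 4 \<partial>P) - (\<integral>\<omega>. f (X l \<omega>) \<partial>P)\<bar> \<le> e / 4"
      by (rule close[OF P X]) (use X6[of l] in \<open>simp add: K'_def\<close>)
    moreover have "\<bar>(\<integral>\<omega>. \<phi> (Z \<omega>) ^ 4 \<partial>Q) - (\<integral>\<omega>. f (Z \<omega>) \<partial>Q)\<bar> \<le> e / 4"
      by (rule close[OF Q Z]) (simp add: K'_def)
    ultimately show ?case using elim e by (simp add: dist_real_def abs_if split: if_splits)
  qed
qed

section \<open>The complex Gaussian law and the dual convolution powers\<close>

lemma normal_centered_gaussian_rv:
  assumes "\<sigma> > 0"
  shows "centered_gaussian_rv (density lborel (\<lambda>x. ennreal (normal_density 0 \<sigma> x))) (\<lambda>x. x)"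
proof -
  let ?N = "density lborel (\<lambda>x. ennreal (normal_density 0 \<sigma> x))"
  have "distr ?N lborel (\<lambda>x. x) = ?N" by (rule distr_id2) simp
  then have "distributed ?N lborel (\<lambda>x. x) (\<lambda>x. ennreal (normal_density 0 \<sigma> x))"
    by (simp add: distributed_def)
  then show ?thesis using assms by (auto simp: centered_gaussian_rv_def)
qed

lemma normal_variance:
  assumes "\<sigma> > 0"
  shows "(\<integral>x. x\<^sup>2 \<partial>density lborel (\<lambda>x. ennreal (normal_density 0 \<sigma> x))) = \<sigma>\<^sup>2"
  using has_bochner_integral_integral_eq[OF normal_moment_even[OF assms, of 0 1]] assms
  by (subst integral_density) (simp_all add: field_simps power2_eq_square)

text \<open>The moment method applied to a constant sequence: the transform is equal to its own
  limit.\<close>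

lemma normal_char:
  assumes "\<sigma> > 0"
  shows "(\<integral>x. iexp (t * x) \<partial>density lborel (\<lambda>x. ennreal (normal_density 0 \<sigma> x))) = of_real (exp (- (\<sigma> * t)\<^sup>2 / 2))"
proof -
  interpret prob_space "density lborel (\<lambda>x. ennreal (normal_density 0 \<sigma> x))" by (rule prob_space_normal_density[OF assms])
  note g = normal_centered_gaussian_rv[OF assms]
  note m = centered_gaussian_rv_moment[OF g, unfolded normal_variance[OF assms]]
  have "(\<lambda>l::nat. expectation (\<lambda>x. (t * x) ^ k)) \<longlonglongrightarrow> gmom ((\<sigma> * t)\<^sup>2) k" for k
  proof (rule gaussian_moments_limit)
    show "(\<lambda>l::nat. expectation (\<lambda>x. t * x)) \<longlonglongrightarrow> 0" using m[of 0] by simp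
    fix k
    have "expectation (\<lambda>x. (t * x) ^ Suc (Suc k)) = real (Suc k) * (\<sigma> * t)\<^sup>2 * expectation (\<lambda>x. (t * x) ^ k)"
      unfolding power_mult_distrib[of t] integral_mult_right_zero m[of "Suc k"]
      by (simp add: power_mult_distrib power2_eq_square mult_ac)
    then show "(\<lambda>l::nat. expectation (\<lambda>x. (t * x) ^ Suc (Suc k)) - real (Suc k) * (\<sigma> * t)\<^sup>2 * expectation (\<lambda>x. (t * x) ^ k)) \<longlonglongrightarrow> 0"
      by (simp only: diff_self tendsto_const)
  qed
  from moment_method[where Y = "\<lambda>l x. t * x", OF fmom_scale[OF centered_gaussian_rv_fmom[OF g]] this]
  show ?thesis by (simp add: LIMSEQ_const_iff)
qed

abbreviation cgauss_var :: "real \<times> real \<Rightarrow> complex" where "cgauss_var z \<equiv> Complex (fst z) (snd z)"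

lemma cgauss_prob: "prob_space cgauss_law"
  and cgauss_fmom: "fmom cgauss_law cgauss_var"
  and cgauss_second: "(\<integral>z. (cmod (cgauss_var z))\<^sup>2 \<partial>cgauss_law) = 1"
  and cgauss_Re4: "(\<integral>z. Re (cgauss_var z) ^ 4 \<partial>cgauss_law) = 3 / 4"
  and cgauss_Im4: "(\<integral>z. Im (cgauss_var z) ^ 4 \<partial>cgauss_law) = 3 / 4"
  and cgauss_char: "(\<integral>z. iexp (Re (\<zeta> * cgauss_var z)) \<partial>cgauss_law) = of_real (exp (- (cmod \<zeta>)\<^sup>2 / 4))"
proof -
  let ?s = "sqrt (1 / 2)"
  define N where "N = density lborel (\<lambda>x. ennreal (normal_density 0 ?s x))"
  have s: "?s > 0" by simp
  interpret N: prob_space N unfolding N_def by (rule prob_space_normal_density[OF s])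
  interpret NN: pair_prob_space N N ..
  have law: "cgauss_law = N \<Otimes>\<^sub>M N" by (simp add: cgauss_law_def N_def)
  show "prob_space cgauss_law" unfolding law by (rule NN.P.prob_space_axioms)
  note g = normal_centered_gaussian_rv[OF s, folded N_def]
  have f: "fmom N (\<lambda>x. x)" by (rule N.centered_gaussian_rv_fmom[OF g])
  have f1: "fmom (N \<Otimes>\<^sub>M N) fst" and f2: "fmom (N \<Otimes>\<^sub>M N) snd"
    using NN.fmom_fst[OF f] NN.fmom_snd[OF f] by auto
  have sets: "sets (N \<Otimes>\<^sub>M N) = sets (borel :: (real \<times> real) measure)"
    unfolding borel_prod[symmetric] N_def by (intro sets_pair_measure_cong) auto
  have cm: "cgauss_var \<in> borel_measurable (N \<Otimes>\<^sub>M N)"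
    unfolding measurable_cong_sets[OF sets refl] Complex_eq by (intro borel_measurable_continuous_onI continuous_intros)
  show "fmom cgauss_law cgauss_var" unfolding law
  proof (rule fmom_mono[OF cm])
    show "fmom (N \<Otimes>\<^sub>M N) (\<lambda>z. \<bar>fst z\<bar> + \<bar>snd z\<bar>)" by (intro fmom_add NN.P.fmom_abs f1 f2)
    show "norm (cgauss_var z) \<le> norm (\<bar>fst z\<bar> + \<bar>snd z\<bar>)" for z using cmod_le[of "cgauss_var z"] by simp
  qed
  have marg: "(\<integral>z. h (fst z) \<partial>(N \<Otimes>\<^sub>M N)) = (\<integral>x. h x \<partial>N)" "(\<integral>z. h (snd z) \<partial>(N \<Otimes>\<^sub>M N)) = (\<integral>x. h x \<partial>N)"
    if "integrable N h" for h :: "real \<Rightarrow> real"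
  proof -
    have m[measurable]: "h \<in> borel_measurable N" using that by simp
    have "(\<integral>z. h (fst z) \<partial>(N \<Otimes>\<^sub>M N)) = (\<integral>x. h x \<partial>distr (N \<Otimes>\<^sub>M N) N fst)" by (rule integral_distr[symmetric]) auto
    then show "(\<integral>z. h (fst z) \<partial>(N \<Otimes>\<^sub>M N)) = (\<integral>x. h x \<partial>N)" by (simp only: N.distr_pair_fst)
    have "(\<integral>z. h (snd z) \<partial>(N \<Otimes>\<^sub>M N)) = (\<integral>x. h x \<partial>distr (N \<Otimes>\<^sub>M N) N snd)" by (rule integral_distr[symmetric]) auto
    then show "(\<integral>z. h (snd z) \<partial>(N \<Otimes>\<^sub>M N)) = (\<integral>x. h x \<partial>N)" by (simp only: NN.distr_snd)
  qed
  have v2: "N.expectation (\<lambda>x. x\<^sup>2) = 1 / 2" using normal_variance[OF s, folded N_def] by simp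
  have v4: "N.expectation (\<lambda>x. x ^ 4) = 3 / 4"
  proof -
    have "Suc 3 = 4" "3 - 1 = (2::nat)" by simp_all
    then show ?thesis using N.centered_gaussian_rv_moment[OF g, of 3] by (simp only: v2)
  qed
  have i: "integrable N (\<lambda>x. x ^ k)" for k by (intro fmom_integrable N.fmom_power f)
  show "(\<integral>z. Re (cgauss_var z) ^ 4 \<partial>cgauss_law) = 3 / 4" "(\<integral>z. Im (cgauss_var z) ^ 4 \<partial>cgauss_law) = 3 / 4"
    unfolding law complex.sel marg[OF i] v4 by auto
  have "(\<integral>z. (cmod (cgauss_var z))\<^sup>2 \<partial>(N \<Otimes>\<^sub>M N)) = (\<integral>z. (fst z)\<^sup>2 + (snd z)\<^sup>2 \<partial>(N \<Otimes>\<^sub>M N))" by (simp add: cmod_power2)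
  also have "\<dots> = (\<integral>z. (fst z)\<^sup>2 \<partial>(N \<Otimes>\<^sub>M N)) + (\<integral>z. (snd z)\<^sup>2 \<partial>(N \<Otimes>\<^sub>M N))"
    by (intro Bochner_Integration.integral_add fmom_integrable NN.P.fmom_power f1 f2)
  finally show "(\<integral>z. (cmod (cgauss_var z))\<^sup>2 \<partial>cgauss_law) = 1" unfolding law marg[OF i] v2 by simp
  note ch = normal_char[OF s, folded N_def]
  have "(\<integral>z. iexp (Re (\<zeta> * cgauss_var z)) \<partial>(N \<Otimes>\<^sub>M N)) = (\<integral>z. iexp (Re \<zeta> * fst z) * iexp (- Im \<zeta> * snd z) \<partial>(N \<Otimes>\<^sub>M N))"
    unfolding iexp_add by simp
  also have "\<dots> = (\<integral>x. \<integral>y. iexp (Re \<zeta> * x) * iexp (- Im \<zeta> * y) \<partial>N \<partial>N)"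
  proof -
    have "integrable (N \<Otimes>\<^sub>M N) (\<lambda>z. iexp (Re \<zeta> * fst z) * iexp (- Im \<zeta> * snd z))"
    proof (rule NN.P.integrable_const_bound[where B = 1])
      show "(\<lambda>z. iexp (Re \<zeta> * fst z) * iexp (- Im \<zeta> * snd z)) \<in> borel_measurable (N \<Otimes>\<^sub>M N)"
        unfolding measurable_cong_sets[OF sets refl] by (intro borel_measurable_continuous_onI continuous_intros)
    qed (simp add: norm_mult)
    from NN.integral_fst'[OF this] show ?thesis by simp
  qed
  also have "\<dots> = (\<integral>x. iexp (Re \<zeta> * x) \<partial>N) * (\<integral>y. iexp (- Im \<zeta> * y) \<partial>N)" by (simp only: integral_mult_right_zero integral_mult_left_zero)
  also have "\<dots> = of_real (exp (- (?s * Re \<zeta>)\<^sup>2 / 2 + - (?s * - Im \<zeta>)\<^sup>2 / 2))" by (simp only: ch) (simp only: exp_add of_real_mult)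
  also have "- (?s * Re \<zeta>)\<^sup>2 / 2 + - (?s * - Im \<zeta>)\<^sup>2 / 2 = - (cmod \<zeta>)\<^sup>2 / 4"
    by (simp add: cmod_power2 power_mult_distrib)
  finally show "(\<integral>z. iexp (Re (\<zeta> * cgauss_var z)) \<partial>cgauss_law) = of_real (exp (- (cmod \<zeta>)\<^sup>2 / 4))" unfolding law .
qed

section \<open>Suprema, sums of squares and maxima in conditions 3 and 4\<close>

lemma sup_ratio_bounds:
  fixes x :: "'a \<Rightarrow> real"
  assumes x: "\<And>a. a \<in> A \<Longrightarrow> 0 \<le> x a" "x summable_on A" and V: "infsum x A > 0"
  defines "V \<equiv> infsum x A"
  shows "(\<Sum>\<^sub>\<infinity>a\<in>A. (x a)\<^sup>2) / V\<^sup>2 \<le> (SUP a\<in>A. x a) / V" and "(SUP a\<in>A. x a) / V \<le> sqrt ((\<Sum>\<^sub>\<infinity>a\<in>A. (x a)\<^sup>2) / V\<^sup>2)"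
    and "0 \<le> (\<Sum>\<^sub>\<infinity>a\<in>A. (x a)\<^sup>2) / V\<^sup>2" and "0 \<le> (SUP a\<in>A. x a) / V"
proof -
  have V0: "V > 0" using V by (simp add: V_def)
  have le_V: "x a \<le> V" if "a \<in> A" for a
    using infsum_mono_neutral[of x "{a}" x A] x that by (auto simp: V_def)
  have bdd: "bdd_above (x ` A)" using le_V by (auto intro!: bdd_aboveI)
  define S where "S = (SUP a\<in>A. x a)"
  have le_S: "x a \<le> S" if "a \<in> A" for a unfolding S_def by (rule cSUP_upper[OF that bdd])
  have "A \<noteq> {}" using V by auto
  then have S0: "S \<ge> 0" using le_S x(1) by (meson ex_in_conv order_trans)
  have sq: "(\<lambda>a. S * x a) summable_on A" using x(2) by (rule summable_on_cmult_right)
  have x2: "(\<lambda>a. (x a)\<^sup>2) summable_on A"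
    by (rule summable_on_comparison_test[OF sq]) (auto simp: power2_eq_square intro!: mult_right_mono le_S x(1))
  have "(\<Sum>\<^sub>\<infinity>a\<in>A. (x a)\<^sup>2) \<le> (\<Sum>\<^sub>\<infinity>a\<in>A. S * x a)"
    by (rule infsum_mono[OF x2 sq]) (auto simp: power2_eq_square intro!: mult_right_mono le_S x(1))
  also have "\<dots> = S * V" unfolding V_def by (rule infsum_cmult_right') 
  finally have "(\<Sum>\<^sub>\<infinity>a\<in>A. (x a)\<^sup>2) / V\<^sup>2 \<le> S * V / V\<^sup>2" using V0 by (intro divide_right_mono) auto
  then show "(\<Sum>\<^sub>\<infinity>a\<in>A. (x a)\<^sup>2) / V\<^sup>2 \<le> (SUP a\<in>A. x a) / V" using V0 by (simp add: S_def power2_eq_square)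
  have pos2: "0 \<le> (\<Sum>\<^sub>\<infinity>a\<in>A. (x a)\<^sup>2)" by (rule infsum_nonneg) simp
  then show "0 \<le> (\<Sum>\<^sub>\<infinity>a\<in>A. (x a)\<^sup>2) / V\<^sup>2" by simp
  show "0 \<le> (SUP a\<in>A. x a) / V" using S0 V0 by (simp add: S_def)
  have "x a \<le> sqrt (\<Sum>\<^sub>\<infinity>a\<in>A. (x a)\<^sup>2)" if "a \<in> A" for a
  proof (rule real_le_rsqrt)
    show "(x a)\<^sup>2 \<le> (\<Sum>\<^sub>\<infinity>a\<in>A. (x a)\<^sup>2)"
      using infsum_mono_neutral[of "\<lambda>a. (x a)\<^sup>2" "{a}" "\<lambda>a. (x a)\<^sup>2" A] x2 that by auto
  qed
  then have "S \<le> sqrt (\<Sum>\<^sub>\<infinity>a\<in>A. (x a)\<^sup>2)" unfolding S_def by (intro cSUP_least \<open>A \<noteq> {}\<close>)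
  then show "(SUP a\<in>A. x a) / V \<le> sqrt ((\<Sum>\<^sub>\<infinity>a\<in>A. (x a)\<^sup>2) / V\<^sup>2)"
    using V0 by (simp add: S_def real_sqrt_divide divide_right_mono)
qed

lemma Max_tendsto_0_iff:
  fixes h :: "'q \<Rightarrow> nat \<Rightarrow> real"
  assumes "finite J" "J \<noteq> {}" "\<And>q l. q \<in> J \<Longrightarrow> 0 \<le> h q l"
  shows "(\<lambda>l. Max ((\<lambda>q. h q l) ` J)) \<longlonglongrightarrow> 0 \<longleftrightarrow> (\<forall>q\<in>J. h q \<longlonglongrightarrow> 0)"
proof
  assume L: "(\<lambda>l. Max ((\<lambda>q. h q l) ` J)) \<longlonglongrightarrow> 0"
  show "\<forall>q\<in>J. h q \<longlonglongrightarrow> 0"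
    by (intro ballI tendsto_sandwich[OF _ _ tendsto_const L] always_eventually allI) (use assms in auto)
next
  assume R: "\<forall>q\<in>J. h q \<longlonglongrightarrow> 0"
  have s: "(\<lambda>l. \<Sum>q\<in>J. h q l) \<longlonglongrightarrow> 0" using R by (intro tendsto_null_sum) auto
  have nn: "0 \<le> Max ((\<lambda>q. h q l) ` J)" for l
    using assms Max_ge[of "(\<lambda>q. h q l) ` J"] by (meson ex_in_conv finite_imageI image_eqI order_trans)
  have le: "Max ((\<lambda>q. h q l) ` J) \<le> (\<Sum>q\<in>J. h q l)" for l
    using assms by (subst Max_le_iff) (auto intro!: member_le_sum)
  show "(\<lambda>l. Max ((\<lambda>q. h q l) ` J)) \<longlonglongrightarrow> 0"
    by (rule tendsto_sandwich[OF _ _ tendsto_const s]) (use nn le in auto)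
qed

context isotropic_field
begin

lemma spec_pow_expectation_infsum:
  assumes g: "\<And>\<kappa>. 0 \<le> g \<kappa>" "\<And>\<kappa>. g \<kappa> \<le> (1::real)"
  shows "(\<lambda>\<kappa>. pmf (spec_pow i) \<kappa> * g \<kappa>) summable_on dual" and "measure_pmf.expectation (spec_pow i) g = (\<Sum>\<^sub>\<infinity>\<kappa>\<in>dual. pmf (spec_pow i) \<kappa> * g \<kappa>)"
proof -
  let ?f = "\<lambda>\<kappa>. pmf (spec_pow i) \<kappa> * g \<kappa>"
  have abs: "Infinite_Set_Sum.abs_summable_on ?f UNIV"
    by (rule abs_summable_on_comparison_test[OF pmf_abs_summable[of "spec_pow i"]]) (use g in \<open>auto simp: abs_mult intro!: mult_left_le\<close>)
  have "?f summable_on UNIV" using abs unfolding abs_summable_equivalent[symmetric] by (rule abs_summable_summable)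
  then show "?f summable_on dual" by (rule summable_on_subset_banach) simp
  have "measure_pmf.expectation (spec_pow i) g = infsetsum ?f UNIV" by (rule pmf_expectation_eq_infsetsum)
  also have "\<dots> = infsum ?f UNIV" by (rule infsetsum_infsum[OF abs])
  also have "\<dots> = infsum ?f dual" by (rule infsum_cong_neutral) (auto simp: pmf_spec_pow_notin)
  finally show "measure_pmf.expectation (spec_pow i) g = infsum ?f dual" .
qed

lemma SS_infsum: "SS i j \<pi> = (\<Sum>\<^sub>\<infinity>\<kappa>\<in>dual. (pmf (spec_pow i) \<kappa>)\<^sup>2 * (pmf (spec_pow j) (char_mult \<pi> (char_inv \<kappa>)))\<^sup>2)"
proof -
  have "SS i j \<pi> = (\<Sum>\<^sub>\<infinity>\<kappa>\<in>dual. pmf (spec_pow i) \<kappa> * (pmf (spec_pow i) \<kappa> * (pmf (spec_pow j) (char_mult \<pi> (char_inv \<kappa>)))\<^sup>2))"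
    unfolding SS_def by (rule spec_pow_expectation_infsum) (auto intro!: mult_le_one simp: pmf_le_1 power_le_one)
  then show ?thesis by (simp add: power2_eq_square mult.assoc)
qed

lemma spec_pow_add_infsum:
  assumes "\<pi> \<in> dual"
  shows "(\<lambda>\<kappa>. pmf (spec_pow i) \<kappa> * pmf (spec_pow j) (char_mult \<pi> (char_inv \<kappa>))) summable_on dual"
    and "(\<Sum>\<^sub>\<infinity>\<kappa>\<in>dual. pmf (spec_pow i) \<kappa> * pmf (spec_pow j) (char_mult \<pi> (char_inv \<kappa>))) = pmf (spec_pow (i + j)) \<pi>"
proof -
  show "(\<lambda>\<kappa>. pmf (spec_pow i) \<kappa> * pmf (spec_pow j) (char_mult \<pi> (char_inv \<kappa>))) summable_on dual"
    by (rule spec_pow_expectation_infsum) (auto simp: pmf_le_1)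
  have "pmf (spec_pow (i + j)) \<pi> = measure_pmf.expectation (spec_pow (i + j)) (\<lambda>z. if z = \<pi> then 1 else 0)"
    using pmf_expectation_point[of "spec_pow (i + j)" \<pi> "\<lambda>_. 1"] by simp
  also have "\<dots> = measure_pmf.expectation (spec_pow i) (\<lambda>x. measure_pmf.expectation (spec_pow j) (\<lambda>y. if char_mult x y = \<pi> then 1 else 0))"
    by (rule expectation_spec_pow_add[where B = 1]) simp
  also have "\<dots> = measure_pmf.expectation (spec_pow i) (\<lambda>x. pmf (spec_pow j) (char_mult \<pi> (char_inv x)))"
  proof (rule pmf_expectation_cong)
    fix x assume "x \<in> set_pmf (spec_pow i)"
    then have "char_mult x y = \<pi> \<longleftrightarrow> y = char_mult \<pi> (char_inv x)" for y
      using char_mult_eq_iff[OF dual_spec_pow] by (simp add: char_mult_commute)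
    then show "measure_pmf.expectation (spec_pow j) (\<lambda>y. if char_mult x y = \<pi> then 1 else 0) = pmf (spec_pow j) (char_mult \<pi> (char_inv x))"
      using pmf_expectation_point[of "spec_pow j" _ "\<lambda>_. 1"] by simp
  qed
  also have "\<dots> = (\<Sum>\<^sub>\<infinity>\<kappa>\<in>dual. pmf (spec_pow i) \<kappa> * pmf (spec_pow j) (char_mult \<pi> (char_inv \<kappa>)))"
    by (rule spec_pow_expectation_infsum) (auto simp: pmf_le_1)
  finally show "(\<Sum>\<^sub>\<infinity>\<kappa>\<in>dual. pmf (spec_pow i) \<kappa> * pmf (spec_pow j) (char_mult \<pi> (char_inv \<kappa>))) = pmf (spec_pow (i + j)) \<pi>" by simp
qed

text \<open>The character \<pi> is the product of itself and \<open>m - 1\<close> trivial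
  characters, all of positive weight.\<close>

lemma spec_pow_pos:
  assumes C: "\<And>\<pi>. \<pi> \<in> dual \<Longrightarrow> C \<pi> > 0" and pi: "\<pi> \<in> dual" and m: "m \<ge> 1"
  shows "pmf (spec_pow m) \<pi> > 0"
proof -
  have spec: "set_pmf spec = dual" using C set_spec by (force simp: set_pmf_eq pmf_spec)
  have one: "char_one \<in> set_pmf (spec_pow k)" for k
  proof (induction k)
    case (Suc k)
    then show ?case using char_one_dual by (auto simp: spec intro!: bexI[of _ char_one])
  qed simp
  obtain k where "m = Suc k" using m by (cases m) auto
  then have "\<pi> \<in> set_pmf (spec_pow m)" using one[of k] pi by (auto simp: spec char_mult_one(2) intro!: bexI[of _ \<pi>] image_eqI[of _ _ char_one])
  then show ?thesis by (rule pmf_positive)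
qed

text \<open>The term at the trivial \<kappa> alone is positive. This later keeps the trivial
  character out of the tail of a sequence satisfying condition 3.\<close>

lemma SS_one_pos:
  assumes C: "\<And>\<pi>. \<pi> \<in> dual \<Longrightarrow> C \<pi> > 0" and "i \<ge> 1" "j \<ge> 1"
  shows "SS i j char_one > 0"
proof -
  let ?x = "\<lambda>\<kappa>. pmf (spec_pow i) \<kappa> * (pmf (spec_pow j) (char_mult char_one (char_inv \<kappa>)))\<^sup>2"
  have p: "pmf (spec_pow i) char_one > 0" "pmf (spec_pow j) char_one > 0" using spec_pow_pos[OF C char_one_dual] assms by auto
  have "0 < pmf (spec_pow i) char_one * ?x char_one" using p by (simp add: char_mult_one)
  also have "\<dots> = measure_pmf.expectation (spec_pow i) (\<lambda>\<kappa>. if \<kappa> = char_one then ?x \<kappa> else 0)" by (rule pmf_expectation_point[symmetric])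
  also have "\<dots> \<le> SS i j char_one" unfolding SS_def
    by (rule pmf_expectation_mono[where B = 1]) (auto intro!: mult_le_one simp: pmf_le_1 power_le_one)
  finally show ?thesis .
qed

text \<open>A continuous function with values in \<open>{1, -1}\<close> on a connected group is
  constant. Applied to a character and to its square, this rules out orders 2 and 4.\<close>

lemma torsion_free_dual:
  fixes \<pi> :: "'g \<Rightarrow> complex"
  assumes conn: "connected (UNIV :: 'g set)" and pi: "\<pi> \<in> dual" and sq: "char_mult \<pi> \<pi> = char_one"
  shows "\<pi> = char_one"
proof -
  have sub: "range \<pi> \<subseteq> {1, - 1}"
  proof
    fix z assume "z \<in> range \<pi>"
    then obtain g where g: "z = \<pi> g" by auto
    have "z\<^sup>2 = 1" using fun_cong[OF sq, of g] by (simp add: g char_mult_def char_one_def power2_eq_square)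
    then show "z \<in> {1, - 1}" by (simp add: power2_eq_1_iff)
  qed
  have "connected (range \<pi>)" by (rule connected_continuous_image[OF dual_continuous[OF pi] conn])
  moreover have "finite (range \<pi>)" using sub by (rule finite_subset) simp
  ultimately obtain z where z: "range \<pi> = {z}" by (metis UNIV_not_empty connected_finite_iff_sing empty_is_image)
  have "\<pi> g = \<pi> 0" for g using z by (metis rangeI singletonD)
  then show ?thesis by (simp add: fun_eq_iff char_one_def dual_0[OF pi])
qed

end

section \<open>The central limit theorem and the equivalences\<close>

context isotropic_field
begin

definition hvar :: "nat \<Rightarrow> ('g \<Rightarrow> complex) \<Rightarrow> real" where
  "hvar m \<pi> = fact m * pmf (spec_pow m) \<pi>"

definition nhint :: "nat \<Rightarrow> ('g \<Rightarrow> complex) \<Rightarrow> 'w \<Rightarrow> complex" where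
  "nhint m \<pi> \<omega> = hint m (char_inv \<pi>) \<omega> / complex_of_real (sqrt (hvar m \<pi>))"

lemma hint_cmult: "hint m (\<lambda>g. \<zeta> * w g :: complex) \<omega> = \<zeta> * hint m w \<omega>"
  unfolding hint_def gint_def mult.left_commute[of _ \<zeta>] by (rule integral_mult_right_zero)

lemma hint_second_moment:
  assumes "\<pi> \<in> dual" shows "expectation (\<lambda>\<omega>. (cmod (hint m (char_inv \<pi>) \<omega>))\<^sup>2) = hvar m \<pi>"
proof -
  have "complex_of_real (expectation (\<lambda>\<omega>. (cmod (hint m (char_inv \<pi>) \<omega>))\<^sup>2)) = of_real (hvar m \<pi>)"
    unfolding hint_norm_moment[OF assms] rhat_eq_pmf[OF assms] hvar_def by simp
  then show ?thesis by (simp only: of_real_eq_iff)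
qed

lemma hint_char_fmom: "\<pi> \<in> dual \<Longrightarrow> fmom P (hint m (char_inv \<pi>))"
  by (rule hint_fmom[OF weight_char_inv])

lemma nhint_fmom:
  assumes "\<pi> \<in> dual" shows "fmom P (nhint m \<pi>)"
proof -
  have "nhint m \<pi> = (\<lambda>\<omega>. inverse (complex_of_real (sqrt (hvar m \<pi>))) * hint m (char_inv \<pi>) \<omega>)"
    by (simp add: nhint_def fun_eq_iff field_simps)
  then show ?thesis using fmom_scale[OF hint_char_fmom[OF assms]] by (simp only:)
qed

lemma nhint_abs_moment:
  assumes "pmf (spec_pow m) \<pi> > 0"
  shows "expectation (\<lambda>\<omega>. cmod (nhint m \<pi> \<omega>) ^ (2 * k)) = expectation (\<lambda>\<omega>. cmod (hint m (char_inv \<pi>) \<omega>) ^ (2 * k)) / hvar m \<pi> ^ k"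
proof -
  have v: "hvar m \<pi> > 0" using assms by (simp add: hvar_def)
  have "sqrt (hvar m \<pi>) ^ (2 * k) = hvar m \<pi> ^ k" using v by (simp only: power_mult real_sqrt_pow2 less_imp_le)
  then have "cmod (nhint m \<pi> \<omega>) ^ (2 * k) = cmod (hint m (char_inv \<pi>) \<omega>) ^ (2 * k) / hvar m \<pi> ^ k" for \<omega>
    using v by (simp only: nhint_def norm_divide norm_of_real real_sqrt_abs2 power_divide abs_of_pos real_sqrt_gt_zero)
  then show ?thesis by simp
qed

lemma nhint_second_moment:
  assumes "\<pi> \<in> dual" "pmf (spec_pow m) \<pi> > 0"
  shows "expectation (\<lambda>\<omega>. (cmod (nhint m \<pi> \<omega>))\<^sup>2) = 1"
proof -
  have "hvar m \<pi> > 0" using assms by (simp add: hvar_def)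
  then show ?thesis using nhint_abs_moment[OF assms(2), of 1] hint_second_moment[OF assms(1), of m] by simp
qed

lemma nhint_fourth_moment:
  assumes "pmf (spec_pow m) \<pi> > 0"
  shows "expectation (\<lambda>\<omega>. Re (nhint m \<pi> \<omega>) ^ 4) = expectation (\<lambda>\<omega>. Re (hint m (char_inv \<pi>) \<omega>) ^ 4) / (hvar m \<pi>)\<^sup>2"
    and "expectation (\<lambda>\<omega>. Im (nhint m \<pi> \<omega>) ^ 4) = expectation (\<lambda>\<omega>. Im (hint m (char_inv \<pi>) \<omega>) ^ 4) / (hvar m \<pi>)\<^sup>2"
proof -
  have v: "hvar m \<pi> > 0" using assms by (simp add: hvar_def)
  have "sqrt (hvar m \<pi>) ^ (2 * 2) = (hvar m \<pi>)\<^sup>2" using v by (simp only: power_mult real_sqrt_pow2 less_imp_le)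
  then have s4: "sqrt (hvar m \<pi>) ^ 4 = (hvar m \<pi>)\<^sup>2" by simp
  show "expectation (\<lambda>\<omega>. Re (nhint m \<pi> \<omega>) ^ 4) = expectation (\<lambda>\<omega>. Re (hint m (char_inv \<pi>) \<omega>) ^ 4) / (hvar m \<pi>)\<^sup>2"
    "expectation (\<lambda>\<omega>. Im (nhint m \<pi> \<omega>) ^ 4) = expectation (\<lambda>\<omega>. Im (hint m (char_inv \<pi>) \<omega>) ^ 4) / (hvar m \<pi>)\<^sup>2"
    unfolding nhint_def Re_divide_of_real Im_divide_of_real power_divide s4 by (rule integral_divide_zero)+
qed

lemma Re_nhint_AE:
  assumes pi: "\<pi> \<in> dual"
  shows "AE \<omega> in P. Re (\<zeta> * nhint m \<pi> \<omega>) = hint m (\<lambda>g. Re (\<zeta> / of_real (sqrt (hvar m \<pi>)) * char_inv \<pi> g)) \<omega>"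
proof -
  let ?z = "\<zeta> / complex_of_real (sqrt (hvar m \<pi>))"
  have "weight (\<lambda>g. ?z * char_inv \<pi> g)" by (intro weight_mult weight_const weight_char_inv pi)
  from hint_Re_Im[OF this, of m] show ?thesis
  proof eventually_elim
    case (elim \<omega>)
    have "\<zeta> * nhint m \<pi> \<omega> = ?z * hint m (char_inv \<pi>) \<omega>" by (simp add: nhint_def)
    also have "\<dots> = hint m (\<lambda>g. ?z * char_inv \<pi> g) \<omega>" by (rule hint_cmult[symmetric])
    finally have "\<zeta> * nhint m \<pi> \<omega> = hint m (\<lambda>g. ?z * char_inv \<pi> g) \<omega>" .
    then show ?case using elim by (simp only: complex.sel)
  qed
qed

text \<open>By \<open>(Re z)\<^sup>2 = (cmod z)\<^sup>2 / 2 + Re (z\<^sup>2) / 2\<close>: the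
  unconjugated second moment vanishes because \<pi> differs from its inverse, so every direction
  \<zeta> receives half of the variance, as for the limit law.\<close>

lemma Re_nhint_variance:
  assumes pi: "\<pi> \<in> dual" "pmf (spec_pow m) \<pi> > 0" "char_mult \<pi> \<pi> \<noteq> char_one"
  shows "expectation (\<lambda>\<omega>. (Re (\<zeta> * nhint m \<pi> \<omega>))\<^sup>2) = (cmod \<zeta>)\<^sup>2 / 2"
proof -
  let ?F = "hint m (char_inv \<pi>)" and ?z = "\<zeta> / complex_of_real (sqrt (hvar m \<pi>))"
  have ne: "\<pi> \<noteq> char_inv \<pi>" using pi(3) char_inv_right[OF pi(1)] by auto
  have "expectation (\<lambda>\<omega>. ?F \<omega> * ?F \<omega>) = 0"
    using hint_char_moment[OF pi(1) char_inv_dual[OF pi(1)], of m] ne by simp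
  then have sq: "expectation (\<lambda>\<omega>. (\<zeta> * nhint m \<pi> \<omega>)\<^sup>2) = 0"
  proof -
    assume F: "expectation (\<lambda>\<omega>. ?F \<omega> * ?F \<omega>) = 0"
    have "(\<zeta> * nhint m \<pi> \<omega>)\<^sup>2 = ?z\<^sup>2 * (?F \<omega> * ?F \<omega>)" for \<omega> by (simp add: nhint_def power2_eq_square)
    then show ?thesis by (simp only: integral_mult_right_zero F mult_zero_right)
  qed
  have i1: "integrable P (\<lambda>\<omega>. (\<zeta> * nhint m \<pi> \<omega>)\<^sup>2)" by (intro fmom_integrable fmom_power fmom_scale nhint_fmom pi)
  have i2: "integrable P (\<lambda>\<omega>. (cmod (nhint m \<pi> \<omega>))\<^sup>2)" by (intro fmom_power_integrable nhint_fmom pi)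
  have alg: "(Re z)\<^sup>2 = (cmod z)\<^sup>2 / 2 + Re (z\<^sup>2) / 2" for z
    by (simp add: cmod_power2 Re_power2 field_simps)
  have "expectation (\<lambda>\<omega>. (Re (\<zeta> * nhint m \<pi> \<omega>))\<^sup>2) = expectation (\<lambda>\<omega>. (cmod \<zeta>)\<^sup>2 / 2 * (cmod (nhint m \<pi> \<omega>))\<^sup>2 + Re ((\<zeta> * nhint m \<pi> \<omega>)\<^sup>2) / 2)"
    unfolding alg by (simp add: norm_mult power_mult_distrib)
  also have "\<dots> = (cmod \<zeta>)\<^sup>2 / 2 * expectation (\<lambda>\<omega>. (cmod (nhint m \<pi> \<omega>))\<^sup>2) + expectation (\<lambda>\<omega>. Re ((\<zeta> * nhint m \<pi> \<omega>)\<^sup>2)) / 2"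
    using i1 i2 by (subst Bochner_Integration.integral_add) (auto intro!: integrable_mult_right integrable_divide integrable_Re simp del: times_complex.simps)
  also have "expectation (\<lambda>\<omega>. Re ((\<zeta> * nhint m \<pi> \<omega>)\<^sup>2)) = 0"
    using i1 sq by (simp only: integral_Re zero_complex.sel)
  finally show ?thesis by (simp add: nhint_second_moment[OF pi(1,2)])
qed

text \<open>A fixed direction \<zeta> is treated as in the Cramer-Wold device. The weight
  \<open>w l\<close> contains the normalization, so that \<open>Y l\<close> has the same variance
  \<open>s\<close> for every \<open>l\<close>.\<close>

theorem nhint_char_limit:
  assumes pi: "\<And>l. \<pi> l \<in> dual" and pos: "\<And>l. pmf (spec_pow (Suc n)) (\<pi> l) > 0"
    and nontriv: "\<And>l. char_mult (\<pi> l) (\<pi> l) \<noteq> char_one" "\<And>l. char_mult (char_mult (\<pi> l) (\<pi> l)) (char_mult (\<pi> l) (\<pi> l)) \<noteq> char_one"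
    and lim: "(\<lambda>l. SS_sum (Suc n) (\<pi> l) / (hvar (Suc n) (\<pi> l))\<^sup>2) \<longlonglongrightarrow> 0"
  shows "(\<lambda>l. expectation (\<lambda>\<omega>. iexp (Re (\<zeta> * nhint (Suc n) (\<pi> l) \<omega>)))) \<longlonglongrightarrow> of_real (exp (- (cmod \<zeta>)\<^sup>2 / 4))"
proof -
  define v where "v l = hvar (Suc n) (\<pi> l)" for l
  have v: "v l > 0" for l using pos by (simp add: v_def hvar_def)
  define z where "z l = \<zeta> / complex_of_real (sqrt (v l))" for l
  define w where "w l = (\<lambda>g. Re (z l * char_inv (\<pi> l) g))" for l
  define Y where "Y l = hint (Suc n) (w l)" for l
  define s where "s = (cmod \<zeta>)\<^sup>2 / 2"
  have s0: "s \<ge> 0" by (simp add: s_def)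
  have w: "weight (w l)" for l unfolding w_def by (intro weight_Re weight_mult weight_const weight_char_inv pi)
  have Yf: "fmom P (Y l)" for l unfolding Y_def by (rule hint_fmom[OF w])
  have Gf: "fmom P (Gam n (w l))" for l by (rule Gam_fmom[OF w])
  have [measurable]: "Y l \<in> borel_measurable P" "nhint (Suc n) (\<pi> l) \<in> borel_measurable P" for l
    by (rule fmom_measurable[OF Yf], rule fmom_measurable[OF nhint_fmom[OF pi]])
  have AE_Y: "AE \<omega> in P. Re (\<zeta> * nhint (Suc n) (\<pi> l) \<omega>) = Y l \<omega>" for l
    unfolding Y_def w_def z_def v_def by (rule Re_nhint_AE[OF pi])
  have z2: "(cmod (z l))\<^sup>2 = (cmod \<zeta>)\<^sup>2 / v l" for l
    using v[of l] by (simp add: z_def norm_divide power_divide)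
  have EY2: "expectation (\<lambda>\<omega>. (Y l \<omega>)\<^sup>2) = s" for l
  proof -
    have "expectation (\<lambda>\<omega>. (Y l \<omega>)\<^sup>2) = expectation (\<lambda>\<omega>. (Re (\<zeta> * nhint (Suc n) (\<pi> l) \<omega>))\<^sup>2)"
    proof (rule integral_cong_AE)
      show "AE \<omega> in P. (Y l \<omega>)\<^sup>2 = (Re (\<zeta> * nhint (Suc n) (\<pi> l) \<omega>))\<^sup>2"
        using AE_Y[of l] by eventually_elim (simp only:)
    qed measurable
    then show ?thesis unfolding s_def Re_nhint_variance[OF pi pos nontriv(1)] .
  qed
  have EG: "expectation (Gam n (w l)) = s" for l
    using second_moment_Gam[OF w[of l], of n] EY2[of l] by (simp add: Y_def)
  define A where "A = (real (Suc n))\<^sup>2 * (\<Sum>(a, b, c)\<in>triples n. tcoef n a b c) * cmod \<zeta> ^ 4"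
  define \<delta> where "\<delta> l = SS_sum (Suc n) (\<pi> l) / (v l)\<^sup>2" for l
  \<comment> \<open>The leading term of \<open>Gam_square_upper\<close> equals the squared mean
    \<open>s\<^sup>2\<close>, so only the sums of condition 3 remain in the variance.\<close>
  have var: "expectation (\<lambda>\<omega>. (Gam n (w l) \<omega> - s)\<^sup>2) \<le> A * \<delta> l" for l
  proof -
    have "expectation (\<lambda>\<omega>. (Gam n (w l) \<omega> - s)\<^sup>2) = expectation (\<lambda>\<omega>. (Gam n (w l) \<omega>)\<^sup>2 - 2 * s * Gam n (w l) \<omega> + s\<^sup>2)"
    proof -
      have "(x - s)\<^sup>2 = x\<^sup>2 - 2 * s * x + s\<^sup>2" for x by (simp add: power2_eq_square algebra_simps)
      then show ?thesis by (simp only:)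
    qed
    also have "\<dots> = expectation (\<lambda>\<omega>. (Gam n (w l) \<omega>)\<^sup>2) - 2 * s * s + s\<^sup>2"
      using Gf[of l] by (simp add: fmom_integrable fmom_intros EG prob_space)
    also have "\<dots> = expectation (\<lambda>\<omega>. (Gam n (w l) \<omega>)\<^sup>2) - s\<^sup>2" by (simp add: power2_eq_square)
    also have "\<dots> \<le> A * \<delta> l"
    proof -
      have e1: "(cmod (z l))\<^sup>2 * v l / 2 = s" using v[of l] by (simp add: z2 s_def)
      have e2: "cmod (z l) ^ 4 = cmod \<zeta> ^ 4 / (v l)\<^sup>2"
      proof -
        have "cmod (z l) ^ (2 * 2) = cmod \<zeta> ^ (2 * 2) / (v l)\<^sup>2" unfolding power_mult z2 power_divide ..
        then show ?thesis by simp
      qed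
      have "expectation (\<lambda>\<omega>. (Gam n (w l) \<omega>)\<^sup>2) \<le> s\<^sup>2 + (real (Suc n))\<^sup>2 * (\<Sum>(a, b, c)\<in>triples n. tcoef n a b c) * cmod (z l) ^ 4 * SS_sum (Suc n) (\<pi> l)"
        using Gam_square_upper[OF pi nontriv, of n "z l" l] e1 unfolding w_def v_def hvar_def by (simp only:)
      then show ?thesis unfolding e2 A_def \<delta>_def by (simp del: of_nat_Suc)
    qed
    finally show ?thesis .
  qed
  have "(\<lambda>l. expectation (\<lambda>\<omega>. Y l \<omega> ^ k)) \<longlonglongrightarrow> gmom s k" for k
  proof (rule gaussian_moments_limit)
    have "expectation (Y l) = 0" for l
      using moment_recursion[OF w[of l], of n 0] by (simp add: Y_def)
    then show "(\<lambda>l. expectation (Y l)) \<longlonglongrightarrow> 0" by simp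
  next
    fix k
    obtain K where K: "K \<ge> 0" "\<And>w :: 'g \<Rightarrow> real. weight w \<Longrightarrow> expectation (\<lambda>\<omega>. hint (Suc n) w \<omega> ^ (2 * k)) \<le> K * expectation (\<lambda>\<omega>. (hint (Suc n) w \<omega>)\<^sup>2) ^ k"
      using hypercontractive[of "Suc n" k] by auto
    have eq: "expectation (\<lambda>\<omega>. Y l \<omega> ^ Suc (Suc k)) - real (Suc k) * s * expectation (\<lambda>\<omega>. Y l \<omega> ^ k) =
        real (Suc k) * expectation (\<lambda>\<omega>. (Gam n (w l) \<omega> - s) * Y l \<omega> ^ k)" for l
    proof -
      have "expectation (\<lambda>\<omega>. (Gam n (w l) \<omega> - s) * Y l \<omega> ^ k) = expectation (\<lambda>\<omega>. Gam n (w l) \<omega> * Y l \<omega> ^ k - s * Y l \<omega> ^ k)"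
        by (simp add: left_diff_distrib)
      also have "\<dots> = expectation (\<lambda>\<omega>. Gam n (w l) \<omega> * Y l \<omega> ^ k) - s * expectation (\<lambda>\<omega>. Y l \<omega> ^ k)"
        using Gf[of l] Yf[of l] by (simp add: fmom_integrable fmom_intros)
      finally show ?thesis using moment_recursion[OF w[of l], of n "Suc k"] by (simp add: Y_def right_diff_distrib del: power_Suc of_nat_Suc)
    qed
    \<comment> \<open>Hypercontractivity bounds the moments of order \<open>2 * k\<close> uniformly
      in \<open>l\<close>, as the second moment is always \<open>s\<close>.\<close>
    have bd: "\<bar>expectation (\<lambda>\<omega>. (Gam n (w l) \<omega> - s) * Y l \<omega> ^ k)\<bar> \<le> sqrt (A * \<delta> l * (K * s ^ k))" for l
    proof (rule real_le_rsqrt)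
      have "(expectation (\<lambda>\<omega>. (Gam n (w l) \<omega> - s) * Y l \<omega> ^ k))\<^sup>2 \<le> expectation (\<lambda>\<omega>. (Gam n (w l) \<omega> - s)\<^sup>2) * expectation (\<lambda>\<omega>. (Y l \<omega> ^ k)\<^sup>2)"
        by (rule fmom_Cauchy_Schwarz) (intro fmom_intros Gf Yf)+
      also have "\<dots> \<le> (A * \<delta> l) * (K * s ^ k)"
      proof (rule mult_mono[OF var])
        show "expectation (\<lambda>\<omega>. (Y l \<omega> ^ k)\<^sup>2) \<le> K * s ^ k"
          using K(2)[OF w[of l]] EY2[of l] by (simp add: Y_def power_mult[symmetric] mult.commute)
        show "0 \<le> A * \<delta> l" using var[of l] by (rule order_trans[rotated]) simp
      qed simp
      finally show "\<bar>expectation (\<lambda>\<omega>. (Gam n (w l) \<omega> - s) * Y l \<omega> ^ k)\<bar>\<^sup>2 \<le> A * \<delta> l * (K * s ^ k)" by simp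
    qed
    have "\<delta> \<longlonglongrightarrow> 0" using lim by (simp add: \<delta>_def[abs_def] v_def)
    then have "(\<lambda>l. sqrt (A * \<delta> l * (K * s ^ k))) \<longlonglongrightarrow> sqrt (A * 0 * (K * s ^ k))" by (intro tendsto_intros)
    then have "(\<lambda>l. sqrt (A * \<delta> l * (K * s ^ k))) \<longlonglongrightarrow> 0" by simp
    then have "(\<lambda>l. expectation (\<lambda>\<omega>. (Gam n (w l) \<omega> - s) * Y l \<omega> ^ k)) \<longlonglongrightarrow> 0"
      by (rule Lim_null_comparison[rotated]) (use bd in simp)
    then have "(\<lambda>l. real (Suc k) * expectation (\<lambda>\<omega>. (Gam n (w l) \<omega> - s) * Y l \<omega> ^ k)) \<longlonglongrightarrow> real (Suc k) * 0" by (rule tendsto_mult_left)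
    then show "(\<lambda>l. expectation (\<lambda>\<omega>. Y l \<omega> ^ Suc (Suc k)) - real (Suc k) * s * expectation (\<lambda>\<omega>. Y l \<omega> ^ k)) \<longlonglongrightarrow> 0"
      unfolding eq by simp
  qed
  from moment_method[OF Yf this] have "(\<lambda>l. expectation (\<lambda>\<omega>. iexp (Y l \<omega>))) \<longlonglongrightarrow> of_real (exp (- s / 2))" .
  moreover have "expectation (\<lambda>\<omega>. iexp (Y l \<omega>)) = expectation (\<lambda>\<omega>. iexp (Re (\<zeta> * nhint (Suc n) (\<pi> l) \<omega>)))" for l
  proof (rule integral_cong_AE)
    show "AE \<omega> in P. iexp (Y l \<omega>) = iexp (Re (\<zeta> * nhint (Suc n) (\<pi> l) \<omega>))"
      using AE_Y[of l] by eventually_elim (simp only:)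
  qed measurable
  ultimately show ?thesis by (simp add: s_def)
qed

lemma nhint_law_limit:
  assumes pi: "\<And>l. \<pi> l \<in> dual" and pos: "\<And>l. pmf (spec_pow (Suc n)) (\<pi> l) > 0"
    and nontriv: "\<And>l. char_mult (\<pi> l) (\<pi> l) \<noteq> char_one" "\<And>l. char_mult (char_mult (\<pi> l) (\<pi> l)) (char_mult (\<pi> l) (\<pi> l)) \<noteq> char_one"
    and lim: "(\<lambda>l. SS_sum (Suc n) (\<pi> l) / (hvar (Suc n) (\<pi> l))\<^sup>2) \<longlonglongrightarrow> 0"
  shows "conv_law_cgauss P (\<lambda>l. nhint (Suc n) (\<pi> l))"
  unfolding conv_law_cgauss_def
proof (intro allI impI)
  fix f :: "complex \<Rightarrow> real" assume f: "continuous_on UNIV f \<and> bounded (range f)"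
  then obtain B where B: "\<And>x. \<bar>f x\<bar> \<le> B" by (auto simp: bounded_iff)
  show "(\<lambda>l. expectation (\<lambda>\<omega>. f (nhint (Suc n) (\<pi> l) \<omega>))) \<longlonglongrightarrow> (\<integral>z. f (cgauss_var z) \<partial>cgauss_law)"
  proof (rule planar_Levy[where K = 1 and B = B])
    show "prob_space P" by (rule prob_space_axioms)
    show "(\<lambda>l. expectation (\<lambda>\<omega>. iexp (Re (\<zeta> * nhint (Suc n) (\<pi> l) \<omega>)))) \<longlonglongrightarrow> (\<integral>z. iexp (Re (\<zeta> * cgauss_var z)) \<partial>cgauss_law)" for \<zeta>
      unfolding cgauss_char by (rule nhint_char_limit[OF pi pos nontriv lim])
    show "expectation (\<lambda>\<omega>. (cmod (nhint (Suc n) (\<pi> l) \<omega>))\<^sup>2) \<le> 1" for l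
      by (simp only: nhint_second_moment[OF pi pos] order_refl)
    show "(\<integral>z. (cmod (cgauss_var z))\<^sup>2 \<partial>cgauss_law) \<le> 1" by (simp only: cgauss_second order_refl)
  qed (use f B pi in \<open>auto intro: cgauss_prob fmom_measurable[OF cgauss_fmom] fmom_measurable[OF nhint_fmom] fmom_power_integrable[OF nhint_fmom] fmom_power_integrable[OF cgauss_fmom]\<close>)
qed

end

context isotropic_field
begin

text \<open>Convergence in law passes to fourth moments because the sixth moments are bounded:
  hypercontractivity compares them with the second moment, which is 1.\<close>

lemma fourth_moments_of_law_limit:
  assumes pi: "\<And>l. \<pi> l \<in> dual" and pos: "\<And>l. pmf (spec_pow m) (\<pi> l) > 0"
    and law: "conv_law_cgauss P (\<lambda>l. nhint m (\<pi> l))"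
  shows "(\<lambda>l. expectation (\<lambda>\<omega>. Re (nhint m (\<pi> l) \<omega>) ^ 4)) \<longlonglongrightarrow> 3 / 4"
    and "(\<lambda>l. expectation (\<lambda>\<omega>. Im (nhint m (\<pi> l) \<omega>) ^ 4)) \<longlonglongrightarrow> 3 / 4"
proof -
  obtain K where K: "K \<ge> 0" "\<And>w :: 'g \<Rightarrow> real. weight w \<Longrightarrow> expectation (\<lambda>\<omega>. hint m w \<omega> ^ (2 * 3)) \<le> K * expectation (\<lambda>\<omega>. (hint m w \<omega>)\<^sup>2) ^ 3"
    using hypercontractive[of m 3] by auto
  have X6: "expectation (\<lambda>\<omega>. cmod (nhint m (\<pi> l) \<omega>) ^ 6) \<le> 2 ^ Suc 3 * K" for l
  proof -
    have v: "hvar m (\<pi> l) > 0" using pos by (simp add: hvar_def)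
    have "expectation (\<lambda>\<omega>. cmod (hint m (char_inv (\<pi> l)) \<omega>) ^ (2 * 3)) \<le> 2 ^ Suc 3 * K * hvar m (\<pi> l) ^ 3"
      using hypercontractive_complex[OF K(2,1) weight_char_inv[OF pi[of l]]] unfolding hint_second_moment[OF pi] .
    then have "expectation (\<lambda>\<omega>. cmod (hint m (char_inv (\<pi> l)) \<omega>) ^ (2 * 3)) / hvar m (\<pi> l) ^ 3 \<le> 2 ^ Suc 3 * K"
      using v by (subst pos_divide_le_eq) auto
    then show ?thesis using nhint_abs_moment[OF pos, of l 3] by simp
  qed
  have conv: "(\<lambda>l. expectation (\<lambda>\<omega>. f (nhint m (\<pi> l) \<omega>))) \<longlonglongrightarrow> (\<integral>z. f (cgauss_var z) \<partial>cgauss_law)"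
    if "continuous_on UNIV f" "bounded (range f)" for f :: "complex \<Rightarrow> real"
    using law that unfolding conv_law_cgauss_def by blast
  have lim: "(\<lambda>l. expectation (\<lambda>\<omega>. \<phi> (nhint m (\<pi> l) \<omega>) ^ 4)) \<longlonglongrightarrow> (\<integral>z. \<phi> (cgauss_var z) ^ 4 \<partial>cgauss_law)"
    if "continuous_on UNIV \<phi>" "\<And>x. \<bar>\<phi> x\<bar> \<le> cmod x" for \<phi> :: "complex \<Rightarrow> real"
  proof (rule fourth_moment_limit[where X = "\<lambda>l. nhint m (\<pi> l)" and Z = cgauss_var and \<phi> = \<phi>])
    show "prob_space P" by (rule prob_space_axioms)
    show "fmom P (nhint m (\<pi> l))" for l by (rule nhint_fmom[OF pi])
  qed (fact cgauss_prob cgauss_fmom X6 that conv)+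
  show "(\<lambda>l. expectation (\<lambda>\<omega>. Re (nhint m (\<pi> l) \<omega>) ^ 4)) \<longlonglongrightarrow> 3 / 4"
    using lim[of Re, OF continuous_on_Re[OF continuous_on_id] abs_Re_le_cmod] by (simp only: cgauss_Re4)
  show "(\<lambda>l. expectation (\<lambda>\<omega>. Im (nhint m (\<pi> l) \<omega>) ^ 4)) \<longlonglongrightarrow> 3 / 4"
    using lim[of Im, OF continuous_on_Im[OF continuous_on_id] abs_Im_le_cmod] by (simp only: cgauss_Im4)
qed

text \<open>The two normalized fourth moments add up to at least \<open>3 / 2\<close> plus
  \<open>3 / 4\<close> of the normalized \<open>SS_sum\<close>. Since their sum tends to
  \<open>3 / 2\<close>, the excess tends to 0.\<close>

lemma contractions_of_fourth_moments:
  assumes pi: "\<And>l. \<pi> l \<in> dual" and pos: "\<And>l. pmf (spec_pow m) (\<pi> l) > 0" and m: "m \<ge> 1"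
    and Re4: "(\<lambda>l. expectation (\<lambda>\<omega>. Re (nhint m (\<pi> l) \<omega>) ^ 4)) \<longlonglongrightarrow> 3 / 4"
    and Im4: "(\<lambda>l. expectation (\<lambda>\<omega>. Im (nhint m (\<pi> l) \<omega>) ^ 4)) \<longlonglongrightarrow> 3 / 4"
  shows "(\<lambda>l. SS_sum m (\<pi> l) / (hvar m (\<pi> l))\<^sup>2) \<longlonglongrightarrow> 0"
proof -
  let ?b = "\<lambda>l. 4 / 3 * (expectation (\<lambda>\<omega>. Re (nhint m (\<pi> l) \<omega>) ^ 4) + expectation (\<lambda>\<omega>. Im (nhint m (\<pi> l) \<omega>) ^ 4) - 3 / 2)"
  have le: "SS_sum m (\<pi> l) / (hvar m (\<pi> l))\<^sup>2 \<le> ?b l" for l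
  proof -
    let ?F = "hint m (char_inv (\<pi> l))" and ?v = "hvar m (\<pi> l)"
    have v: "?v > 0" using pos by (simp add: hvar_def)
    have f: "fmom P ?F" by (rule hint_char_fmom[OF pi])
    have fr: "fmom P (\<lambda>\<omega>. Re (?F \<omega>))" "fmom P (\<lambda>\<omega>. Im (?F \<omega>))"
      by (rule fmom_mono[OF _ f]; use fmom_measurable[OF f] in \<open>simp add: abs_Re_le_cmod abs_Im_le_cmod\<close>)+
    \<comment> \<open>By the diagram formula the real part of \<open>z ^ 4\<close> has nonnegative
      expectation, so it may be dropped from a lower bound.\<close>
    have alg: "Re z ^ 4 + Im z ^ 4 = 3 / 4 * cmod z ^ 4 + 1 / 4 * Re (z ^ 4)" for z
    proof -
      have c4: "cmod z ^ 4 = ((Re z)\<^sup>2 + (Im z)\<^sup>2)\<^sup>2" using cmod_power2[of z] by (metis power_mult numeral_times_numeral semiring_norm(11,13))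
      have z4: "z ^ 4 = z\<^sup>2 * z\<^sup>2" by (simp add: power_add[symmetric])
      show ?thesis unfolding c4 z4 times_complex.sel Re_power2 Im_power2 by (simp add: power2_eq_square eval_nat_numeral algebra_simps)
    qed
    have "expectation (\<lambda>\<omega>. Re (?F \<omega>) ^ 4) + expectation (\<lambda>\<omega>. Im (?F \<omega>) ^ 4) = expectation (\<lambda>\<omega>. Re (?F \<omega>) ^ 4 + Im (?F \<omega>) ^ 4)"
      by (rule Bochner_Integration.integral_add[symmetric]) (intro fmom_integrable fmom_power fr)+
    also have "\<dots> = expectation (\<lambda>\<omega>. 3 / 4 * cmod (?F \<omega>) ^ 4 + 1 / 4 * Re (?F \<omega> ^ 4))" by (simp only: alg)
    also have "\<dots> = 3 / 4 * expectation (\<lambda>\<omega>. cmod (?F \<omega>) ^ 4) + 1 / 4 * Re (expectation (\<lambda>\<omega>. ?F \<omega> ^ 4))"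
    proof -
      have i: "integrable P (\<lambda>\<omega>. ?F \<omega> ^ 4)" by (intro fmom_integrable fmom_power f)
      have "expectation (\<lambda>\<omega>. 3 / 4 * cmod (?F \<omega>) ^ 4 + 1 / 4 * Re (?F \<omega> ^ 4)) =
        expectation (\<lambda>\<omega>. 3 / 4 * cmod (?F \<omega>) ^ 4) + expectation (\<lambda>\<omega>. 1 / 4 * Re (?F \<omega> ^ 4))"
        by (rule Bochner_Integration.integral_add) (intro integrable_mult_right fmom_power_integrable f integrable_Re i)+
      then show ?thesis by (simp only: integral_mult_right_zero integral_Re[OF i])
    qed
    also have "\<dots> \<ge> 3 / 4 * (2 * ?v\<^sup>2 + SS_sum m (\<pi> l))"
    proof (rule add_increasing2)
      note low = fourth_moment_lower[OF pi m, of l, folded hvar_def]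
      show "3 / 4 * (2 * ?v\<^sup>2 + SS_sum m (\<pi> l)) \<le> 3 / 4 * expectation (\<lambda>\<omega>. cmod (?F \<omega>) ^ 4)"
        by (rule mult_left_mono[OF low(1)]) simp
      show "0 \<le> 1 / 4 * Re (expectation (\<lambda>\<omega>. ?F \<omega> ^ 4))" using low(2) by simp
    qed
    finally have "(3 / 4 * (2 * ?v\<^sup>2 + SS_sum m (\<pi> l))) / ?v\<^sup>2 \<le> (expectation (\<lambda>\<omega>. Re (?F \<omega>) ^ 4) + expectation (\<lambda>\<omega>. Im (?F \<omega>) ^ 4)) / ?v\<^sup>2"
      by (rule divide_right_mono) simp
    then have "3 / 2 + 3 / 4 * (SS_sum m (\<pi> l) / ?v\<^sup>2) \<le> expectation (\<lambda>\<omega>. Re (nhint m (\<pi> l) \<omega>) ^ 4) + expectation (\<lambda>\<omega>. Im (nhint m (\<pi> l) \<omega>) ^ 4)"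
      unfolding nhint_fourth_moment[OF pos] using v by (simp add: add_divide_distrib distrib_left)
    moreover have "x \<le> 4 / 3 * (y + z - 3 / 2)" if "3 / 2 + 3 / 4 * x \<le> y + z" for x y z :: real
      using that by (simp add: field_simps)
    ultimately show ?thesis by blast
  qed
  have "?b \<longlonglongrightarrow> 4 / 3 * (3 / 4 + 3 / 4 - 3 / 2)" by (intro tendsto_intros Re4 Im4)
  then have "?b \<longlonglongrightarrow> 0" by simp
  then show ?thesis
    by (rule tendsto_sandwich[OF _ _ tendsto_const, rotated 2]) (use le SS_sum_nonneg in auto)
qed

text \<open>The reflection of \<open>q\<close> to \<open>m - q\<close> exchanges the two index
  orders, and finitely many nonnegative sequences tend to 0 exactly when their sum does. The
  normalizations differ by the constant \<open>(fact m)\<^sup>2\<close>.\<close>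

lemma contractions_iff_SS_sum:
  "(\<forall>q\<in>{1..m-1}. (\<lambda>l. SS q (m - q) (\<pi> l) / (pmf (spec_pow m) (\<pi> l))\<^sup>2) \<longlonglongrightarrow> 0) \<longleftrightarrow> (\<lambda>l. SS_sum m (\<pi> l) / (hvar m (\<pi> l))\<^sup>2) \<longlonglongrightarrow> 0"
    (is "?L \<longleftrightarrow> ?R")
proof
  assume L: ?L
  have "(\<lambda>l. SS (m - q) q (\<pi> l) / (pmf (spec_pow m) (\<pi> l))\<^sup>2) \<longlonglongrightarrow> 0" if "q \<in> {1..m-1}" for q
  proof -
    have "m - q \<in> {1..m-1}" "m - (m - q) = q" using that by auto
    then show ?thesis using L by (metis (no_types))
  qed
  then have "(\<lambda>l. 1 / (fact m)\<^sup>2 * (\<Sum>q=1..m-1. SS (m - q) q (\<pi> l) / (pmf (spec_pow m) (\<pi> l))\<^sup>2)) \<longlonglongrightarrow> 1 / (fact m)\<^sup>2 * 0"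
    by (intro tendsto_mult_left tendsto_null_sum) auto
  moreover have "1 / (fact m)\<^sup>2 * (\<Sum>q=1..m-1. SS (m - q) q (\<pi> l) / (pmf (spec_pow m) (\<pi> l))\<^sup>2) = SS_sum m (\<pi> l) / (hvar m (\<pi> l))\<^sup>2" for l
    by (simp add: SS_sum_def hvar_def power_mult_distrib sum_divide_distrib mult_ac)
  ultimately show ?R by (simp only: mult_zero_right)
next
  assume R: ?R
  show ?L
  proof
    fix q assume q: "q \<in> {1..m-1}"
    have "(\<lambda>l. (fact m)\<^sup>2 * (SS_sum m (\<pi> l) / (hvar m (\<pi> l))\<^sup>2)) \<longlonglongrightarrow> (fact m)\<^sup>2 * 0" by (intro tendsto_mult_left R)
    then have lim: "(\<lambda>l. SS_sum m (\<pi> l) / (pmf (spec_pow m) (\<pi> l))\<^sup>2) \<longlonglongrightarrow> 0"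
      by (simp add: hvar_def power_mult_distrib)
    have "1 \<le> m - q" "m - q < m" "m - (m - q) = q" using q by auto
    then have "SS q (m - q) (\<pi> l) \<le> SS_sum m (\<pi> l)" for l using SS_le_SS_sum[of "m - q" m "\<pi> l"] by simp
    then show "(\<lambda>l. SS q (m - q) (\<pi> l) / (pmf (spec_pow m) (\<pi> l))\<^sup>2) \<longlonglongrightarrow> 0"
      by (intro tendsto_sandwich[OF _ _ tendsto_const lim] always_eventually allI divide_right_mono divide_nonneg_nonneg SS_nonneg) auto
  qed
qed

text \<open>At the trivial character the normalized \<open>SS_sum\<close> is a fixed positive
  number, so condition 3 makes \<open>\<pi> l\<close> nontrivial from some index \<open>L\<close>
  on. Connectedness extends this to its square and fourth power, and an initial segment does not
  affect the limit.\<close>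

lemma law_limit_of_contractions:
  assumes conn: "connected (UNIV :: 'g set)" and C: "\<And>\<pi>. \<pi> \<in> dual \<Longrightarrow> C \<pi> > 0" and m: "m \<ge> 2"
    and pi: "\<And>l. \<pi> l \<in> dual" and lim: "(\<lambda>l. SS_sum m (\<pi> l) / (hvar m (\<pi> l))\<^sup>2) \<longlonglongrightarrow> 0"
  shows "conv_law_cgauss P (\<lambda>l. nhint m (\<pi> l))"
proof -
  obtain n where n: "m = Suc n" using m by (cases m) auto
  have pos: "pmf (spec_pow m) \<pi>' > 0" if "\<pi>' \<in> dual" for \<pi>' using spec_pow_pos[OF C that] m by simp
  have "SS (m - 1) 1 char_one \<le> SS_sum m char_one" by (rule SS_le_SS_sum) (use m in auto)
  with SS_one_pos[OF C] have "SS_sum m char_one > 0" by (rule less_le_trans) (use m in auto)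
  moreover have "hvar m char_one > 0" using pos[OF char_one_dual] by (simp add: hvar_def)
  ultimately have "SS_sum m char_one / (hvar m char_one)\<^sup>2 > 0" by simp
  from order_tendstoD(2)[OF lim this] obtain L where L: "\<And>l. l \<ge> L \<Longrightarrow> SS_sum m (\<pi> l) / (hvar m (\<pi> l))\<^sup>2 < SS_sum m char_one / (hvar m char_one)\<^sup>2"
    by (auto simp: eventually_sequentially)
  have ne: "\<pi> (l + L) \<noteq> char_one" for l using L[of "l + L"] by auto
  have ne2: "char_mult (\<pi> (l + L)) (\<pi> (l + L)) \<noteq> char_one" for l
    using torsion_free_dual[OF conn pi] ne by blast
  have ne4: "char_mult (char_mult (\<pi> (l + L)) (\<pi> (l + L))) (char_mult (\<pi> (l + L)) (\<pi> (l + L))) \<noteq> char_one" for l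
    using torsion_free_dual[OF conn char_mult_dual[OF pi pi]] ne2 by blast
  have "conv_law_cgauss P (\<lambda>l. nhint m (\<pi> (l + L)))"
    unfolding n by (rule nhint_law_limit[OF pi _ ne2 ne4]) (use pos[OF pi] LIMSEQ_ignore_initial_segment[OF lim, of L] in \<open>simp_all add: n del: spec_pow.simps\<close>)
  then show ?thesis
    unfolding conv_law_cgauss_def using LIMSEQ_offset[of "\<lambda>l. expectation (\<lambda>\<omega>. f (nhint m (\<pi> l) \<omega>))" L for f :: "complex \<Rightarrow> real"] by blast
qed

text \<open>For every \<open>q\<close> the denominator in condition 4 is the same number
  \<open>pmf (spec_pow m) (\<pi> l)\<close>, since the laws of orders \<open>q\<close> and
  \<open>m - q\<close> convolve to that of order \<open>m\<close>. Condition 3 divides by its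
  square, so \<open>sup_ratio_bounds\<close> compares the two for each \<open>q\<close>.\<close>

lemma contractions_iff_sup_ratio:
  assumes C: "\<And>\<pi>. \<pi> \<in> dual \<Longrightarrow> C \<pi> > 0" and m: "m \<ge> 2" and pi: "\<And>l. \<pi> l \<in> dual"
  shows "(\<forall>q\<in>{1..m-1}. (\<lambda>l. SS q (m - q) (\<pi> l) / (pmf (spec_pow m) (\<pi> l))\<^sup>2) \<longlonglongrightarrow> 0) \<longleftrightarrow>
    (\<lambda>l. Max ((\<lambda>q. (SUP \<kappa>\<in>dual. pmf (spec_pow q) \<kappa> * pmf (spec_pow (m - q)) (char_mult (\<pi> l) (char_inv \<kappa>))) /
      (\<Sum>\<^sub>\<infinity>\<nu>\<in>dual. pmf (spec_pow q) \<nu> * pmf (spec_pow (m - q)) (char_mult (\<pi> l) (char_inv \<nu>)))) ` {1..m-1})) \<longlonglongrightarrow> 0"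
proof -
  define x where "x q l \<kappa> = pmf (spec_pow q) \<kappa> * pmf (spec_pow (m - q)) (char_mult (\<pi> l) (char_inv \<kappa>))" for q l \<kappa>
  have V: "infsum (x q l) dual = pmf (spec_pow m) (\<pi> l)" if "q \<in> {1..m-1}" for q l
  proof -
    have "q + (m - q) = m" using that by auto
    then show ?thesis unfolding x_def using spec_pow_add_infsum(2)[OF pi, of q "m - q" l] by simp
  qed
  have SSx: "SS q (m - q) (\<pi> l) = (\<Sum>\<^sub>\<infinity>\<kappa>\<in>dual. (x q l \<kappa>)\<^sup>2)" for q l
    unfolding SS_infsum x_def power_mult_distrib ..
  have Vpos: "infsum (x q l) dual > 0" if "q \<in> {1..m-1}" for q l
    unfolding V[OF that] using spec_pow_pos[OF C pi] m by simp
  have summ: "x q l summable_on dual" for q l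
    unfolding x_def[abs_def] by (rule spec_pow_add_infsum(1)[OF pi])
  have nn: "0 \<le> x q l a" for q l a by (simp add: x_def)
  note b = sup_ratio_bounds[of dual "x q l" for q l, OF nn summ Vpos]
  have eq: "SS q (m - q) (\<pi> l) / (pmf (spec_pow m) (\<pi> l))\<^sup>2 = (\<Sum>\<^sub>\<infinity>\<kappa>\<in>dual. (x q l \<kappa>)\<^sup>2) / (infsum (x q l) dual)\<^sup>2" if "q \<in> {1..m-1}" for q l
    unfolding V[OF that] SSx ..
  have one: "(\<lambda>l. SS q (m - q) (\<pi> l) / (pmf (spec_pow m) (\<pi> l))\<^sup>2) \<longlonglongrightarrow> 0 \<longleftrightarrow> (\<lambda>l. (SUP \<kappa>\<in>dual. x q l \<kappa>) / infsum (x q l) dual) \<longlonglongrightarrow> 0" if q: "q \<in> {1..m-1}" for q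
    unfolding eq[OF q]
  proof
    assume "(\<lambda>l. (\<Sum>\<^sub>\<infinity>\<kappa>\<in>dual. (x q l \<kappa>)\<^sup>2) / (infsum (x q l) dual)\<^sup>2) \<longlonglongrightarrow> 0"
    from tendsto_real_sqrt[OF this] have "(\<lambda>l. sqrt ((\<Sum>\<^sub>\<infinity>\<kappa>\<in>dual. (x q l \<kappa>)\<^sup>2) / (infsum (x q l) dual)\<^sup>2)) \<longlonglongrightarrow> 0" by simp
    then show "(\<lambda>l. (SUP \<kappa>\<in>dual. x q l \<kappa>) / infsum (x q l) dual) \<longlonglongrightarrow> 0"
      by (rule tendsto_sandwich[OF always_eventually always_eventually tendsto_const, rotated 2]) (intro allI b(4,2) q)+
  next
    assume "(\<lambda>l. (SUP \<kappa>\<in>dual. x q l \<kappa>) / infsum (x q l) dual) \<longlonglongrightarrow> 0"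
    then show "(\<lambda>l. (\<Sum>\<^sub>\<infinity>\<kappa>\<in>dual. (x q l \<kappa>)\<^sup>2) / (infsum (x q l) dual)\<^sup>2) \<longlonglongrightarrow> 0"
      by (rule tendsto_sandwich[OF always_eventually always_eventually tendsto_const, rotated 2]) (intro allI b(3,1) q)+
  qed
  have "(\<forall>q\<in>{1..m-1}. (\<lambda>l. SS q (m - q) (\<pi> l) / (pmf (spec_pow m) (\<pi> l))\<^sup>2) \<longlonglongrightarrow> 0) \<longleftrightarrow>
    (\<forall>q\<in>{1..m-1}. (\<lambda>l. (SUP \<kappa>\<in>dual. x q l \<kappa>) / infsum (x q l) dual) \<longlonglongrightarrow> 0)"
    by (rule ball_cong[OF refl one])
  also have "\<dots> \<longleftrightarrow> (\<lambda>l. Max ((\<lambda>q. (SUP \<kappa>\<in>dual. x q l \<kappa>) / infsum (x q l) dual) ` {1..m-1})) \<longlonglongrightarrow> 0"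
    by (rule Max_tendsto_0_iff[symmetric, where h = "\<lambda>q l. (SUP \<kappa>\<in>dual. x q l \<kappa>) / infsum (x q l) dual"]) (use m b(4) in auto)
  finally show ?thesis unfolding x_def[abs_def] .
qed

end

theorem theorem3p1:
  fixes \<mu> :: "('g::{ab_group_add, t2_space, second_countable_topology}) measure"
    and P :: "'w measure"
    and T :: "'g \<Rightarrow> 'w \<Rightarrow> real"
    and m :: nat
  assumes add_cont: "continuous_on UNIV (\<lambda>p :: 'g \<times> 'g. fst p + snd p)"
    and neg_cont: "continuous_on UNIV (uminus :: 'g \<Rightarrow> 'g)"
    and compact_G: "compact (UNIV :: 'g set)"
    and connected_G: "connected (UNIV :: 'g set)"
    and haar: "haar_prob \<mu>"
    and dual_inf: "infinite (dual :: ('g \<Rightarrow> complex) set)"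
    and P: "prob_space P"
    and T_meas: "(\<lambda>(g, \<omega>). T g \<omega>) \<in> borel_measurable (\<mu> \<Otimes>\<^sub>M P)"
    and T_gauss: "centered_gaussian_field P T"
    and T_iso: "isotropic P T"
    and T_var: "\<forall>g. integral\<^sup>L P (\<lambda>\<omega>. (T g \<omega>)\<^sup>2) = 1"
    and C_pos: "\<forall>\<pi>\<in>dual. Cpow P \<mu> T \<pi> > 0"
    and m2: "m \<ge> 2"
  shows "(\<forall>\<pi>\<in>dual. integral\<^sup>L P (\<lambda>\<omega>. (cmod (hcoef \<mu> T m \<pi> \<omega>))\<^sup>2)
                    = fact m * Chat (Cpow P \<mu> T) \<pi> m)
    \<and> (\<forall>\<pi>s :: nat \<Rightarrow> 'g \<Rightarrow> complex. range \<pi>s \<subseteq> dual \<longrightarrow>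
        (let C = Cpow P \<mu> T;
             c1 = conv_law_cgauss P (\<lambda>l \<omega>. hcoef \<mu> T m (\<pi>s l) \<omega> / sqrt (fact m * Chat C (\<pi>s l) m));
             c2 = ((\<lambda>l. integral\<^sup>L P (\<lambda>\<omega>. (Re (hcoef \<mu> T m (\<pi>s l) \<omega>)) ^ 4)
                          / (fact m * Chat C (\<pi>s l) m)\<^sup>2) \<longlonglongrightarrow> 3/4)
                \<and> ((\<lambda>l. integral\<^sup>L P (\<lambda>\<omega>. (Im (hcoef \<mu> T m (\<pi>s l) \<omega>)) ^ 4)
                          / (fact m * Chat C (\<pi>s l) m)\<^sup>2) \<longlonglongrightarrow> 3/4);
             c3 = (\<forall>q\<in>{1..m-1}.
                    (\<lambda>l. (\<Sum>\<^sub>\<infinity>\<kappa>\<in>dual. (Chat C \<kappa> q)\<^sup>2 * (Chat C (char_mult (\<pi>s l) (char_inv \<kappa>)) (m - q))\<^sup>2)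
                          / (Chat C (\<pi>s l) m)\<^sup>2) \<longlonglongrightarrow> 0);
             c4 = ((\<lambda>l. Max ((\<lambda>q. (SUP \<kappa>\<in>dual. Chat C \<kappa> q * Chat C (char_mult (\<pi>s l) (char_inv \<kappa>)) (m - q))
                                 / (\<Sum>\<^sub>\<infinity>\<nu>\<in>dual. Chat C \<nu> q * Chat C (char_mult (\<pi>s l) (char_inv \<nu>)) (m - q)))
                            ` {1..m-1})) \<longlonglongrightarrow> 0)
         in (c1 \<longleftrightarrow> c2) \<and> (c2 \<longleftrightarrow> c3) \<and> (c3 \<longleftrightarrow> c4)))"
proof -
  interpret P: prob_space P by (rule P)
  interpret F: isotropic_field \<mu> P T
    by unfold_locales (fact add_cont neg_cont compact_G haar T_gauss T_meas T_iso T_var)+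
  note Chat = F.Chat_eq_pmf[unfolded F.C_def]
  have C: "F.C \<pi> > 0" if "\<pi> \<in> dual" for \<pi> using C_pos that by (simp add: F.C_def)
  show ?thesis
  proof (intro conjI ballI allI impI)
    show "integral\<^sup>L P (\<lambda>\<omega>. (cmod (hcoef \<mu> T m \<pi> \<omega>))\<^sup>2) = fact m * Chat (Cpow P \<mu> T) \<pi> m" if "\<pi> \<in> dual" for \<pi>
      using F.second_moment[OF that, of m] by (simp only: F.C_def)
  next
    fix \<pi>s :: "nat \<Rightarrow> 'g \<Rightarrow> complex" assume "range \<pi>s \<subseteq> dual"
    then have pi: "\<pi>s l \<in> dual" for l by auto
    have pos: "pmf (F.spec_pow m) (\<pi>s l) > 0" for l using F.spec_pow_pos[OF C pi] m2 by simp
    have X: "(\<lambda>l \<omega>. hcoef \<mu> T m (\<pi>s l) \<omega> / complex_of_real (sqrt (fact m * pmf (F.spec_pow m) (\<pi>s l)))) = (\<lambda>l. F.nhint m (\<pi>s l))"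
      by (intro ext) (simp only: F.nhint_def F.hvar_def F.hcoef_eq[OF pi])
    have Re4: "P.expectation (\<lambda>\<omega>. (Re (hcoef \<mu> T m (\<pi>s l) \<omega>)) ^ 4) / (fact m * pmf (F.spec_pow m) (\<pi>s l))\<^sup>2 = P.expectation (\<lambda>\<omega>. Re (F.nhint m (\<pi>s l) \<omega>) ^ 4)"
      and Im4: "P.expectation (\<lambda>\<omega>. (Im (hcoef \<mu> T m (\<pi>s l) \<omega>)) ^ 4) / (fact m * pmf (F.spec_pow m) (\<pi>s l))\<^sup>2 = P.expectation (\<lambda>\<omega>. Im (F.nhint m (\<pi>s l) \<omega>) ^ 4)" for l
      unfolding F.nhint_fourth_moment[OF pos] F.hvar_def F.hcoef_eq[OF pi] by (rule refl)+
    let ?c1 = "conv_law_cgauss P (\<lambda>l. F.nhint m (\<pi>s l))"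
    let ?c2 = "(\<lambda>l. P.expectation (\<lambda>\<omega>. Re (F.nhint m (\<pi>s l) \<omega>) ^ 4)) \<longlonglongrightarrow> 3 / 4 \<and> (\<lambda>l. P.expectation (\<lambda>\<omega>. Im (F.nhint m (\<pi>s l) \<omega>) ^ 4)) \<longlonglongrightarrow> 3 / 4"
    let ?c3 = "\<forall>q\<in>{1..m-1}. (\<lambda>l. F.SS q (m - q) (\<pi>s l) / (pmf (F.spec_pow m) (\<pi>s l))\<^sup>2) \<longlonglongrightarrow> 0"
    have 12: ?c2 if ?c1 using F.fourth_moments_of_law_limit[OF pi pos that] by blast
    have 23: ?c3 if ?c2
      unfolding F.contractions_iff_SS_sum
      by (rule F.contractions_of_fourth_moments[OF pi pos _ conjunct1[OF that] conjunct2[OF that]]) (use m2 in simp)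
    have 31: ?c1 if ?c3
      by (rule F.law_limit_of_contractions[OF connected_G C m2 pi that[unfolded F.contractions_iff_SS_sum]])
    have "(?c1 \<longleftrightarrow> ?c2) \<and> (?c2 \<longleftrightarrow> ?c3)" using 12 23 31 by blast
    then show "let C = Cpow P \<mu> T;
             c1 = conv_law_cgauss P (\<lambda>l \<omega>. hcoef \<mu> T m (\<pi>s l) \<omega> / sqrt (fact m * Chat C (\<pi>s l) m));
             c2 = ((\<lambda>l. integral\<^sup>L P (\<lambda>\<omega>. (Re (hcoef \<mu> T m (\<pi>s l) \<omega>)) ^ 4)
                          / (fact m * Chat C (\<pi>s l) m)\<^sup>2) \<longlonglongrightarrow> 3/4)
                \<and> ((\<lambda>l. integral\<^sup>L P (\<lambda>\<omega>. (Im (hcoef \<mu> T m (\<pi>s l) \<omega>)) ^ 4)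
                          / (fact m * Chat C (\<pi>s l) m)\<^sup>2) \<longlonglongrightarrow> 3/4);
             c3 = (\<forall>q\<in>{1..m-1}.
                    (\<lambda>l. (\<Sum>\<^sub>\<infinity>\<kappa>\<in>dual. (Chat C \<kappa> q)\<^sup>2 * (Chat C (char_mult (\<pi>s l) (char_inv \<kappa>)) (m - q))\<^sup>2)
                          / (Chat C (\<pi>s l) m)\<^sup>2) \<longlonglongrightarrow> 0);
             c4 = ((\<lambda>l. Max ((\<lambda>q. (SUP \<kappa>\<in>dual. Chat C \<kappa> q * Chat C (char_mult (\<pi>s l) (char_inv \<kappa>)) (m - q))
                                 / (\<Sum>\<^sub>\<infinity>\<nu>\<in>dual. Chat C \<nu> q * Chat C (char_mult (\<pi>s l) (char_inv \<nu>)) (m - q)))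
                            ` {1..m-1})) \<longlonglongrightarrow> 0)
         in (c1 \<longleftrightarrow> c2) \<and> (c2 \<longleftrightarrow> c3) \<and> (c3 \<longleftrightarrow> c4)"
      using F.contractions_iff_sup_ratio[of m \<pi>s, OF C m2 pi]
      unfolding Let_def Chat X Re4 Im4 F.SS_infsum by blast
  qed
qed

end
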